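(* Let $p$ be a prime and $n\ge1$. A cyclic subgroup $C\cong\mathbb Z_p$ of $GL(n,\mathbb Z)$ lifts to $\mathrm{Out}\,F_n$ with respect to $\beta:\mathrm{Out}\,F_n\to GL(n,\mathbb Z)$ if and only if the corresponding integral representation of $\mathbb Z_p$ on $\mathbb Z^n$ is standard.
   Context: $F_n$ is the free group of rank $n$, $\mathrm{Out}\,F_n=\mathrm{Aut}\,F_n/\mathrm{Inn}\,F_n$, and $\beta$ is the homomorphism induced by the action on the abelianization $(F_n)_{ab}=\mathbb Z^n$. A subgroup $U\le GL(n,\mathbb Z)$ lifts to $\mathrm{Out}\,F_n$ if there is an injective homomorphism $\iota:U\to\mathrm{Out}\,F_n$ with $\beta\circ\iota=\mathrm{id}_U$. Let $t$ be a generator of $\mathbb Z_p$ and $\lambda$ a primitive $p$-th root of unity. The following $\mathbb Z[\mathbb Z_p]$-lattices are called standard indecomposables: the trivial module $\mathbb Z$; the regular module $\mathbb Z[\mathbb Z_p]$; and the cyclotomic module $\mathbb Z[\lambda]$ on which $t$ acts by multiplication by $\lambda$. An integral representation of $\mathbb Z_p$ on $\mathbb Z^n$ is called standard if, as a $\mathbb Z[\mathbb Z_p]$-module, it is isomorphic to a direct sum of standard indecomposables (i.e. it has no indecomposable summand isomorphic to a non-principal ideal of $\mathbb Z[\lambda]$ with $t$ acting by multiplication by $\lambda$). *)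

theory Defs
  imports "HOL-Algebra.Coset" "HOL-Algebra.Bij" "Jordan_Normal_Form.Determinant"
begin

text \<open>A letter (i, True) is x_i, a letter (i, False) is x_i^(-1).
  Elements of F_n are freely reduced words; multiplication is
  concatenation followed by free reduction.\<close>

type_synonym fg_word = "(nat \<times> bool) list"

fun fg_red :: "fg_word \<Rightarrow> fg_word" where
  "fg_red [] = []"
| "fg_red (x # xs) =
     (case fg_red xs of
        [] \<Rightarrow> [x]
      | y # ys \<Rightarrow> (if fst x = fst y \<and> snd x \<noteq> snd y then ys else x # y # ys))"

definition free_group :: "nat \<Rightarrow> fg_word monoid" where
  "free_group n =
    \<lparr>Congruence.partial_object.carrier = {w. (\<forall>l\<in>set w. fst l < n) \<and> fg_red w = w},
     Group.monoid.mult = (\<lambda>u v. fg_red (u @ v)),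
     Group.monoid.one = []\<rparr>"

definition inn :: "nat \<Rightarrow> (fg_word \<Rightarrow> fg_word) set" where
  "inn n = {(\<lambda>x\<in>carrier (free_group n).
               g \<otimes>\<^bsub>free_group n\<^esub> x \<otimes>\<^bsub>free_group n\<^esub> inv\<^bsub>free_group n\<^esub> g)
            | g. g \<in> carrier (free_group n)}"

definition Out :: "nat \<Rightarrow> (fg_word \<Rightarrow> fg_word) set monoid" where
  "Out n = AutoGroup (free_group n) Mod inn n"

definition GL_Z :: "nat \<Rightarrow> int mat monoid" where
  "GL_Z n = \<lparr>Congruence.partial_object.carrier = {A \<in> carrier_mat n n. det A = 1 \<or> det A = -1},
             Group.monoid.mult = (*), Group.monoid.one = 1\<^sub>m n\<rparr>"

definition exp_sum :: "nat \<Rightarrow> fg_word \<Rightarrow> int" where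
  "exp_sum i w = sum_list (map (\<lambda>(k, b). if k = i then (if b then 1 else -1) else 0) w)"

text \<open>Action on the abelianization Z^n: column j is the image of x_j.\<close>
definition beta_aut :: "nat \<Rightarrow> (fg_word \<Rightarrow> fg_word) \<Rightarrow> int mat" where
  "beta_aut n f = mat n n (\<lambda>(i, j). exp_sum i (f [(j, True)]))"

text \<open>beta on Out F_n (well defined since inner automorphisms act trivially).\<close>
definition beta :: "nat \<Rightarrow> (fg_word \<Rightarrow> fg_word) set \<Rightarrow> int mat" where
  "beta n X = beta_aut n (SOME f. f \<in> X)"

definition lifts_to_Out :: "nat \<Rightarrow> int mat set \<Rightarrow> bool" where
  "lifts_to_Out n U \<longleftrightarrow>
     (\<exists>\<iota>. \<iota> \<in> hom ((GL_Z n)\<lparr>Congruence.partial_object.carrier := U\<rparr>) (Out n) \<and> inj_on \<iota> U \<and>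
          (\<forall>u\<in>U. beta n (\<iota> u) = u))"

definition cyclic_subgroup :: "int mat \<Rightarrow> int mat set" where
  "cyclic_subgroup A = {A ^\<^sub>m k | k. True}"

definition triv_block :: "int mat" where
  "triv_block = 1\<^sub>m 1"

text \<open>Regular module Z[Z_p] in the basis 1, t, ..., t^(p-1): t permutes cyclically.\<close>
definition reg_block :: "nat \<Rightarrow> int mat" where
  "reg_block p = mat p p (\<lambda>(i, j). if i = (j + 1) mod p then 1 else 0)"

text \<open>Cyclotomic module Z[lambda] in the basis 1, lambda, ..., lambda^(p-2):
  multiplication by lambda (companion matrix of the p-th cyclotomic polynomial).\<close>
definition cyc_block :: "nat \<Rightarrow> int mat" where
  "cyc_block p = mat (p - 1) (p - 1)
     (\<lambda>(i, j). if j + 2 < p then (if i = j + 1 then 1 else 0) else -1)"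

text \<open>A (acting on Z^n) is standard iff Z^n with t acting by A is isomorphic as a
  Z[Z_p]-module to a direct sum of a copies of Z, b copies of Z[Z_p] and
  c copies of Z[lambda], i.e. A is GL(n,Z)-conjugate to the corresponding block
  diagonal matrix (P A = D P with P invertible over Z).\<close>
definition standard_rep :: "nat \<Rightarrow> nat \<Rightarrow> int mat \<Rightarrow> bool" where
  "standard_rep n p A \<longleftrightarrow>
     (\<exists>a b c P. a + b * p + c * (p - 1) = n \<and> P \<in> carrier (GL_Z n) \<and>
        P * A = diag_block_mat (replicate a triv_block @ replicate b (reg_block p)
                                 @ replicate c (cyc_block p)) * P)"

end

theory Submission
  imports Defs "HOL-Library.Function_Algebras" "HOL-Library.Sublist" "HOL-Library.Countable"
    "HOL-Computational_Algebra.Polynomial_Factorial"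
begin

text \<open>
  Let \<open>t\<close> be the action of a generator on \<open>\<int>\<^sup>n\<close>. The representation is standard iff the kernel of
  \<open>1 + t + \<dots> + t\<^bsup>p-1\<^esup>\<close>, a torsion-free module over \<open>\<int>[\<lambda>]\<close>, is free.

  Standard blocks are induced by automorphisms of order \<open>p\<close>, and \<open>Aut F\<^sub>n\<close> maps onto \<open>GL(n, \<int>)\<close>, so
  conjugation lifts every standard representation even to \<open>Aut F\<^sub>n\<close>.

  Conversely, for \<open>p = 2\<close> there is nothing to prove because \<open>\<int>[\<lambda>] = \<int>\<close>. For odd \<open>p\<close>, a lift is represented
  by an automorphism whose \<open>p\<close>-th power is conjugation by an element that it fixes. Adjoining \<open>p - 1\<close>
  generators turns it into an automorphism \<open>\<phi>\<close> with \<open>\<phi>\<^sup>p = 1\<close> of a larger free group \<open>F\<close>, and changes the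
  representation only by an extension with \<open>\<int>[\<lambda>]\<close>. The word length maximised over the powers of
  \<open>\<phi>\<close> is a \<open>\<phi>\<close>-invariant metric on \<open>F\<close>; a Rips complex of it is acyclic because the Cayley graph is
  a tree. Its \<open>F\<close>-invariant alternating cochains form signed permutation modules for \<open>\<phi>\<close>, whose norm
  kernels are free over \<open>\<int>[\<lambda>]\<close>. Going down the exact sequence of cocycles, each step changes
  modules only by free ones up to division by \<open>1 - \<lambda>\<close>, and one arrives at \<open>Hom(F, \<int>)\<close>, the dual of
  the representation.
\<close>

subsection \<open>The free group as a type\<close>

text \<open>Freeness must survive two operations. Passing to norm kernels is not exact, but the
  cokernel that arises is killed by 1 - lambda. Kernels of maps between free modules are a priori
  only projective; here the image of each functional is an ideal containing 1 - lambda, hence the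
  unit ideal or (1 - lambda), and after division the functional is unimodular. Completing unimodular
  rows relies on the finiteness of the proper quotients of Z[lambda], so no class group enters.
  Oddness of \<open>p\<close> is a matter of orientation: a simplex class mapped to itself might be
  reversed, but its sign has \<open>p\<close>-th power 1. Word length is additive along geodesics
  but not invariant under \<open>\<phi>\<close>; the sum of the word lengths over the powers of
  \<open>\<phi>\<close>, which is the metric \<open>d\<close> used below, is invariant but additive
  only up to a constant, by bounded cancellation. The scale \<open>rad\<close> of the Rips complex
  absorbs that constant. The complex sees the dual lattice, and a trace form carries freeness back
  to the representation itself.\<close>

definition linv :: "nat \<times> bool => nat \<times> bool" where
  "linv l = (fst l, \<not> snd l)"

lemma linv_linv [simp]: "linv (linv l) = l"
  by (simp add: linv_def)

lemma linv_neq [simp]: "linv l \<noteq> l" "l \<noteq> linv l"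
  by (auto simp: linv_def prod_eq_iff)

lemma fst_linv [simp]: "fst (linv l) = fst l"
  by (simp add: linv_def)

lemma linv_eq_iff: "linv a = b \<longleftrightarrow> a = linv b"
  by auto

definition nocanc :: "fg_word => bool" where
  "nocanc = successively (\<lambda>x y. y \<noteq> linv x)"

lemma nocanc_simps [simp]:
  "nocanc []" "nocanc [x]" "nocanc (x # y # zs) \<longleftrightarrow> y \<noteq> linv x \<and> nocanc (y # zs)"
  by (auto simp: nocanc_def)

lemma nocanc_ConsD: "nocanc (x # xs) ==> nocanc xs"
  by (cases xs) auto

definition rcons :: "nat \<times> bool => fg_word => fg_word" where
  "rcons x w = (case w of [] => [x] | y # ys => if y = linv x then ys else x # y # ys)"

lemma fg_red_Cons [simp]: "fg_red (x # xs) = rcons x (fg_red xs)"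
proof (cases "fg_red xs")
  case (Cons y ys)
  then show ?thesis by (cases x; cases y) (auto simp: rcons_def linv_def)
qed (simp add: rcons_def)

declare fg_red.simps(2) [simp del]

lemma fg_red_foldr: "fg_red w = foldr rcons w []"
  by (induction w) auto

lemma nocanc_rcons: "nocanc w ==> nocanc (rcons x w)"
  by (auto simp: rcons_def dest: nocanc_ConsD split: list.splits)

lemma nocanc_foldr: "nocanc w ==> nocanc (foldr rcons u w)"
  by (induction u) (auto simp: nocanc_rcons)

lemma nocanc_fg_red: "nocanc (fg_red w)"
  by (simp add: fg_red_foldr nocanc_foldr)

lemma fg_red_id: "nocanc w ==> fg_red w = w"
proof (induction w)
  case (Cons x w)
  then show ?case by (cases w) (auto simp: rcons_def)
qed simp

lemma fg_red_fixed_iff: "fg_red w = w \<longleftrightarrow> nocanc w"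
  using fg_red_id nocanc_fg_red by metis

text \<open>Letters act on reduced words through \<open>rcons\<close>, and opposite letters act by
  inverse permutations. This action, rather than confluence of cancellation, makes the product of
  reduced words associative.\<close>

lemma rcons_rcons_linv: "nocanc w ==> rcons x (rcons (linv x) w) = w"
  by (cases w) (auto simp: rcons_def split: list.splits)

lemma foldr_rcons_fg_red: "nocanc v ==> foldr rcons (fg_red u) v = foldr rcons u v"
proof (induction u)
  case (Cons x u)
  have "foldr rcons (rcons x w) v = rcons x (foldr rcons w v)" for w
  proof (cases w)
    case (Cons y ys)
    show ?thesis
    proof (cases "y = linv x")
      case True
      then show ?thesis
        using Cons rcons_rcons_linv[of "foldr rcons ys v" x] nocanc_foldr[OF \<open>nocanc v\<close>]
        by (simp add: rcons_def[of x "linv x # ys"])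
    qed (simp add: Cons rcons_def[of x "y # ys"])
  qed (simp add: rcons_def)
  with Cons show ?case by simp
qed simp

lemma fg_red_append: "fg_red (u @ v) = foldr rcons u (fg_red v)"
  by (simp add: fg_red_foldr)

lemma fg_red_red_left [simp]: "fg_red (fg_red u @ v) = fg_red (u @ v)"
  by (simp add: fg_red_append foldr_rcons_fg_red nocanc_fg_red)

lemma fg_red_red_right [simp]: "fg_red (u @ fg_red v) = fg_red (u @ v)"
  by (simp add: fg_red_append fg_red_id nocanc_fg_red)

lemma set_fg_red: "set (fg_red w) \<subseteq> set w"
  by (induction w) (auto simp: rcons_def split: list.splits if_splits)

definition winv :: "fg_word => fg_word" where
  "winv w = rev (map linv w)"

lemma winv_simps [simp]: "winv [] = []" "winv (x # w) = winv w @ [linv x]"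
  "winv (u @ v) = winv v @ winv u" "length (winv w) = length w" "winv (winv w) = w"
  by (auto simp: winv_def rev_map comp_def)

lemma nocanc_winv: "nocanc w ==> nocanc (winv w)"
  unfolding nocanc_def winv_def successively_rev successively_map
  by (erule successively_mono) (auto simp: linv_eq_iff)

lemma fg_red_winv_cancel: "fg_red (winv w @ w @ v) = fg_red v"
proof (induction w arbitrary: v)
  case (Cons x w)
  have "fg_red (winv (x # w) @ (x # w) @ v) = fg_red (winv w @ fg_red (linv x # x # w @ v))"
    by (simp del: fg_red_Cons)
  also have "fg_red (linv x # x # w @ v) = fg_red (w @ v)"
    using rcons_rcons_linv[of "fg_red (w @ v)" "linv x"] nocanc_fg_red by simp
  finally show ?case using Cons by simp
qed simp

text \<open>All ranks share one type with infinitely many generators, so enlarging the rank means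
  passing from \<open>FN n\<close> to a larger subset. The group is written additively to use
  \<open>group_add\<close>, which does not assume commutativity.\<close>

typedef fw = "{w. nocanc w}" morphisms word_of Fw
  by (intro exI[of _ "[]"]) simp

lemma nocanc_word_of [simp]: "nocanc (word_of x)"
  using word_of by simp

lemma word_of_Fw: "nocanc w ==> word_of (Fw w) = w"
  by (simp add: Fw_inverse)

instantiation fw :: group_add
begin
definition "0 = Fw []"
definition "x + y = Fw (fg_red (word_of x @ word_of y))"
definition "- x = Fw (winv (word_of x))"
definition "x - y = x + - (y :: fw)"

lemma word_of_zero: "word_of 0 = []"
  by (simp add: zero_fw_def word_of_Fw)

lemma word_of_plus: "word_of (x + y) = fg_red (word_of x @ word_of y)"
  by (simp add: plus_fw_def word_of_Fw nocanc_fg_red)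

lemma word_of_uminus: "word_of (- x) = winv (word_of x)"
  by (simp add: uminus_fw_def word_of_Fw nocanc_winv)

instance
proof
  fix a b c :: fw
  show "a + b + c = a + (b + c)"
    by (simp flip: word_of_inject add: word_of_plus)
  show "0 + a = a" "a + 0 = a"
    by (simp_all flip: word_of_inject add: word_of_plus word_of_zero fg_red_id)
  show "- a + a = 0"
    using fg_red_winv_cancel[of "word_of a" "[]"]
    by (simp flip: word_of_inject add: word_of_plus word_of_zero word_of_uminus)
  show "a + - b = a - b" by (simp add: minus_fw_def)
qed
end

definition flen :: "fw => nat" where
  "flen x = length (word_of x)"

definition fgen :: "nat \<times> bool => fw" where
  "fgen l = Fw [l]"

abbreviation gen :: "nat => fw" where
  "gen i \<equiv> fgen (i, True)"

definition FN :: "nat => fw set" where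
  "FN n = {x. \<forall>l\<in>set (word_of x). fst l < n}"

lemma word_of_fgen [simp]: "word_of (fgen l) = [l]"
  by (simp add: fgen_def word_of_Fw)

lemma flen_zero [simp]: "flen 0 = 0"
  by (simp add: flen_def word_of_zero)

lemma flen_eq_0_iff [simp]: "flen x = 0 \<longleftrightarrow> x = 0"
  by (simp add: flen_def word_of_zero flip: word_of_inject)

lemma flen_fgen [simp]: "flen (fgen l) = 1"
  by (simp add: flen_def)

lemma flen_uminus [simp]: "flen (- x) = flen x"
  by (simp add: flen_def word_of_uminus)

lemma uminus_fgen: "- fgen l = fgen (linv l)"
  by (simp flip: word_of_inject add: word_of_uminus)

lemma fgen_False: "fgen (i, False) = - gen i"
  by (simp add: uminus_fgen linv_def)

lemma length_rcons: "length (rcons x w) \<le> Suc (length w)"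
  by (auto simp: rcons_def split: list.splits)

lemma length_fg_red: "length (fg_red w) \<le> length w"
proof (induction w)
  case (Cons a w)
  then show ?case using length_rcons[of a "fg_red w"] by simp
qed simp

lemma flen_add_le: "flen (x + y) \<le> flen x + flen y"
  using length_fg_red[of "word_of x @ word_of y"] by (simp add: flen_def word_of_plus)

lemma FN_zero [simp]: "0 \<in> FN n"
  by (simp add: FN_def word_of_zero)

lemma FN_plus [intro]: "x \<in> FN n ==> y \<in> FN n ==> x + y \<in> FN n"
  using set_fg_red[of "word_of x @ word_of y"] by (fastforce simp: FN_def word_of_plus)

lemma FN_uminus [simp]: "- x \<in> FN n \<longleftrightarrow> x \<in> FN n"
  by (simp add: FN_def word_of_uminus winv_def)

lemma FN_plus_iff: "x \<in> FN n ==> x + y \<in> FN n \<longleftrightarrow> y \<in> FN n"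
  by (metis FN_plus FN_uminus add.assoc left_minus add_0)

lemma FN_fgen [simp]: "fgen l \<in> FN n \<longleftrightarrow> fst l < n"
  by (simp add: FN_def)

lemma FN_mono: "m \<le> n ==> x \<in> FN m ==> x \<in> FN n"
  by (auto simp: FN_def)

lemma ex_FN: "\<exists>n. x \<in> FN n"
proof -
  have "fst l < Suc (Max (fst ` set (word_of x)))" if "l \<in> set (word_of x)" for l
    using that by (simp add: less_Suc_eq_le)
  then have "x \<in> FN (Suc (Max (fst ` set (word_of x))))" unfolding FN_def by blast
  then show ?thesis ..
qed

lemma Fw_Cons: "nocanc (l # w) ==> Fw (l # w) = fgen l + Fw w"
  by (simp flip: word_of_inject add: word_of_Fw nocanc_ConsD word_of_plus fg_red_id del: fg_red_Cons)

lemma fw_induct [case_names zero Cons]: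
  assumes "P 0"
    and "\<And>l x. nocanc (l # word_of x) ==> P x ==> P (fgen l + x)"
  shows "P x"
proof -
  have "nocanc w ==> P (Fw w)" for w
  proof (induction w)
    case Nil
    then show ?case using assms(1) by (simp add: zero_fw_def)
  next
    case (Cons l w)
    then show ?case using assms(2)[of l "Fw w"] nocanc_ConsD[OF Cons.prems]
      by (simp add: Fw_Cons word_of_Fw)
  qed
  from this[of "word_of x"] show ?thesis by (simp add: word_of_inverse)
qed

lemma word_of_fgen_plus: "nocanc (l # word_of x) ==> word_of (fgen l + x) = l # word_of x"
  by (simp add: word_of_plus fg_red_id del: fg_red_Cons)

lemma FN_induct [consumes 1, case_names zero Cons]:
  assumes "x \<in> FN n" "P 0"
    and "\<And>l x. fst l < n ==> x \<in> FN n ==> P x ==> P (fgen l + x)"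
  shows "P x"
  using assms(1)
proof (induction x rule: fw_induct)
  case (Cons l x)
  then show ?case using assms(3) by (auto simp: FN_def word_of_fgen_plus)
qed (rule assms(2))

subsection \<open>Homomorphisms out of the free group\<close>

definition word_eval :: "(nat => 'g::group_add) => fg_word => 'g" where
  "word_eval u w = sum_list (map (\<lambda>(i, b). if b then u i else - u i) w)"

definition fext :: "(nat => 'g::group_add) => fw => 'g" where
  "fext u x = word_eval u (word_of x)"

lemma word_eval_fg_red: "word_eval u (fg_red w) = word_eval u w"
proof (induction w)
  case (Cons x w)
  have "word_eval u (rcons x v) = word_eval u [x] + word_eval u v" for v
    by (cases v; cases x) (auto simp: rcons_def word_eval_def linv_def simp flip: add.assoc)
  with Cons show ?case by (auto simp: word_eval_def)
qed simp

text \<open>Serves for endomorphisms of the free group, for its homomorphisms to the integers and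
  for additive operators on integer-valued functions.\<close>

definition addmap :: "('a::plus => 'b::plus) => bool" where
  "addmap f \<longleftrightarrow> (\<forall>x y. f (x + y) = f x + f y)"

lemma addmapD: "addmap f ==> f (x + y) = f x + f y"
  by (simp add: addmap_def)

lemma addmap_zero: "addmap f ==> f 0 = 0" for f :: "'a::group_add => 'b::group_add"
  using addmapD[of f 0 0] by (metis add.right_neutral add_left_cancel)

lemma addmap_uminus: "addmap f ==> f (- x) = - f x" for f :: "'a::group_add => 'b::group_add"
  using addmapD[of f "- x" x] addmap_zero[of f] by (simp add: eq_neg_iff_add_eq_0)

lemma addmap_diff: "addmap f ==> f (x - y) = f x - f y" for f :: "'a::group_add => 'b::group_add"
  using addmapD[of f x "- y"] addmap_uminus[of f] by simp

lemma addmap_funpow: "addmap f ==> addmap (f ^^ k)" for f :: "'a::plus => 'a"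
  by (induction k) (auto simp: addmap_def)

lemma addmap_comp: "addmap f ==> addmap g ==> addmap (\<lambda>x. f (g x))"
  by (auto simp: addmap_def)

lemma addmap_fext: "addmap (fext u)"
  unfolding addmap_def fext_def word_of_plus word_eval_fg_red by (simp add: word_eval_def)

lemma fext_gen [simp]: "fext u (gen i) = u i"
  by (simp add: fext_def word_eval_def)

lemma addmap_eqI:
  fixes f g :: "fw => 'g::group_add"
  assumes "addmap f" "addmap g" "x \<in> FN n" "\<And>i. i < n ==> f (gen i) = g (gen i)"
  shows "f x = g x"
  using assms(3)
proof (induction rule: FN_induct)
  case zero
  then show ?case using assms by (simp add: addmap_zero)
next
  case (Cons l x)
  have "f (fgen l) = g (fgen l)"
    using assms Cons by (cases l; cases "snd l") (auto simp: fgen_False addmap_uminus)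
  with Cons assms show ?case by (simp add: addmapD)
qed

lemma addmap_eqI_all:
  fixes f g :: "fw => 'g::group_add"
  assumes "addmap f" "addmap g" "\<And>i. f (gen i) = g (gen i)"
  shows "f = g"
  using addmap_eqI[OF assms(1,2)] ex_FN assms(3) by (metis ext)

lemma addmap_FN:
  fixes f :: "fw => fw"
  assumes "addmap f" "x \<in> FN n" "\<And>i. i < n ==> f (gen i) \<in> FN m"
  shows "f x \<in> FN m"
  using assms(2)
proof (induction rule: FN_induct)
  case zero
  then show ?case using assms by (simp add: addmap_zero)
next
  case (Cons l x)
  have "f (fgen l) \<in> FN m"
    using assms Cons by (cases l; cases "snd l") (auto simp: fgen_False addmap_uminus)
  with Cons assms show ?case by (auto simp: addmapD)
qed

definition es :: "nat => fw => int" where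
  "es i x = exp_sum i (word_of x)"

lemma es_eq_fext: "es i = fext (\<lambda>j. if j = i then 1 else 0)"
proof
  fix x
  have "exp_sum i w = word_eval (\<lambda>j. if j = i then 1 else 0) w" for w
    by (induction w) (auto simp: exp_sum_def word_eval_def)
  then show "es i x = fext (\<lambda>j. if j = i then 1 else 0) x"
    by (simp add: es_def fext_def)
qed

lemma addmap_es: "addmap (es i)"
  by (simp add: es_eq_fext addmap_fext)

lemma es_gen: "es i (gen j) = (if j = i then 1 else 0)"
  by (simp add: es_eq_fext)

subsection \<open>Geometry of the Cayley tree\<close>

text \<open>The Gromov product based at the root of the Cayley tree: the length that the geodesics
  to \<open>x\<close> and \<open>y\<close> share.\<close>

definition cpl :: "fw => fw => nat" where
  "cpl x y = length (longest_common_prefix (word_of x) (word_of y))"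

definition ftake :: "nat => fw => fw" where
  "ftake k x = Fw (take k (word_of x))"

lemma nocanc_take: "nocanc w ==> nocanc (take k w)"
  unfolding nocanc_def by (metis append_take_drop_id successively_append_iff)

lemma word_of_ftake [simp]: "word_of (ftake k x) = take k (word_of x)"
  by (simp add: ftake_def word_of_Fw nocanc_take)

lemma flen_ftake: "flen (ftake k x) = min k (flen x)"
  by (simp add: flen_def min.commute)

lemma FN_ftake: "x \<in> FN n ==> ftake k x \<in> FN n"
  by (auto simp: FN_def dest: in_set_takeD)

lemma cpl_le: "cpl x y \<le> flen x" "cpl x y \<le> flen y"
  unfolding cpl_def flen_def
  by (intro prefix_length_le longest_common_prefix_prefix1 longest_common_prefix_prefix2)+

lemma cpl_take: "take (cpl x y) (word_of x) = take (cpl x y) (word_of y)"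
  using longest_common_prefix_prefix1[of "word_of x" "word_of y"]
    longest_common_prefix_prefix2[of "word_of x" "word_of y"]
  unfolding cpl_def by (metis append_eq_conv_conj prefix_def)

lemma cpl_ge: "take k (word_of x) = take k (word_of y) ==> k \<le> flen x ==> k \<le> cpl x y"
  unfolding cpl_def flen_def
  using longest_common_prefix_max_prefix[of "take k (word_of x)" "word_of x" "word_of y"]
  by (metis length_take min_absorb2 prefix_length_le take_is_prefix)

text \<open>Once the longest common prefix is removed, the inverse of one remainder and the other
  remainder meet without cancellation; this is the tree formula for the distance from
  \<open>x\<close> to \<open>y\<close>.\<close>

lemma flen_diff: "flen (- x + y) + 2 * cpl x y = flen x + flen y"
proof -
  define c where "c = longest_common_prefix (word_of x) (word_of y)"
  obtain a where a: "word_of x = c @ a"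
    using longest_common_prefix_prefix1[of "word_of x" "word_of y"] by (auto simp: c_def prefix_def)
  obtain b where b: "word_of y = c @ b"
    using longest_common_prefix_prefix2[of "word_of x" "word_of y"] by (auto simp: c_def prefix_def)
  have na: "nocanc a" "nocanc b"
    using nocanc_word_of[of x] nocanc_word_of[of y] unfolding a b
    by (auto simp: nocanc_def successively_append_iff)
  have hd: "a = [] \<or> b = [] \<or> hd a \<noteq> hd b"
  proof (rule ccontr)
    assume "\<not> ?thesis"
    then obtain l a' b' where "a = l # a'" "b = l # b'"
      by (metis list.exhaust_sel)
    then have "prefix (c @ [l]) (word_of x)" "prefix (c @ [l]) (word_of y)"
      using a b by auto
    then have "prefix (c @ [l]) c"
      unfolding c_def by (rule longest_common_prefix_max_prefix)
    then show False using prefix_length_le by fastforce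
  qed
  have "nocanc (winv a @ b)"
    using nocanc_winv[OF na(1)] na(2) hd
    by (auto simp: nocanc_def successively_append_iff winv_def last_rev hd_map)
  then have "word_of (- x + y) = winv a @ b"
    using fg_red_red_right[of "winv a" "winv c @ c @ b"] fg_red_winv_cancel[of c b] na
    by (simp add: word_of_plus word_of_uminus a b fg_red_id)
  then have "flen (- x + y) = length a + length b" by (simp add: flen_def)
  moreover have "cpl x y = length c" by (simp add: cpl_def c_def)
  ultimately show ?thesis using a b by (simp add: flen_def)
qed

text \<open>The length can fail to grow only if at least half of \<open>x\<close> cancels in
  \<open>x + x\<close>. Then the middle letter would be its own inverse, or the two middle letters
  of a reduced word would be inverse to each other.\<close>

lemma flen_add_self: "x \<noteq> 0 ==> flen x < flen (x + x)"
proof -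
  assume "x \<noteq> 0"
  define m where "m = flen x"
  define w where "w = word_of x"
  define k where "k = cpl (- x) x"
  have m: "m > 0" "length w = m" using \<open>x \<noteq> 0\<close> by (auto simp: m_def w_def flen_def word_of_zero simp flip: word_of_inject)
  have "2 * k < m"
  proof (rule ccontr)
    assume large: "\<not> 2 * k < m"
    define i where "i = (m - 1) div 2"
    have i: "i < k" "i < m" using large m by (auto simp: i_def)
    have "take k (winv w) ! i = take k w ! i"
      using cpl_take[of "- x" x] by (simp add: w_def k_def word_of_uminus)
    then have eq: "linv (w ! (m - 1 - i)) = w ! i"
      using i m by (simp add: winv_def rev_nth)
    show False
    proof (cases "even m")
      case False
      then have "m - 1 - i = i" using m by (auto simp: i_def elim!: oddE)
      with eq show False by simp
    next
      case True
      then obtain b where b: "m = 2 * b" by blast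
      then have "i = b - 1" "b > 0" using m by (auto simp: i_def)
      then have "m - 1 - i = Suc i" "Suc i < m" using b by auto
      moreover have "nocanc w" by (simp add: w_def)
      ultimately show False using eq m
        by (auto simp: nocanc_def successively_conv_nth linv_eq_iff)
    qed
  qed
  then show ?thesis using flen_diff[of "- x" x] by (simp add: k_def m_def)
qed

text \<open>Repeated doubling of a nonzero \<open>g\<close> gives elements of strictly growing
  length, so infinitely many translations would preserve a finite set.\<close>

lemma translation_stabilizer_trivial:
  fixes g :: fw
  assumes "finite \<sigma>" "\<sigma> \<noteq> {}" "(+) g ` \<sigma> = \<sigma>"
  shows "g = 0"
proof (rule ccontr)
  assume "g \<noteq> 0"
  define G where "G k = ((\<lambda>h. h + h) ^^ k) g" for k
  have G: "G 0 = g" "G (Suc k) = G k + G k" for k by (simp_all add: G_def)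
  have nz: "G k \<noteq> 0" for k
  proof (induction k)
    case (Suc k)
    then show ?case using flen_add_self[of "G k"] G(2)[of k] by auto
  qed (simp add: G \<open>g \<noteq> 0\<close>)
  have "strict_mono (\<lambda>k. flen (G k))"
    using nz by (auto simp: strict_mono_Suc_iff G(2) flen_add_self)
  then have inj: "inj G"
    by (metis injI strict_mono_eq)
  have "G k + x \<in> \<sigma>" if "x \<in> \<sigma>" for k x
    using that
  proof (induction k arbitrary: x)
    case 0
    then show ?case using assms(3) by (auto simp: G)
  next
    case (Suc k)
    then show ?case by (simp add: G(2) add.assoc)
  qed
  moreover obtain x where "x \<in> \<sigma>" using assms by auto
  ultimately have "range (\<lambda>k. G k + x) \<subseteq> \<sigma>" by auto
  moreover have "inj (\<lambda>k. G k + x)" using inj by (auto simp: inj_def)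
  ultimately show False using assms(1) by (meson finite_subset range_inj_infinite)
qed

text \<open>The translates of a finite set by the inverses of its elements depend only on the orbit of
  the set; picking one of them singles out an element, since no translation fixes the set.\<close>

lemma ex_equivariant_point:
  "\<exists>\<gamma> :: fw set => fw. \<forall>\<sigma>. finite \<sigma> \<longrightarrow> \<sigma> \<noteq> {} \<longrightarrow> \<gamma> \<sigma> \<in> \<sigma> \<and> (\<forall>g. \<gamma> ((+) g ` \<sigma>) = g + \<gamma> \<sigma>)"
proof -
  define T where "T \<sigma> = (\<lambda>x. (+) (- x) ` \<sigma>) ` \<sigma>" for \<sigma> :: "fw set"
  define \<rho> where "\<rho> \<sigma> = (SOME \<tau>. \<tau> \<in> T \<sigma>)" for \<sigma>
  define \<gamma> where "\<gamma> \<sigma> = (THE x. x \<in> \<sigma> \<and> (+) (- x) ` \<sigma> = \<rho> \<sigma>)" for \<sigma>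
  have T: "T ((+) g ` \<sigma>) = T \<sigma>" for g \<sigma>
    unfolding T_def image_image by (simp add: minus_add add.assoc del: add_uminus_conv_diff)
  have uniq: "x = y" if "finite \<sigma>" "x \<in> \<sigma>" "(+) (- x) ` \<sigma> = (+) (- y) ` \<sigma>" for x y :: fw and \<sigma>
  proof -
    have "(+) x ` (+) (- x) ` \<sigma> = (+) x ` (+) (- y) ` \<sigma>" using that by simp
    moreover have "(+) x ` (+) (- x) ` \<sigma> = \<sigma>" by (simp add: image_image)
    moreover have "(+) x ` (+) (- y) ` \<sigma> = (+) (x + - y) ` \<sigma>"
      unfolding image_image by (intro image_cong) (simp_all only: add.assoc)
    ultimately have "(+) (x + - y) ` \<sigma> = \<sigma>" by simp
    then have "x + - y = 0" using translation_stabilizer_trivial that by blast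
    then show ?thesis by (metis add.inverse_inverse eq_neg_iff_add_eq_0)
  qed
  have ex: "\<exists>x. x \<in> \<sigma> \<and> (+) (- x) ` \<sigma> = \<rho> \<sigma>" if "\<sigma> \<noteq> {}" for \<sigma>
  proof -
    have "T \<sigma> \<noteq> {}" using that by (simp add: T_def)
    then have "\<rho> \<sigma> \<in> T \<sigma>" unfolding \<rho>_def by (simp add: some_in_eq)
    then show ?thesis by (auto simp: T_def)
  qed
  have \<gamma>: "\<gamma> \<sigma> \<in> \<sigma> \<and> (+) (- \<gamma> \<sigma>) ` \<sigma> = \<rho> \<sigma>" if "finite \<sigma>" "\<sigma> \<noteq> {}" for \<sigma>
    unfolding \<gamma>_def by (rule theI') (use ex[OF that(2)] uniq[OF that(1)] in metis)
  have "\<gamma> ((+) g ` \<sigma>) = g + \<gamma> \<sigma>" if "finite \<sigma>" "\<sigma> \<noteq> {}" for \<sigma> g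
  proof (rule uniq[of "(+) g ` \<sigma>"])
    show "\<gamma> ((+) g ` \<sigma>) \<in> (+) g ` \<sigma>" using \<gamma>[of "(+) g ` \<sigma>"] that by auto
    have "(+) (- (g + \<gamma> \<sigma>)) ` (+) g ` \<sigma> = \<rho> \<sigma>"
      using \<gamma>[OF that] by (simp add: image_image minus_add add.assoc del: add_uminus_conv_diff)
    moreover have "\<rho> ((+) g ` \<sigma>) = \<rho> \<sigma>" by (simp add: \<rho>_def T)
    ultimately show "(+) (- \<gamma> ((+) g ` \<sigma>)) ` (+) g ` \<sigma> = (+) (- (g + \<gamma> \<sigma>)) ` (+) g ` \<sigma>"
      using \<gamma>[of "(+) g ` \<sigma>"] that by auto
  qed (use that in auto)
  with \<gamma> show ?thesis by blast
qed

text \<open>Of the four letters of the first two generators at least two differ from the first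
  letter of \<open>x\<close> and from the inverse of its last letter. Such a letter is appended to
  \<open>x\<close> without cancellation, so commuting with it would force \<open>x\<close> to begin
  with it.\<close>

lemma center_trivial:
  assumes "n \<ge> 2" "\<And>i. i < n ==> x + gen i = gen i + x"
  shows "x = 0"
proof (rule ccontr)
  assume "x \<noteq> 0"
  define w where "w = word_of x"
  have w: "w \<noteq> []" using \<open>x \<noteq> 0\<close> by (auto simp: w_def word_of_zero simp flip: word_of_inject)
  have "\<exists>l. fst l < 2 \<and> l \<noteq> linv (last w) \<and> l \<noteq> hd w"
  proof (rule ccontr)
    assume "\<not> ?thesis"
    then have "l = linv (last w) \<or> l = hd w" if "fst l < 2" for l using that by blast
    from this[of "(0, True)"] this[of "(0, False)"] this[of "(1, True)"]
    show False by (cases "linv (last w)"; cases "hd w") auto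
  qed
  then obtain l where l: "fst l < 2" "l \<noteq> linv (last w)" "l \<noteq> hd w" by auto
  have comm: "x + fgen l = fgen l + x"
  proof (cases "snd l")
    case True
    then show ?thesis using assms l by (cases l) auto
  next
    case False
    have "x + gen (fst l) = gen (fst l) + x" using assms l by auto
    then have "- gen (fst l) + x = x + - gen (fst l)"
      by (metis add.assoc add.right_neutral left_minus minus_add_cancel right_minus)
    then show ?thesis using False by (cases l) (auto simp: fgen_False)
  qed
  have "nocanc (w @ [l])"
    using l w nocanc_word_of[of x] unfolding nocanc_def successively_append_iff w_def by simp
  then have 1: "word_of (x + fgen l) = w @ [l]" by (simp add: word_of_plus w_def fg_red_id)
  have "word_of (fgen l + x) = rcons l w" by (simp add: word_of_plus w_def fg_red_id)
  with 1 comm have "w @ [l] = rcons l w" by simp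
  then show False using l w by (cases w) (auto simp: rcons_def split: if_splits dest: arg_cong[of _ _ length])
qed

text \<open>While \<open>w\<close> is read letter by letter, the images of its prefixes move through
  the tree in steps of length at most \<open>L\<close>. The first prefix whose image lies beyond the
  point at depth \<open>k\<close> on the geodesic to \<open>f w\<close> has a predecessor on the
  other side, so the step passed through that point and ended close to it.\<close>

lemma ex_prefix_image_near:
  assumes f: "addmap f" and L: "\<And>x. flen (f x) \<le> L * flen x"
    and k: "0 < k" "k \<le> flen (f w)"
  shows "\<exists>j. take k (word_of (f (ftake j w))) = take k (word_of (f w)) \<and>
    k \<le> flen (f (ftake j w)) \<and> flen (f (ftake j w)) \<le> k + L"
proof -
  define P where "P j \<longleftrightarrow> k \<le> flen (f (ftake j w)) \<and>
    take k (word_of (f (ftake j w))) = take k (word_of (f w))" for j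
  have "ftake (flen w) w = w" by (simp flip: word_of_inject add: flen_def)
  then have "P (flen w)" using k by (simp add: P_def)
  define j where "j = (LEAST j. P j)"
  have Pj: "P j" unfolding j_def by (rule LeastI) fact
  have "\<not> P 0" using k by (simp add: P_def ftake_def addmap_zero[OF f] flip: zero_fw_def)
  then obtain i where i: "j = Suc i" using Pj by (cases j) auto
  then have nP: "\<not> P i" using not_less_Least[of i P] by (simp add: j_def)
  have "i < flen w"
  proof (rule ccontr)
    assume "\<not> ?thesis"
    then have "ftake i w = ftake j w" by (simp add: i flen_def flip: word_of_inject)
    with nP Pj show False by (simp add: P_def)
  qed
  let ?u = "f (ftake i w)" and ?v = "f (ftake j w)"
  have "flen (- ftake i w + ftake j w) \<le> 1"
  proof -
    have "i \<le> cpl (ftake i w) (ftake j w)"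
      using \<open>i < flen w\<close> by (intro cpl_ge) (auto simp: i flen_ftake)
    then show ?thesis using flen_diff[of "ftake i w" "ftake j w"] \<open>i < flen w\<close>
      by (simp add: flen_ftake i)
  qed
  then have "flen (f (- ftake i w + ftake j w)) \<le> L"
    using L[of "- ftake i w + ftake j w"]
    by (metis mult.right_neutral mult_le_mono2 order_trans)
  then have "flen (- ?u + ?v) \<le> L"
    by (simp add: addmapD[OF f] addmap_uminus[OF f])
  moreover have "cpl ?u ?v < k"
  proof (rule ccontr)
    assume "\<not> ?thesis"
    then have le: "k \<le> cpl ?u ?v" by simp
    have "take k (take (cpl ?u ?v) (word_of ?u)) = take k (take (cpl ?u ?v) (word_of ?v))"
      by (rule arg_cong[OF cpl_take])
    then have "take k (word_of ?u) = take k (word_of ?v)" using le by (simp add: min_def)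
    moreover have "k \<le> flen ?u" using le cpl_le(1) order_trans by blast
    ultimately show False using nP Pj by (simp add: P_def)
  qed
  ultimately have "flen ?v \<le> k + L"
    using flen_diff[of ?u ?v] cpl_le(1)[of ?u ?v] by linarith
  with Pj show ?thesis by (auto simp: P_def)
qed

text \<open>If \<open>k\<close> letters cancel between the two images, some prefixes of
  \<open>- a\<close> and of \<open>b\<close> have images of length at least \<open>k\<close> at
  distance at most \<open>2 * L\<close> from each other. Applying \<open>f'\<close>, the prefixes
  themselves are at distance at most \<open>2 * L ^ 2\<close>. They leave the root in different
  directions, so both are at most that long and their images have length at most
  \<open>2 * L ^ 3\<close>, which bounds \<open>k\<close>.\<close>

lemma bounded_cancellation:
  assumes f: "addmap f" and f': "addmap f'" and inv: "\<And>x. f' (f x) = x"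
    and L: "\<And>x. flen (f x) \<le> L * flen x" and L': "\<And>x. flen (f' x) \<le> L * flen x"
    and ab: "flen (a + b) = flen a + flen b"
  shows "flen (f a) + flen (f b) \<le> flen (f (a + b)) + 4 * L ^ 3"
proof -
  define k where "k = cpl (f (- a)) (f b)"
  have c0: "cpl (- a) b = 0" using flen_diff[of "- a" b] ab by simp
  have eq: "flen (f (a + b)) + 2 * k = flen (f a) + flen (f b)"
    using flen_diff[of "f (- a)" "f b"] addmap_uminus[OF f]
    by (simp add: k_def addmapD[OF f])
  have "k \<le> 2 * L ^ 3"
  proof (cases "k = 0")
    case False
    then have k: "0 < k" "k \<le> flen (f (- a))" "k \<le> flen (f b)"
      by (auto simp: k_def cpl_le)
    obtain i where i: "take k (word_of (f (ftake i (- a)))) = take k (word_of (f (- a)))"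
      "k \<le> flen (f (ftake i (- a)))" "flen (f (ftake i (- a))) \<le> k + L"
      using ex_prefix_image_near[OF f L k(1,2)] by blast
    obtain j where j: "take k (word_of (f (ftake j b))) = take k (word_of (f b))"
      "k \<le> flen (f (ftake j b))" "flen (f (ftake j b)) \<le> k + L"
      using ex_prefix_image_near[OF f L k(1,3)] by blast
    let ?a = "ftake i (- a)" and ?b = "ftake j b"
    have "k \<le> cpl (f ?a) (f ?b)"
      by (rule cpl_ge) (use i j cpl_take[of "f (- a)" "f b"] in \<open>simp_all add: k_def\<close>)
    then have "flen (- f ?a + f ?b) \<le> 2 * L"
      using flen_diff[of "f ?a" "f ?b"] i j by linarith
    then have 1: "flen (f' (- f ?a + f ?b)) \<le> L * (2 * L)"
      using L' by (meson mult_le_mono2 order_trans)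
    have "f' (- f ?a + f ?b) = - ?a + ?b"
      by (simp add: addmapD[OF f'] addmap_uminus[OF f'] inv)
    moreover have "cpl ?a ?b = 0"
    proof -
      let ?c = "cpl ?a ?b"
      have "take ?c (take i (word_of (- a))) = take ?c (take j (word_of b))"
        using cpl_take[of ?a ?b] by simp
      moreover have "?c \<le> i" "?c \<le> j" using cpl_le[of ?a ?b] by (auto simp: flen_ftake)
      moreover have "?c \<le> flen (- a)" using cpl_le(1)[of ?a ?b] by (simp add: flen_ftake)
      ultimately have "?c \<le> cpl (- a) b" by (intro cpl_ge) (auto simp: min_absorb1)
      then show ?thesis using c0 by simp
    qed
    ultimately have "flen ?a \<le> 2 * L ^ 2"
      using 1 flen_diff[of ?a ?b] by (simp add: power2_eq_square)
    then have "L * flen ?a \<le> L * (2 * L ^ 2)" by (rule mult_le_mono2)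
    also have "\<dots> = 2 * L ^ 3" by (simp add: power2_eq_square power3_eq_cube)
    finally show ?thesis using i(2) L[of ?a] by linarith
  qed simp
  with eq show ?thesis by simp
qed

subsection \<open>The ring \<open>\<int>[x] / (1 + x + \<dots> + x\<^bsup>p-1\<^esup>)\<close>\<close>

definition X1 :: "int poly" where "X1 = [:0, 1:]"

definition pi1 :: "int poly" where "pi1 = 1 - X1"

lemma poly_X1 [simp]: "poly X1 c = c"
  by (simp add: X1_def)

lemma poly_pi1 [simp]: "poly pi1 c = 1 - c"
  by (simp add: pi1_def)

lemma pi1_eq: "pi1 = - [:-1, 1:]"
  by (simp add: pi1_def X1_def one_pCons)

definition Phi :: "nat => int poly" where
  "Phi p = (\<Sum>i<p. X1 ^ i)"

text \<open>Equality in the cyclotomic ring Z[lambda], whose elements are represented by integer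
  polynomials throughout: \<open>X1\<close> stands for lambda and \<open>pi1\<close> for 1 -
  lambda.\<close>

definition cg :: "nat => int poly => int poly => bool" where
  "cg p a b \<longleftrightarrow> Phi p dvd a - b"

lemma cg_refl [simp]: "cg p a a"
  by (simp add: cg_def)

lemma cg_sym: "cg p a b ==> cg p b a"
  unfolding cg_def by (metis dvd_minus_iff minus_diff_eq)

lemma cg_trans [trans]: "cg p a b ==> cg p b c ==> cg p a c"
  unfolding cg_def using dvd_add[of "Phi p" "a - b" "b - c"] by simp

lemma cg_add: "cg p a b ==> cg p c d ==> cg p (a + c) (b + d)"
  unfolding cg_def using dvd_add[of "Phi p" "a - b" "c - d"] by (simp add: algebra_simps)

lemma cg_diff: "cg p a b ==> cg p c d ==> cg p (a - c) (b - d)"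
  unfolding cg_def using dvd_diff[of "Phi p" "a - b" "c - d"] by (simp add: algebra_simps)

lemma cg_mult: "cg p a b ==> cg p c d ==> cg p (a * c) (b * d)"
proof -
  assume "cg p a b" "cg p c d"
  then have "Phi p dvd (a - b) * c + b * (c - d)" by (simp add: cg_def)
  then show ?thesis by (simp add: cg_def algebra_simps)
qed

lemma cg_mult_left: "cg p c d ==> cg p (a * c) (a * d)"
  by (rule cg_mult) simp

lemma cg_sum: "(\<And>i. i \<in> A ==> cg p (f i) (g i)) ==> cg p (sum f A) (sum g A)"
  by (induction A rule: infinite_finite_induct) (auto intro: cg_add)

lemma cg_power: "cg p a b ==> cg p (a ^ k) (b ^ k)"
  by (induction k) (auto intro: cg_mult)

lemma cg_0_iff: "cg p a 0 \<longleftrightarrow> Phi p dvd a"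
  by (simp add: cg_def)

lemma X1_pow_eq_monom: "X1 ^ i = monom 1 i"
  by (simp add: X1_def monom_altdef)

lemma pi1_mult_Phi: "pi1 * Phi p = 1 - X1 ^ p"
  unfolding Phi_def pi1_def by (simp add: one_diff_power_eq)

lemma coeff_Phi: "coeff (Phi p) i = (if i < p then 1 else 0)"
  by (simp add: Phi_def X1_pow_eq_monom coeff_sum)

lemma degree_Phi: "p > 0 ==> degree (Phi p) = p - 1"
  by (intro antisym degree_le le_degree) (auto simp: coeff_Phi)

lemma lead_coeff_Phi: "p > 0 ==> lead_coeff (Phi p) = 1"
  by (simp add: degree_Phi coeff_Phi)

lemma poly_Phi_1: "poly (Phi p) 1 = int p"
  by (simp add: Phi_def poly_sum)

lemma cg_X1_pow: "cg p (X1 ^ p) 1"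
proof -
  have "Phi p dvd - (pi1 * Phi p)" by simp
  then show ?thesis unfolding cg_def pi1_mult_Phi by simp
qed

lemma poly_eq_const_plus_pi1: "\<exists>g. a = [:poly a 1:] + pi1 * g"
proof -
  have "[:- 1, 1:] dvd a - [:poly a 1:]" by (simp flip: poly_eq_0_iff_dvd)
  then obtain g where "a - [:poly a 1:] = [:- 1, 1:] * g" by auto
  moreover have "[:- 1, 1:] * g = pi1 * (- g)" unfolding pi1_eq by (simp only: minus_mult_minus)
  ultimately have "a = [:poly a 1:] + pi1 * (- g)" by (metis add_diff_cancel_left' diff_add_cancel add.commute)
  then show ?thesis ..
qed

text \<open>The value of \<open>f\<close> at 1 makes \<open>f\<close> coprime to x - 1. Modulo
  \<open>p\<close> it divides X^p - 1 = (x - 1)^p, so it becomes a unit modulo \<open>p\<close>. Its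
  leading coefficient is 1 or -1, which forbids this in positive degree.\<close>

lemma Phi_irreducible_aux:
  assumes p: "prime p" and fg: "Phi p = f * g" and f1: "\<bar>poly f 1\<bar> = 1"
  shows "is_unit f"
proof (rule ccontr)
  assume nu: "\<not> is_unit f"
  have p0: "p > 0" using p prime_gt_0_nat by blast
  have "lead_coeff f * lead_coeff g = 1"
    using lead_coeff_Phi[OF p0] fg by (simp add: lead_coeff_mult)
  then have lf: "\<bar>lead_coeff f\<bar> = 1" by (metis abs_1 abs_mult abs_zmult_eq_1)
  have deg: "degree f > 0"
  proof (rule ccontr)
    assume "\<not> ?thesis"
    then obtain c where "f = [:c:]" by (auto elim: degree_eq_zeroE)
    then show False using nu lf by (auto simp: is_unit_const_poly_iff abs_if split: if_splits)
  qed
  obtain w where w: "f = [:poly f 1:] + pi1 * w" using poly_eq_const_plus_pi1 by blast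
  define e where "e = poly f 1"
  have "e * e = 1" using f1 unfolding e_def by (metis abs_mult_self_eq mult_1)
  then have one: "[:e:] * f + [:-1, 1:] * ([:e:] * w) = 1"
    by (subst w) (simp add: algebra_simps one_pCons pi1_eq flip: e_def)
  define k where "k = (\<Sum>i\<in>{0<..<p}. [:int (p choose i) div int p:] * [:-1, 1:] ^ i)"
  have fresh: "X1 ^ p = 1 + [:-1, 1:] ^ p + [:int p:] * k"
  proof -
    have "X1 = [:-1, 1:] + 1" by (simp add: one_pCons X1_def)
    then have "X1 ^ p = (\<Sum>i\<le>p. of_nat (p choose i) * [:-1, 1:] ^ i)"
      by (metis (no_types, lifting) binomial_ring mult.right_neutral power_one sum.cong)
    also have "{..p} = insert 0 (insert p {0<..<p})" using p0 by auto
    also have "(\<Sum>i\<in>\<dots>. of_nat (p choose i) * [:-1, 1:] ^ i) =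
        1 + ([:-1, 1:] ^ p + (\<Sum>i\<in>{0<..<p}. of_nat (p choose i) * [:-1, 1 :: int:] ^ i))"
      using p0 by simp
    also have "(\<Sum>i\<in>{0<..<p}. of_nat (p choose i) * [:-1, 1 :: int:] ^ i) = [:int p:] * k"
      unfolding k_def sum_distrib_left
    proof (rule sum.cong)
      fix i assume "i \<in> {0<..<p}"
      then have "p dvd (p choose i)" using p by (intro dvd_choose_prime) auto
      then have "int (p choose i) = int p * (int (p choose i) div int p)" by simp
      then have "of_nat (p choose i) = [:int p:] * [:int (p choose i) div int p:]"
        by (simp add: of_nat_poly mult.commute)
      then show "of_nat (p choose i) * [:-1, 1:] ^ i =
        [:int p:] * ([:int (p choose i) div int p:] * [:-1, 1 :: int:] ^ i)" by (simp only: mult.assoc)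
    qed simp
    finally show ?thesis by (simp add: algebra_simps)
  qed
  have "f dvd [:-1, 1:] ^ p + [:int p:] * k"
  proof -
    have "f dvd - (pi1 * Phi p)" unfolding fg by simp
    then show ?thesis unfolding pi1_mult_Phi fresh by (simp add: add.commute)
  qed
  then obtain h where h: "[:-1, 1:] ^ p + [:int p:] * k = f * h" by auto
  have "f dvd 1 - ([:-1, 1:] * ([:e:] * w)) ^ p"
  proof -
    have "1 - ([:-1, 1:] * ([:e:] * w)) dvd 1 - ([:-1, 1:] * ([:e:] * w)) ^ p"
      by (simp only: one_diff_power_eq dvd_triv_left)
    moreover have "1 - ([:-1, 1:] * ([:e:] * w)) = [:e:] * f" using one by (metis add_diff_cancel_right')
    ultimately show ?thesis by (metis dvd_mult_right)
  qed
  then obtain h' where h': "1 - ([:-1, 1:] * ([:e:] * w)) ^ p = f * h'" by auto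
  have "1 - (h' + h * ([:e:] * w) ^ p) * f = [:int p:] * (- k * ([:e:] * w) ^ p)"
  proof -
    have "1 = f * h' + ([:-1, 1:] ^ p) * ([:e:] * w) ^ p"
      using h' by (metis diff_add_cancel power_mult_distrib)
    also have "[:-1, 1:] ^ p = f * h - [:int p:] * k" using h by (simp add: algebra_simps)
    finally show ?thesis by (simp add: algebra_simps)
  qed
  then have "\<exists>\<alpha>. [:int p:] dvd 1 - \<alpha> * f" by (metis dvd_triv_left)
  moreover have False if "[:int p:] dvd 1 - \<alpha> * f" for \<alpha>
    using that
  proof (induction "if \<alpha> = 0 then 0 else Suc (degree \<alpha>)" arbitrary: \<alpha> rule: less_induct)
    case less
    show False
    proof (cases "\<alpha> = 0")
      case True
      then have "int p dvd 1" using less.prems by (auto simp: const_poly_dvd_iff dest: spec[of _ 0])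
      then show False using p by (auto dest: prime_ge_2_nat)
    next
      case False
      let ?m = "degree \<alpha>"
      define \<beta> where "\<beta> = \<alpha> - monom (lead_coeff \<alpha>) ?m"
      have "int p dvd coeff (1 - \<alpha> * f) (?m + degree f)"
        using less.prems unfolding const_poly_dvd_iff by blast
      then have "int p dvd lead_coeff \<alpha> * lead_coeff f"
        using deg by (simp add: coeff_mult_degree_sum one_pCons coeff_pCons split: nat.splits)
      then have "int p dvd lead_coeff \<alpha>"
        using lf by (metis abs_dvd_iff dvd_abs_iff abs_mult mult.right_neutral)
      then have "[:int p:] dvd monom (lead_coeff \<alpha>) ?m * f"
        by (intro dvd_mult2) (auto simp: const_poly_dvd_iff)
      with less.prems have "[:int p:] dvd (1 - \<alpha> * f) + monom (lead_coeff \<alpha>) ?m * f" by (rule dvd_add)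
      then have "[:int p:] dvd 1 - \<beta> * f" by (simp add: \<beta>_def algebra_simps)
      moreover have "\<beta> = 0 \<or> degree \<beta> < ?m"
      proof (rule disjCI)
        assume "\<not> degree \<beta> < ?m"
        moreover have "degree \<beta> \<le> ?m"
          unfolding \<beta>_def by (intro degree_diff_le degree_monom_le order_refl)
        ultimately have "degree \<beta> = ?m" by simp
        moreover have "coeff \<beta> ?m = 0" by (simp add: \<beta>_def)
        ultimately show "\<beta> = 0" by (metis leading_coeff_0_iff)
      qed
      ultimately show False using less.hyps[of \<beta>] False by (cases "\<beta> = 0") auto
    qed
  qed
  ultimately show False by blast
qed

text \<open>A factorisation evaluates at 1 to a factorisation of \<open>p\<close>, so one factor has
  value 1 or -1 there.\<close>

lemma prime_elem_Phi: "prime p ==> prime_elem (Phi p)"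
proof -
  assume p: "prime p"
  then have p2: "p \<ge> 2" by (rule prime_ge_2_nat)
  have "irreducible (Phi p)"
  proof (rule irreducibleI)
    show "Phi p \<noteq> 0" using lead_coeff_Phi[of p] p2 by auto
    show "\<not> is_unit (Phi p)"
    proof
      assume "is_unit (Phi p)"
      then have "degree (Phi p) = 0" by (metis is_unit_polyE degree_pCons_0)
      then show False using degree_Phi[of p] p2 by simp
    qed
    fix f g assume fg: "Phi p = f * g"
    then have "poly f 1 * poly g 1 = int p" by (metis poly_Phi_1 poly_mult)
    then have "\<bar>poly f 1\<bar> * \<bar>poly g 1\<bar> = int p" by (metis abs_mult abs_of_nat)
    then have "nat \<bar>poly f 1\<bar> * nat \<bar>poly g 1\<bar> = p" by (simp flip: nat_mult_distrib)
    then have "nat \<bar>poly f 1\<bar> = 1 \<or> nat \<bar>poly g 1\<bar> = 1" using p by (metis prime_product)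
    then have "\<bar>poly f 1\<bar> = 1 \<or> \<bar>poly g 1\<bar> = 1" by linarith
    then show "is_unit f \<or> is_unit g"
      using Phi_irreducible_aux[OF p, of f g] Phi_irreducible_aux[OF p, of g f] fg
      by (auto simp: mult.commute)
  qed
  then show ?thesis by (rule irreducible_imp_prime_elem_gcd)
qed

lemma Phi_not_dvd_const: "prime p ==> c \<noteq> 0 ==> \<not> Phi p dvd [:c:]"
proof
  assume "prime p" "c \<noteq> 0" "Phi p dvd [:c:]"
  then have "degree (Phi p) \<le> 0" by (metis dvd_imp_degree_le degree_pCons_0 pCons_eq_0_iff)
  then show False using \<open>prime p\<close> degree_Phi[of p] prime_ge_2_nat[of p] by simp
qed

lemma cg_p_pi1: "\<exists>h. cg p [:int p:] (pi1 * h)"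
proof -
  obtain g where "Phi p = [:int p:] + pi1 * g" using poly_eq_const_plus_pi1[of "Phi p"] by (auto simp: poly_Phi_1)
  then have "[:int p:] - pi1 * (- g) = Phi p" by simp
  then show ?thesis unfolding cg_def by (metis dvd_refl)
qed

lemma Phi_not_dvd_pi1: "prime p ==> \<not> Phi p dvd pi1"
proof
  assume p: "prime p" and d: "Phi p dvd pi1"
  obtain h where "cg p [:int p:] (pi1 * h)" using cg_p_pi1 by blast
  then have "Phi p dvd ([:int p:] - pi1 * h) + pi1 * h" using d unfolding cg_def by (intro dvd_add dvd_mult2)
  then show False using Phi_not_dvd_const[OF p, of "int p"] p by (auto dest: prime_gt_0_nat)
qed

lemma cg_pi1_cancel: "prime p ==> cg p (pi1 * a) (pi1 * b) ==> cg p a b"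
proof -
  assume p: "prime p" and "cg p (pi1 * a) (pi1 * b)"
  then have "Phi p dvd pi1 * (a - b)" by (simp add: cg_def algebra_simps)
  then show ?thesis
    using prime_elem_dvd_mult_iff[OF prime_elem_Phi[OF p]] Phi_not_dvd_pi1[OF p] by (simp add: cg_def)
qed

text \<open>The units are the cyclotomic ones: (1 - lambda^m) / (1 - lambda) = 1 + ... +
  lambda^(m-1) has residue \<open>m\<close> modulo 1 - lambda. Its inverse is (1 - lambda^(m d)) /
  (1 - lambda^m) with m d congruent to 1 modulo \<open>p\<close>.\<close>

lemma Phi_unit_residue:
  assumes p: "prime p" and c: "\<not> int p dvd c"
  shows "\<exists>u w g. cg p (u * w) 1 \<and> cg p u ([:c:] + pi1 * g)"
proof -
  define m where "m = nat (c mod int p)"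
  have p0: "p > 0" using p prime_gt_0_nat by blast
  have m: "int m = c mod int p" using p0 by (simp add: m_def)
  have "\<not> p dvd m" using c m p0 by (metis dvd_imp_mod_0 dvd_mod_iff dvd_refl int_dvd_int_iff)
  then have "coprime m p" using p by (metis coprime_commute prime_imp_coprime)
  moreover have "m \<noteq> 0" using \<open>\<not> p dvd m\<close> by (metis dvd_0_right)
  ultimately obtain d k where dk: "m * d = p * k + 1" using coprime_bezout_strong[of m p] p
    by (metis not_prime_1 )
  define u where "u = (\<Sum>i<m. X1 ^ i)"
  define w where "w = (\<Sum>i<d. (X1 ^ m) ^ i)"
  have pu: "pi1 * u = 1 - X1 ^ m" unfolding u_def pi1_def by (simp add: one_diff_power_eq)
  have "pi1 * (u * w) = (1 - X1 ^ m) * w" using pu by (simp only: mult.assoc flip: mult.assoc)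
  also have "\<dots> = 1 - X1 ^ (p * k + 1)"
    unfolding w_def by (simp only: one_diff_power_eq[symmetric] power_mult[symmetric] dk)
  also have "X1 ^ (p * k + 1) = (X1 ^ p) ^ k * X1" by (simp add: power_mult)
  finally have "pi1 * (u * w) = 1 - (X1 ^ p) ^ k * X1" .
  moreover have "cg p (1 - (X1 ^ p) ^ k * X1) (1 - 1 ^ k * X1)"
    by (intro cg_diff cg_mult cg_power cg_X1_pow cg_refl)
  moreover have "1 - 1 ^ k * X1 = pi1 * 1" by (simp add: pi1_def)
  ultimately have uw: "cg p (u * w) 1" using cg_pi1_cancel[OF p, of "u * w" 1] by metis
  obtain g1 where g1: "u = [:poly u 1:] + pi1 * g1" using poly_eq_const_plus_pi1 by blast
  have "poly u 1 = int m" by (simp add: u_def poly_sum)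
  then have u: "u = [:c:] + pi1 * g1 - [:int p:] * [:c div int p:]"
    using g1 m by (simp add: minus_mult_div_eq_mod[symmetric])
  obtain h where "cg p [:int p:] (pi1 * h)" using cg_p_pi1 by blast
  then have "cg p u ([:c:] + pi1 * g1 - (pi1 * h) * [:c div int p:])"
    unfolding u by (intro cg_diff cg_mult cg_refl)
  also have "[:c:] + pi1 * g1 - (pi1 * h) * [:c div int p:] = [:c:] + pi1 * (g1 - h * [:c div int p:])"
    by (simp only: algebra_simps)
  finally show ?thesis using uw by blast
qed

text \<open>A substitute for the norm. An element of least degree in the ideal generated by
  \<open>a\<close> and \<open>Phi p\<close> divides both of them up to nonzero integer factors.
  Since \<open>Phi p\<close> is prime and does not divide \<open>a\<close>, that element is
  constant.\<close>

lemma ex_const_multiple: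
  assumes p: "prime p" and a: "\<not> cg p a 0"
  shows "\<exists>u d. d \<noteq> 0 \<and> cg p (u * a) [:d:]"
proof -
  define J where "J = {u * a + v * Phi p | u v. True}"
  have J_diff: "x - y \<in> J" if "x \<in> J" "y \<in> J" for x y
  proof -
    from that obtain u v u' v' where "x = u * a + v * Phi p" "y = u' * a + v' * Phi p" by (auto simp: J_def)
    then have "x - y = (u - u') * a + (v - v') * Phi p" by (simp add: algebra_simps)
    then show ?thesis by (auto simp: J_def)
  qed
  have J_mult: "c * x \<in> J" if "x \<in> J" for c x
  proof -
    from that obtain u v where "x = u * a + v * Phi p" by (auto simp: J_def)
    then have "c * x = (c * u) * a + (c * v) * Phi p" by (simp add: algebra_simps)
    then show ?thesis by (auto simp: J_def)
  qed
  have "a = 1 * a + 0 * Phi p" "Phi p = 0 * a + 1 * Phi p" by simp_all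
  then have aJ: "a \<in> J" and PJ: "Phi p \<in> J" unfolding J_def by blast+
  have a0: "a \<noteq> 0" using a by auto
  obtain g where g: "g \<in> J" "g \<noteq> 0" and gmin: "\<And>h. h \<in> J ==> h \<noteq> 0 ==> degree g \<le> degree h"
    using ex_has_least_nat[of "\<lambda>h. h \<in> J \<and> h \<noteq> 0" a degree] aJ a0 by blast
  have div: "\<exists>c q. c \<noteq> 0 \<and> [:c:] * f = g * q" if "f \<in> J" for f
  proof -
    obtain q r where qr: "pseudo_divmod f g = (q, r)" by force
    define c where "c = lead_coeff g ^ (Suc (degree f) - degree g)"
    have eq: "smult c f = g * q + r" and r: "r = 0 \<or> degree r < degree g"
      using pseudo_divmod[OF g(2) qr] by (simp_all add: c_def)
    have "r = [:c:] * f - q * g" using eq by (simp add: algebra_simps)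
    then have "r \<in> J" using J_diff[OF J_mult[OF that] J_mult[OF g(1)]] by metis
    then have "r = 0" using r gmin[of r] by linarith
    moreover have "c \<noteq> 0" using g by (simp add: c_def)
    ultimately show ?thesis using eq by auto
  qed
  have ndvd: "\<not> Phi p dvd g"
  proof
    assume "Phi p dvd g"
    obtain c q where "c \<noteq> 0" "[:c:] * a = g * q" using div[OF aJ] by blast
    then have "Phi p dvd [:c:] * a" using \<open>Phi p dvd g\<close> by simp
    then show False using prime_elem_dvd_mult_iff[OF prime_elem_Phi[OF p]]
        Phi_not_dvd_const[OF p \<open>c \<noteq> 0\<close>] a unfolding cg_0_iff by blast
  qed
  obtain c q where cq: "c \<noteq> 0" "[:c:] * Phi p = g * q" using div[OF PJ] by blast
  then have "Phi p dvd g * q" by (metis dvd_triv_right)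
  then have "Phi p dvd q" using prime_elem_dvd_mult_iff[OF prime_elem_Phi[OF p]] ndvd by blast
  then obtain q' where "q = Phi p * q'" by auto
  then have "Phi p * [:c:] = Phi p * (g * q')" using cq by (simp only: mult.commute mult.left_commute)
  moreover have "Phi p \<noteq> 0" using prime_elem_Phi[OF p] by auto
  ultimately have "[:c:] = g * q'" by (metis mult_left_cancel)
  then have "degree g = 0" using \<open>c \<noteq> 0\<close> g(2)
    by (metis add_is_0 degree_mult_eq degree_pCons_0 mult_zero_right pCons_eq_0_iff)
  then obtain d where d: "g = [:d:]" by (auto elim: degree_eq_zeroE)
  obtain u v where "g = u * a + v * Phi p" using g by (auto simp: J_def)
  then have "u * a - [:d:] = Phi p * (- v)" using d by (simp add: algebra_simps)
  then have "cg p (u * a) [:d:]" unfolding cg_def by (metis dvd_triv_left)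
  moreover have "d \<noteq> 0" using g d by auto
  ultimately show ?thesis by blast
qed

lemma finite_bounded_polys: "finite {r :: int poly. degree r \<le> n \<and> (\<forall>i. coeff r i \<in> {0..<d})}"
proof -
  have "{r :: int poly. degree r \<le> n \<and> (\<forall>i. coeff r i \<in> {0..<d})} \<subseteq>
    Poly ` {xs. set xs \<subseteq> insert 0 {0..<d} \<and> length xs \<le> Suc n}"
  proof
    fix r :: "int poly" assume r: "r \<in> {r. degree r \<le> n \<and> (\<forall>i. coeff r i \<in> {0..<d})}"
    have "set (coeffs r) \<subseteq> range (coeff r)" by (auto simp: range_coeff)
    then have "set (coeffs r) \<subseteq> insert 0 {0..<d}" using r by fastforce
    moreover have "length (coeffs r) \<le> Suc n" using r by (cases "r = 0") (auto simp: length_coeffs)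
    ultimately show "r \<in> Poly ` {xs. set xs \<subseteq> insert 0 {0..<d} \<and> length xs \<le> Suc n}"
      by (intro image_eqI[of _ _ "coeffs r"]) auto
  qed
  then show ?thesis by (rule finite_subset) (intro finite_imageI finite_lists_length_le, simp)
qed

text \<open>The quotient by a nonzero element is a finite ring, so some power of \<open>b\<close> is idempotent there.\<close>

lemma ex_idempotent_power:
  assumes p: "prime p" and a: "\<not> cg p a 0"
  shows "\<exists>m q. m \<ge> 1 \<and> cg p (b ^ m * b ^ m) (b ^ m + q * a)"
proof -
  obtain u d where d: "d \<noteq> 0" "cg p (u * a) [:d:]" using ex_const_multiple[OF assms] by blast
  define D where "D = \<bar>d\<bar>"
  define eqv where "eqv x y \<longleftrightarrow> (\<exists>q. cg p x (y + q * a))" for x y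
  define R where "R = {r :: int poly. degree r \<le> p \<and> (\<forall>i. coeff r i \<in> {0..<D})}"
  \<comment> \<open>Division by the monic \<open>Phi p\<close> bounds the degree, and the
    coefficients can be reduced modulo \<open>D\<close> because \<open>d\<close> is a multiple of
    \<open>a\<close> in the cyclotomic ring.\<close>
  have red: "\<exists>r\<in>R. \<exists>q. cg p x (r + q * a)" for x
  proof -
    obtain q r0 where qr: "pseudo_divmod x (Phi p) = (q, r0)" by force
    have Phi0: "Phi p \<noteq> 0" using prime_elem_Phi[OF p] by auto
    have p0: "p > 0" using p prime_gt_0_nat by blast
    have eq: "x = Phi p * q + r0" and r0: "r0 = 0 \<or> degree r0 < degree (Phi p)"
      using pseudo_divmod[OF Phi0 qr] lead_coeff_Phi[OF p0] by simp_all
    define r where "r = map_poly (\<lambda>c. c mod D) r0"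
    define v where "v = map_poly (\<lambda>c. c div D) r0"
    have "r0 = r + [:D:] * v"
      by (rule poly_eqI) (simp add: r_def v_def coeff_map_poly)
    moreover have "[:D:] = [:sgn d:] * [:d:]" by (simp add: D_def abs_sgn mult.commute)
    ultimately have "x = Phi p * q + r + [:sgn d:] * v * [:d:]" using eq by (simp only: ac_simps)
    moreover have "cg p (Phi p * q + r + [:sgn d:] * v * [:d:]) (0 + r + [:sgn d:] * v * (u * a))"
      by (intro cg_add cg_mult cg_refl cg_sym[OF d(2)]) (simp add: cg_0_iff)
    ultimately have "cg p x (r + ([:sgn d:] * v * u) * a)" by (simp only: mult.assoc add_0)
    moreover have "degree r \<le> p"
      using r0 map_poly_degree_leq[of "\<lambda>c. c mod D" r0] degree_Phi[OF p0] unfolding r_def by auto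
    then have "r \<in> R" using d by (auto simp: R_def r_def coeff_map_poly D_def)
    ultimately show ?thesis by blast
  qed
  then obtain \<rho> where \<rho>: "\<And>x. \<rho> x \<in> R" "\<And>x. \<exists>q. cg p x (\<rho> x + q * a)" by metis
  have "finite R" unfolding R_def by (rule finite_bounded_polys)
  then have "finite (range (\<lambda>i. \<rho> (b ^ Suc i)))" by (rule finite_subset[rotated]) (use \<rho> in auto)
  then have "\<not> inj (\<lambda>i. \<rho> (b ^ Suc i))" using range_inj_infinite by blast
  then obtain i0 j0 where "i0 < j0" "\<rho> (b ^ Suc i0) = \<rho> (b ^ Suc j0)"
    by (metis (no_types, lifting) injI linorder_neqE_nat)
  then obtain i k where ik: "\<rho> (b ^ i) = \<rho> (b ^ (i + k))" "i \<ge> 1" "k \<ge> 1"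
    by (metis One_nat_def Suc_le_mono add_Suc le0 less_imp_Suc_add plus_1_eq_Suc le_add1 add_Suc_right)
  have eqvI: "eqv x y" if "\<rho> x = \<rho> y" for x y
  proof -
    obtain q q' where "cg p x (\<rho> x + q * a)" "cg p y (\<rho> y + q' * a)" using \<rho>(2) by blast
    then have "cg p (x - y) (\<rho> x + q * a - (\<rho> y + q' * a))" by (rule cg_diff)
    then have "cg p ((x - y) + y) (\<rho> x + q * a - (\<rho> y + q' * a) + y)" by (rule cg_add) simp
    then have "cg p x (y + (q - q') * a)" using that by (simp add: algebra_simps)
    then show ?thesis by (auto simp: eqv_def)
  qed
  have eqv_trans: "eqv x z" if "eqv x y" "eqv y z" for x y z
  proof -
    from that obtain q q' where "cg p x (y + q * a)" "cg p y (z + q' * a)" unfolding eqv_def by blast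
    then have "cg p x (z + q' * a + q * a)" using cg_trans cg_add cg_refl by blast
    then show ?thesis unfolding eqv_def by (intro exI[of _ "q' + q"]) (simp add: algebra_simps)
  qed
  have eqv_mult: "eqv (c * x) (c * y)" if "eqv x y" for c x y
  proof -
    from that obtain q where "cg p x (y + q * a)" by (auto simp: eqv_def)
    then have "cg p (c * x) (c * (y + q * a))" by (rule cg_mult_left)
    then show ?thesis unfolding eqv_def by (intro exI[of _ "c * q"]) (simp add: algebra_simps)
  qed
  have per: "eqv (b ^ (i + l)) (b ^ (i + l + k * t))" for l t
  proof (induction t)
    case 0
    then show ?case unfolding eqv_def by (auto intro!: exI[of _ 0])
  next
    case (Suc t)
    have "eqv (b ^ (l + k * t) * b ^ i) (b ^ (l + k * t) * b ^ (i + k))" by (rule eqv_mult) (rule eqvI[OF ik(1)])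
    then have "eqv (b ^ (i + l + k * t)) (b ^ (i + l + k * Suc t))"
      by (simp add: ac_simps flip: power_add)
    then show ?case using Suc eqv_trans by blast
  qed
  \<comment> \<open>A multiple of the period \<open>k\<close> that is not below the preperiod
    \<open>i\<close>, so that the exponents \<open>m\<close> and \<open>2 * m\<close> give the same
    class.\<close>
  define m where "m = i * k"
  have "m \<ge> i" "m \<ge> 1" using ik by (auto simp: m_def)
  have "eqv (b ^ m) (b ^ (m + k * i))" using per[of "m - i" i] \<open>m \<ge> i\<close> by simp
  then have "eqv (b ^ m) (b ^ m * b ^ m)" by (simp add: m_def power_add mult.commute)
  then obtain q where "cg p (b ^ m) (b ^ m * b ^ m + q * a)" by (auto simp: eqv_def)
  then have "cg p (b ^ m + - q * a) (b ^ m * b ^ m + q * a + - q * a)" by (rule cg_add) simp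
  then have "cg p (b ^ m * b ^ m) (b ^ m + - q * a)" by (simp add: cg_sym)
  then show ?thesis using \<open>m \<ge> 1\<close> by blast
qed

text \<open>The quotient by 1 - lambda is the field with \<open>p\<close> elements, so the ideal
  generated by 1 - lambda is maximal. This is why all ideals met below are principal.\<close>

lemma ideal_with_pi1:
  assumes p: "prime p" and I_add: "\<And>a b. a \<in> I ==> b \<in> I ==> a + b \<in> I"
    and I_mult: "\<And>a c. a \<in> I ==> c * a \<in> I" and I_cg: "\<And>a b. a \<in> I ==> cg p a b ==> b \<in> I"
    and pi: "pi1 \<in> I"
  shows "1 \<in> I \<or> (\<forall>z\<in>I. \<exists>g. cg p z (pi1 * g))"
proof (rule disjCI)
  assume "\<not> (\<forall>z\<in>I. \<exists>g. cg p z (pi1 * g))"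
  then obtain z where z: "z \<in> I" "\<And>g. \<not> cg p z (pi1 * g)" by blast
  obtain g where g: "z = [:poly z 1:] + pi1 * g" using poly_eq_const_plus_pi1 by blast
  define c where "c = poly z 1"
  obtain h where h: "cg p [:int p:] (pi1 * h)" using cg_p_pi1 by blast
  have "\<not> int p dvd c"
  proof
    assume "int p dvd c"
    then obtain k where "c = int p * k" by auto
    then have "z = [:int p:] * [:k:] + pi1 * g" using g by (simp add: c_def)
    moreover have "cg p ([:int p:] * [:k:] + pi1 * g) (pi1 * h * [:k:] + pi1 * g)"
      by (intro cg_add cg_mult h cg_refl)
    ultimately have "cg p z (pi1 * (h * [:k:] + g))" by (simp only: distrib_left mult.assoc)
    then show False using z by blast
  qed
  then have "coprime (int p) c" using p by (simp add: prime_imp_coprime)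
  then obtain x y where xy: "x * int p + y * c = 1" using bezout_int[of "int p" c] by auto
  have pI: "[:int p:] \<in> I" using I_cg[OF _ cg_sym[OF h]] I_mult[OF pi, of h] by (simp only: mult.commute)
  have "z + (- g) * pi1 \<in> I" by (intro I_add z I_mult pi)
  moreover have "z + (- g) * pi1 = [:c:]" using g by (simp add: c_def algebra_simps)
  ultimately have cI: "[:c:] \<in> I" by simp
  have "[:x:] * [:int p:] + [:y:] * [:c:] \<in> I" by (intro I_add I_mult pI cI)
  then show "1 \<in> I" using xy by (simp add: one_pCons algebra_simps)
qed

subsection \<open>Free modules over the ring\<close>

text \<open>The polynomial ring acts on the whole type, while \<open>slat\<close> selects the
  submodules on which \<open>Phi p\<close> acts as zero, that is, modules over Z[lambda].
  Coefficients and values of functionals are representatives, so independence in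
  \<open>sbasis\<close> and linearity in \<open>slin\<close> are required only up to
  \<open>cg\<close>.\<close>

locale pmod =
  fixes s :: "int poly => 'b::ab_group_add => 'b" and p :: nat
  assumes s_add_left: "s (a + b) x = s a x + s b x"
    and s_add_right: "s a (x + y) = s a x + s a y"
    and s_mult: "s (a * b) x = s a (s b x)"
    and s_one [simp]: "s 1 x = x"
    and prime_p: "prime p"
begin

lemma s_zero_left [simp]: "s 0 x = 0"
  using s_add_left[of 0 0 x] by simp

lemma s_zero_right [simp]: "s a 0 = 0"
  using s_add_right[of a 0 0] by simp

lemma s_minus_left: "s (- a) x = - s a x"
  using s_add_left[of "- a" a x] by (simp add: eq_neg_iff_add_eq_0)

lemma s_minus_right: "s a (- x) = - s a x"
  using s_add_right[of a "- x" x] by (simp add: eq_neg_iff_add_eq_0)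

lemma s_diff_left: "s (a - b) x = s a x - s b x"
  using s_add_left[of a "- b" x] by (simp add: s_minus_left)

lemma s_diff_right: "s a (x - y) = s a x - s a y"
  using s_add_right[of a x "- y"] by (simp add: s_minus_right)

lemma s_sum_right: "s a (sum f A) = (\<Sum>i\<in>A. s a (f i))"
  by (induction A rule: infinite_finite_induct) (auto simp: s_add_right)

lemma s_sum_left: "s (sum f A) x = (\<Sum>i\<in>A. s (f i) x)"
  by (induction A rule: infinite_finite_induct) (auto simp: s_add_left)

definition slat :: "'b set => bool" where
  "slat L \<longleftrightarrow> 0 \<in> L \<and> (\<forall>x\<in>L. \<forall>y\<in>L. x + y \<in> L) \<and> (\<forall>a. \<forall>x\<in>L. s a x \<in> L) \<and>
    (\<forall>x\<in>L. s (Phi p) x = 0)"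

definition sbasis :: "nat set => (nat => 'b) => 'b set => bool" where
  "sbasis I e L \<longleftrightarrow> finite I \<and> (\<forall>i\<in>I. e i \<in> L) \<and> (\<forall>x\<in>L. \<exists>q. x = (\<Sum>i\<in>I. s (q i) (e i))) \<and>
    (\<forall>q. (\<Sum>i\<in>I. s (q i) (e i)) = 0 \<longrightarrow> (\<forall>i\<in>I. cg p (q i) 0))"

definition sfree :: "'b set => bool" where
  "sfree L \<longleftrightarrow> slat L \<and> (\<exists>I e. sbasis I e L)"

definition slin :: "('b => int poly) => 'b set => bool" where
  "slin f L \<longleftrightarrow> (\<forall>x\<in>L. \<forall>y\<in>L. cg p (f (x + y)) (f x + f y)) \<and> (\<forall>a. \<forall>x\<in>L. cg p (f (s a x)) (a * f x))"

lemma slatD: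
  assumes "slat L"
  shows "0 \<in> L" "x \<in> L ==> y \<in> L ==> x + y \<in> L" "x \<in> L ==> s a x \<in> L" "x \<in> L ==> s (Phi p) x = 0"
  using assms by (auto simp: slat_def)

lemma slat_uminus: "slat L ==> x \<in> L ==> - x \<in> L"
  using slatD(3)[of L x "-1"] by (simp add: s_minus_left)

lemma slat_diff: "slat L ==> x \<in> L ==> y \<in> L ==> x - y \<in> L"
  using slatD(2)[of L x "- y"] slat_uminus[of L y] by simp

lemma slat_sum: "slat L ==> (\<And>i. i \<in> A ==> f i \<in> L) ==> sum f A \<in> L"
  by (induction A rule: infinite_finite_induct) (auto simp: slatD)

lemma slat_cg: "slat L ==> x \<in> L ==> cg p a b ==> s a x = s b x"
proof -
  assume L: "slat L" and x: "x \<in> L" and "cg p a b"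
  then obtain c where "a - b = Phi p * c" by (auto simp: cg_def)
  then have "s (a - b) x = s c (s (Phi p) x)" by (simp add: mult.commute s_mult)
  then show ?thesis using slatD(4)[OF L x] by (simp add: s_diff_left)
qed

lemma slinD:
  assumes "slin f L"
  shows "x \<in> L ==> y \<in> L ==> cg p (f (x + y)) (f x + f y)" "x \<in> L ==> cg p (f (s a x)) (a * f x)"
  using assms by (auto simp: slin_def)

lemma slin_zero: "slat L ==> slin f L ==> cg p (f 0) 0"
  using slinD(2)[of f L 0 0] slatD(1)[of L] by simp

lemma slin_sum:
  assumes "slat L" "slin f L" "\<And>i. i \<in> A ==> x i \<in> L"
  shows "cg p (f (sum x A)) (\<Sum>i\<in>A. f (x i))"
  using assms(3)
proof (induction A rule: infinite_finite_induct)
  case (insert i A)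
  have "cg p (f (x i + sum x A)) (f (x i) + f (sum x A))"
    using insert assms by (intro slinD slat_sum) auto
  also have "cg p (f (x i) + f (sum x A)) (f (x i) + (\<Sum>i\<in>A. f (x i)))"
    using insert by (intro cg_add) auto
  finally show ?case using insert by simp
qed (use slin_zero[OF assms(1,2)] in auto)

lemma slin_comb:
  assumes "slat L" "slin f L" "\<And>i. i \<in> A ==> x i \<in> L"
  shows "cg p (f (\<Sum>i\<in>A. s (q i) (x i))) (\<Sum>i\<in>A. q i * f (x i))"
proof -
  have "cg p (f (\<Sum>i\<in>A. s (q i) (x i))) (\<Sum>i\<in>A. f (s (q i) (x i)))"
    using assms by (intro slin_sum) (auto simp: slatD)
  also have "cg p (\<Sum>i\<in>A. f (s (q i) (x i))) (\<Sum>i\<in>A. q i * f (x i))"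
    using assms by (intro cg_sum slinD) auto
  finally show ?thesis .
qed

lemma slin_diff:
  assumes "slat L" "slin f L" "x \<in> L" "y \<in> L"
  shows "cg p (f (x - y)) (f x - f y)"
proof -
  have "cg p (f (x + s (-1) y)) (f x + f (s (-1) y))" using assms by (intro slinD slatD)
  also have "cg p (f x + f (s (-1) y)) (f x + (-1) * f y)"
    by (rule cg_add[OF cg_refl slinD(2)[OF assms(2,4)]])
  finally show ?thesis by (simp add: s_minus_left)
qed

lemma slin_subset: "slin f L ==> K \<subseteq> L ==> slin f K"
  unfolding slin_def by blast

lemma slat_kernel: "slat L ==> slin f L ==> slat {x\<in>L. cg p (f x) 0}"
proof -
  assume L: "slat L" and f: "slin f L"
  have "cg p (f (x + y)) 0" if "x \<in> L" "y \<in> L" "cg p (f x) 0" "cg p (f y) 0" for x y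
    using cg_trans[OF slinD(1)[OF f that(1,2)] cg_add[OF that(3,4)]] by simp
  moreover have "cg p (f (s a x)) 0" if "x \<in> L" "cg p (f x) 0" for a x
    using cg_trans[OF slinD(2)[OF f that(1)] cg_mult_left[OF that(2)]] by simp
  ultimately show ?thesis using L slin_zero[OF L f] by (auto simp: slat_def)
qed

lemma sbasisD:
  assumes "sbasis I e L"
  shows "finite I" "i \<in> I ==> e i \<in> L" "x \<in> L ==> \<exists>q. x = (\<Sum>i\<in>I. s (q i) (e i))"
    "(\<Sum>i\<in>I. s (q i) (e i)) = 0 ==> i \<in> I ==> cg p (q i) 0"
  using assms by (auto simp: sbasis_def)

lemma sbasis_replace:
  fixes c :: "nat => int poly"
  assumes L: "slat L" and B: "sbasis I e L" and i: "i \<in> I" and u: "cg p (u * w) 1"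
  defines "v \<equiv> s u (e i) + (\<Sum>j\<in>I - {i}. s (c j) (e j))"
  shows "sbasis I (e(i := v)) L"
proof -
  note fin = sbasisD(1)[OF B]
  have vL: "v \<in> L" unfolding v_def using B i by (intro slatD(2)[OF L] slatD(3)[OF L] slat_sum[OF L] sbasisD(2)) auto
  have split: "(\<Sum>j\<in>I. s (q j) ((e(i := v)) j)) = s (q i * u) (e i) + (\<Sum>j\<in>I - {i}. s (q j + q i * c j) (e j))" for q
  proof -
    have "(\<Sum>j\<in>I. s (q j) ((e(i := v)) j)) = s (q i) v + (\<Sum>j\<in>I - {i}. s (q j) (e j))"
      using fin i by (simp add: sum.remove)
    also have "\<dots> = s (q i * u) (e i) + ((\<Sum>j\<in>I - {i}. s (q i) (s (c j) (e j))) + (\<Sum>j\<in>I - {i}. s (q j) (e j)))"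
      unfolding v_def by (simp add: s_add_right s_mult s_sum_right)
    finally show ?thesis by (simp add: s_add_left s_mult add.commute flip: sum.distrib)
  qed
  show ?thesis unfolding sbasis_def
  proof (intro conjI ballI allI impI fin)
    show "(e(i := v)) j \<in> L" if "j \<in> I" for j using that vL sbasisD(2)[OF B] by simp
    fix x assume "x \<in> L"
    then obtain q where q: "x = (\<Sum>j\<in>I. s (q j) (e j))" using sbasisD(3)[OF B] by blast
    define q' where "q' = (\<lambda>j. q j - q i * w * c j)(i := q i * w)"
    have "cg p (q i * w * u) (q i)" using cg_mult_left[OF u, of "q i"] by (simp add: ac_simps)
    then have "s (q i * w * u) (e i) = s (q i) (e i)" using slat_cg[OF L] sbasisD(2)[OF B i] by blast
    then have "(\<Sum>j\<in>I. s (q' j) ((e(i := v)) j)) = s (q i) (e i) + (\<Sum>j\<in>I - {i}. s (q j) (e j))"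
      unfolding split by (simp add: q'_def)
    also have "\<dots> = x" using q fin i by (simp add: sum.remove)
    finally show "\<exists>q. x = (\<Sum>j\<in>I. s (q j) ((e(i := v)) j))" by metis
  next
    fix q j assume 0: "(\<Sum>j\<in>I. s (q j) ((e(i := v)) j)) = 0" and j: "j \<in> I"
    define q' where "q' = (\<lambda>j. q j + q i * c j)(i := q i * u)"
    have "(\<Sum>j\<in>I. s (q' j) (e j)) = s (q i * u) (e i) + (\<Sum>j\<in>I - {i}. s (q j + q i * c j) (e j))"
      using fin i by (simp add: sum.remove q'_def)
    then have "(\<Sum>j\<in>I. s (q' j) (e j)) = 0" using 0 split by simp
    then have q': "cg p (q' k) 0" if "k \<in> I" for k using sbasisD(4)[OF B] that by blast
    have "cg p (q i * u * w) (0 * w)" using q'[OF i] by (intro cg_mult) (simp_all add: q'_def)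
    moreover have "cg p (q i * u * w) (q i)" using cg_mult_left[OF u, of "q i"] by (simp add: ac_simps)
    ultimately have qi: "cg p (q i) 0" by (metis cg_sym cg_trans mult_zero_left)
    show "cg p (q j) 0"
    proof (cases "j = i")
      case False
      have "cg p (q j + q i * c j - q i * c j) (0 - 0 * c j)"
        using q'[OF j] False by (intro cg_diff cg_mult qi cg_refl) (simp add: q'_def)
      then show ?thesis by simp
    qed (simp add: qi)
  qed
qed

lemma sbasis_insert:
  assumes L: "slat L" and K: "K \<subseteq> L" and B: "sbasis I e K" and x0: "x0 \<in> L" and i: "i \<notin> I"
    and gen: "\<And>x. x \<in> L ==> \<exists>q. x - s q x0 \<in> K" and ind: "\<And>q. s q x0 \<in> K ==> cg p q 0"
    and sK: "slat K"
  shows "sbasis (insert i I) (e(i := x0)) L"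
proof -
  note fin = sbasisD(1)[OF B]
  have split: "(\<Sum>j\<in>insert i I. s (q j) ((e(i := x0)) j)) = s (q i) x0 + (\<Sum>j\<in>I. s (q j) (e j))" for q
    using fin i by (simp add: sum.insert) (intro sum.cong, auto)
  show ?thesis unfolding sbasis_def
  proof (intro conjI ballI allI impI)
    show "(e(i := x0)) j \<in> L" if "j \<in> insert i I" for j using that x0 sbasisD(2)[OF B] K by auto
    fix x assume "x \<in> L"
    then obtain a where "x - s a x0 \<in> K" using gen by blast
    then obtain q where "x - s a x0 = (\<Sum>j\<in>I. s (q j) (e j))" using sbasisD(3)[OF B] by blast
    moreover have "(\<Sum>j\<in>I. s ((q(i := a)) j) (e j)) = (\<Sum>j\<in>I. s (q j) (e j))"
      using i by (intro sum.cong) auto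
    ultimately have "x = (\<Sum>j\<in>insert i I. s ((q(i := a)) j) ((e(i := x0)) j))"
      unfolding split by (simp add: algebra_simps)
    then show "\<exists>q. x = (\<Sum>j\<in>insert i I. s (q j) ((e(i := x0)) j))" by blast
  next
    fix q j assume 0: "(\<Sum>j\<in>insert i I. s (q j) ((e(i := x0)) j)) = 0" and j: "j \<in> insert i I"
    have "s (q i) x0 = - (\<Sum>j\<in>I. s (q j) (e j))" using 0 split by (simp add: eq_neg_iff_add_eq_0)
    then have "s (q i) x0 \<in> K" using sbasisD(2)[OF B] by (auto intro!: slat_uminus slat_sum slatD sK)
    then have qi: "cg p (q i) 0" by (rule ind)
    then have "s (q i) x0 = 0" using slat_cg[OF L x0 qi] by simp
    then have "(\<Sum>j\<in>I. s (q j) (e j)) = 0" using 0 split by simp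
    then show "cg p (q j) 0" using qi j sbasisD(4)[OF B] by blast
  qed (use fin in simp)
qed

lemma sfree_extend:
  assumes L: "slat L" and K: "K \<subseteq> L" and free: "sfree K" and x0: "x0 \<in> L"
    and gen: "\<And>x. x \<in> L ==> \<exists>q. x - s q x0 \<in> K" and ind: "\<And>q. s q x0 \<in> K ==> cg p q 0"
  shows "sfree L"
proof -
  obtain I e where B: "sbasis I e K" using free by (auto simp: sfree_def)
  obtain i where "i \<notin> I" using sbasisD(1)[OF B] ex_new_if_finite infinite_UNIV_nat by blast
  then show ?thesis using sbasis_insert[OF L K B x0 _ gen ind] free L unfolding sfree_def by blast
qed

lemma sfree_trivial: "sfree {0}"
  unfolding sfree_def slat_def sbasis_def by (auto intro!: exI[of _ "{}"])

lemma sbasis_subset: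
  assumes L: "slat L" and B: "sbasis I e L" and J: "J \<subseteq> I"
  defines "K \<equiv> {x. \<exists>q. x = (\<Sum>j\<in>J. s (q j) (e j))}"
  shows "slat K" "sbasis J e K" "K \<subseteq> L"
proof -
  have fin: "finite J" using sbasisD(1)[OF B] J finite_subset by blast
  show KL: "K \<subseteq> L" unfolding K_def using J by (auto intro!: slat_sum[OF L] slatD(3)[OF L] sbasisD(2)[OF B])
  show "slat K" unfolding slat_def
  proof (intro conjI ballI allI)
    show "0 \<in> K" unfolding K_def by (auto intro!: exI[of _ "\<lambda>_. 0"])
    show "x + y \<in> K" if xy: "x \<in> K" "y \<in> K" for x y
    proof -
      obtain q r where "x = (\<Sum>j\<in>J. s (q j) (e j))" "y = (\<Sum>j\<in>J. s (r j) (e j))" using xy unfolding K_def by blast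
      then have "x + y = (\<Sum>j\<in>J. s (q j + r j) (e j))" by (simp add: sum.distrib s_add_left)
      then show ?thesis unfolding K_def mem_Collect_eq by (rule exI[of _ "\<lambda>j. q j + r j"])
    qed
    show "s a x \<in> K" if x: "x \<in> K" for a x
    proof -
      obtain q where "x = (\<Sum>j\<in>J. s (q j) (e j))" using x unfolding K_def by blast
      then have "s a x = (\<Sum>j\<in>J. s (a * q j) (e j))" by (simp add: s_sum_right s_mult)
      then show ?thesis unfolding K_def mem_Collect_eq by (rule exI[of _ "\<lambda>j. a * q j"])
    qed
    show "s (Phi p) x = 0" if "x \<in> K" for x using that KL slatD(4)[OF L] by blast
  qed
  show "sbasis J e K" unfolding sbasis_def
  proof (intro conjI ballI allI impI fin)
    show "e j \<in> K" if "j \<in> J" for j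
    proof -
      have "(\<Sum>k\<in>J. s (if k = j then 1 else 0) (e k)) = (\<Sum>k\<in>J. if k = j then e k else 0)"
        by (intro sum.cong) auto
      also have "\<dots> = e j" using fin that by simp
      finally show ?thesis unfolding K_def by (auto intro!: exI[of _ "\<lambda>k. if k = j then 1 else 0"])
    qed
    show "\<exists>q. x = (\<Sum>i\<in>J. s (q i) (e i))" if "x \<in> K" for x using that by (auto simp: K_def)
    fix q j assume 0: "(\<Sum>i\<in>J. s (q i) (e i)) = 0" and j: "j \<in> J"
    define q' where "q' i = (if i \<in> J then q i else 0)" for i
    have "(\<Sum>i\<in>I. s (q' i) (e i)) = (\<Sum>i\<in>J. s (q' i) (e i))"
      using J sbasisD(1)[OF B] by (intro sum.mono_neutral_right) (auto simp: q'_def)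
    also have "\<dots> = 0" using 0 by (simp add: q'_def)
    finally have "cg p (q' j) 0" using sbasisD(4)[OF B] J j by blast
    then show "cg p (q j) 0" using j by (simp add: q'_def)
  qed
qed

lemma sbasis_change_part:
  assumes L: "slat L" and B: "sbasis I e L" and i: "i \<in> I"
    and B': "sbasis (I - {i}) e' {x. \<exists>q. x = (\<Sum>j\<in>I - {i}. s (q j) (e j))}"
  shows "sbasis I (e'(i := e i)) L"
proof -
  let ?K = "{x. \<exists>q. x = (\<Sum>j\<in>I - {i}. s (q j) (e j))}"
  note K = sbasis_subset[OF L B, of "I - {i}"]
  note fin = sbasisD(1)[OF B]
  have "sbasis (insert i (I - {i})) (e'(i := e i)) L"
  proof (rule sbasis_insert[OF L K(3) B' sbasisD(2)[OF B i]])
    fix x assume "x \<in> L"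
    then obtain q where "x = (\<Sum>j\<in>I. s (q j) (e j))" using sbasisD(3)[OF B] by blast
    then have "x - s (q i) (e i) = (\<Sum>j\<in>I - {i}. s (q j) (e j))" using fin i by (simp add: sum.remove)
    then show "\<exists>q. x - s q (e i) \<in> ?K" by blast
  next
    fix a assume "s a (e i) \<in> ?K"
    then obtain q where q: "s a (e i) = (\<Sum>j\<in>I - {i}. s (q j) (e j))" by blast
    have "(\<Sum>j\<in>I. s (((\<lambda>j. - q j)(i := a)) j) (e j)) = s a (e i) + (\<Sum>j\<in>I - {i}. s (- q j) (e j))"
      using fin i by (simp add: sum.remove)
    also have "\<dots> = 0" using q by (simp add: s_minus_left sum_negf)
    finally have "cg p (((\<lambda>j. - q j)(i := a)) i) 0" using sbasisD(4)[OF B _ i] by blast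
    then show "cg p a 0" by simp
  qed (use K(1) in auto)
  then show ?thesis using i by (simp add: insert_absorb)
qed

text \<open>A stable range argument. Modulo a nonzero value at \<open>i2\<close> the ring is finite,
  so some power of the value \<open>b\<close> at \<open>i1\<close> is idempotent there. Adding to
  \<open>b\<close> the complementary idempotent times the value at \<open>i0\<close> makes the row
  without \<open>i0\<close> unimodular.\<close>

lemma unimodular_reduction:
  assumes L: "slat L" and B: "sbasis I e L" and f: "slin f L"
    and u: "cg p (\<Sum>i\<in>I. u i * f (e i)) 1" and card: "card I \<ge> 3"
  shows "\<exists>e' i0 u'. i0 \<in> I \<and> sbasis I e' L \<and> cg p (\<Sum>i\<in>I - {i0}. u' i * f (e' i)) 1"
proof -
  note fin = sbasisD(1)[OF B]
  obtain i0 where i0: "i0 \<in> I" using card by (metis card.empty ex_in_conv not_numeral_le_zero)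
  have "card (I - {i0}) \<ge> 2" using card i0 fin by simp
  then obtain i1 where i1: "i1 \<in> I - {i0}" by (metis card.empty ex_in_conv not_numeral_le_zero)
  have "card (I - {i0} - {i1}) \<ge> 1" using card i0 i1 fin by simp
  then obtain i2 where i2: "i2 \<in> I - {i0} - {i1}" by (metis card.empty ex_in_conv not_one_le_zero)
  show ?thesis
  proof (cases "cg p (f (e i2)) 0")
    case True
    \<comment> \<open>The value at \<open>i2\<close> is zero, so the unimodular combination of the
      other vectors can be added to \<open>e i2\<close>, which gives it the value 1.\<close>
    define v where "v = s 1 (e i2) + (\<Sum>j\<in>I - {i2}. s (u j) (e j))"
    have B': "sbasis I (e(i2 := v)) L"
      unfolding v_def using i2 by (intro sbasis_replace[OF L B, of _ _ 1]) auto
    have "cg p (f (s 1 (e i2) + (\<Sum>j\<in>I - {i2}. s (u j) (e j))))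
        (f (s 1 (e i2)) + f (\<Sum>j\<in>I - {i2}. s (u j) (e j)))"
      using i2 sbasisD(2)[OF B] by (intro slinD(1)[OF f] slat_sum[OF L] slatD(3)[OF L]) auto
    also have "cg p \<dots> (0 + (\<Sum>j\<in>I - {i2}. u j * f (e j)))"
      using True sbasisD(2)[OF B] by (intro cg_add slin_comb[OF L f]) auto
    also have "(0 + (\<Sum>j\<in>I - {i2}. u j * f (e j))) = (\<Sum>j\<in>I. u j * f (e j)) - u i2 * f (e i2)"
      using i2 fin by (simp add: sum.remove[of I i2])
    also have "cg p \<dots> (1 - u i2 * 0)" by (intro cg_diff u cg_mult_left True)
    finally have fv: "cg p (f v) 1" by (simp add: v_def)
    have "(\<Sum>i\<in>I - {i0}. (if i = i2 then 1 else 0) * f ((e(i2 := v)) i)) =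
        (\<Sum>i\<in>I - {i0}. if i = i2 then f v else 0)"
      by (intro sum.cong) auto
    also have "\<dots> = f v" using i2 fin by simp
    finally have "cg p (\<Sum>i\<in>I - {i0}. (if i = i2 then 1 else 0) * f ((e(i2 := v)) i)) 1"
      using fv by simp
    then show ?thesis using B' i0
      by (intro exI[of _ "e(i2 := v)"] exI[of _ i0] exI[of _ "\<lambda>i. if i = i2 then 1 else 0"] conjI)
  next
    case False
    define b where "b = f (e i1)"
    obtain m q where m: "m \<ge> 1" and bm: "cg p (b ^ m * b ^ m) (b ^ m + q * f (e i2))"
      using ex_idempotent_power[OF prime_p False] by blast
    define y where "y = 1 - b ^ m"
    define v where "v = s 1 (e i1) + (\<Sum>j\<in>I - {i1}. s (if j = i0 then y else 0) (e j))"
    have B': "sbasis I (e(i1 := v)) L"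
      unfolding v_def using i1 by (intro sbasis_replace[OF L B, of _ _ 1]) auto
    have "(\<Sum>j\<in>I - {i1}. s (if j = i0 then y else 0) (e j)) = (\<Sum>j\<in>I - {i1}. if j = i0 then s y (e j) else 0)"
      by (intro sum.cong) auto
    also have "\<dots> = s y (e i0)" using i0 i1 fin by simp
    finally have v: "v = e i1 + s y (e i0)" by (simp add: v_def)
    have "cg p (f v) (f (e i1) + f (s y (e i0)))"
      unfolding v using i0 i1 sbasisD(2)[OF B] by (intro slinD(1)[OF f] slatD(3)[OF L]) auto
    also have "cg p \<dots> (b + y * f (e i0))"
      unfolding b_def by (intro cg_add cg_refl slinD(2)[OF f] sbasisD(2)[OF B] i0)
    finally have fv: "cg p (f v) (b + y * f (e i0))" .
    \<comment> \<open>The ideal generated by the values of the modified basis outside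
      \<open>i0\<close>; the goal is to show that it contains 1.\<close>
    define T where "T = {z. \<exists>c. cg p (\<Sum>i\<in>I - {i0}. c i * f ((e(i1 := v)) i)) z}"
    have T_add: "x + z \<in> T" if xz: "x \<in> T" "z \<in> T" for x z
    proof -
      obtain c d where "cg p (\<Sum>i\<in>I - {i0}. c i * f ((e(i1 := v)) i)) x"
        "cg p (\<Sum>i\<in>I - {i0}. d i * f ((e(i1 := v)) i)) z" using xz unfolding T_def by blast
      then have "cg p (\<Sum>i\<in>I - {i0}. (c i + d i) * f ((e(i1 := v)) i)) (x + z)"
        using cg_add by (simp only: sum.distrib distrib_right) 
      then show ?thesis unfolding T_def mem_Collect_eq by (rule exI[of _ "\<lambda>i. c i + d i"])
    qed
    have T_mult: "a * x \<in> T" if x: "x \<in> T" for a x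
    proof -
      obtain c where "cg p (\<Sum>i\<in>I - {i0}. c i * f ((e(i1 := v)) i)) x" using x unfolding T_def by blast
      from cg_mult_left[OF this, of a] have "cg p (\<Sum>i\<in>I - {i0}. (a * c i) * f ((e(i1 := v)) i)) (a * x)"
        by (simp only: sum_distrib_left mult.assoc)
      then show ?thesis unfolding T_def mem_Collect_eq by (rule exI[of _ "\<lambda>i. a * c i"])
    qed
    have T_cg: "z \<in> T" if "x \<in> T" "cg p x z" for x z
      using that cg_trans unfolding T_def by blast
    have T_gen: "f ((e(i1 := v)) j) \<in> T" if "j \<in> I - {i0}" for j
    proof -
      have "(\<Sum>i\<in>I - {i0}. (if i = j then 1 else 0) * f ((e(i1 := v)) i)) =
          (\<Sum>i\<in>I - {i0}. if i = j then f ((e(i1 := v)) i) else 0)" by (intro sum.cong) auto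
      also have "\<dots> = f ((e(i1 := v)) j)" using that fin by simp
      finally have "cg p (\<Sum>i\<in>I - {i0}. (if i = j then 1 else 0) * f ((e(i1 := v)) i)) (f ((e(i1 := v)) j))"
        by simp
      then show ?thesis unfolding T_def mem_Collect_eq by (rule exI[of _ "\<lambda>i. if i = j then 1 else 0"])
    qed
    have T_diff: "x - z \<in> T" if "x \<in> T" "z \<in> T" for x z
      using T_add[OF that(1) T_mult[OF that(2), of "-1"]] by simp
    have T_sum: "sum g A \<in> T" if "\<And>i. i \<in> A ==> g i \<in> T" for g and A :: "nat set"
      using that
    proof (induction A rule: infinite_finite_induct)
      have "0 \<in> T" using T_mult[OF T_gen[OF i1], of 0] by simp
      then show "sum g {} \<in> T" "infinite A ==> sum g A \<in> T" for A by simp_all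
    qed (auto intro: T_add)
    have f2T: "f (e i2) \<in> T" using T_gen[of i2] i2 by auto
    define a0 where "a0 = f (e i0)"
    have wT: "b + y * a0 \<in> T" using T_cg[OF _ fv] T_gen[of i1] i1 by (simp add: a0_def)
    \<comment> \<open>Modulo the value at \<open>i2\<close>, multiplication by \<open>b ^ m\<close>
      annihilates \<open>y\<close>. It therefore turns the generator \<open>b + y * a0\<close> of
      the ideal into a multiple of a power of \<open>b\<close> alone.\<close>
    have bmT: "b ^ m \<in> T"
    proof -
      have "b ^ m * (b + y * a0) - (b ^ m - b ^ m * b ^ m) * a0 = b ^ m * b"
        by (simp add: y_def algebra_simps)
      moreover have "b ^ m - b ^ m * b ^ m \<in> T"
      proof (rule T_cg)
        show "(- q) * f (e i2) \<in> T" by (rule T_mult[OF f2T])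
        have "cg p (b ^ m - b ^ m * b ^ m) (b ^ m - (b ^ m + q * f (e i2)))" by (rule cg_diff[OF cg_refl bm])
        then show "cg p ((- q) * f (e i2)) (b ^ m - b ^ m * b ^ m)" by (simp add: cg_sym)
      qed
      then have "b ^ m * (b + y * a0) - a0 * (b ^ m - b ^ m * b ^ m) \<in> T"
        using T_diff T_mult wT by blast
      ultimately have "b ^ m * b \<in> T" by (simp add: mult.commute)
      then have "b ^ (m - 1) * (b ^ m * b) \<in> T" by (rule T_mult)
      moreover have "b ^ (m - 1) * (b ^ m * b) = b ^ m * b ^ m"
        using m by (cases m) (simp_all add: ac_simps)
      ultimately have "b ^ m * b ^ m \<in> T" by (simp only:)
      then have "b ^ m * b ^ m + (b ^ m - b ^ m * b ^ m) \<in> T"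
        using \<open>b ^ m - b ^ m * b ^ m \<in> T\<close> by (rule T_add)
      then show ?thesis by simp
    qed
    have sT: "b + a0 \<in> T"
      using T_add[OF wT T_mult[OF bmT, of a0]] by (simp add: y_def algebra_simps)
    have 1: "1 - (u i0 * a0 + u i1 * b) \<in> T"
    proof (rule T_cg)
      show "(\<Sum>i\<in>I - {i0} - {i1}. u i * f (e i)) \<in> T"
      proof (rule T_sum)
        fix i assume "i \<in> I - {i0} - {i1}"
        then show "u i * f (e i) \<in> T" using T_mult[OF T_gen[of i], of "u i"] by simp
      qed
      have "(\<Sum>i\<in>I. u i * f (e i)) = u i0 * a0 + (u i1 * b + (\<Sum>i\<in>I - {i0} - {i1}. u i * f (e i)))"
        using fin i0 i1 by (simp add: sum.remove a0_def b_def)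
      then have "(\<Sum>i\<in>I - {i0} - {i1}. u i * f (e i)) = (\<Sum>i\<in>I. u i * f (e i)) - (u i0 * a0 + u i1 * b)"
        by (simp add: algebra_simps)
      then show "cg p (\<Sum>i\<in>I - {i0} - {i1}. u i * f (e i)) (1 - (u i0 * a0 + u i1 * b))"
        using cg_diff[OF u cg_refl] by simp
    qed
    \<comment> \<open>Modulo \<open>T\<close> the values at \<open>i0\<close> and \<open>i1\<close>
      are opposite and the remaining ones vanish, so unimodularity says that \<open>b\<close> is
      invertible there. As \<open>b ^ m\<close> lies in \<open>T\<close>, the quotient by
      \<open>T\<close> is zero.\<close>
    define r where "r = u i1 - u i0"
    have "1 - (u i0 * a0 + u i1 * b) + u i0 * (b + a0) \<in> T" by (intro T_add 1 T_mult sT)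
    then have rT: "1 - r * b \<in> T" by (simp add: r_def algebra_simps)
    have "1 - (r * b) ^ m \<in> T"
      using T_mult[OF rT, of "\<Sum>i<m. (r * b) ^ i"] by (simp only: one_diff_power_eq mult.commute)
    moreover have "(r * b) ^ m \<in> T" using T_mult[OF bmT, of "r ^ m"] by (simp add: power_mult_distrib)
    ultimately have "1 - (r * b) ^ m + (r * b) ^ m \<in> T" by (rule T_add)
    then have "1 \<in> T" by simp
    then show ?thesis using B' i0 unfolding T_def by blast
  qed
qed

text \<open>Completion of a unimodular row. In rank 1 its entry is a unit, in rank 2 there is an
  explicit matrix of determinant 1, and longer rows are shortened by
  \<open>unimodular_reduction\<close>.\<close>

lemma sbasis_unimodular:
  assumes "slat L" "sbasis I e L" "slin f L" "cg p (\<Sum>i\<in>I. u i * f (e i)) 1"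
  shows "\<exists>e' i0. i0 \<in> I \<and> sbasis I e' L \<and> cg p (f (e' i0)) 1 \<and> (\<forall>i\<in>I - {i0}. cg p (f (e' i)) 0)"
  using assms
proof (induction "card I" arbitrary: I e L u rule: less_induct)
  case less
  note L = less.prems(1) and B = less.prems(2) and f = less.prems(3) and u = less.prems(4)
  note fin = sbasisD(1)[OF B]
  have "I \<noteq> {}"
  proof
    assume "I = {}"
    then have "cg p [:-1:] 0" using u cg_sym[OF u] by (simp add: cg_def one_pCons)
    then show False using Phi_not_dvd_const[OF prime_p, of "-1"] by (simp add: cg_0_iff)
  qed
  then have "card I > 0" using fin by (simp add: card_gt_0_iff)
  then consider "card I = 1" | "card I = 2" | "card I \<ge> 3" by linarith
  then show ?case
  proof cases
    case 1
    then obtain i where I: "I = {i}" by (auto simp: card_1_singleton_iff)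
    define v where "v = s (u i) (e i) + (\<Sum>j\<in>I - {i}. s 0 (e j))"
    have "sbasis I (e(i := v)) L"
      unfolding v_def using u by (intro sbasis_replace[OF L B, of _ _ "f (e i)"]) (auto simp: I)
    moreover have "v = s (u i) (e i)" by (simp add: v_def)
    moreover have "cg p (f (s (u i) (e i))) (u i * f (e i))"
      using sbasisD(2)[OF B] by (intro slinD(2)[OF f]) (auto simp: I)
    then have "cg p (f (s (u i) (e i))) 1" using u cg_trans by (auto simp: I)
    ultimately show ?thesis by (intro exI[of _ "e(i := v)"] exI[of _ i]) (auto simp: I)
  next
    case 2
    then obtain i j where I: "I = {i, j}" and ij: "i \<noteq> j" by (auto simp: card_2_iff)
    define a b where "a = f (e i)" and "b = f (e j)"
    have uv: "cg p (u i * a + u j * b) 1" using u ij by (simp add: I a_def b_def)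
    have eL: "e i \<in> L" "e j \<in> L" using sbasisD(2)[OF B] I by auto
    \<comment> \<open>The rows (u i, u j) and (-b, a) form a matrix whose determinant
      \<open>u i * a + u j * b\<close> is 1 in the cyclotomic ring; \<open>w\<close> spans the
      kernel of the functional.\<close>
    define v w where "v = s (u i) (e i) + s (u j) (e j)" and "w = s a (e j) - s b (e i)"
    define e' where "e' = e(i := v, j := w)"
    have e': "e' i = v" "e' j = w" using ij by (auto simp: e'_def)
    have vw: "v \<in> L" "w \<in> L" unfolding v_def w_def using eL by (auto intro!: slatD[OF L] slat_diff[OF L])
    have comb: "s q v + s r w = s (q * u i - r * b) (e i) + s (q * u j + r * a) (e j)" for q r
      unfolding v_def w_def by (simp add: s_add_right s_diff_right s_diff_left s_add_left s_mult)
    have sumI: "(\<Sum>k\<in>I. s (q k) (g k)) = s (q i) (g i) + s (q j) (g j)" for q g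
      using ij by (simp add: I)
    have "sbasis I e' L" unfolding sbasis_def
    proof (intro conjI ballI allI impI fin)
      show "e' k \<in> L" if "k \<in> I" for k using that vw e' by (auto simp: I)
      fix x assume "x \<in> L"
      then obtain q where q: "x = s (q i) (e i) + s (q j) (e j)" using sbasisD(3)[OF B] sumI by metis
      define c d where "c = q i * a + q j * b" and "d = q j * u i - q i * u j"
      have "cg p (q i * (u i * a + u j * b)) (q i * 1)" "cg p (q j * (u i * a + u j * b)) (q j * 1)"
        by (intro cg_mult_left uv)+
      then have "cg p (c * u i - d * b) (q i)" "cg p (c * u j + d * a) (q j)"
        by (simp_all add: c_def d_def algebra_simps)
      then have "s (c * u i - d * b) (e i) = s (q i) (e i)" "s (c * u j + d * a) (e j) = s (q j) (e j)"
        using slat_cg[OF L] eL by blast+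
      then have "x = s c v + s d w" using q comb by simp
      also have "\<dots> = (\<Sum>k\<in>I. s (((\<lambda>_. c)(j := d)) k) (e' k))" using sumI e' ij by simp
      finally show "\<exists>q. x = (\<Sum>k\<in>I. s (q k) (e' k))" by blast
    next
      fix q k assume 0: "(\<Sum>k\<in>I. s (q k) (e' k)) = 0" and k: "k \<in> I"
      define r where "r = (\<lambda>_. q i * u i - q j * b)(j := q i * u j + q j * a)"
      have "(\<Sum>k\<in>I. s (r k) (e k)) = 0" using 0 sumI[of q e'] sumI[of r e] comb e' ij by (simp add: r_def)
      then have r: "cg p (r i) 0" "cg p (r j) 0" using sbasisD(4)[OF B] I by blast+
      then have ri: "cg p (q i * u i - q j * b) 0" and rj: "cg p (q i * u j + q j * a) 0"
        using ij by (simp_all add: r_def)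
      have "cg p (a * (q i * u i - q j * b) + b * (q i * u j + q j * a)) (a * 0 + b * 0)"
        by (intro cg_add cg_mult_left ri rj)
      then have "cg p (q i * (u i * a + u j * b)) 0" by (simp add: algebra_simps)
      then have qi: "cg p (q i) 0" using cg_trans[OF cg_sym[OF cg_mult_left[OF uv, of "q i"]]] by simp
      have "cg p (u i * (q i * u j + q j * a) - u j * (q i * u i - q j * b)) (u i * 0 - u j * 0)"
        by (intro cg_diff cg_mult_left ri rj)
      then have "cg p (q j * (u i * a + u j * b)) 0" by (simp add: algebra_simps)
      then have qj: "cg p (q j) 0" using cg_trans[OF cg_sym[OF cg_mult_left[OF uv, of "q j"]]] by simp
      show "cg p (q k) 0" using qi qj k I by auto
    qed
    moreover have "cg p (f v) 1"
    proof -
      have "cg p (f v) (f (s (u i) (e i)) + f (s (u j) (e j)))"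
        unfolding v_def using eL by (intro slinD(1)[OF f] slatD(3)[OF L])
      also have "cg p \<dots> (u i * a + u j * b)"
        unfolding a_def b_def using eL by (intro cg_add slinD(2)[OF f])
      also note uv
      finally show ?thesis .
    qed
    moreover have "cg p (f w) 0"
    proof -
      have "cg p (f w) (f (s a (e j)) - f (s b (e i)))"
        unfolding w_def using eL by (intro slin_diff[OF L f] slatD(3)[OF L])
      also have "cg p \<dots> (a * f (e j) - b * f (e i))"
        using eL by (intro cg_diff slinD(2)[OF f])
      finally show ?thesis by (simp add: a_def b_def mult.commute)
    qed
    ultimately show ?thesis using e' ij by (intro exI[of _ e'] exI[of _ i]) (auto simp: I)
  next
    case 3
    obtain e1 i0 u' where i0: "i0 \<in> I" and B1: "sbasis I e1 L"
      and u': "cg p (\<Sum>i\<in>I - {i0}. u' i * f (e1 i)) 1"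
      using unimodular_reduction[OF L B f u 3] by blast
    let ?K = "{x. \<exists>q. x = (\<Sum>j\<in>I - {i0}. s (q j) (e1 j))}"
    note K = sbasis_subset[OF L B1, of "I - {i0}"]
    have "card (I - {i0}) < card I" using fin i0 by (meson card_Diff1_less)
    then obtain e2 j0 where j0: "j0 \<in> I - {i0}" and B2: "sbasis (I - {i0}) e2 ?K"
      and e2: "cg p (f (e2 j0)) 1" "\<forall>i\<in>I - {i0} - {j0}. cg p (f (e2 i)) 0"
      using less.hyps[of "I - {i0}" ?K e1 u'] K slin_subset[OF f] u' by blast
    define e3 where "e3 = e2(i0 := e1 i0)"
    have B3: "sbasis I e3 L" unfolding e3_def by (rule sbasis_change_part[OF L B1 i0 B2])
    define a where "a = f (e1 i0)"
    define v where "v = s 1 (e3 i0) + (\<Sum>j\<in>I - {i0}. s (if j = j0 then - a else 0) (e3 j))"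
    have B4: "sbasis I (e3(i0 := v)) L"
      unfolding v_def using i0 by (intro sbasis_replace[OF L B3, of _ _ 1]) auto
    have "(\<Sum>j\<in>I - {i0}. s (if j = j0 then - a else 0) (e3 j)) = (\<Sum>j\<in>I - {i0}. if j = j0 then s (- a) (e2 j) else 0)"
      by (intro sum.cong) (auto simp: e3_def)
    also have "\<dots> = s (- a) (e2 j0)" using j0 fin by simp
    finally have v: "v = e1 i0 + s (- a) (e2 j0)" by (simp add: v_def e3_def)
    have e2L: "e2 j0 \<in> L" using sbasisD(2)[OF B2 j0] K(3) by blast
    have "cg p (f v) (f (e1 i0) + f (s (- a) (e2 j0)))"
      unfolding v using e2L sbasisD(2)[OF B1 i0] by (intro slinD(1)[OF f] slatD(3)[OF L])
    also have "cg p \<dots> (a + (- a) * f (e2 j0))"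
      unfolding a_def by (intro cg_add cg_refl slinD(2)[OF f e2L])
    also have "cg p \<dots> (a + (- a) * 1)" by (intro cg_add cg_refl cg_mult_left e2)
    finally have "cg p (f v) 0" by simp
    then have "\<forall>i\<in>I - {j0}. cg p (f ((e3(i0 := v)) i)) 0" using e2 by (auto simp: e3_def)
    moreover have "cg p (f ((e3(i0 := v)) j0)) 1" using e2 j0 by (auto simp: e3_def)
    ultimately show ?thesis using B4 j0 by blast
  qed
qed

lemma sfree_kernel_unimodular:
  assumes free: "sfree L" and f: "slin f L" and x: "x \<in> L" "cg p (f x) 1"
  shows "sfree {x\<in>L. cg p (f x) 0}"
proof -
  obtain I e where L: "slat L" and B: "sbasis I e L" using free by (auto simp: sfree_def)
  obtain u where u: "x = (\<Sum>i\<in>I. s (u i) (e i))" using sbasisD(3)[OF B x(1)] by blast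
  have "cg p (f x) (\<Sum>i\<in>I. u i * f (e i))" unfolding u by (intro slin_comb[OF L f] sbasisD(2)[OF B])
  then have "cg p (\<Sum>i\<in>I. u i * f (e i)) 1" using x(2) cg_sym cg_trans by blast
  then obtain e' i0 where i0: "i0 \<in> I" and B': "sbasis I e' L" and e': "cg p (f (e' i0)) 1"
    "\<forall>i\<in>I - {i0}. cg p (f (e' i)) 0" using sbasis_unimodular[OF L B f] by blast
  let ?K = "{x. \<exists>q. x = (\<Sum>j\<in>I - {i0}. s (q j) (e' j))}"
  note K = sbasis_subset[OF L B', of "I - {i0}"]
  note fin = sbasisD(1)[OF B]
  have "{x\<in>L. cg p (f x) 0} = ?K"
  proof (intro equalityI subsetI)
    fix y assume "y \<in> ?K"
    then obtain q where y: "y = (\<Sum>j\<in>I - {i0}. s (q j) (e' j))" by blast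
    have "cg p (f y) (\<Sum>i\<in>I - {i0}. q i * f (e' i))"
      unfolding y using sbasisD(2)[OF B'] by (intro slin_comb[OF L f]) auto
    also have "cg p \<dots> (\<Sum>i\<in>I - {i0}. q i * 0)" by (intro cg_sum cg_mult_left) (use e' in auto)
    finally show "y \<in> {x\<in>L. cg p (f x) 0}" using K(3) \<open>y \<in> ?K\<close> by auto
  next
    fix y assume y: "y \<in> {x\<in>L. cg p (f x) 0}"
    then obtain q where q: "y = (\<Sum>i\<in>I. s (q i) (e' i))" using sbasisD(3)[OF B'] by blast
    have "cg p (f y) (\<Sum>i\<in>I. q i * f (e' i))"
      unfolding q by (intro slin_comb[OF L f] sbasisD(2)[OF B'])
    also have "cg p \<dots> (\<Sum>i\<in>I. q i * (if i = i0 then 1 else 0))"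
      by (intro cg_sum cg_mult_left) (use e' in auto)
    also have "(\<Sum>i\<in>I. q i * (if i = i0 then 1 else 0)) = (\<Sum>i\<in>I. if i = i0 then q i else 0)"
      by (intro sum.cong) auto
    also have "\<dots> = q i0" using fin i0 by simp
    finally have "cg p (q i0) 0" using y cg_sym cg_trans by blast
    then have "s (q i0) (e' i0) = 0" using slat_cg[OF L sbasisD(2)[OF B' i0], of "q i0" 0] by simp
    then have "y = (\<Sum>i\<in>I - {i0}. s (q i) (e' i))" using q fin i0 by (simp add: sum.remove)
    then show "y \<in> ?K" by blast
  qed
  moreover have "sfree ?K" unfolding sfree_def 
    by (intro conjI exI[of _ "I - {i0}"] exI[of _ e'] K(1,2)[OF Diff_subset])
  ultimately show ?thesis by (simp only:)
qed

text \<open>The values of \<open>f\<close> form an ideal containing \<open>pi1\<close>. If it is the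
  unit ideal, \<open>f\<close> itself is unimodular; otherwise all values are multiples of
  \<open>pi1\<close>, and cancelling \<open>pi1\<close> gives a unimodular functional with the same
  kernel.\<close>

lemma slin_normalize:
  assumes L: "slat L" and f: "slin f L" and x: "x \<in> L" "cg p (f x) pi1"
  shows "\<exists>g y. slin g L \<and> y \<in> L \<and> cg p (g y) 1 \<and> (\<forall>z\<in>L. cg p (g z) 0 \<longleftrightarrow> cg p (f z) 0)"
proof -
  define T where "T = {a. \<exists>y\<in>L. cg p (f y) a}"
  have "1 \<in> T \<or> (\<forall>z\<in>T. \<exists>g. cg p z (pi1 * g))"
  proof (rule ideal_with_pi1[OF prime_p])
    show "a + b \<in> T" if ab: "a \<in> T" "b \<in> T" for a b
    proof -
      obtain y z where yz: "y \<in> L" "z \<in> L" "cg p (f y) a" "cg p (f z) b" using ab unfolding T_def by blast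
      have "cg p (f (y + z)) (a + b)" using cg_trans[OF slinD(1)[OF f yz(1,2)] cg_add[OF yz(3,4)]] .
      then show ?thesis unfolding T_def using slatD(2)[OF L yz(1,2)] by blast
    qed
    show "c * a \<in> T" if a: "a \<in> T" for a c
    proof -
      obtain y where y: "y \<in> L" "cg p (f y) a" using a unfolding T_def by blast
      have "cg p (f (s c y)) (c * a)" using cg_trans[OF slinD(2)[OF f y(1)] cg_mult_left[OF y(2)]] .
      then show ?thesis unfolding T_def using slatD(3)[OF L y(1)] by blast
    qed
    show "b \<in> T" if "a \<in> T" "cg p a b" for a b using that cg_trans unfolding T_def by blast
    show "pi1 \<in> T" using x unfolding T_def by blast
  qed
  then show ?thesis
  proof
    assume "1 \<in> T"
    then show ?thesis using f unfolding T_def by blast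
  next
    assume all: "\<forall>z\<in>T. \<exists>g. cg p z (pi1 * g)"
    have "\<exists>g. cg p (f y) (pi1 * g)" if "y \<in> L" for y
      using that all cg_refl unfolding T_def by blast
    then obtain g where g: "\<And>y. y \<in> L ==> cg p (f y) (pi1 * g y)" by metis
    have "slin g L" unfolding slin_def
    proof (intro conjI ballI allI)
      fix y z assume yz: "y \<in> L" "z \<in> L"
      have "cg p (pi1 * g (y + z)) (f (y + z))" using g slatD(2)[OF L yz] cg_sym by blast
      also have "cg p \<dots> (f y + f z)" by (rule slinD(1)[OF f yz])
      also have "cg p \<dots> (pi1 * g y + pi1 * g z)" by (intro cg_add g yz)
      finally show "cg p (g (y + z)) (g y + g z)"
        using cg_pi1_cancel[OF prime_p] by (simp add: distrib_left)
    next
      fix a y assume y: "y \<in> L"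
      have "cg p (pi1 * g (s a y)) (f (s a y))" using g slatD(3)[OF L y] cg_sym by blast
      also have "cg p \<dots> (a * f y)" by (rule slinD(2)[OF f y])
      also have "cg p \<dots> (a * (pi1 * g y))" by (intro cg_mult_left g y)
      finally show "cg p (g (s a y)) (a * g y)"
        using cg_pi1_cancel[OF prime_p] by (simp add: mult.left_commute)
    qed
    moreover have "cg p (g x) 1"
      using cg_pi1_cancel[OF prime_p, of "g x" 1] g[OF x(1)] x(2)
      by (metis cg_sym cg_trans mult.right_neutral)
    moreover have "cg p (g z) 0 \<longleftrightarrow> cg p (f z) 0" if "z \<in> L" for z
    proof
      assume "cg p (g z) 0"
      then show "cg p (f z) 0" using cg_trans[OF g[OF that] cg_mult_left[of p "g z" 0 pi1]] by simp
    next
      assume "cg p (f z) 0"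
      then have "cg p (pi1 * g z) (pi1 * 0)" using cg_trans[OF cg_sym[OF g[OF that]]] by simp
      then show "cg p (g z) 0" by (rule cg_pi1_cancel[OF prime_p])
    qed
    ultimately show ?thesis using x by blast
  qed
qed

lemma sfree_kernel:
  assumes free: "sfree L" and f: "slin f L" and x: "x \<in> L" "cg p (f x) pi1"
  shows "sfree {x\<in>L. cg p (f x) 0}"
proof -
  have L: "slat L" using free by (simp add: sfree_def)
  obtain g y where "slin g L" "y \<in> L" "cg p (g y) 1" "\<forall>z\<in>L. cg p (g z) 0 \<longleftrightarrow> cg p (f z) 0"
    using slin_normalize[OF L f x] by blast
  moreover from this have "{x\<in>L. cg p (f x) 0} = {x\<in>L. cg p (g x) 0}" by blast
  ultimately show ?thesis using sfree_kernel_unimodular[OF free] by metis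
qed

text \<open>Kernels are taken one functional at a time; the vectors that witness the hypothesis for
  the remaining functionals already lie in the kernel of the first.\<close>

lemma sfree_common_kernel:
  assumes "finite C" "sfree L" "\<And>c. c \<in> C ==> slin (F c) L"
    and "\<And>c. c \<in> C ==> \<exists>x\<in>L. cg p (F c x) pi1 \<and> (\<forall>d\<in>C - {c}. cg p (F d x) 0)"
  shows "sfree {x\<in>L. \<forall>c\<in>C. cg p (F c x) 0}"
  using assms
proof (induction C arbitrary: L rule: finite_induct)
  case (insert c C)
  let ?K = "{x\<in>L. cg p (F c x) 0}"
  obtain x where x: "x \<in> L" "cg p (F c x) pi1" using insert.prems(3)[of c] by blast
  have "sfree ?K" using sfree_kernel[OF insert.prems(1) insert.prems(2) x] by simp
  moreover have "slin (F d) ?K" if "d \<in> C" for d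
    using that by (intro slin_subset[OF insert.prems(2)]) auto
  moreover have "\<exists>x\<in>?K. cg p (F d x) pi1 \<and> (\<forall>d'\<in>C - {d}. cg p (F d' x) 0)" if "d \<in> C" for d
  proof -
    have "d \<in> insert c C" "c \<in> insert c C - {d}" using that insert.hyps by auto
    then show ?thesis using insert.prems(3)[of d] by auto
  qed
  ultimately have "sfree {x\<in>?K. \<forall>c\<in>C. cg p (F c x) 0}" by (rule insert.IH)
  moreover have "{x\<in>?K. \<forall>c\<in>C. cg p (F c x) 0} = {x\<in>L. \<forall>c\<in>insert c C. cg p (F c x) 0}" by auto
  ultimately show ?case by simp
qed simp

text \<open>Rank is built up one functional at a time: the normalised functional splits off a vector
  of value 1 as a direct complement of its kernel. Joint injectivity starts the induction with the
  zero module.\<close>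

lemma sfree_by_functionals:
  assumes "finite C" "slat L" "\<And>c. c \<in> C ==> slin (F c) L"
    and "\<And>x. x \<in> L ==> (\<And>c. c \<in> C ==> cg p (F c x) 0) ==> x = 0"
    and "\<And>c. c \<in> C ==> \<exists>x\<in>L. cg p (F c x) pi1 \<and> (\<forall>d\<in>C - {c}. cg p (F d x) 0)"
  shows "sfree L"
  using assms
proof (induction C arbitrary: L rule: finite_induct)
  case empty
  then have "L = {0}" using slatD(1) by blast
  then show ?case by (simp add: sfree_trivial)
next
  case (insert c C)
  note L = insert.prems(1)
  let ?K = "{x\<in>L. cg p (F c x) 0}"
  have c: "slin (F c) L" by (rule insert.prems(2)) simp
  obtain x where x: "x \<in> L" "cg p (F c x) pi1" using insert.prems(4)[of c] by blast
  have "sfree ?K"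
  proof (rule insert.IH)
    show "slat ?K" by (rule slat_kernel[OF L c])
    show "slin (F d) ?K" if "d \<in> C" for d
      using that by (intro slin_subset[OF insert.prems(2)]) auto
    show "x = 0" if "x \<in> ?K" "\<And>d. d \<in> C ==> cg p (F d x) 0" for x
      using that by (intro insert.prems(3)) auto
    show "\<exists>x\<in>?K. cg p (F d x) pi1 \<and> (\<forall>d'\<in>C - {d}. cg p (F d' x) 0)" if "d \<in> C" for d
    proof -
      have "d \<in> insert c C" "c \<in> insert c C - {d}" using that insert.hyps by auto
      then show ?thesis using insert.prems(4)[of d] by auto
    qed
  qed
  obtain g y where g: "slin g L" "y \<in> L" "cg p (g y) 1" and gz: "\<And>z. z \<in> L ==> cg p (g z) 0 \<longleftrightarrow> cg p (F c z) 0"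
    using slin_normalize[OF L c x] by blast
  show ?case
  proof (rule sfree_extend[OF L _ \<open>sfree ?K\<close> g(2)])
    fix z assume z: "z \<in> L"
    have m: "z - s (g z) y \<in> L" using z g by (intro slat_diff[OF L] slatD(3)[OF L])
    have "cg p (g (z - s (g z) y)) (g z - g (s (g z) y))" using z g by (intro slin_diff[OF L] slatD(3)[OF L])
    also have "cg p \<dots> (g z - g z * g y)" using g by (intro cg_diff cg_refl slinD(2))
    also have "cg p \<dots> (g z - g z * 1)" using g by (intro cg_diff cg_refl cg_mult_left)
    finally have "cg p (g (z - s (g z) y)) 0" by simp
    then show "\<exists>q. z - s q y \<in> ?K" using gz[OF m] m by blast
  next
    fix q assume "s q y \<in> ?K"
    then have "cg p (g (s q y)) 0" using gz by blast
    moreover have "cg p (g (s q y)) (q * g y)" using g by (intro slinD(2))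
    moreover have "cg p (q * g y) (q * 1)" using g by (intro cg_mult_left)
    ultimately show "cg p q 0" using cg_sym cg_trans by (metis mult.right_neutral)
  qed blast
qed

end

lemma sfree_image:
  assumes "pmod s p" "pmod s' p" and free: "pmod.sfree s p L"
    and h_add: "\<And>x y. x \<in> L ==> y \<in> L ==> h (x + y) = h x + h y"
    and h_s: "\<And>a x. x \<in> L ==> h (s a x) = s' a (h x)"
    and inj: "\<And>x. x \<in> L ==> h x = 0 ==> x = 0"
  shows "pmod.sfree s' p (h ` L)"
proof -
  interpret m: pmod s p by fact
  interpret m': pmod s' p by fact
  obtain I e where L: "m.slat L" and B: "m.sbasis I e L" using free by (auto simp: m.sfree_def)
  have h0: "h 0 = 0" using h_add[of 0 0] m.slatD(1)[OF L] by simp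
  have h_comb: "h (\<Sum>i\<in>A. s (q i) (e i)) = (\<Sum>i\<in>A. s' (q i) (h (e i)))" if "A \<subseteq> I" for q A
    using that
  proof (induction A rule: infinite_finite_induct)
    case (insert i A)
    then have "(\<Sum>i\<in>A. s (q i) (e i)) \<in> L" "s (q i) (e i) \<in> L"
      using m.sbasisD(2)[OF B] by (auto intro!: m.slat_sum[OF L] m.slatD(3)[OF L])
    then show ?case using insert m.sbasisD(2)[OF B, of i] by (simp add: h_add h_s)
  qed (simp_all add: h0)
  have "m'.slat (h ` L)" unfolding m'.slat_def
  proof (intro conjI ballI allI)
    show "0 \<in> h ` L" using h0 m.slatD(1)[OF L] by (metis imageI)
    show "x + y \<in> h ` L" if xy: "x \<in> h ` L" "y \<in> h ` L" for x y
      using xy h_add m.slatD(2)[OF L] by (auto simp flip: h_add)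
    show "s' a x \<in> h ` L" if x: "x \<in> h ` L" for a x
      using x m.slatD(3)[OF L] by (auto simp flip: h_s)
    show "s' (Phi p) x = 0" if x: "x \<in> h ` L" for x
      using x m.slatD(4)[OF L] h0 by (auto simp flip: h_s)
  qed
  moreover have "m'.sbasis I (\<lambda>i. h (e i)) (h ` L)" unfolding m'.sbasis_def
  proof (intro conjI ballI allI impI m.sbasisD(1)[OF B])
    show "h (e i) \<in> h ` L" if "i \<in> I" for i using m.sbasisD(2)[OF B that] by blast
    show "\<exists>q. x = (\<Sum>i\<in>I. s' (q i) (h (e i)))" if x: "x \<in> h ` L" for x
    proof -
      obtain y where y: "y \<in> L" "x = h y" using x by blast
      then obtain q where "y = (\<Sum>i\<in>I. s (q i) (e i))" using m.sbasisD(3)[OF B] by blast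
      then show ?thesis using h_comb[of I] y by auto
    qed
    fix q i assume 0: "(\<Sum>i\<in>I. s' (q i) (h (e i))) = 0" and i: "i \<in> I"
    have "(\<Sum>i\<in>I. s (q i) (e i)) \<in> L"
      using m.sbasisD(2)[OF B] by (auto intro!: m.slat_sum[OF L] m.slatD(3)[OF L])
    then have "(\<Sum>i\<in>I. s (q i) (e i)) = 0" using inj h_comb[of I q] 0 by simp
    then show "cg p (q i) 0" using m.sbasisD(4)[OF B] i by blast
  qed
  ultimately show ?thesis unfolding m'.sfree_def by blast
qed

subsection \<open>Integral polynomials in an additive operator\<close>

definition pact :: "(('a => int) => ('a => int)) => int poly => ('a => int) => ('a => int)" where
  "pact t q c = (\<lambda>x. \<Sum>i\<le>degree q. coeff q i * (t ^^ i) c x)"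

definition zmul :: "int => ('a => int) => ('a => int)" where
  "zmul n c = (\<lambda>x. n * c x)"

lemma zmul_simps: "zmul 0 c = 0" "zmul 1 c = c" "zmul (m + n) c = zmul m c + zmul n c"
  "zmul (m - n) c = zmul m c - zmul n c" "zmul (- n) c = - zmul n c" "zmul n 0 = 0"
  "zmul m (zmul n c) = zmul (m * n) c" "zmul n (c + d) = zmul n c + zmul n d"
  by (auto simp: zmul_def fun_eq_iff algebra_simps)

lemma pact_bound: "degree q \<le> n ==> pact t q c x = (\<Sum>i\<le>n. coeff q i * (t ^^ i) c x)"
  unfolding pact_def by (intro sum.mono_neutral_left) (auto simp: coeff_eq_0)

lemma pact_lessThan: "degree q < n ==> pact t q c x = (\<Sum>i<n. coeff q i * (t ^^ i) c x)"
  using pact_bound[of q "n - 1" t c x] by (cases n) (auto simp: lessThan_Suc_atMost)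

lemma pact_pCons: "pact t (pCons a q) c = zmul a c + pact t q (t c)"
proof
  fix x
  have "pact t (pCons a q) c x = (\<Sum>i\<le>Suc (degree q). coeff (pCons a q) i * (t ^^ i) c x)"
    by (rule pact_bound) (simp add: degree_pCons_le)
  also have "\<dots> = a * c x + (\<Sum>i\<le>degree q. coeff q i * (t ^^ Suc i) c x)"
    unfolding sum.atMost_Suc_shift by simp
  also have "\<dots> = (zmul a c + pact t q (t c)) x"
    unfolding pact_def by (simp add: zmul_def funpow_swap1)
  finally show "pact t (pCons a q) c x = (zmul a c + pact t q (t c)) x" .
qed

lemma pact_0 [simp]: "pact t 0 c = 0"
  by (auto simp: pact_def)

lemma pact_const: "pact t [:a:] c = zmul a c"
  by (simp add: pact_pCons)

lemma pact_add_left: "pact t (q + r) c = pact t q c + pact t r c"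
proof
  fix x
  let ?n = "max (degree q) (degree r)"
  have "pact t (q + r) c x = (\<Sum>i\<le>?n. coeff (q + r) i * (t ^^ i) c x)"
    by (rule pact_bound) (rule degree_add_le_max)
  also have "\<dots> = pact t q c x + pact t r c x"
    by (simp add: pact_bound[of q ?n] pact_bound[of r ?n] distrib_right sum.distrib)
  finally show "pact t (q + r) c x = (pact t q c + pact t r c) x" by simp
qed

lemma addmap_zmul:
  fixes t :: "('a => int) => ('b => int)"
  assumes "addmap t"
  shows "t (zmul n c) = zmul n (t c)"
proof (induction n rule: int_induct[where k = 0])
  case base
  then show ?case using addmap_zero[OF assms] by (simp add: zmul_simps zero_fun_def)
next
  case (step1 i)
  then show ?case unfolding zmul_simps addmapD[OF assms] by (simp only:)
next
  case (step2 i)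
  then show ?case unfolding zmul_simps addmap_diff[OF assms] by (simp only:)
qed

lemma addmap_pact:
  fixes t :: "('a => int) => ('a => int)"
  assumes "addmap t"
  shows "addmap (pact t q)"
proof (induction q)
  case 0
  show ?case by (simp add: addmap_def zero_fun_def)
next
  case (pCons a q)
  show ?case unfolding addmap_def pact_pCons addmapD[OF assms] addmapD[OF pCons.IH] zmul_simps
    by (simp add: algebra_simps)
qed

lemma pact_commute:
  fixes t :: "('a => int) => ('a => int)"
  assumes "addmap t"
  shows "t (pact t q c) = pact t q (t c)"
  by (induction q arbitrary: c)
    (simp_all add: addmap_zero[OF assms] pact_pCons addmapD[OF assms] addmap_zmul[OF assms])

lemma pact_smult: "pact t (smult k q) c = zmul k (pact t q c)"
  by (induction q arbitrary: c) (simp_all add: zmul_simps pact_pCons)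

lemma pact_mult:
  fixes t :: "('a => int) => ('a => int)"
  assumes "addmap t"
  shows "pact t (q * r) c = pact t q (pact t r c)"
proof (induction q arbitrary: c)
  case (pCons a q)
  have "pact t (pCons a q * r) c = zmul a (pact t r c) + pact t (q * r) (t c)"
    by (simp add: pact_add_left pact_smult pact_pCons zmul_simps)
  then show ?case using pCons.IH by (simp add: pact_pCons pact_commute[OF assms])
qed simp

lemma pmod_pact:
  fixes t :: "('a => int) => ('a => int)"
  assumes "addmap t" "prime p"
  shows "pmod (pact t) p"
proof
  show "pact t 1 x = x" for x by (simp add: one_pCons pact_const zmul_simps)
qed (use assms addmapD[OF addmap_pact] in \<open>auto simp: pact_add_left pact_mult\<close>)

lemma pact_X1: "pact t X1 c = t c"
  by (simp add: X1_def pact_pCons zmul_simps)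

lemma pact_X1_pow:
  fixes t :: "('a => int) => ('a => int)"
  assumes "addmap t"
  shows "pact t (X1 ^ i) c = (t ^^ i) c"
  by (induction i) (simp_all add: one_pCons pact_const zmul_simps pact_mult[OF assms] pact_X1)

lemma pact_minus_left: "pact t (q - r) c = pact t q c - pact t r c"
  using pact_add_left[of t "q - r" r c] by (simp add: algebra_simps)

lemma pact_pi1: "pact t pi1 c = c - t c"
  by (simp add: pi1_def pact_minus_left pact_X1 one_pCons[symmetric])
    (simp add: one_pCons pact_const zmul_simps)

lemma pact_Phi: "p > 0 ==> pact t (Phi p) c x = (\<Sum>i<p. (t ^^ i) c x)"
  by (subst pact_lessThan[of _ p]) (auto simp: degree_Phi coeff_Phi)

definition tsub :: "(('a => int) => ('a => int)) => ('a => int) set => bool" where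
  "tsub t L \<longleftrightarrow> 0 \<in> L \<and> (\<forall>x\<in>L. \<forall>y\<in>L. x + y \<in> L) \<and> (\<forall>x\<in>L. - x \<in> L) \<and> (\<forall>x\<in>L. t x \<in> L)"

lemma tsubD:
  assumes "tsub t L"
  shows "0 \<in> L" "x \<in> L ==> y \<in> L ==> x + y \<in> L" "x \<in> L ==> - x \<in> L" "x \<in> L ==> t x \<in> L"
  using assms by (auto simp: tsub_def)

lemma tsub_diff: "tsub t L ==> x \<in> L ==> y \<in> L ==> x - y \<in> L"
  using tsubD(2)[of t L x "- y"] tsubD(3)[of t L y] by simp

lemma tsub_zmul: "tsub t L ==> x \<in> L ==> zmul n x \<in> L"
  by (induction n rule: int_induct[where k = 0]) (simp_all add: zmul_simps tsubD tsub_diff)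

lemma tsub_pact: "tsub t L ==> x \<in> L ==> pact t q x \<in> L"
  by (induction q arbitrary: x) (simp_all add: pact_pCons tsubD tsub_zmul)

lemma tsub_funpow: "tsub t L ==> x \<in> L ==> (t ^^ i) x \<in> L"
  by (induction i) (simp_all add: tsubD)

definition normker :: "(('a => int) => ('a => int)) => nat => ('a => int) set => ('a => int) set" where
  "normker t p L = {x\<in>L. pact t (Phi p) x = 0}"

lemma slat_normker:
  fixes t :: "('a => int) => ('a => int)"
  assumes t: "addmap t" and p: "prime p" and L: "tsub t L"
  shows "pmod.slat (pact t) p (normker t p L)"
proof -
  interpret pmod "pact t" p by (rule pmod_pact[OF t p])
  have "pact t (Phi p) (pact t a x) = 0" if "pact t (Phi p) x = 0" for a x
    using that by (metis mult.commute s_mult s_zero_right)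
  then show ?thesis unfolding slat_def normker_def
    using tsubD[OF L] tsub_pact[OF L] by (auto simp: s_add_right)
qed

lemma hom_pact:
  fixes t :: "('a => int) => ('a => int)" and t' :: "('b => int) => ('b => int)"
  assumes L: "tsub t L" and h_add: "\<And>x y. x \<in> L ==> y \<in> L ==> h (x + y) = h x + h y"
    and h_t: "\<And>x. x \<in> L ==> h (t x) = t' (h x)" and x: "x \<in> L"
  shows "h (pact t q x) = pact t' q (h x)"
proof -
  have h0: "h 0 = 0" using h_add[of 0 0] tsubD(1)[OF L] by simp
  have h_zmul: "h (zmul n x) = zmul n (h x)" if "x \<in> L" for n x
  proof (induction n rule: int_induct[where k = 0])
    case base
    then show ?case using h0 by (simp add: zmul_simps zero_fun_def)
  next
    case (step1 i)
    then show ?case unfolding zmul_simps h_add[OF tsub_zmul[OF L that] that] by (simp only:)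
  next
    case (step2 i)
    have "zmul (i - 1) x + x = zmul i x" by (simp add: zmul_def fun_eq_iff algebra_simps)
    then have "h (zmul i x) = h (zmul (i - 1) x) + h x" using h_add[OF tsub_zmul[OF L that] that] by metis
    moreover have "zmul (i - 1) (h x) = zmul i (h x) - h x" by (simp add: zmul_def fun_eq_iff algebra_simps)
    ultimately show ?case using step2 by (metis add_diff_cancel_right')
  qed
  show ?thesis using x
  proof (induction q arbitrary: x)
    case (pCons a q)
    note tx = tsubD(4)[OF L pCons.prems]
    show ?case
      unfolding pact_pCons h_add[OF tsub_zmul[OF L pCons.prems] tsub_pact[OF L tx]]
        h_zmul[OF pCons.prems] pCons.IH[OF tx] h_t[OF pCons.prems] ..
  qed (simp add: h0)
qed

lemma slin_pactI:
  fixes t :: "('a => int) => ('a => int)"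
  assumes t: "addmap t" and p: "prime p" and L: "tsub t L"
    and add: "\<And>x y. x \<in> L ==> y \<in> L ==> cg p (f (x + y)) (f x + f y)"
    and ft: "\<And>x. x \<in> L ==> cg p (f (t x)) (X1 * f x)"
  shows "pmod.slin (pact t) p f L"
proof -
  interpret pmod "pact t" p by (rule pmod_pact[OF t p])
  have f0: "cg p (f 0) 0" using add[of 0 0] tsubD(1)[OF L] by (simp add: cg_def)
  have f_zmul: "cg p (f (zmul n x)) ([:n:] * f x)" if x: "x \<in> L" for n x
  proof (induction n rule: int_induct[where k = 0])
    case base
    then show ?case using f0 by (simp add: zmul_simps zero_fun_def)
  next
    case (step1 i)
    have "cg p (f (zmul i x + x)) (f (zmul i x) + f x)" by (rule add[OF tsub_zmul[OF L x] x])
    also have "cg p \<dots> ([:i:] * f x + f x)" by (intro cg_add cg_refl step1)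
    also have "[:i:] * f x + f x = [:i + 1:] * f x" by (simp add: smult_add_left)
    finally show ?case by (simp add: zmul_simps)
  next
    case (step2 i)
    have eq: "zmul i x = zmul (i - 1) x + x" by (simp add: zmul_simps)
    have "cg p (f (zmul i x)) (f (zmul (i - 1) x) + f x)" unfolding eq by (rule add[OF tsub_zmul[OF L x] x])
    then have "cg p (f (zmul (i - 1) x) + f x) ([:i:] * f x)" using step2 cg_sym cg_trans by blast
    then have "cg p (f (zmul (i - 1) x) + f x - f x) ([:i:] * f x - f x)" by (intro cg_diff cg_refl)
    moreover have "[:i:] * f x - f x = [:i - 1:] * f x" by (simp add: smult_diff_left)
    ultimately show ?case by simp
  qed
  have "cg p (f (pact t q x)) (q * f x)" if "x \<in> L" for q x
    using that
  proof (induction q arbitrary: x)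
    case (pCons a q)
    have tx: "t x \<in> L" by (rule tsubD(4)[OF L pCons.prems])
    have "cg p (f (pact t (pCons a q) x)) (f (zmul a x) + f (pact t q (t x)))"
      unfolding pact_pCons by (intro add tsub_zmul[OF L] tsub_pact[OF L] pCons.prems tx)
    also have "cg p \<dots> ([:a:] * f x + q * f (t x))" by (intro cg_add f_zmul pCons.prems pCons.IH tx)
    also have "cg p \<dots> ([:a:] * f x + q * (X1 * f x))" by (intro cg_add cg_refl cg_mult_left ft pCons.prems)
    also have "[:a:] * f x + q * (X1 * f x) = pCons a q * f x"
      by (simp add: X1_def algebra_simps)
    finally show ?case .
  qed (use f0 in simp)
  then show ?thesis unfolding slin_def using add by blast
qed

subsection \<open>Signed permutation modules\<close>

lemma prime_period:
  assumes p: "prime p" and per: "(\<tau> ^^ p) y = y" and ne: "\<tau> y \<noteq> y" and i: "(\<tau> ^^ i) y = y"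
  shows "p dvd i"
proof (rule ccontr)
  assume "\<not> p dvd i"
  then have "coprime i p" using p by (metis coprime_commute prime_imp_coprime)
  moreover have "i \<noteq> 0" using \<open>\<not> p dvd i\<close> by (metis dvd_0_right)
  ultimately obtain a b where ab: "i * a = p * b + 1"
    using coprime_bezout_strong[of i p] p by (metis not_prime_1)
  have mult: "(\<tau> ^^ (k * m)) y = y" if "(\<tau> ^^ k) y = y" for k m
    using that by (induction m) (simp_all add: funpow_add)
  have "(\<tau> ^^ (p * b + 1)) y = y" using mult[OF i, of a] ab by simp
  then have "\<tau> ((\<tau> ^^ (p * b)) y) = y" by simp
  then show False using mult[OF per, of b] ne by simp
qed

text \<open>\<open>L\<close> behaves like the lattice of integer functions on the finite set
  \<open>Y\<close>: values on \<open>Y\<close> determine an element, the \<open>\<delta> y\<close>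
  form the dual basis, and \<open>t\<close> permutes the evaluations at points of \<open>Y\<close>
  up to the signs \<open>\<epsilon>\<close>.\<close>

locale signed_perm =
  fixes t :: "('a => int) => ('a => int)" and p :: nat and L :: "('a => int) set"
    and Y :: "'a set" and \<tau> :: "'a => 'a" and \<epsilon> :: "'a => int" and \<delta> :: "'a => 'a => int"
  assumes t: "addmap t" and p: "prime p" "odd p" and L: "tsub t L"
    and tp: "\<And>c. c \<in> L ==> (t ^^ p) c = c" and Y: "finite Y"
    and ext0: "\<And>c. c \<in> L ==> (\<And>y. y \<in> Y ==> c y = 0) ==> c = 0"
    and \<delta>: "\<And>y. y \<in> Y ==> \<delta> y \<in> L" "\<And>y z. y \<in> Y ==> z \<in> Y ==> \<delta> y z = (if z = y then 1 else 0)"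
    and \<tau>: "\<And>y. y \<in> Y ==> \<tau> y \<in> Y" and \<epsilon>: "\<And>y. y \<in> Y ==> \<epsilon> y = 1 \<or> \<epsilon> y = -1"
    and t_at: "\<And>y c. y \<in> Y ==> c \<in> L ==> t c y = \<epsilon> y * c (\<tau> y)"
begin

sublocale pmod "pact t" p by (rule pmod_pact[OF t p(1)])

lemma p_pos: "p > 0"
  using p(1) by (rule prime_gt_0_nat)

lemma \<tau>_pow: "y \<in> Y ==> (\<tau> ^^ k) y \<in> Y"
  by (induction k) (simp_all add: \<tau>)

lemma t_pow_at: "y \<in> Y ==> \<exists>s. (s = 1 \<or> s = -1) \<and> (\<forall>c\<in>L. (t ^^ k) c y = s * c ((\<tau> ^^ k) y))"
proof (induction k)
  case (Suc k)
  then obtain s where s: "s = 1 \<or> s = -1" "\<And>c. c \<in> L ==> (t ^^ k) c y = s * c ((\<tau> ^^ k) y)" by blast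
  have "(t ^^ Suc k) c y = (s * \<epsilon> ((\<tau> ^^ k) y)) * c ((\<tau> ^^ Suc k) y)" if "c \<in> L" for c
    using s(2)[OF tsubD(4)[OF L that]] t_at[OF \<tau>_pow[OF Suc.prems] that]
    by (simp add: funpow_swap1)
  moreover have "s * \<epsilon> ((\<tau> ^^ k) y) = 1 \<or> s * \<epsilon> ((\<tau> ^^ k) y) = -1"
    using s(1) \<epsilon>[OF \<tau>_pow[OF Suc.prems, of k]] by auto
  ultimately show ?case by blast
qed auto

lemma \<tau>_period: "y \<in> Y ==> (\<tau> ^^ p) y = y"
proof -
  assume y: "y \<in> Y"
  obtain s where s: "s = 1 \<or> s = -1" "\<And>c. c \<in> L ==> (t ^^ p) c y = s * c ((\<tau> ^^ p) y)" using t_pow_at[OF y] by blast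
  have "1 = s * \<delta> y ((\<tau> ^^ p) y)" using s(2)[OF \<delta>(1)[OF y]] tp[OF \<delta>(1)[OF y]] \<delta>(2)[OF y y] by simp
  then show ?thesis using \<delta>(2)[OF y \<tau>_pow[OF y]] by (metis mult_zero_right zero_neq_one)
qed

lemma vanish_iff: "y \<in> Y ==> c \<in> L ==> c ((\<tau> ^^ k) y) = 0 \<longleftrightarrow> (t ^^ k) c y = 0"
  using t_pow_at[of y k] by auto

lemma t_pow_\<delta>:
  assumes y: "y \<in> Y" and ne: "\<tau> y \<noteq> y"
  shows "(t ^^ k) (\<delta> y) y = (if p dvd k then 1 else 0)"
proof (cases "p dvd k")
  case True
  then obtain m where "k = p * m" by auto
  moreover have "(t ^^ (p * m)) (\<delta> y) = \<delta> y"
    by (induction m) (simp_all add: funpow_add tp \<delta>(1) y)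
  ultimately show ?thesis using \<delta>(2)[OF y y] by simp
next
  case False
  then have "(\<tau> ^^ k) y \<noteq> y" using prime_period[OF p(1) \<tau>_period[OF y] ne] by blast
  then have "\<delta> y ((\<tau> ^^ k) y) = 0" using \<delta>(2)[OF y \<tau>_pow[OF y]] by simp
  then show ?thesis using vanish_iff[OF y \<delta>(1)[OF y]] False by simp
qed

text \<open>The iterates of \<open>\<delta> y\<close> have value 1 at \<open>y\<close> for exponents
  divisible by \<open>p\<close> and 0 otherwise, so only the exponent complementary to
  \<open>i\<close> contributes; \<open>mod p\<close> treats the case \<open>i = 0\<close>.\<close>

lemma pact_\<delta>_at:
  assumes y: "y \<in> Y" and ne: "\<tau> y \<noteq> y" and Q: "degree Q < p" and i: "i < p"
  shows "(t ^^ i) (pact t Q (\<delta> y)) y = coeff Q ((p - i) mod p)"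
proof -
  have "(t ^^ i) (pact t Q (\<delta> y)) = pact t Q ((t ^^ i) (\<delta> y))"
    by (induction i) (simp_all add: pact_commute[OF t])
  then have "(t ^^ i) (pact t Q (\<delta> y)) y = (\<Sum>j<p. coeff Q j * (t ^^ j) ((t ^^ i) (\<delta> y)) y)"
    using pact_lessThan[OF Q] by metis
  also have "\<dots> = (\<Sum>j<p. if j = (p - i) mod p then coeff Q j else 0)"
  proof (rule sum.cong)
    fix j assume j: "j \<in> {..<p}"
    have "p dvd j + i \<longleftrightarrow> j = (p - i) mod p"
    proof
      assume "p dvd j + i"
      then obtain k where k: "j + i = p * k" by auto
      then have "p * k < p * 2" using i j unfolding lessThan_iff by linarith
      then have "k = 0 \<or> k = 1" by auto
      then show "j = (p - i) mod p" using k i j by (cases "i = 0") auto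
    next
      assume "j = (p - i) mod p"
      then show "p dvd j + i" using i by (cases "i = 0") auto
    qed
    then show "coeff Q j * (t ^^ j) ((t ^^ i) (\<delta> y)) y = (if j = (p - i) mod p then coeff Q j else 0)"
      using t_pow_\<delta>[OF y ne, of "j + i"] by (simp add: funpow_add)
  qed simp
  also have "\<dots> = coeff Q ((p - i) mod p)" using p_pos by simp
  finally show ?thesis .
qed

text \<open>Induction over the \<open>\<tau>\<close>-orbits in the support. An orbit of length
  \<open>p\<close> contributes a regular module, whose norm kernel is free of rank one on
  \<open>pact t pi1 (\<delta> y)\<close>; a fixed point contributes nothing.\<close>

lemma sfree_supported:
  assumes "\<Theta> \<subseteq> Y" "\<And>y. y \<in> \<Theta> ==> \<tau> y \<in> \<Theta>"
  shows "sfree {c \<in> normker t p L. \<forall>y\<in>Y - \<Theta>. c y = 0}"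
  using assms
proof (induction "card \<Theta>" arbitrary: \<Theta> rule: less_induct)
  case less
  define M where "M \<Theta> = {c \<in> normker t p L. \<forall>y\<in>Y - \<Theta>. c y = 0}" for \<Theta>
  have Minv: "slat (M \<Theta>)" if inv: "\<Theta> \<subseteq> Y" "\<And>y. y \<in> \<Theta> ==> \<tau> y \<in> \<Theta>" for \<Theta>
  proof -
    have out: "\<tau> y \<in> Y - \<Theta>" if y: "y \<in> Y - \<Theta>" for y
    proof -
      have "(\<tau> ^^ (p - 1)) (\<tau> y) = y" using \<tau>_period[of y] y p_pos
        by (cases p) (auto simp: funpow_swap1)
      moreover have "(\<tau> ^^ k) z \<in> \<Theta>" if "z \<in> \<Theta>" for k z using that by (induction k) (auto simp: inv)
      ultimately show ?thesis using y \<tau> by (metis DiffD1 DiffD2 DiffI)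
    qed
    have "tsub t {c\<in>L. \<forall>y\<in>Y - \<Theta>. c y = 0}"
      using tsubD[OF L] out by (auto simp: tsub_def t_at)
    from slat_normker[OF t p(1) this] show ?thesis by (auto simp: M_def normker_def intro: arg_cong[of _ _ slat, THEN iffD1, rotated])
  qed
  have fin: "finite \<Theta>" using less.prems(1) Y finite_subset by blast
  have M: "slat (M \<Theta>)" by (rule Minv[OF less.prems])
  show ?case unfolding M_def[symmetric]
  proof (cases "\<exists>y\<in>\<Theta>. \<tau> y \<noteq> y")
    case False
    have "c = 0" if c: "c \<in> M \<Theta>" for c
    proof (rule ext0)
      show cL: "c \<in> L" using c by (simp add: M_def normker_def)
      fix y assume y: "y \<in> Y"
      show "c y = 0"
      proof (cases "y \<in> \<Theta>")
        case True
        then have fix_y: "\<tau> y = y" using False by blast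
        have pow: "(t ^^ k) d y = \<epsilon> y ^ k * d y" if "d \<in> L" for k d
          using that
        proof (induction k)
          case (Suc k)
          then show ?case using t_at[OF y tsub_funpow[OF L Suc.prems, of k]] fix_y by simp
        qed simp
        \<comment> \<open>The sign at a fixed point has \<open>p\<close>-th power 1, hence is 1 for
          odd \<open>p\<close>. The norm then multiplies the value at \<open>y\<close> by
          \<open>p\<close> and is injective there.\<close>
        have "\<epsilon> y ^ p = 1" using pow[OF \<delta>(1)[OF y], of p] tp[OF \<delta>(1)[OF y]] \<delta>(2)[OF y y] by simp
        then have "\<epsilon> y = 1" using \<epsilon>[OF y] p(2) by auto
        then have "(\<Sum>i<p. (t ^^ i) c y) = int p * c y" using pow[OF cL] by simp
        moreover have "pact t (Phi p) c y = 0" using c by (simp add: M_def normker_def)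
        ultimately show ?thesis using p_pos by (simp add: pact_Phi[OF p_pos])
      next
        case False
        then show ?thesis using c y by (simp add: M_def)
      qed
    qed
    then have "M \<Theta> = {0}" using slatD(1)[OF M] by blast
    then show "sfree (M \<Theta>)" by (simp add: sfree_trivial)
  next
    case True
    then obtain y where y\<Theta>: "y \<in> \<Theta>" and ne: "\<tau> y \<noteq> y" by blast
    have y: "y \<in> Y" using y\<Theta> less.prems(1) by blast
    define orb where "orb = {(\<tau> ^^ i) y | i. i < p}"
    define \<Theta>' where "\<Theta>' = \<Theta> - orb"
    have "(\<tau> ^^ k) y \<in> orb" for k
    proof -
      have "(\<tau> ^^ (p * m)) y = y" for m
        using \<tau>_period[OF y] by (induction m) (simp_all add: funpow_add)
      then have "(\<tau> ^^ (k mod p + p * (k div p))) y = (\<tau> ^^ (k mod p)) y" unfolding funpow_add by simp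
      then show ?thesis using p_pos by (auto simp: orb_def intro!: exI[of _ "k mod p"])
    qed
    note orb_all = this
    have \<Theta>': "\<Theta>' \<subseteq> Y" "\<And>z. z \<in> \<Theta>' ==> \<tau> z \<in> \<Theta>'"
    proof -
      show "\<Theta>' \<subseteq> Y" using less.prems(1) by (auto simp: \<Theta>'_def)
      fix z assume z: "z \<in> \<Theta>'"
      have "\<tau> z \<notin> orb"
      proof
        assume "\<tau> z \<in> orb"
        then obtain i where "\<tau> z = (\<tau> ^^ i) y" by (auto simp: orb_def)
        then have "(\<tau> ^^ (p - 1)) (\<tau> z) = (\<tau> ^^ (p - 1 + i)) y" by (simp add: funpow_add)
        moreover have "(\<tau> ^^ (p - 1)) (\<tau> z) = z" using \<tau>_period[of z] z less.prems(1) p_pos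
          by (cases p) (auto simp: funpow_swap1 \<Theta>'_def)
        ultimately show False using orb_all z by (metis DiffD2 \<Theta>'_def)
      qed
      then show "\<tau> z \<in> \<Theta>'" using z less.prems(2) by (auto simp: \<Theta>'_def)
    qed
    have "y \<in> orb" using orb_all[of 0] by simp
    then have "\<Theta>' \<subset> \<Theta>" using y\<Theta> by (auto simp: \<Theta>'_def)
    then have free': "sfree (M \<Theta>')" unfolding M_def using less.hyps[OF _ \<Theta>'] fin psubset_card_mono by blast
    have orb\<Theta>: "orb \<subseteq> \<Theta>"
    proof -
      have "(\<tau> ^^ i) y \<in> \<Theta>" for i using y\<Theta> by (induction i) (auto simp: less.prems(2))
      then show ?thesis by (auto simp: orb_def)
    qed
    have M'_iff: "c \<in> M \<Theta>' \<longleftrightarrow> c \<in> M \<Theta> \<and> (\<forall>i<p. (t ^^ i) c y = 0)" for c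
    proof -
      have "Y - \<Theta>' = (Y - \<Theta>) \<union> orb" using orb\<Theta> less.prems(1) by (auto simp: \<Theta>'_def)
      then have "c \<in> M \<Theta>' \<longleftrightarrow> c \<in> M \<Theta> \<and> (\<forall>z\<in>orb. c z = 0)" by (auto simp: M_def)
      also have "\<dots> \<longleftrightarrow> c \<in> M \<Theta> \<and> (\<forall>i<p. c ((\<tau> ^^ i) y) = 0)" by (auto simp: orb_def)
      finally show ?thesis using vanish_iff[OF y, of c] by (auto simp: M_def normker_def)
    qed
    define e where "e = pact t pi1 (\<delta> y)"
    have tpX: "pact t (X1 ^ p - 1) (\<delta> y) = 0"
      by (simp add: pact_minus_left pact_X1_pow[OF t] tp \<delta>(1) y)
    have eM: "e \<in> M \<Theta>"
    proof -
      have "e \<in> L" unfolding e_def by (rule tsub_pact[OF L \<delta>(1)[OF y]])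
      moreover have "pact t (Phi p) e = - pact t (X1 ^ p - 1) (\<delta> y)"
      proof -
        have "pact t (Phi p) e = pact t (pi1 * Phi p) (\<delta> y)" by (simp only: e_def s_mult[symmetric] mult.commute)
        also have "pi1 * Phi p = - (X1 ^ p - 1)" by (simp add: pi1_mult_Phi)
        finally show ?thesis by (simp only: s_minus_left)
      qed
      moreover have "e z = 0" if "z \<in> Y - \<Theta>" for z
      proof -
        have "z \<noteq> y" "\<tau> z \<noteq> y"
        proof -
          show "z \<noteq> y" using that y\<Theta> by auto
          show "\<tau> z \<noteq> y"
          proof
            assume "\<tau> z = y"
            moreover have "(\<tau> ^^ (p - 1)) (\<tau> z) = z" using \<tau>_period[of z] that p_pos
              by (cases p) (auto simp: funpow_swap1)
            ultimately have "z \<in> orb" using orb_all by metis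
            then show False using that orb\<Theta> by blast
          qed
        qed
        then show ?thesis using that \<delta>[OF y] t_at[of z "\<delta> y"] \<tau>[of z] by (simp add: e_def pact_pi1)
      qed
      ultimately show ?thesis using tpX by (simp add: M_def normker_def)
    qed
    show "sfree (M \<Theta>)"
    proof (rule sfree_extend[OF M _ free' eM])
      show "M \<Theta>' \<subseteq> M \<Theta>" using M'_iff by blast
      fix c assume c: "c \<in> M \<Theta>"
      then have cL: "c \<in> L" by (simp add: M_def normker_def)
      \<comment> \<open>The values of \<open>c\<close> along the orbit of \<open>y\<close>, in the
        reversed order in which \<open>pact_\<delta>_at\<close> reads coefficients. That
        \<open>c\<close> has norm zero means that \<open>Q\<close> vanishes at 1, so
        \<open>Q\<close> is a multiple of \<open>pi1\<close>.\<close>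
      define Q where "Q = (\<Sum>j<p. monom ((t ^^ ((p - j) mod p)) c y) j)"
      have cQ: "coeff Q j = (if j < p then (t ^^ ((p - j) mod p)) c y else 0)" for j
        by (simp add: Q_def coeff_sum)
      have dQ: "degree Q < p" using p_pos cQ by (intro degree_lessI) auto
      have "poly Q 1 = (\<Sum>j<p. (t ^^ ((p - j) mod p)) c y)"
        by (simp add: Q_def poly_sum poly_monom)
      also have "\<dots> = (\<Sum>i<p. (t ^^ i) c y)"
        by (rule sum.reindex_bij_witness[of _ "\<lambda>i. (p - i) mod p" "\<lambda>i. (p - i) mod p"])
          (use p_pos in \<open>auto simp: mod_if\<close>)
      also have "\<dots> = 0" using c pact_Phi[OF p_pos, of t c y] by (simp add: M_def normker_def)
      finally obtain q where q: "Q = pi1 * q" using poly_eq_const_plus_pi1[of Q] by auto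
      have eq: "pact t q e = pact t Q (\<delta> y)" unfolding e_def q mult.commute[of pi1] s_mult ..
      have "c - pact t q e \<in> M \<Theta>" by (intro slat_diff[OF M] c slatD(3)[OF M] eM)
      moreover have "(t ^^ i) (c - pact t q e) y = 0" if i: "i < p" for i
      proof -
        have "(t ^^ i) (c - pact t q e) y = (t ^^ i) c y - (t ^^ i) (pact t Q (\<delta> y)) y"
          unfolding eq using addmap_diff[OF addmap_funpow[OF t, of i]] by simp
        also have "(t ^^ i) (pact t Q (\<delta> y)) y = coeff Q ((p - i) mod p)" by (rule pact_\<delta>_at[OF y ne dQ i])
        also have "\<dots> = (t ^^ i) c y" using i p_pos by (cases "i = 0") (auto simp: cQ)
        finally show ?thesis by (simp only: diff_self)
      qed
      ultimately show "\<exists>q. c - pact t q e \<in> M \<Theta>'" using M'_iff by blast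
    next
      fix q assume q: "pact t q e \<in> M \<Theta>'"
      \<comment> \<open>\<open>W\<close> annihilates \<open>\<delta> y\<close>, and the remainder of
        \<open>pi1 * q\<close> modulo \<open>W\<close> can be read off from values on the orbit.
        These vanish, so \<open>pi1 * q\<close> is a multiple of \<open>W = - pi1 * Phi p\<close>,
        and \<open>pi1\<close> cancels in the polynomial ring.\<close>
      define W where "W = X1 ^ p - (1 :: int poly)"
      have dW: "degree W = p" and lW: "lead_coeff W = 1" and W0: "W \<noteq> 0"
      proof -
        have cW: "coeff W i = (if i = p then 1 else 0) - (if i = 0 then 1 else 0)" for i
          by (simp add: W_def X1_pow_eq_monom)
        show dW: "degree W = p" by (intro antisym degree_le le_degree) (use p_pos cW in auto)
        show "lead_coeff W = 1" using dW cW p_pos by simp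
        then show "W \<noteq> 0" by auto
      qed
      obtain k R where kR: "pseudo_divmod (pi1 * q) W = (k, R)" by force
      have eq: "pi1 * q = W * k + R" and R: "R = 0 \<or> degree R < p"
        using pseudo_divmod[OF W0 kR] lW dW by simp_all
      have dR: "degree R < p" using R p_pos by auto
      have "pact t q e = pact t (pi1 * q) (\<delta> y)" unfolding e_def mult.commute[of pi1] s_mult ..
      also have "\<dots> = pact t k (pact t W (\<delta> y)) + pact t R (\<delta> y)"
        unfolding eq s_add_left mult.commute[of W] s_mult ..
      also have "\<dots> = pact t R (\<delta> y)" using tpX by (simp add: W_def)
      finally have eR: "pact t q e = pact t R (\<delta> y)" .
      have "R = 0"
      proof (rule poly_eqI)
        fix j show "coeff R j = coeff 0 j"
        proof (cases "j < p")
          case True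
          define i where "i = (p - j) mod p"
          have i: "i < p" "(p - i) mod p = j" using True p_pos by (auto simp: i_def mod_if)
          have "(t ^^ i) (pact t R (\<delta> y)) y = 0" using q M'_iff eR i by auto
          then show ?thesis using pact_\<delta>_at[OF y ne dR i(1)] i(2) by simp
        next
          case False
          then show ?thesis using dR by (simp add: coeff_eq_0)
        qed
      qed
      moreover have "W = pi1 * (- Phi p)" by (simp add: W_def pi1_mult_Phi)
      ultimately have "pi1 * q = pi1 * (- Phi p * k)" using eq by (simp only: mult.assoc add_0_right)
      moreover have "pi1 \<noteq> 0" by (simp add: pi1_eq)
      ultimately have "q = - Phi p * k" by (metis mult_left_cancel)
      then show "cg p q 0" by (simp add: cg_0_iff)
    qed
  qed
qed

theorem sfree_normker: "sfree (normker t p L)"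
  using sfree_supported[of Y] \<tau> by (simp add: Collect_mem_eq)

end

subsection \<open>Alternating functions on lists\<close>

definition alt :: "('a list => int) => bool" where
  "alt c \<longleftrightarrow> (\<forall>u x y w. c (u @ x # y # w) = - c (u @ y # x # w))"

lemma altD: "alt c ==> c (u @ x # y # w) = - c (u @ y # x # w)"
  unfolding alt_def by blast

lemma alt_prefix: "alt c ==> alt (\<lambda>ys. c (v @ ys))"
  unfolding alt_def append.assoc[symmetric] by blast

lemma alt_Cons: "alt c ==> alt (\<lambda>ys. c (x # ys))"
  using alt_prefix[of c "[x]"] by simp

lemma alt_move: "alt c ==> c (u @ v # w) = (-1) ^ length u * c (v # u @ w)"
proof (induction u arbitrary: w rule: rev_induct)
  case (snoc a u)
  then show ?case using altD[OF snoc.prems, of u a v w] snoc.IH[OF snoc.prems, of "a # w"] by simp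
qed simp

lemma alt_not_distinct: "alt c ==> \<not> distinct xs ==> c xs = 0"
proof -
  assume c: "alt c" and "\<not> distinct xs"
  then obtain u v w x where xs: "xs = u @ [x] @ v @ [x] @ w" using not_distinct_decomp by blast
  have "c xs = (-1) ^ length v * c (u @ x # x # v @ w)"
    using alt_move[OF alt_prefix[OF c, of "u @ [x]"], of v x w] by (simp add: xs)
  moreover have "c (u @ x # x # v @ w) = 0" using altD[OF c, of u x x "v @ w"] by simp
  ultimately show ?thesis by simp
qed

text \<open>The simplicial coboundary, the alternating sum over omissions of one entry, unfolded at
  the first vertex. It is the augmented version: on a single vertex it yields the value at the empty
  list.\<close>

fun dlt :: "('a list => int) => 'a list => int" where
  "dlt c [] = 0"
| "dlt c (x # xs) = c xs - dlt (\<lambda>ys. c (x # ys)) xs"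

lemma dlt_cong:
  "(\<And>ys. set ys \<subseteq> set xs ==> Suc (length ys) = length xs ==> c ys = c' ys) ==> dlt c xs = dlt c' xs"
proof (induction xs arbitrary: c c')
  case (Cons x xs)
  have "dlt (\<lambda>ys. c (x # ys)) xs = dlt (\<lambda>ys. c' (x # ys)) xs"
    by (rule Cons.IH, rule Cons.prems) auto
  moreover have "c xs = c' xs" using Cons.prems by auto
  ultimately show ?case by simp
qed simp

lemma dlt_zero: "dlt (\<lambda>_. 0) xs = 0"
  by (induction xs) auto

lemma dlt_add: "dlt (\<lambda>ys. a ys + b ys) xs = dlt a xs + dlt b xs"
  by (induction xs arbitrary: a b) auto

lemma dlt_diff: "dlt (\<lambda>ys. a ys - b ys) xs = dlt a xs - dlt b xs"
  by (induction xs arbitrary: a b) auto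

lemma dlt_uminus: "dlt (\<lambda>ys. - b ys) xs = - dlt b xs"
  using dlt_diff[of "\<lambda>_. 0" b xs] by (simp add: dlt_zero)

lemma dlt_dlt: "dlt (dlt c) xs = 0"
proof (induction xs arbitrary: c)
  case (Cons x xs)
  have "dlt (dlt c) (x # xs) = dlt c xs - dlt (\<lambda>ys. c ys - dlt (\<lambda>zs. c (x # zs)) ys) xs" by simp
  also have "\<dots> = dlt (dlt (\<lambda>zs. c (x # zs))) xs" unfolding dlt_diff by simp
  finally show ?case using Cons.IH by simp
qed simp

lemma dlt_map: "dlt c (map f xs) = dlt (\<lambda>ys. c (map f ys)) xs"
  by (induction xs arbitrary: c) auto

lemma alt_dlt: "alt c ==> alt (dlt c)"
  unfolding alt_def[of "dlt c"]
proof (intro allI)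
  fix u x y w assume "alt c"
  then show "dlt c (u @ x # y # w) = - dlt c (u @ y # x # w)"
  proof (induction u arbitrary: c)
    case Nil
    have "(\<lambda>z. c (x # y # z)) = (\<lambda>z. - c (y # x # z))" 
      by (intro ext) (use altD[OF Nil, of "[]" x y] in simp)
    then show ?case using dlt_uminus[of "\<lambda>z. c (y # x # z)" w] by simp
  next
    case (Cons z u)
    then show ?case using Cons.IH[OF alt_Cons[OF Cons.prems, of z]] altD[OF Cons.prems, of u x y w] by simp
  qed
qed

definition code :: "fw => int" where
  "code x = int (to_nat (word_of x))"

lemma code_inj: "code x = code y \<longleftrightarrow> x = y"
  by (simp add: code_def word_of_inject)

text \<open>The sign of the permutation sorting a list by \<open>code\<close>, which merely supplies
  a total order on the free group. It is the reference with which alternating functions are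
  compared.\<close>

fun sg :: "fw list => int" where
  "sg [] = 1"
| "sg (x # xs) = prod_list (map (\<lambda>y. sgn (code y - code x)) xs) * sg xs"

lemma prod_list_mset_cong: "mset xs = mset ys ==> prod_list (map f xs) = prod_list (map f ys)"
  for f :: "'a => int"
  by (metis mset_map prod_mset_prod_list)

lemma alt_sg: "alt sg"
  unfolding alt_def
proof (intro allI)
  fix u x y w
  show "sg (u @ x # y # w) = - sg (u @ y # x # w)"
  proof (induction u)
    case Nil
    have "sgn (code y - code x) = - sgn (code x - code y)" by (simp add: sgn_if)
    then show ?case by simp
  next
    case (Cons z u)
    have "prod_list (map (\<lambda>a. sgn (code a - code z)) (u @ x # y # w)) =
      prod_list (map (\<lambda>a. sgn (code a - code z)) (u @ y # x # w))"
      by (rule prod_list_mset_cong) simp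
    then show ?case using Cons by simp
  qed
qed

lemma sg_distinct: "distinct xs ==> sg xs = 1 \<or> sg xs = -1"
proof (induction xs)
  case (Cons x xs)
  have "x \<notin> set ys ==> prod_list (map (\<lambda>y. sgn (code y - code x)) ys) \<in> {1, -1}" for ys
    by (induction ys) (auto simp: sgn_if code_inj)
  from this[of xs] Cons show ?case by auto
qed simp

text \<open>Moving an entry to the front costs the same sign for \<open>c\<close> and for
  \<open>sg\<close>, so the first entry of \<open>xs\<close> can be split off on both sides.\<close>

lemma alt_compare_sg: "alt c ==> mset xs = mset ys ==> c xs * sg ys = c ys * sg xs"
proof (induction xs arbitrary: c ys)
  case (Cons x xs)
  have "x \<in> set ys" using Cons.prems(2) by (metis list.set_intros(1) set_mset_mset)
  then obtain u w where ys: "ys = u @ x # w" by (meson split_list)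
  have m: "mset xs = mset (u @ w)" using Cons.prems(2) ys by simp
  let ?P = "\<lambda>zs. prod_list (map (\<lambda>y. sgn (code y - code x)) zs)"
  have P: "?P xs = ?P (u @ w)" by (rule prod_list_mset_cong[OF m])
  have IH: "c (x # xs) * sg (u @ w) = c (x # u @ w) * sg xs"
    using Cons.IH[OF alt_Cons[OF Cons.prems(1), of x] m] by simp
  have "c (x # xs) * sg ys = (-1) ^ length u * (?P (u @ w) * (c (x # xs) * sg (u @ w)))"
    unfolding ys alt_move[OF alt_sg] by simp
  also have "\<dots> = (-1) ^ length u * (?P xs * (c (x # u @ w) * sg xs))" unfolding IH P ..
  also have "\<dots> = c ys * sg (x # xs)" unfolding ys alt_move[OF Cons.prems(1), of u] by simp
  finally show ?case .
qed simp

subsection \<open>An invariant metric and its Rips complex\<close>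

text \<open>\<open>Lip\<close> bounds all powers of \<open>\<phi>\<close> at once. The inverse of a
  power is again a power, so bounded cancellation applies with this single constant.\<close>

locale free_aut =
  fixes N p :: nat and \<phi> :: "fw => fw" and Lip :: nat
  assumes p: "prime p" and \<phi>: "addmap \<phi>" and \<phi>_period: "(\<phi> ^^ p) x = x"
    and \<phi>_FN: "x \<in> FN N ==> \<phi> x \<in> FN N" and lip: "flen ((\<phi> ^^ i) x) \<le> Lip * flen x"
begin

lemma p_gt_0: "p > 0"
  using p by (rule prime_gt_0_nat)

text \<open>Shifting the summation index makes \<open>\<phi>\<close> an isometry, besides the left
  translations. With a sum rather than a maximum, the estimates of bounded cancellation can be added
  term by term in \<open>d_between\<close>.\<close>

definition d :: "fw => fw => nat" where
  "d x y = (\<Sum>i<p. flen ((\<phi> ^^ i) (- x + y)))"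

text \<open>Bounded cancellation loses at most \<open>4 * Lip ^ 3\<close> for each of the
  \<open>p\<close> powers; the extra 1 makes \<open>d_between\<close> strict and lets
  \<open>push\<close> shorten every nonzero word. The radius \<open>rad\<close> is the bound that
  \<open>d_le\<close> gives for points at word distance at most \<open>slack\<close>.\<close>

definition slack :: nat where "slack = p * (4 * Lip ^ 3) + 1"

definition rad :: nat where "rad = p * (Lip * slack)"

lemma d_translate: "d (g + x) (g + y) = d x y"
proof -
  have "- (g + x) + (g + y) = - x + y" by (simp add: minus_add add.assoc del: add_uminus_conv_diff)
  then show ?thesis by (simp only: d_def)
qed

lemma d_\<phi>: "d (\<phi> x) (\<phi> y) = d x y"
proof -
  define z where "z = - x + y"
  have "- \<phi> x + \<phi> y = \<phi> z" by (simp add: z_def addmapD[OF \<phi>] addmap_uminus[OF \<phi>])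
  then have "d (\<phi> x) (\<phi> y) = (\<Sum>i<p. flen ((\<phi> ^^ Suc i) z))" by (simp add: d_def funpow_swap1)
  moreover have "(\<Sum>i<Suc p. flen ((\<phi> ^^ i) z)) = flen z + (\<Sum>i<p. flen ((\<phi> ^^ Suc i) z))"
    by (subst sum.lessThan_Suc_shift) simp
  moreover have "(\<Sum>i<Suc p. flen ((\<phi> ^^ i) z)) = d x y + flen z"
    by (simp add: d_def z_def \<phi>_period)
  ultimately show ?thesis by simp
qed

lemma d_self [simp]: "d x x = 0"
  by (simp add: d_def addmap_zero[OF addmap_funpow[OF \<phi>]])

lemma d_sym: "d x y = d y x"
proof -
  have "flen ((\<phi> ^^ i) (- x + y)) = flen ((\<phi> ^^ i) (- y + x))" for i
  proof -
    have "- (- x + y) = - y + x" by (simp add: minus_add)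
    then have "(\<phi> ^^ i) (- y + x) = - (\<phi> ^^ i) (- x + y)"
      using addmap_uminus[OF addmap_funpow[OF \<phi>], of i "- x + y"] by metis
    then show ?thesis by simp
  qed
  then show ?thesis by (simp add: d_def)
qed

lemma flen_le_d: "flen (- x + y) \<le> d x y"
proof -
  have "(\<Sum>i\<in>{0}. flen ((\<phi> ^^ i) (- x + y))) \<le> d x y"
    unfolding d_def using p_gt_0 by (intro sum_mono2) auto
  then show ?thesis by simp
qed

lemma d_le: "flen (- x + y) \<le> k ==> d x y \<le> p * (Lip * k)"
proof -
  assume k: "flen (- x + y) \<le> k"
  have "d x y \<le> (\<Sum>i<p. Lip * k)"
    unfolding d_def using lip k by (intro sum_mono) (meson le_trans mult_le_mono2)
  then show ?thesis by simp
qed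

text \<open>The hypothesis places \<open>z\<close> on the tree geodesic from \<open>x\<close> to
  \<open>y\<close>. Each power of \<open>\<phi>\<close> nearly preserves this additivity by
  \<open>bounded_cancellation\<close>, with \<open>\<phi> ^^ (p - i)\<close> as the inverse of
  \<open>\<phi> ^^ i\<close>.\<close>

lemma d_between:
  assumes "flen (- x + y) = flen (- x + z) + flen (- z + y)"
  shows "d x z + d z y < d x y + slack"
proof -
  have sum: "(- x + z) + (- z + y) = - x + y" by (simp add: add.assoc)
  have "flen ((\<phi> ^^ i) (- x + z)) + flen ((\<phi> ^^ i) (- z + y)) \<le> flen ((\<phi> ^^ i) (- x + y)) + 4 * Lip ^ 3"
    if "i < p" for i
  proof -
    have inv: "(\<phi> ^^ (p - i)) ((\<phi> ^^ i) w) = w" for w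
      using that \<phi>_period[of w] by (simp flip: funpow_add o_apply[of "\<phi> ^^ (p - i)" "\<phi> ^^ i"])
    show ?thesis
      using bounded_cancellation[OF addmap_funpow[OF \<phi>] addmap_funpow[OF \<phi>] inv lip lip, of "- x + z" "- z + y"]
        assms by (simp only: sum)
  qed
  then have "(\<Sum>i<p. flen ((\<phi> ^^ i) (- x + z)) + flen ((\<phi> ^^ i) (- z + y))) \<le>
    (\<Sum>i<p. flen ((\<phi> ^^ i) (- x + y)) + 4 * Lip ^ 3)"
    by (intro sum_mono) auto
  then show ?thesis by (simp add: d_def sum.distrib slack_def)
qed

text \<open>Moves \<open>v\<close> by \<open>slack\<close> letters towards the root of the tree;
  truncated subtraction sends words of length at most \<open>slack\<close> to the root
  itself.\<close>

definition push :: "fw => fw" where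
  "push v = ftake (flen v - slack) v"

lemma flen_push: "v \<noteq> 0 ==> flen (push v) < flen v"
proof -
  assume "v \<noteq> 0"
  then have "flen v > 0" by (metis flen_eq_0_iff gr0I)
  then show ?thesis by (simp add: push_def flen_ftake slack_def)
qed

lemma FN_push: "v \<in> FN N ==> push v \<in> FN N"
  by (simp add: push_def FN_ftake)

text \<open>This makes the Rips complex contractible towards the root. If \<open>w\<close> branches
  off at or before \<open>push v\<close>, then \<open>push v\<close> lies on the geodesic from
  \<open>v\<close> to \<open>w\<close>, and the distance gained by moving it is at least the error
  \<open>slack\<close>. Otherwise \<open>w\<close> lies beyond \<open>push v\<close> but no farther
  from the root than \<open>v\<close>, so its word distance from \<open>push v\<close> is at most
  \<open>slack\<close>, a case that \<open>rad\<close> is chosen to cover.\<close>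

lemma push_close:
  assumes w: "flen w \<le> flen v" and vw: "d v w \<le> rad"
  shows "d (push v) w \<le> rad"
proof (cases "flen v \<le> slack")
  case True
  then have "push v = 0" by (simp add: push_def flip: flen_eq_0_iff add: flen_ftake)
  moreover have "d 0 w \<le> rad" unfolding rad_def using True w by (intro d_le) simp
  ultimately show ?thesis by simp
next
  case False
  define k where "k = flen v - slack"
  have k: "flen v = k + slack" using False by (simp add: k_def)
  have lk: "flen (push v) = k" by (simp add: push_def flen_ftake k_def)
  have wk: "word_of (push v) = take k (word_of v)" by (simp add: push_def k_def)
  define q where "q = cpl v w"
  show ?thesis
  proof (cases "q \<le> k")
    case True
    have "cpl (push v) w = q"
    proof (rule antisym)
      show "q \<le> cpl (push v) w"
        using True lk cpl_take[of v w] by (intro cpl_ge) (simp_all add: wk q_def min_absorb1)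
      let ?r = "cpl (push v) w"
      have "?r \<le> k" using cpl_le(1)[of "push v" w] lk by simp
      moreover have "take ?r (word_of (push v)) = take ?r (word_of w)" by (rule cpl_take)
      ultimately have "take ?r (word_of v) = take ?r (word_of w)" by (simp add: wk min_absorb1)
      then show "?r \<le> q" unfolding q_def using \<open>?r \<le> k\<close> k by (intro cpl_ge) auto
    qed
    moreover have "cpl v (push v) = k"
      using cpl_le(2)[of v "push v"] lk cpl_ge[of k v "push v"] k by (simp add: wk)
    ultimately have 1: "flen (- v + push v) = slack" "flen (- push v + w) + 2 * q = k + flen w"
      "flen (- v + w) + 2 * q = flen v + flen w"
      using flen_diff[of v "push v"] flen_diff[of "push v" w] flen_diff[of v w] lk k by (auto simp: q_def)
    then have "flen (- v + w) = flen (- v + push v) + flen (- push v + w)" using k by linarith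
    from d_between[OF this] have "d v (push v) + d (push v) w < d v w + slack" .
    moreover have "slack \<le> d v (push v)" using flen_le_d[of v "push v"] 1 by simp
    ultimately show ?thesis using vw by linarith
  next
    case False
    have "take k (take q (word_of v)) = take k (take q (word_of w))"
      unfolding q_def by (rule arg_cong[OF cpl_take])
    then have "k \<le> cpl (push v) w"
      using False lk by (intro cpl_ge) (simp_all add: wk min_def split: if_splits)
    then have "flen (- push v + w) \<le> slack"
      using flen_diff[of "push v" w] lk w k by linarith
    then show ?thesis unfolding rad_def by (rule d_le)
  qed
qed

section \<open>Simplices of the Rips complex and their alternating cochains\<close>

definition adm :: "fw list => bool" where
  "adm xs \<longleftrightarrow> set xs \<subseteq> FN N \<and> (\<forall>x\<in>set xs. \<forall>y\<in>set xs. d x y \<le> rad)"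

lemma adm_mono: "adm xs ==> set ys \<subseteq> set xs ==> adm ys"
  unfolding adm_def by blast

lemma adm_cong: "set xs = set ys ==> adm xs = adm ys"
  unfolding adm_def by simp

lemma adm_push:
  assumes "adm (v # ys)" "\<And>y. y \<in> set ys ==> flen y \<le> flen v"
  shows "adm (push v # v # ys)"
proof -
  have "d (push v) y \<le> rad" if "y \<in> set (v # ys)" for y
    using that assms by (intro push_close) (auto simp: adm_def)
  moreover have "push v \<in> FN N" using assms FN_push by (simp add: adm_def)
  ultimately show ?thesis using assms(1) d_sym by (auto simp: adm_def) 
qed

text \<open>A list of length \<open>l\<close> is a simplex of dimension \<open>l - 1\<close>.
  Cochains of every degree are functions on all lists, extended by zero.\<close>

definition coch :: "nat => (fw list => int) set" where
  "coch l = {c. alt c \<and> (\<forall>xs. c xs \<noteq> 0 \<longrightarrow> adm xs \<and> length xs = l)}"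

definition cob :: "(fw list => int) => fw list => int" where
  "cob c xs = (if adm xs then dlt c xs else 0)"

lemma alt_restrict: "alt c ==> alt (\<lambda>xs. if adm xs \<and> length xs = l then c xs else 0)"
  unfolding alt_def
proof (intro allI)
  fix u x y w assume "\<forall>u x y w. c (u @ x # y # w) = - c (u @ y # x # w)"
  then have c: "c (u @ x # y # w) = - c (u @ y # x # w)" by blast
  have "adm (u @ x # y # w) = adm (u @ y # x # w)" by (rule adm_cong) auto
  then show "(if adm (u @ x # y # w) \<and> length (u @ x # y # w) = l then c (u @ x # y # w) else 0) =
    - (if adm (u @ y # x # w) \<and> length (u @ y # x # w) = l then c (u @ y # x # w) else 0)"
    using c by simp
qed

lemma coch_restrict: "alt c ==> (\<lambda>xs. if adm xs \<and> length xs = l then c xs else 0) \<in> coch l"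
  unfolding coch_def using alt_restrict by auto

lemma cochD: "c \<in> coch l ==> alt c" "c \<in> coch l ==> c xs \<noteq> 0 ==> adm xs \<and> length xs = l"
  by (auto simp: coch_def)

lemma dlt_length: "c \<in> coch l ==> length xs \<noteq> Suc l ==> dlt c xs = 0"
proof -
  assume c: "c \<in> coch l" and l: "length xs \<noteq> Suc l"
  have "dlt c xs = dlt (\<lambda>_. 0) xs" using l cochD(2)[OF c] by (intro dlt_cong) force
  then show ?thesis by (simp add: dlt_zero)
qed

lemma cob_coch: "c \<in> coch l ==> cob c \<in> coch (Suc l)"
proof -
  assume c: "c \<in> coch l"
  have "cob c = (\<lambda>xs. if adm xs \<and> length xs = Suc l then dlt c xs else 0)"
    using dlt_length[OF c] by (auto simp: cob_def fun_eq_iff)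
  then show ?thesis using coch_restrict[OF alt_dlt[OF cochD(1)[OF c]]] by simp
qed

lemma cob_cob: "cob (cob c) xs = 0"
proof (cases "adm xs")
  case True
  then have "dlt (cob c) xs = dlt (dlt c) xs"
    by (intro dlt_cong) (use adm_mono in \<open>auto simp: cob_def\<close>)
  then show ?thesis unfolding cob_def[of "cob c"] by (simp add: dlt_dlt)
qed (simp add: cob_def)

section \<open>Contraction of the Rips complex towards the root\<close>

definition le :: "fw => fw => bool" where
  "le x y \<longleftrightarrow> flen x < flen y \<or> flen x = flen y \<and> code x \<le> code y"

lemma ex_max: "xs \<noteq> [] ==> \<exists>v\<in>set xs. \<forall>y\<in>set xs. le y v"
proof (induction xs rule: list_nonempty_induct)
  case (cons x xs)
  then obtain v where v: "v \<in> set xs" "\<forall>y\<in>set xs. le y v" by blast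
  show ?case
  proof (cases "le x v")
    case False
    then have "\<forall>y\<in>set (x # xs). le y x" using v by (auto simp: le_def) 
    then show ?thesis by auto
  qed (use v in auto)
qed (simp add: le_def)

definition maxv :: "fw list => fw" where
  "maxv xs = (SOME v. v \<in> set xs \<and> (\<forall>y\<in>set xs. le y v))"

lemma maxv: "xs \<noteq> [] ==> maxv xs \<in> set xs \<and> (\<forall>y\<in>set xs. le y (maxv xs))"
  unfolding maxv_def by (rule someI_ex) (use ex_max in blast)

lemma le_antisym: "le x y ==> le y x ==> x = y"
  by (auto simp: le_def code_inj)

lemma maxv_eqI: "v \<in> set xs ==> (\<And>y. y \<in> set xs ==> le y v) ==> maxv xs = v"
  using maxv[of xs] le_antisym by (metis empty_iff empty_set)

lemma maxv_nonzero: "\<exists>x\<in>set xs. x \<noteq> 0 ==> maxv xs \<noteq> 0"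
proof -
  assume "\<exists>x\<in>set xs. x \<noteq> 0"
  then obtain x where x: "x \<in> set xs" "x \<noteq> 0" by blast
  then have "le x (maxv xs)" using maxv[of xs] by force
  then show ?thesis using x by (auto simp: le_def)
qed

context
  fixes c :: "fw list => int"
begin

text \<open>A contracting homotopy on cochains. Each step replaces the vertex farthest from the root
  by its push and records \<open>c\<close> on the simplex that contains both; the power of -1 comes
  from moving that vertex to the front. The total word length decreases until all entries are at the
  root.\<close>

function filling :: "fw list => int" where
  "filling xs = (if \<forall>x\<in>set xs. x = 0 then 0 else
     (let v = maxv xs; u = takeWhile (\<lambda>x. x \<noteq> v) xs; w = tl (dropWhile (\<lambda>x. x \<noteq> v) xs)
      in filling (u @ push v # w) + (-1) ^ length u * c (push v # v # u @ w)))"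
  by auto
termination
proof (relation "measure (\<lambda>xs. sum_list (map flen xs))")
  fix xs v u w
  assume nz: "\<not> (\<forall>x\<in>set xs. x = 0)" and v: "v = maxv xs" and u: "u = takeWhile (\<lambda>x. x \<noteq> v) xs"
    and w: "w = tl (dropWhile (\<lambda>x. x \<noteq> v) xs)"
  have "xs \<noteq> []" using nz by auto
  then have "v \<in> set xs" using maxv v by blast
  then obtain u' w' where xs: "xs = u' @ v # w'" "v \<notin> set u'" by (meson split_list_first)
  moreover from this have "dropWhile (\<lambda>x. x \<noteq> v) u' = []" by (auto simp: dropWhile_eq_Nil_conv)
  ultimately have "u = u'" "w = w'" unfolding u w
    by (auto simp: takeWhile_tail takeWhile_eq_all_conv dropWhile_append3)
  then have "xs = u @ v # w" using xs by simp
  moreover have "flen (push v) < flen v" using flen_push maxv_nonzero nz v by blast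
  ultimately show "(u @ push v # w, xs) \<in> measure (\<lambda>xs. sum_list (map flen xs))" by simp
qed simp

declare filling.simps [simp del]

lemma filling_zero: "(\<And>x. x \<in> set xs ==> x = 0) ==> filling xs = 0"
  by (subst filling.simps) auto

lemma filling_step:
  assumes "v \<notin> set u" "v \<noteq> 0" "\<And>y. y \<in> set (u @ v # w) ==> le y v"
  shows "filling (u @ v # w) = filling (u @ push v # w) + (-1) ^ length u * c (push v # v # u @ w)"
proof -
  have m: "maxv (u @ v # w) = v" using assms by (intro maxv_eqI) auto
  have "takeWhile (\<lambda>x. x \<noteq> v) (u @ v # w) = u" "dropWhile (\<lambda>x. x \<noteq> v) (u @ v # w) = v # w"
    using assms(1) by (auto simp: takeWhile_tail takeWhile_eq_all_conv dropWhile_append3)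
  then show ?thesis using assms(2) by (subst filling.simps) (simp add: m Let_def)
qed

context
  assumes alt_c: "alt c"
begin

text \<open>\<open>maxv\<close> depends only on the set of entries, so both lists push the same
  vertex. The cases distinguish where its first occurrence lies relative to the transposed
  pair.\<close>

lemma alt_filling: "alt filling"
proof -
  have "filling (u @ x # y # w) = - filling (u @ y # x # w)" for u x y w
  proof (induction "sum_list (map flen (u @ x # y # w))" arbitrary: u x y w rule: less_induct)
    case less
    show ?case
    proof (cases "\<forall>z\<in>set (u @ x # y # w). z = 0")
      case True
      then show ?thesis using filling_zero[of "u @ x # y # w"] filling_zero[of "u @ y # x # w"] by auto
    next
      case False
      define v where "v = maxv (u @ x # y # w)"
      have v: "v \<in> set (u @ x # y # w)" and vmax: "\<And>z. z \<in> set (u @ x # y # w) ==> le z v"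
        using maxv[of "u @ x # y # w"] by (auto simp: v_def)
      have v0: "v \<noteq> 0" using False maxv_nonzero unfolding v_def by blast
      have dec: "flen (push v) < flen v" using flen_push v0 by blast
      consider "v \<in> set u" | "v \<notin> set u" "v = x" "v \<noteq> y" | "v \<notin> set u" "v \<noteq> x" "v = y" |
        "v \<notin> set u" "v = x" "v = y" | "v \<notin> set u" "v \<noteq> x" "v \<noteq> y" "v \<in> set w" using v by auto
      then show ?thesis
      proof cases
        case 1
        then obtain u1 u2 where u: "u = u1 @ v # u2" "v \<notin> set u1" by (meson split_list_first)
        have "filling (u1 @ v # u2 @ x # y # w) = filling (u1 @ push v # u2 @ x # y # w) +
            (-1) ^ length u1 * c (push v # v # u1 @ u2 @ x # y # w)"
          by (rule filling_step) (use u v0 vmax in auto)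
        moreover have "filling (u1 @ v # u2 @ y # x # w) = filling (u1 @ push v # u2 @ y # x # w) +
            (-1) ^ length u1 * c (push v # v # u1 @ u2 @ y # x # w)"
          by (rule filling_step) (use u v0 vmax in auto)
        moreover have "filling (u1 @ push v # u2 @ x # y # w) = - filling (u1 @ push v # u2 @ y # x # w)"
          using less[of "u1 @ push v # u2" x y w] dec by (simp add: u)
        moreover have "c (push v # v # u1 @ u2 @ x # y # w) = - c (push v # v # u1 @ u2 @ y # x # w)"
          using altD[OF alt_c, of "push v # v # u1 @ u2" x y w] by simp
        ultimately show ?thesis by (simp add: u)
      next
        case 2
        have "filling (u @ v # y # w) = filling (u @ push v # y # w) + (-1) ^ length u * c (push v # v # u @ y # w)"
          by (rule filling_step) (use 2 v0 vmax in auto)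
        moreover have "filling ((u @ [y]) @ v # w) = filling ((u @ [y]) @ push v # w) +
            (-1) ^ length (u @ [y]) * c (push v # v # (u @ [y]) @ w)"
          by (rule filling_step) (use 2 v0 vmax in auto)
        moreover have "filling (u @ push v # y # w) = - filling (u @ y # push v # w)"
          using less[of u "push v" y w] dec 2 by simp
        ultimately show ?thesis using 2 by simp
      next
        case 3
        have "filling (u @ v # x # w) = filling (u @ push v # x # w) + (-1) ^ length u * c (push v # v # u @ x # w)"
          by (rule filling_step) (use 3 v0 vmax in auto)
        moreover have "filling ((u @ [x]) @ v # w) = filling ((u @ [x]) @ push v # w) +
            (-1) ^ length (u @ [x]) * c (push v # v # (u @ [x]) @ w)"
          by (rule filling_step) (use 3 v0 vmax in auto)
        moreover have "filling (u @ push v # x # w) = - filling (u @ x # push v # w)"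
          using less[of u "push v" x w] dec 3 by simp
        ultimately show ?thesis using 3 by simp
      next
        case 4
        \<comment> \<open>Both transposed entries equal \<open>v\<close>, so two steps are unfolded.
          The recorded values vanish because entries repeat, and the list that remains has two equal
          neighbours, where the induction hypothesis forces the value 0.\<close>
        have "filling (u @ v # v # w) = filling (u @ push v # v # w) + (-1) ^ length u * c (push v # v # u @ v # w)"
          by (rule filling_step) (use 4 v0 vmax in auto)
        moreover have "c (push v # v # u @ v # w) = 0" by (rule alt_not_distinct[OF alt_c]) auto
        moreover have "filling ((u @ [push v]) @ v # w) = filling ((u @ [push v]) @ push v # w) +
            (-1) ^ length (u @ [push v]) * c (push v # v # (u @ [push v]) @ w)"
        proof (rule filling_step)
          show "v \<notin> set (u @ [push v])" using 4 dec by auto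
          show "le z v" if "z \<in> set ((u @ [push v]) @ v # w)" for z
            using that vmax 4 dec by (auto simp: le_def)
        qed fact
        moreover have "c (push v # v # (u @ [push v]) @ w) = 0" by (rule alt_not_distinct[OF alt_c]) auto
        moreover have "filling (u @ push v # push v # w) = 0"
          using less[of u "push v" "push v" w] dec 4 by simp
        ultimately show ?thesis using 4 by simp
      next
        case 5
        then obtain w1 w2 where w: "w = w1 @ v # w2" "v \<notin> set w1" by (meson split_list_first)
        have "filling ((u @ x # y # w1) @ v # w2) = filling ((u @ x # y # w1) @ push v # w2) +
            (-1) ^ length (u @ x # y # w1) * c (push v # v # (u @ x # y # w1) @ w2)"
          by (rule filling_step) (use 5 w v0 vmax in auto)
        moreover have "filling ((u @ y # x # w1) @ v # w2) = filling ((u @ y # x # w1) @ push v # w2) +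
            (-1) ^ length (u @ y # x # w1) * c (push v # v # (u @ y # x # w1) @ w2)"
          by (rule filling_step) (use 5 w v0 vmax in auto)
        moreover have "filling (u @ x # y # w1 @ push v # w2) = - filling (u @ y # x # w1 @ push v # w2)"
          using less[of u x y "w1 @ push v # w2"] dec by (simp add: w)
        moreover have "c (push v # v # u @ x # y # w1 @ w2) = - c (push v # v # u @ y # x # w1 @ w2)"
          using altD[OF alt_c, of "push v # v # u" x y "w1 @ w2"] by simp
        ultimately show ?thesis by (simp add: w)
      qed
    qed
  qed
  then show ?thesis unfolding alt_def by blast
qed

text \<open>By alternation the farthest vertex \<open>v\<close> may stand in front. The cocycle
  identity on the simplex \<open>push v # v # ys\<close>, admissible by \<open>adm_push\<close>,
  carries the claim from \<open>push v # ys\<close> to \<open>v # ys\<close>. A list of zeros of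
  length at least 2 repeats an entry, so \<open>c\<close> vanishes on it.\<close>

lemma dlt_filling:
  assumes cocycle: "\<And>xs. adm xs ==> dlt c xs = 0"
  shows "adm xs ==> length xs \<ge> 2 ==> dlt filling xs = c xs"
proof (induction "sum_list (map flen xs)" arbitrary: xs rule: less_induct)
  case less
  show ?case
  proof (cases "\<forall>z\<in>set xs. z = 0")
    case True
    have "dlt filling xs = dlt (\<lambda>_. 0) xs" by (intro dlt_cong filling_zero) (use True in blast)
    moreover have "\<not> distinct xs"
    proof
      assume "distinct xs"
      then have "length xs = card (set xs)" by (simp add: distinct_card)
      also have "\<dots> \<le> card {0 :: fw}" using True by (intro card_mono) auto
      finally show False using less.prems by simp
    qed
    then have "c xs = 0" by (rule alt_not_distinct[OF alt_c])
    ultimately show ?thesis by (simp add: dlt_zero)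
  next
    case False
    define v where "v = maxv xs"
    have "xs \<noteq> []" using False by auto
    then have v: "v \<in> set xs" and vmax: "\<And>z. z \<in> set xs ==> le z v"
      using maxv[of xs] by (auto simp: v_def)
    have v0: "v \<noteq> 0" using False maxv_nonzero unfolding v_def by blast
    have dec: "flen (push v) < flen v" using flen_push v0 by blast
    obtain u w where xs: "xs = u @ v # w" using v by (meson split_list)
    define ys where "ys = u @ w"
    have setys: "set (v # ys) = set xs" by (auto simp: xs ys_def)
    have adm1: "adm (push v # v # ys)"
    proof (rule adm_push)
      show "adm (v # ys)" using less.prems adm_cong[OF setys] by simp
      show "flen y \<le> flen v" if "y \<in> set ys" for y
      proof -
        have "y \<in> set xs" using that setys by auto
        then show ?thesis using vmax[of y] by (auto simp: le_def)
      qed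
    qed
    have step: "filling (v # zs) = filling (push v # zs) + c (push v # v # zs)" if "set zs \<subseteq> set ys" for zs
      using filling_step[of v "[]" zs] v0 vmax setys that by fastforce
    have IH: "dlt filling (push v # ys) = c (push v # ys)"
    proof (rule less.hyps)
      show "sum_list (map flen (push v # ys)) < sum_list (map flen xs)" using dec by (simp add: xs ys_def)
      show "adm (push v # ys)" by (rule adm_mono[OF adm1]) auto
      show "2 \<le> length (push v # ys)" using less.prems by (simp add: xs ys_def)
    qed
    have "dlt (\<lambda>zs. filling (v # zs)) ys = dlt (\<lambda>zs. filling (push v # zs) + c (push v # v # zs)) ys"
      by (intro dlt_cong step)
    then have "dlt filling (v # ys) = dlt filling (push v # ys) - dlt (\<lambda>zs. c (push v # v # zs)) ys"
      by (simp add: dlt_add)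
    also have "\<dots> = c (v # ys) - dlt c (push v # v # ys)" using IH by simp
    also have "\<dots> = c (v # ys)" using cocycle[OF adm1] by simp
    finally have "dlt filling (v # ys) = c (v # ys)" .
    then show ?thesis
      using alt_move[OF alt_dlt[OF alt_filling], of u v w] alt_move[OF alt_c, of u v w] by (simp add: xs ys_def)
  qed
qed

end
end

lemma coch_acyclic:
  assumes c: "c \<in> coch (Suc l)" and l: "l \<ge> 1" and cocycle: "\<And>xs. cob c xs = 0"
  shows "\<exists>b\<in>coch l. cob b = c"
proof
  \<comment> \<open>The filling is cut off outside the simplices. Faces of admissible lists are
    admissible, so this does not affect the coboundary on simplices.\<close>
  define b where "b xs = (if adm xs \<and> length xs = l then filling c xs else 0)" for xs
  have ac: "alt c" by (rule cochD(1)[OF c])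
  show b: "b \<in> coch l" unfolding b_def by (rule coch_restrict[OF alt_filling[OF ac]])
  show "cob b = c"
  proof
    fix xs
    show "cob b xs = c xs"
    proof (cases "adm xs \<and> length xs = Suc l")
      case True
      have "dlt b xs = dlt (filling c) xs"
        by (intro dlt_cong) (use True adm_mono in \<open>auto simp: b_def\<close>)
      also have "\<dots> = c xs"
      proof (rule dlt_filling[OF ac])
        show "dlt c ys = 0" if "adm ys" for ys using cocycle[of ys] that by (simp add: cob_def)
      qed (use True l in auto)
      finally show ?thesis using True by (simp add: cob_def)
    next
      case False
      then have "cob b xs = 0" using dlt_length[OF b, of xs] by (auto simp: cob_def)
      moreover have "c xs = 0" using cochD(2)[OF c] False by blast
      ultimately show ?thesis by simp
    qed
  qed
qed

end

text \<open>In a basis of \<open>L'\<close> the map \<open>h\<close> becomes a family of functionals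
  on \<open>L\<close>, and near-surjectivity supplies for each of them a vector of value
  \<open>pi1\<close> that the others kill. The kernel of \<open>h\<close> is their common
  kernel.\<close>

lemma sfree_exact_step:
  assumes "pmod s p" "pmod s' p" and L: "pmod.sfree s p L" and L': "pmod.sfree s' p L'"
    and h_in: "\<And>x. x \<in> L ==> h x \<in> L'"
    and h_add: "\<And>x y. x \<in> L ==> y \<in> L ==> h (x + y) = h x + h y"
    and h_s: "\<And>a x. x \<in> L ==> h (s a x) = s' a (h x)"
    and onto: "\<And>y. y \<in> L' ==> \<exists>x\<in>L. h x = s' pi1 y"
  shows "pmod.sfree s p {x\<in>L. h x = 0}"
proof -
  interpret m: pmod s p by fact
  interpret m': pmod s' p by fact
  obtain I e where lat': "m'.slat L'" and B: "m'.sbasis I e L'" using L' by (auto simp: m'.sfree_def)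
  have lat: "m.slat L" using L by (simp add: m.sfree_def)
  have "\<exists>q. h x = (\<Sum>i\<in>I. s' (q i) (e i))" if "x \<in> L" for x using m'.sbasisD(3)[OF B h_in[OF that]] .
  then obtain Q where Q: "\<And>x. x \<in> L ==> h x = (\<Sum>i\<in>I. s' (Q x i) (e i))" by metis
  have uniq: "cg p (Q x i) (r i)" if "x \<in> L" "h x = (\<Sum>i\<in>I. s' (r i) (e i))" "i \<in> I" for x r i
  proof -
    have "(\<Sum>i\<in>I. s' (Q x i - r i) (e i)) = 0"
      using Q[OF that(1)] that(2) by (simp add: m'.s_diff_left sum_subtractf)
    from m'.sbasisD(4)[OF B this that(3)] show ?thesis by (simp add: cg_def)
  qed
  have lin: "m.slin (\<lambda>x. Q x i) L" if i: "i \<in> I" for i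
    unfolding m.slin_def
  proof (intro conjI ballI allI)
    fix x y assume "x \<in> L" "y \<in> L"
    then show "cg p (Q (x + y) i) (Q x i + Q y i)"
      by (intro uniq[where r = "\<lambda>i. Q x i + Q y i"] i m.slatD[OF lat])
        (simp_all add: h_add Q m'.s_add_left sum.distrib)
  next
    fix a x assume "x \<in> L"
    then show "cg p (Q (s a x) i) (a * Q x i)"
      by (intro uniq[where r = "\<lambda>i. a * Q x i"] i m.slatD[OF lat])
        (simp_all add: h_s Q m'.s_mult m'.s_sum_right)
  qed
  have "m.sfree {x\<in>L. \<forall>i\<in>I. cg p (Q x i) 0}"
  proof (rule m.sfree_common_kernel[OF m'.sbasisD(1)[OF B] L lin])
    fix i assume i: "i \<in> I"
    obtain x where x: "x \<in> L" "h x = s' pi1 (e i)" using onto m'.sbasisD(2)[OF B i] by blast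
    have "(\<Sum>j\<in>I. s' (if j = i then pi1 else 0) (e j)) = (\<Sum>j\<in>I. if j = i then s' pi1 (e j) else 0)"
      by (intro sum.cong) auto
    also have "\<dots> = h x" using x m'.sbasisD(1)[OF B] i by simp
    finally have "cg p (Q x j) (if j = i then pi1 else 0)" if "j \<in> I" for j
      using uniq[OF x(1) _ that] by metis
    from this i show "\<exists>x\<in>L. cg p (Q x i) pi1 \<and> (\<forall>d\<in>I - {i}. cg p (Q x d) 0)"
      using x(1) by (intro bexI[of _ x]) (metis (full_types) DiffE singletonI, blast)
  qed
  moreover have "(\<forall>i\<in>I. cg p (Q x i) 0) \<longleftrightarrow> h x = 0" if x: "x \<in> L" for x
  proof
    assume "h x = 0"
    then show "\<forall>i\<in>I. cg p (Q x i) 0" using Q[OF x] m'.sbasisD(4)[OF B] by metis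
  next
    assume z: "\<forall>i\<in>I. cg p (Q x i) 0"
    have "s' (Q x i) (e i) = 0" if "i \<in> I" for i
      using m'.slat_cg[OF lat' m'.sbasisD(2)[OF B that], of "Q x i" 0] z that by simp
    then show "h x = 0" using Q[OF x] by simp
  qed
  then have "{x\<in>L. \<forall>i\<in>I. cg p (Q x i) 0} = {x\<in>L. h x = 0}" by blast
  ultimately show ?thesis by simp
qed

lemma FN_induct_right [consumes 1, case_names zero snoc]:
  assumes "x \<in> FN n" "P 0" and "\<And>l x. fst l < n ==> x \<in> FN n ==> P x ==> P (x + fgen l)"
  shows "P x"
proof -
  have "- x \<in> FN n" using assms(1) by simp
  then have "P (- (- x))"
  proof (induction rule: FN_induct)
    case (Cons l y)
    have "- (fgen l + y) = - y + fgen (linv l)" by (simp add: minus_add uminus_fgen del: add_uminus_conv_diff)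
    then show ?case using assms(3)[of "linv l" "- y"] Cons by simp
  qed (simp add: assms(2))
  then show ?thesis by simp
qed

subsection \<open>Invariant cochains\<close>

context free_aut
begin

definition tinv :: "(fw list => int) => bool" where
  "tinv c \<longleftrightarrow> (\<forall>g\<in>FN N. \<forall>xs. c (map ((+) g) xs) = c xs)"

definition icoch :: "nat => (fw list => int) set" where
  "icoch l = {c \<in> coch l. tinv c}"

lemma map_translate: "map ((+) g) (map ((+) h) xs) = map ((+) (g + h)) xs" for g h :: fw
  by (simp add: add.assoc)

lemma map_translate_inverse [simp]: "map ((+) (- g)) (map ((+) g) xs) = xs" "map ((+) g) (map ((+) (- g)) xs) = xs"
  for g :: fw
  by (simp_all add: map_idI)

lemma map_translate_0 [simp]: "map ((+) 0) xs = xs" for xs :: "fw list"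
  by (simp add: map_idI)

lemma adm_translate: "g \<in> FN N ==> adm (map ((+) g) xs) = adm xs"
  unfolding adm_def by (auto simp: d_translate FN_plus_iff subset_iff)

lemma alt_map: "alt c ==> alt (\<lambda>xs. c (map f xs))"
  unfolding alt_def map_append list.map by blast

lemma coch_translate: "c \<in> coch l ==> g \<in> FN N ==> (\<lambda>xs. c (map ((+) g) xs)) \<in> coch l"
  unfolding coch_def using alt_map[of c] adm_translate by fastforce

lemma cob_translate: "g \<in> FN N ==> cob c (map ((+) g) xs) = cob (\<lambda>ys. c (map ((+) g) ys)) xs"
  by (simp add: cob_def adm_translate dlt_map)

lemma alt_combine: "alt a ==> alt b ==> alt (\<lambda>xs. a xs - b xs)" "alt a ==> alt b ==> alt (\<lambda>xs. a xs + b xs)"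
proof -
  assume a: "alt a" and b: "alt b"
  show "alt (\<lambda>xs. a xs - b xs)" unfolding alt_def
  proof (intro allI)
    fix u x y w
    show "a (u @ x # y # w) - b (u @ x # y # w) = - (a (u @ y # x # w) - b (u @ y # x # w))"
      using altD[OF a, of u x y w] altD[OF b, of u x y w] by simp
  qed
  show "alt (\<lambda>xs. a xs + b xs)" unfolding alt_def
  proof (intro allI)
    fix u x y w
    show "a (u @ x # y # w) + b (u @ x # y # w) = - (a (u @ y # x # w) + b (u @ y # x # w))"
      using altD[OF a, of u x y w] altD[OF b, of u x y w] by simp
  qed
qed

lemma coch_diff: "a \<in> coch l ==> b \<in> coch l ==> (\<lambda>xs. a xs - b xs) \<in> coch l"
  unfolding coch_def using alt_combine(1)[of a b] by force

lemma coch_add: "a \<in> coch l ==> b \<in> coch l ==> (\<lambda>xs. a xs + b xs) \<in> coch l"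
  unfolding coch_def using alt_combine(2)[of a b] by force

lemma coch_zero: "(\<lambda>_. 0) \<in> coch l"
  by (simp add: coch_def alt_def)

lemma cob_diff: "cob (\<lambda>xs. a xs - b xs) xs = cob a xs - cob b xs"
  by (simp add: cob_def dlt_diff)

lemma cob_add: "cob (\<lambda>xs. a xs + b xs) xs = cob a xs + cob b xs"
  by (simp add: cob_def dlt_add)

lemma tinv_if_generators:
  assumes "\<And>i xs. i < N ==> c (map ((+) (- gen i)) xs) = c xs"
  shows "tinv c"
proof -
  have gen: "c (map ((+) (fgen l)) xs) = c xs" if "fst l < N" for l xs
  proof (cases "snd l")
    case True
    then have l: "fgen l = gen (fst l)" by (cases l) auto
    show ?thesis using assms[OF that, of "map ((+) (gen (fst l))) xs"] unfolding l by (simp only: map_translate_inverse)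
  next
    case False
    then have "fgen l = - gen (fst l)" by (cases l) (auto simp: fgen_False)
    then show ?thesis using assms[OF that] by simp
  qed
  have "c (map ((+) g) xs) = c xs" if "g \<in> FN N" for g xs
    using that
  proof (induction arbitrary: xs rule: FN_induct)
    case (Cons l x)
    then show ?case unfolding map_translate[symmetric] gen[OF Cons(1)] by simp
  qed simp
  then show ?thesis by (simp add: tinv_def)
qed

text \<open>A primitive \<open>b0\<close> of \<open>c\<close> need not be invariant; its change
  under the \<open>i\<close>-th generator is a cocycle, hence the coboundary of some
  \<open>e i\<close>. It is corrected by the coboundary of an \<open>f\<close> that changes by
  \<open>e i\<close> under the \<open>i\<close>-th generator. Such an \<open>f\<close> exists
  because the group is free, so the \<open>e i\<close> have no relations to respect, and because
  translations act freely on simplices.\<close>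

lemma icoch_exact:
  assumes c: "c \<in> coch (Suc l)" and inv: "tinv c" and l: "l \<ge> 2" and cocycle: "\<And>xs. cob c xs = 0"
  shows "\<exists>b\<in>icoch l. cob b = c"
proof -
  have l1: "l \<ge> 1" "l - 1 \<ge> 1" "l = Suc (l - 1)" using l by auto
  obtain b0 where b0: "b0 \<in> coch l" "cob b0 = c" using coch_acyclic[OF c l1(1) cocycle] by blast
  define ci where "ci i xs = b0 (map ((+) (- gen i)) xs) - b0 xs" for i xs
  have g: "- gen i \<in> FN N" if "i < N" for i using that by simp
  have ci: "ci i \<in> coch l" if "i < N" for i
    unfolding ci_def by (intro coch_diff coch_translate b0 g that)
  have ci0: "cob (ci i) xs = 0" if i: "i < N" for i xs
  proof -
    have "cob (ci i) xs = cob b0 (map ((+) (- gen i)) xs) - cob b0 xs"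
      unfolding ci_def cob_diff cob_translate[OF g[OF i]] ..
    also have "\<dots> = 0" using inv g[OF i] unfolding b0(2) tinv_def by simp
    finally show ?thesis .
  qed
  have "\<exists>e\<in>coch (l - 1). cob e = ci i" if "i < N" for i
    using coch_acyclic[of "ci i" "l - 1"] ci[OF that] ci0[OF that] l1 by simp
  then obtain e where e: "\<And>i. i < N ==> e i \<in> coch (l - 1)" "\<And>i. i < N ==> cob (e i) = ci i" by metis
  obtain \<gamma> :: "fw set => fw" where \<gamma>: "\<And>\<sigma>. finite \<sigma> ==> \<sigma> \<noteq> {} ==> \<gamma> \<sigma> \<in> \<sigma>"
    "\<And>\<sigma> g. finite \<sigma> ==> \<sigma> \<noteq> {} ==> \<gamma> ((+) g ` \<sigma>) = g + \<gamma> \<sigma>" using ex_equivariant_point by metis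
  \<comment> \<open>The prescribed changes \<open>e i\<close> accumulated along a word, as for a
    crossed homomorphism, while the simplex is translated back letter by letter. The value at the
    empty word is 0.\<close>
  define Fr where "Fr = rec_list (\<lambda>xs. 0) (\<lambda>l w r xs. if snd l then r (map ((+) (- gen (fst l))) xs) - e (fst l) xs
    else r (map ((+) (gen (fst l))) xs) + e (fst l) (map ((+) (gen (fst l))) xs))"
  have Fr: "Fr [] xs = 0" "Fr ((i, True) # w) xs = Fr w (map ((+) (- gen i)) xs) - e i xs"
    "Fr ((i, False) # w) xs = Fr w (map ((+) (gen i)) xs) + e i (map ((+) (gen i)) xs)" for i w xs
    by (simp_all add: Fr_def)
  have alt_Fr: "alt (Fr w)" if "\<forall>l\<in>set w. fst l < N" for w
    using that
  proof (induction w)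
    case Nil
    have "Fr [] = (\<lambda>xs. 0)" by (auto simp: Fr)
    then show ?case by (simp add: alt_def)
  next
    case (Cons lt w)
    obtain i b where lt: "lt = (i, b)" by (cases lt)
    have ae: "alt (e i)" using cochD(1)[OF e(1)] Cons.prems lt by auto
    have aw: "alt (Fr w)" using Cons by simp
    show ?case
    proof (cases b)
      case True
      then have "Fr (lt # w) = (\<lambda>xs. Fr w (map ((+) (- gen i)) xs) - e i xs)"
        by (auto simp: lt Fr fun_eq_iff)
      then show ?thesis using alt_combine(1)[OF alt_map[OF aw] ae] by simp
    next
      case False
      then have "Fr (lt # w) = (\<lambda>xs. Fr w (map ((+) (gen i)) xs) + e i (map ((+) (gen i)) xs))"
        by (auto simp: lt Fr fun_eq_iff)
      then show ?thesis using alt_combine(2)[OF alt_map[OF aw] alt_map[OF ae]] by simp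
    qed
  qed
  \<comment> \<open>The marked point \<open>\<gamma>\<close> of a simplex selects the word. Since
    \<open>\<gamma>\<close> commutes with translations, translating by \<open>- gen i\<close> either
    removes the first letter of that word or prepends a letter without cancellation.\<close>
  define f where "f xs = (if adm xs \<and> length xs = l - 1 then Fr (word_of (\<gamma> (set xs))) xs else 0)" for xs
  have f_supp: "f xs \<noteq> 0 ==> adm xs \<and> length xs = l - 1" for xs by (simp add: f_def split: if_splits)
  have \<gamma>_FN: "\<gamma> (set xs) \<in> FN N" if "adm xs" "length xs = l - 1" for xs
  proof -
    have "set xs \<noteq> {}" using that l1 by auto
    then show ?thesis using \<gamma>(1)[of "set xs"] that by (auto simp: adm_def)
  qed
  have "alt f" unfolding alt_def
  proof (intro allI)
    fix u w :: "fw list" and x y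
    have set: "set (u @ x # y # w) = set (u @ y # x # w)" by auto
    show "f (u @ x # y # w) = - f (u @ y # x # w)"
    proof (cases "adm (u @ x # y # w) \<and> length (u @ x # y # w) = l - 1")
      case True
      then have "\<gamma> (set (u @ x # y # w)) \<in> FN N" using \<gamma>_FN by blast
      then have "alt (Fr (word_of (\<gamma> (set (u @ x # y # w)))))"
        unfolding FN_def mem_Collect_eq by (rule alt_Fr)
      from altD[OF this, of u x y w] show ?thesis using True set adm_cong[OF set] unfolding f_def by simp
    next
      case False
      then show ?thesis using adm_cong[OF set] unfolding f_def by auto
    qed
  qed
  then have f: "f \<in> coch (l - 1)" using f_supp by (simp add: coch_def)
  have f_step: "f (map ((+) (- gen i)) xs) = f xs + e i xs" if i: "i < N" for i xs
  proof (cases "adm xs \<and> length xs = l - 1")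
    case False
    then have "e i xs = 0" using cochD(2)[OF e(1)[OF i]] by blast
    then show ?thesis using False adm_translate[OF g[OF i], of xs] by (auto simp: f_def)
  next
    case True
    have ne: "set xs \<noteq> {}" using True l1 by auto
    define h where "h = \<gamma> (set xs)"
    have "\<gamma> (set (map ((+) (- gen i)) xs)) = - gen i + h"
      unfolding h_def using \<gamma>(2)[of "set xs" "- gen i"] ne by simp
    then have fm: "f (map ((+) (- gen i)) xs) = Fr (word_of (- gen i + h)) (map ((+) (- gen i)) xs)"
      using True adm_translate[OF g[OF i], of xs] by (simp add: f_def)
    have fx: "f xs = Fr (word_of h) xs" using True by (simp add: f_def h_def)
    show ?thesis
    proof (cases "\<exists>w. word_of h = (i, True) # w")
      case True
      then obtain w where w: "word_of h = (i, True) # w" by blast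
      have "nocanc ((i, True) # w)" by (metis nocanc_word_of w)
      then have "h = gen i + Fw w" using Fw_Cons[of "(i, True)" w] w by (metis word_of_inverse)
      then have "- gen i + h = Fw w" by (simp add: add.assoc[symmetric])
      then have "word_of (- gen i + h) = w" using \<open>nocanc ((i, True) # w)\<close> nocanc_ConsD word_of_Fw by auto
      then show ?thesis using fm fx w Fr(2) by simp
    next
      case False
      have "nocanc ((i, False) # word_of h)"
        using False nocanc_word_of[of h] by (cases "word_of h") (auto simp: linv_def)
      then have "word_of (fgen (i, False) + h) = (i, False) # word_of h" by (rule word_of_fgen_plus)
      then have "word_of (- gen i + h) = (i, False) # word_of h" by (simp add: fgen_False)
      then show ?thesis unfolding fm fx Fr(3) by (simp only: Fr(3) map_translate_inverse)
    qed
  qed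
  define b where "b xs = b0 xs - cob f xs" for xs
  have "b \<in> coch l" unfolding b_def using cob_coch[OF f] l1 by (intro coch_diff b0) simp
  moreover have "tinv b"
  proof (rule tinv_if_generators)
    fix i xs assume i: "i < N"
    have "cob f (map ((+) (- gen i)) xs) = cob (\<lambda>ys. f ys + e i ys) xs"
      unfolding cob_translate[OF g[OF i]] f_step[OF i] ..
    also have "\<dots> = cob f xs + ci i xs" unfolding cob_add e(2)[OF i] ..
    finally show "b (map ((+) (- gen i)) xs) = b xs" by (simp add: b_def ci_def)
  qed
  moreover have "cob b = c"
  proof
    fix xs show "cob b xs = c xs" unfolding b_def cob_diff cob_cob using b0(2) by simp
  qed
  ultimately show ?thesis unfolding icoch_def by blast
qed

text \<open>The invariant 1-cocycle of the homomorphism sending \<open>gen i\<close> to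
  \<open>a i\<close>: on an edge it is the image of \<open>- x + y\<close>. Edges are lists of
  length 2.\<close>

definition homcoch :: "(nat => int) => fw list => int" where
  "homcoch a xs = (if adm xs \<and> length xs = 2 then \<Sum>i<N. a i * (es i (xs ! 1) - es i (xs ! 0)) else 0)"

lemma adm_edge: "x \<in> FN N ==> fst l < N ==> adm [x, x + fgen l]"
proof -
  assume x: "x \<in> FN N" and l: "fst l < N"
  have "d x (x + fgen l) \<le> p * (Lip * slack)"
    by (rule d_le) (simp add: slack_def flip: add.assoc)
  then show ?thesis using x l d_sym[of x "x + fgen l"] FN_plus[of x N "fgen l"] by (simp add: adm_def rad_def)
qed

lemma length2_cases: "length xs = 2 ==> \<exists>x y. xs = [x, y]"
  by (metis (no_types, opaque_lifting) One_nat_def Suc_1 length_0_conv length_Suc_conv)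

lemma homcoch_cocycle: "homcoch a \<in> icoch 2" "cob (homcoch a) xs = 0"
proof -
  have alt: "alt (homcoch a)" unfolding alt_def
  proof (intro allI)
    fix u x y w
    have adm: "adm (u @ x # y # w) = adm (u @ y # x # w)" by (rule adm_cong) auto
    show "homcoch a (u @ x # y # w) = - homcoch a (u @ y # x # w)"
    proof (cases "length (u @ x # y # w) = 2")
      case True
      then have "u = []" "w = []" by auto
      then show ?thesis using adm by (simp add: homcoch_def sum_negf[symmetric] algebra_simps)
    qed (auto simp: homcoch_def)
  qed
  have "tinv (homcoch a)" unfolding tinv_def
  proof (intro ballI allI)
    fix g xs assume g: "g \<in> FN N"
    show "homcoch a (map ((+) g) xs) = homcoch a xs"
      using adm_translate[OF g, of xs] by (simp add: homcoch_def addmapD[OF addmap_es])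
  qed
  then show "homcoch a \<in> icoch 2" using alt by (auto simp: icoch_def coch_def homcoch_def split: if_splits)
  show "cob (homcoch a) xs = 0"
  proof (cases "adm xs \<and> length xs = 3")
    case True
    then obtain x y z where xs: "xs = [x, y, z]"
      by (metis (no_types, opaque_lifting) length_0_conv length_Suc_conv numeral_3_eq_3)
    have "adm [x, y]" "adm [y, z]" "adm [x, z]" using True xs by (auto intro: adm_mono)
    then show ?thesis by (simp add: xs cob_def homcoch_def algebra_simps flip: sum.distrib sum_subtractf)
  next
    case False
    have "homcoch a \<in> coch 2" using \<open>homcoch a \<in> icoch 2\<close> by (simp add: icoch_def)
    from dlt_length[OF this, of xs] show ?thesis using False by (auto simp: cob_def)
  qed
qed

text \<open>The primitive of \<open>c\<close> on vertices, normalised to vanish at 0, is additive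
  because \<open>c\<close> is invariant. It is therefore a homomorphism to the integers, determined
  by its values on generators.\<close>

lemma cocycle_homcoch:
  assumes c: "c \<in> icoch 2" and cocycle: "\<And>xs. cob c xs = 0"
  shows "c = homcoch (\<lambda>i. c [0, gen i])"
proof -
  have cc: "c \<in> coch (Suc 1)" and inv: "tinv c" using c by (simp_all add: icoch_def numeral_2_eq_2)
  obtain b where b: "b \<in> coch 1" "cob b = c" using coch_acyclic[OF cc _ cocycle] by auto
  have cb: "c [x, y] = b [y] - b [x]" if "adm [x, y]" for x y
    using that b(2)[symmetric] by (simp add: cob_def)
  \<comment> \<open>By invariance of \<open>c\<close> along Cayley edges, the difference between a
    translate of \<open>b\<close> and \<open>b\<close> does not change from a vertex to its
    neighbours; the Cayley graph is connected.\<close>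
  have const: "b [g + x] - b [x] = b [g] - b [0]" if "g \<in> FN N" "x \<in> FN N" for g x
    using that(2)
  proof (induction rule: FN_induct_right)
    case (snoc l x)
    have adm: "adm [x, x + fgen l]" by (rule adm_edge[OF snoc(2,1)])
    then have "adm [g + x, g + x + fgen l]" using adm_edge[OF FN_plus[OF that(1) snoc(2)] snoc(1)] by blast
    then have "c [g + x, g + x + fgen l] = b [g + x + fgen l] - b [g + x]" by (rule cb)
    moreover have "c [g + x, g + x + fgen l] = c [x, x + fgen l]"
      using inv that(1) unfolding tinv_def by (metis (no_types, lifting) add.assoc list.map)
    ultimately show ?case using cb[OF adm] snoc.IH by (simp add: add.assoc)
  qed simp
  define h where "h x = b [x] - b [0]" for x
  have h_add: "h (g + x) = h g + h x" if "g \<in> FN N" "x \<in> FN N" for g x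
    using const[OF that] by (simp add: h_def)
  have h0: "h 0 = 0" by (simp add: h_def)
  have h_gen: "h (gen i) = c [0, gen i]" if "i < N" for i
    using cb[of 0 "gen i"] adm_edge[of 0 "(i, True)"] that by (simp add: h_def)
  define H where "H x = (\<Sum>i<N. c [0, gen i] * es i x)" for x
  have H: "addmap H" unfolding addmap_def H_def addmapD[OF addmap_es] by (simp add: distrib_left sum.distrib)
  have H_gen: "H (gen j) = c [0, gen j]" if "j < N" for j
  proof -
    have "H (gen j) = (\<Sum>i<N. if i = j then c [0, gen i] else 0)" unfolding H_def by (intro sum.cong) (auto simp: es_gen)
    then show ?thesis using that by simp
  qed
  have hH: "h x = H x" if "x \<in> FN N" for x
    using that
  proof (induction rule: FN_induct)
    case zero
    then show ?case using h0 addmap_zero[OF H] by simp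
  next
    case (Cons l x)
    have "h (fgen l) = H (fgen l)"
    proof (cases "snd l")
      case True
      then have "fgen l = gen (fst l)" by (cases l) auto
      then show ?thesis using h_gen[OF Cons(1)] H_gen[OF Cons(1)] by simp
    next
      case False
      then have l: "fgen l = - gen (fst l)" by (cases l) (auto simp: fgen_False)
      have "h (- gen (fst l) + gen (fst l)) = h (- gen (fst l)) + h (gen (fst l))" using Cons(1) by (intro h_add) auto
      then have "h (- gen (fst l)) = - h (gen (fst l))" using h0 by simp
      then show ?thesis using h_gen[OF Cons(1)] H_gen[OF Cons(1)] by (simp add: l addmap_uminus[OF H])
    qed
    then show ?case using Cons h_add[of "fgen l" x] by (simp add: addmapD[OF H])
  qed
  show ?thesis
  proof
    fix xs show "c xs = homcoch (\<lambda>i. c [0, gen i]) xs"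
    proof (cases "adm xs \<and> length xs = 2")
      case False
      then have "c xs = 0" using cochD(2)[OF cc, of xs] by (auto simp: numeral_2_eq_2)
      then show ?thesis using False by (auto simp: homcoch_def)
    next
      case True
      then obtain x y where xs: "xs = [x, y]" using length2_cases by blast
      then have xy: "x \<in> FN N" "y \<in> FN N" using True by (auto simp: adm_def)
      have "c xs = h y - h x" using cb True xs by (simp add: h_def)
      also have "\<dots> = H y - H x" using hH xy by simp
      also have "\<dots> = (\<Sum>i<N. c [0, gen i] * (es i y - es i x))"
        by (simp add: H_def right_diff_distrib sum_subtractf)
      finally show ?thesis using True by (simp add: homcoch_def xs)
    qed
  qed
qed

section \<open>The action of phi on invariant cochains\<close>

definition T :: "(fw list => int) => fw list => int" where
  "T c xs = (if adm xs then c (map \<phi> xs) else 0)"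

lemma addmap_T: "addmap T"
  by (auto simp: addmap_def T_def fun_eq_iff)

lemma adm_\<phi>: "adm xs ==> adm (map \<phi> xs)"
  unfolding adm_def using \<phi>_FN by (auto simp: d_\<phi>)

lemma T_coch: "c \<in> coch l ==> T c \<in> coch l"
proof -
  assume c: "c \<in> coch l"
  have "T c = (\<lambda>xs. if adm xs \<and> length xs = l then c (map \<phi> xs) else 0)"
  proof
    fix xs
    show "T c xs = (if adm xs \<and> length xs = l then c (map \<phi> xs) else 0)"
      using cochD(2)[OF c, of "map \<phi> xs"] by (auto simp: T_def)
  qed
  then show ?thesis using coch_restrict[OF alt_map[OF cochD(1)[OF c], of \<phi>], of l] by simp
qed

lemma T_icoch: "c \<in> icoch l ==> T c \<in> icoch l"
proof -
  assume c: "c \<in> icoch l"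
  have "tinv (T c)" unfolding tinv_def
  proof (intro ballI allI)
    fix g xs assume g: "g \<in> FN N"
    have "map \<phi> (map ((+) g) xs) = map ((+) (\<phi> g)) (map \<phi> xs)" by (simp add: addmapD[OF \<phi>])
    moreover have "c (map ((+) (\<phi> g)) (map \<phi> xs)) = c (map \<phi> xs)"
      using c \<phi>_FN[OF g] unfolding icoch_def tinv_def by blast
    ultimately have "c (map \<phi> (map ((+) g) xs)) = c (map \<phi> xs)" by (simp only:)
    then show "T c (map ((+) g) xs) = T c xs" using adm_translate[OF g, of xs] unfolding T_def by simp
  qed
  then show ?thesis using c T_coch by (simp add: icoch_def)
qed

lemma T_pow: "c \<in> coch l ==> (T ^^ k) c xs = (if adm xs then c (map (\<phi> ^^ k) xs) else 0)"
proof (induction k arbitrary: xs)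
  case 0
  then show ?case using cochD(2)[OF 0, of xs] by (auto simp: map_idI)
next
  case (Suc k)
  have eq: "map (\<phi> ^^ k) (map \<phi> xs) = map (\<phi> ^^ Suc k) xs" by (simp add: funpow_swap1)
  have "(T ^^ Suc k) c xs = (if adm xs then (T ^^ k) c (map \<phi> xs) else 0)"
    unfolding funpow.simps o_apply T_def[of "(T ^^ k) c"] ..
  then show ?case using adm_\<phi>[of xs] unfolding Suc.IH[OF Suc.prems] eq by (auto simp del: funpow.simps)
qed

lemma T_period: "c \<in> coch l ==> (T ^^ p) c = c"
proof
  fix xs assume c: "c \<in> coch l"
  have "map (\<phi> ^^ p) xs = xs" by (simp add: map_idI \<phi>_period)
  then show "(T ^^ p) c xs = c xs" using T_pow[OF c, of p xs] cochD(2)[OF c, of xs] by auto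
qed

lemma T_cob: "T (cob c) = cob (T c)"
proof
  fix xs
  show "T (cob c) xs = cob (T c) xs"
  proof (cases "adm xs")
    case True
    have "dlt (T c) xs = dlt (\<lambda>ys. c (map \<phi> ys)) xs"
      using adm_mono[OF True] by (intro dlt_cong) (simp add: T_def)
    then show ?thesis using True adm_\<phi>[OF True] by (simp add: T_def cob_def dlt_map)
  qed (simp add: T_def cob_def)
qed

lemma tsub_icoch: "tsub T (icoch l)"
proof -
  have "(\<lambda>xs. a xs + b xs) \<in> icoch l" if "a \<in> icoch l" "b \<in> icoch l" for a b
    using that coch_add by (simp add: icoch_def tinv_def)
  moreover have "(\<lambda>xs. - a xs) \<in> icoch l" if "a \<in> icoch l" for a
    using that coch_diff[OF coch_zero, of a l] by (simp add: icoch_def tinv_def)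
  moreover have "(\<lambda>_. 0) \<in> icoch l" using coch_zero by (simp add: icoch_def tinv_def)
  ultimately show ?thesis using T_icoch by (simp add: tsub_def plus_fun_def zero_fun_def fun_Compl_def)
qed

lemma finite_ball: "finite {x \<in> FN N. flen x \<le> k}"
proof (rule finite_imageD[of word_of])
  have "word_of ` {x \<in> FN N. flen x \<le> k} \<subseteq> {w. set w \<subseteq> {..<N} \<times> UNIV \<and> length w \<le> k}"
    by (auto simp: FN_def flen_def)
  then show "finite (word_of ` {x \<in> FN N. flen x \<le> k})"
    by (rule finite_subset) (intro finite_lists_length_le finite_cartesian_product, simp_all)
  show "inj_on word_of {x \<in> FN N. flen x \<le> k}" by (simp add: inj_on_def word_of_inject)
qed

lemma inj_\<phi>: "inj \<phi>"
proof (rule injI)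
  fix x y assume "\<phi> x = \<phi> y"
  then have "(\<phi> ^^ (p - 1)) (\<phi> x) = (\<phi> ^^ (p - 1)) (\<phi> y)" by simp
  then have "(\<phi> ^^ Suc (p - 1)) x = (\<phi> ^^ Suc (p - 1)) y" by (simp add: funpow_swap1)
  then show "x = y" using p_gt_0 \<phi>_period by simp
qed

text \<open>Every translation class of simplices has a representative with marked point 0, put into
  a fixed order by \<open>ls\<close>. These representatives index the lattice, and
  \<open>\<phi>\<close> permutes them up to the sign of a reordering.\<close>

lemma sfree_icoch:
  assumes odd: "odd p" and l: "l \<ge> 1"
  shows "pmod.sfree (pact T) p (normker T p (icoch l))"
proof -
  obtain \<gamma> :: "fw set => fw" where \<gamma>: "\<And>\<sigma>. finite \<sigma> ==> \<sigma> \<noteq> {} ==> \<gamma> \<sigma> \<in> \<sigma>"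
    "\<And>\<sigma> g. finite \<sigma> ==> \<sigma> \<noteq> {} ==> \<gamma> ((+) g ` \<sigma>) = g + \<gamma> \<sigma>" using ex_equivariant_point by metis
  \<comment> \<open>Translation moving the marked point to 0. The choice \<open>\<gamma>\<close>
    need not commute with \<open>\<phi>\<close>, so images under \<open>\<phi>\<close> are
    normalised again.\<close>
  define nf where "nf xs = map ((+) (- \<gamma> (set xs))) xs" for xs
  define S where "S = {set xs | xs. adm xs \<and> distinct xs \<and> length xs = l \<and> \<gamma> (set xs) = 0}"
  define ls where "ls \<sigma> = (SOME xs. distinct xs \<and> set xs = \<sigma>)" for \<sigma> :: "fw set"
  define Y where "Y = ls ` S"
  define \<tau> where "\<tau> y = ls (set (nf (map \<phi> y)))" for y
  \<comment> \<open>The sign between the order inherited from \<open>y\<close> and the order chosen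
    for the representative of its image.\<close>
  define \<epsilon> where "\<epsilon> y = sg (nf (map \<phi> y)) * sg (\<tau> y)" for y
  define \<delta> where "\<delta> y xs = (if adm xs \<and> length xs = l then (if set (nf xs) = set y then sg (nf xs) * sg y else 0) else 0)" for y xs
  have ls: "distinct (ls \<sigma>) \<and> set (ls \<sigma>) = \<sigma>" if "finite \<sigma>" for \<sigma>
    unfolding ls_def by (rule someI_ex) (use finite_distinct_list[OF that] in blast)
  have Y: "adm y" "distinct y" "length y = l" "\<gamma> (set y) = 0" "ls (set y) = y" "nf y = y" if "y \<in> Y" for y
  proof -
    from that obtain xs where xs: "adm xs" "distinct xs" "length xs = l" "\<gamma> (set xs) = 0" "y = ls (set xs)"
      by (auto simp: Y_def S_def)
    have y: "distinct y" "set y = set xs" using ls[of "set xs"] xs(5) by auto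
    show "adm y" using adm_cong[OF y(2)] xs(1) by simp
    show "distinct y" by fact
    show "length y = l" using y xs by (metis distinct_card)
    show "\<gamma> (set y) = 0" using y xs by simp
    then show "nf y = y" by (simp add: nf_def map_idI)
    show "ls (set y) = y" using y xs by simp
  qed
  have nf: "adm (nf xs)" "distinct (nf xs) = distinct xs" "length (nf xs) = length xs" "\<gamma> (set (nf xs)) = 0"
    if "adm xs" "length xs = l" for xs
  proof -
    have ne: "set xs \<noteq> {}" using that l by auto
    have g: "- \<gamma> (set xs) \<in> FN N" using \<gamma>(1)[of "set xs"] ne that by (auto simp: adm_def)
    show "adm (nf xs)" unfolding nf_def using adm_translate[OF g] that by simp
    show "distinct (nf xs) = distinct xs" "length (nf xs) = length xs"
      by (simp_all add: nf_def distinct_map inj_on_def)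
    have "\<gamma> ((+) (- \<gamma> (set xs)) ` set xs) = - \<gamma> (set xs) + \<gamma> (set xs)" by (rule \<gamma>(2)) (use ne in auto)
    then show "\<gamma> (set (nf xs)) = 0" by (simp add: nf_def)
  qed
  have lsY: "ls (set (nf xs)) \<in> Y" if "adm xs" "length xs = l" "distinct xs" for xs
    unfolding Y_def S_def using nf[OF that(1,2)] that by blast
  have c_nf: "c (nf xs) = c xs" if "c \<in> icoch l" "adm xs" "length xs = l" for c xs
  proof -
    have ne: "set xs \<noteq> {}" using that l by auto
    have g: "- \<gamma> (set xs) \<in> FN N" using \<gamma>(1)[of "set xs"] ne that by (auto simp: adm_def)
    then show ?thesis using that(1) by (simp add: icoch_def tinv_def nf_def)
  qed
  have mset: "mset xs = mset (ls (set xs))" if "distinct xs" for xs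
    using that ls[of "set xs"] by (metis List.finite_set set_eq_iff_mset_eq_distinct)
  have cmp: "c xs = sg (nf xs) * sg (ls (set (nf xs))) * c (ls (set (nf xs)))"
    if c: "c \<in> icoch l" and xs: "adm xs" "length xs = l" "distinct xs" for c xs
  proof -
    let ?y = "ls (set (nf xs))"
    have alt: "alt c" using c by (simp add: icoch_def coch_def)
    have dis: "distinct (nf xs)" using nf[OF xs(1,2)] xs by simp
    have "c (nf xs) * sg ?y = c ?y * sg (nf xs)" by (rule alt_compare_sg[OF alt mset[OF dis]])
    moreover have "sg ?y = 1 \<or> sg ?y = -1" using ls[of "set (nf xs)"] by (intro sg_distinct) simp
    ultimately have "c (nf xs) = sg (nf xs) * sg ?y * c ?y" by (elim disjE) (simp_all add: mult.commute)
    then show ?thesis using c_nf[OF c xs(1,2)] by simp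
  qed
  interpret signed_perm T p "icoch l" Y \<tau> \<epsilon> \<delta>
  proof
    show "addmap T" by (rule addmap_T)
    show "prime p" by (rule p)
    show "odd p" by (rule odd)
    show "tsub T (icoch l)" by (rule tsub_icoch)
    show "(T ^^ p) c = c" if "c \<in> icoch l" for c using that T_period by (auto simp: icoch_def)
    \<comment> \<open>A normalised simplex has 0 as a vertex, and \<open>d\<close> dominates word
      length, so all its vertices lie in a finite ball.\<close>
    have "S \<subseteq> Pow {x \<in> FN N. flen x \<le> rad}"
    proof (clarsimp simp: S_def)
      fix xs x assume xs: "adm xs" "\<gamma> (set xs) = 0" "l = length xs" and x: "x \<in> set xs"
      have "0 \<in> set xs" using \<gamma>(1)[of "set xs"] xs x by (metis List.finite_set empty_iff)
      then have "d 0 x \<le> rad" using xs x by (auto simp: adm_def)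
      then show "x \<in> FN N \<and> flen x \<le> rad" using flen_le_d[of 0 x] xs x by (auto simp: adm_def)
    qed
    then have "finite S" using finite_ball finite_subset by blast
    then show "finite Y" by (simp add: Y_def)
    show "c = 0" if c: "c \<in> icoch l" and z: "\<And>y. y \<in> Y ==> c y = 0" for c
    proof
      fix xs
      have coch: "c \<in> coch l" using c by (simp add: icoch_def)
      show "c xs = 0 xs"
      proof (cases "adm xs \<and> length xs = l \<and> distinct xs")
        case True
        then show ?thesis using cmp[OF c, of xs] z[OF lsY, of xs] by simp
      next
        case False
        then show ?thesis using cochD(2)[OF coch, of xs] alt_not_distinct[OF cochD(1)[OF coch], of xs] by auto
      qed
    qed
    show "\<delta> y \<in> icoch l" if y: "y \<in> Y" for y
    proof -
      have "alt (\<lambda>xs. if set (nf xs) = set y then sg (nf xs) * sg y else 0)" unfolding alt_def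
      proof (intro allI)
        fix u w :: "fw list" and a b
        have set: "set (u @ a # b # w) = set (u @ b # a # w)" by auto
        then have set': "set (nf (u @ a # b # w)) = set (nf (u @ b # a # w))" unfolding nf_def set_map by (simp only:)
        have "sg (nf (u @ a # b # w)) = - sg (nf (u @ b # a # w))"
          unfolding nf_def set using altD[OF alt_map[OF alt_sg], of "(+) (- \<gamma> (set (u @ b # a # w)))" u a b w] by simp
        then show "(if set (nf (u @ a # b # w)) = set y then sg (nf (u @ a # b # w)) * sg y else 0) =
          - (if set (nf (u @ b # a # w)) = set y then sg (nf (u @ b # a # w)) * sg y else 0)"
          unfolding set' by simp
      qed
      then have "\<delta> y \<in> coch l" unfolding \<delta>_def[abs_def] by (rule coch_restrict)
      moreover have "\<delta> y (map ((+) g) xs) = \<delta> y xs" if g: "g \<in> FN N" for g xs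
      proof (cases "xs = []")
        case False
        have "\<gamma> ((+) g ` set xs) = g + \<gamma> (set xs)" using False by (intro \<gamma>(2)) auto
        then have "nf (map ((+) g) xs) = nf xs"
          unfolding nf_def by (simp add: minus_add add.assoc del: add_uminus_conv_diff)
        then show ?thesis unfolding \<delta>_def using adm_translate[OF g, of xs] by simp
      qed simp
      ultimately show ?thesis by (simp add: icoch_def tinv_def)
    qed
    show "\<delta> y z = (if z = y then 1 else 0)" if y: "y \<in> Y" and z: "z \<in> Y" for y z
    proof -
      have "sg y * sg y = 1" using sg_distinct[OF Y(2)[OF y]] by auto
      moreover have "set z = set y \<longleftrightarrow> z = y" using Y(5)[OF y] Y(5)[OF z] by metis
      ultimately show ?thesis unfolding \<delta>_def using Y(1,3,6)[OF z] by auto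
    qed
    fix y assume y: "y \<in> Y"
    have \<phi>y: "adm (map \<phi> y)" "length (map \<phi> y) = l" "distinct (map \<phi> y)"
      using adm_\<phi> Y[OF y] inj_\<phi> by (auto simp: distinct_map inj_on_def inj_def)
    show "\<tau> y \<in> Y" unfolding \<tau>_def by (rule lsY[OF \<phi>y])
    have "distinct (nf (map \<phi> y))" using nf(2)[OF \<phi>y(1,2)] \<phi>y(3) by simp
    then show "\<epsilon> y = 1 \<or> \<epsilon> y = -1"
      unfolding \<epsilon>_def using sg_distinct[of "nf (map \<phi> y)"] sg_distinct[OF Y(2)[OF \<open>\<tau> y \<in> Y\<close>]] by auto
    show "T c y = \<epsilon> y * c (\<tau> y)" if c: "c \<in> icoch l" for c
      using cmp[OF c \<phi>y] Y(1)[OF y] by (simp add: T_def \<epsilon>_def \<tau>_def)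
  qed
  show ?thesis by (rule sfree_normker)
qed

definition zcoch :: "nat => (fw list => int) set" where
  "zcoch l = {c \<in> icoch l. cob c = 0}"

lemma cob_plus: "cob (a + b) = cob a + cob b"
  using cob_add[of a b] by (simp add: plus_fun_def fun_eq_iff)

lemma cob_icoch: "c \<in> icoch l ==> cob c \<in> zcoch (Suc l)"
proof -
  assume c: "c \<in> icoch l"
  have "tinv (cob c)" unfolding tinv_def
  proof (intro ballI allI)
    fix g xs assume g: "g \<in> FN N"
    have "(\<lambda>ys. c (map ((+) g) ys)) = c" using c g by (auto simp: icoch_def tinv_def)
    then show "cob c (map ((+) g) xs) = cob c xs" unfolding cob_translate[OF g] by simp
  qed
  then show ?thesis using c cob_coch[of c l] cob_cob by (auto simp: zcoch_def icoch_def fun_eq_iff)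
qed

lemma tsub_zcoch: "tsub T (zcoch l)"
proof -
  have cm: "addmap cob" by (simp add: addmap_def cob_plus)
  have "cob (T c) = 0" if "cob c = 0" for c
    using that T_cob[of c] addmap_zero[OF addmap_T] by simp
  then show ?thesis using tsubD[OF tsub_icoch[of l]] addmapD[OF cm] addmap_zero[OF cm] addmap_uminus[OF cm]
    unfolding tsub_def zcoch_def by auto
qed

lemma icoch_large: "\<exists>K. \<forall>l\<ge>K. icoch l = {0}"
proof (intro exI allI impI)
  let ?B = "{x \<in> FN N. flen x \<le> rad}"
  fix l assume l: "l \<ge> Suc (card ?B)"
  have "c xs = 0" if c: "c \<in> icoch l" for c xs
  proof (rule ccontr)
    assume nz: "c xs \<noteq> 0"
    have coch: "c \<in> coch l" using c by (simp add: icoch_def)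
    have xs: "adm xs" "length xs = l" using cochD(2)[OF coch nz] by auto
    have dist: "distinct xs" using alt_not_distinct[OF cochD(1)[OF coch]] nz by blast
    obtain x where x: "x \<in> set xs" using xs l by (cases xs) auto
    have "(+) (- x) ` set xs \<subseteq> ?B"
    proof
      fix z assume "z \<in> (+) (- x) ` set xs"
      then obtain y where y: "y \<in> set xs" "z = - x + y" by blast
      then show "z \<in> ?B" using xs x flen_le_d[of x y] FN_plus[of "- x" N y] unfolding adm_def by fastforce
    qed
    then have "card ((+) (- x) ` set xs) \<le> card ?B" by (intro card_mono finite_ball)
    moreover have "card ((+) (- x) ` set xs) = card (set xs)" by (intro card_image) (simp add: inj_on_def)
    ultimately show False using dist xs l by (simp add: distinct_card)
  qed
  then have "c = 0" if "c \<in> icoch l" for c using that by (auto simp: fun_eq_iff)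
  then show "icoch l = {0}" using tsubD(1)[OF tsub_icoch] by blast
qed

text \<open>Induction from high degrees, where there are no nondegenerate simplices, down to degree
  \<open>l\<close>: cocycles are the kernel of \<open>cob\<close> on invariant cochains, and
  \<open>icoch_exact\<close> describes its image.\<close>

lemma sfree_zcoch:
  assumes odd: "odd p" and l: "l \<ge> 2"
  shows "pmod.sfree (pact T) p (normker T p (zcoch l))"
proof -
  interpret pmod "pact T" p by (rule pmod_pact[OF addmap_T p])
  obtain K where K: "\<And>l. l \<ge> K ==> icoch l = {0}" using icoch_large by blast
  have "sfree (normker T p (zcoch l))" if "l \<ge> 2" for l
    using that
  proof (induction "K - l" arbitrary: l)
    case 0
    then have "zcoch l \<subseteq> {0}" using K[of l] by (auto simp: zcoch_def)
    then have "normker T p (zcoch l) = {0}"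
      using tsubD(1)[OF tsub_zcoch] by (auto simp: normker_def)
    then show ?case by (simp add: sfree_trivial)
  next
    case (Suc k)
    have IH: "sfree (normker T p (zcoch (Suc l)))" using Suc.hyps(1)[of "Suc l"] Suc.hyps(2) Suc.prems by simp
    have cob_pact: "cob (pact T q c) = pact T q (cob c)" if "c \<in> icoch l" for q c
      by (rule hom_pact[OF tsub_icoch cob_plus T_cob[symmetric] that])
    have "sfree {x \<in> normker T p (icoch l). cob x = 0}"
    proof (rule sfree_exact_step[OF pmod_axioms pmod_axioms _ IH])
      show "sfree (normker T p (icoch l))" using sfree_icoch[OF odd] Suc.prems by simp
      show "cob x \<in> normker T p (zcoch (Suc l))" if x: "x \<in> normker T p (icoch l)" for x
      proof -
        have xi: "x \<in> icoch l" and x0: "pact T (Phi p) x = 0" using x by (auto simp: normker_def)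
        have "pact T (Phi p) (cob x) = cob 0" using cob_pact[OF xi, of "Phi p"] x0 by simp
        moreover have "cob 0 = 0" using cob_plus[of 0 0] by simp
        ultimately show ?thesis using cob_icoch[OF xi] by (simp add: normker_def)
      qed
      show "cob (x + y) = cob x + cob y" for x y by (rule cob_plus)
      show "cob (pact T a x) = pact T a (cob x)" if "x \<in> normker T p (icoch l)" for a x
        using that cob_pact by (simp add: normker_def)
      fix y assume y: "y \<in> normker T p (zcoch (Suc l))"
      then have "y \<in> icoch (Suc l)" "cob y = 0" by (auto simp: normker_def zcoch_def)
      then obtain b where b: "b \<in> icoch l" "cob b = y"
        using icoch_exact[of y l] Suc.prems by (auto simp: icoch_def)
      \<comment> \<open>The primitive \<open>b\<close> need not lie in the norm kernel, but
        \<open>pact T pi1 b\<close> does, because \<open>pi1 * Phi p = 1 - X1 ^ p\<close> acts as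
        zero. Hence surjectivity holds only up to the factor \<open>pi1\<close>.\<close>
      have "pact T (Phi p) (pact T pi1 b) = pact T (pi1 * Phi p) b" by (simp only: s_mult[symmetric] mult.commute)
      also have "\<dots> = b - (T ^^ p) b"
        unfolding pi1_mult_Phi by (simp only: s_diff_left s_one pact_X1_pow[OF addmap_T])
      also have "\<dots> = 0" using T_period b(1) by (auto simp: icoch_def)
      finally have "pact T pi1 b \<in> normker T p (icoch l)" using tsub_pact[OF tsub_icoch b(1)] by (simp add: normker_def)
      then show "\<exists>x\<in>normker T p (icoch l). cob x = pact T pi1 y" using cob_pact[OF b(1)] b(2) by blast
    qed
    moreover have "{x \<in> normker T p (icoch l). cob x = 0} = normker T p (zcoch l)"
      by (auto simp: normker_def zcoch_def)
    ultimately show ?case by simp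
  qed
  then show ?thesis using l by blast
qed

end

section \<open>Integer vectors and the action of a matrix\<close>

definition tact :: "nat => (nat => nat => int) => (nat => int) => nat => int" where
  "tact n M a = (\<lambda>i. if i < n then \<Sum>j<n. M i j * a j else 0)"

definition lat :: "nat => (nat => int) set" where
  "lat n = {a. \<forall>i\<ge>n. a i = 0}"

lemma addmap_tact: "addmap (tact n M)"
  by (auto simp: addmap_def tact_def fun_eq_iff distrib_left sum.distrib)

lemma tsub_lat: "tsub (tact n M) (lat n)"
  by (auto simp: tsub_def lat_def tact_def)

context free_aut
begin

text \<open>Cocycles of length 2 are the homomorphisms of \<open>FN N\<close> to the integers,
  recorded by their values on generators. Pullback along \<open>\<phi>\<close> acts on them by the
  transpose of the matrix of \<open>\<phi>\<close> on the abelianization.\<close>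

theorem sfree_dual:
  assumes odd: "odd p"
  defines "t' \<equiv> tact N (\<lambda>j i. es i (\<phi> (gen j)))"
  shows "pmod.sfree (pact t') p (normker t' p (lat N))"
proof -
  have t': "addmap t'" unfolding t'_def by (rule addmap_tact)
  interpret m: pmod "pact T" p by (rule pmod_pact[OF addmap_T p])
  interpret m': pmod "pact t'" p by (rule pmod_pact[OF t' p])
  define h where "h c i = (if i < N then c [0, gen i] else 0)" for c :: "fw list => int" and i
  have z: "c = homcoch (h c)" if "c \<in> zcoch 2" for c
  proof -
    have "c = homcoch (\<lambda>i. c [0, gen i])" using that by (intro cocycle_homcoch) (auto simp: zcoch_def)
    also have "\<dots> = homcoch (h c)" by (auto simp: homcoch_def h_def fun_eq_iff)
    finally show ?thesis .
  qed
  have hom: "homcoch a [0, x] = (\<Sum>i<N. a i * es i x)" if "adm [0, x]" for a x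
    using that by (simp add: homcoch_def addmap_zero[OF addmap_es])
  have adm0: "adm [0, gen j]" if "j < N" for j using adm_edge[of 0 "(j, True)"] that by simp
  have h_hom: "h (homcoch a) = a" if a: "a \<in> lat N" for a
  proof
    fix j
    have "(\<Sum>i<N. a i * es i (gen j)) = (\<Sum>i<N. if i = j then a i else 0)" by (intro sum.cong) (auto simp: es_gen)
    then show "h (homcoch a) j = a j" using a hom[OF adm0[of j], of a] by (simp add: h_def lat_def)
  qed
  have h_add: "h (c + c') = h c + h c'" for c c' by (auto simp: h_def fun_eq_iff)
  have h_T: "h (T c) = t' (h c)" if c: "c \<in> zcoch 2" for c
  proof
    fix j
    show "h (T c) j = t' (h c) j"
    proof (cases "j < N")
      case True
      have "h (T c) j = c [0, \<phi> (gen j)]" using True adm0[OF True] addmap_zero[OF \<phi>] by (simp add: h_def T_def)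
      also have "\<dots> = (\<Sum>i<N. h c i * es i (\<phi> (gen j)))"
        using hom[of "\<phi> (gen j)" "h c"] adm_\<phi>[OF adm0[OF True]] addmap_zero[OF \<phi>] by (subst z[OF c]) simp
      finally show ?thesis using True by (simp add: t'_def tact_def mult.commute)
    qed (simp add: h_def t'_def tact_def)
  qed
  have h_pact: "h (pact T q c) = pact t' q (h c)" if "c \<in> zcoch 2" for q c
    by (rule hom_pact[OF tsub_zcoch h_add h_T that])
  have hom0: "homcoch 0 = 0" by (auto simp: homcoch_def fun_eq_iff)
  have inj: "c = 0" if "c \<in> zcoch 2" "h c = 0" for c using z[OF that(1)] that(2) hom0 by simp
  have "m'.sfree (h ` normker T p (zcoch 2))"
    by (rule sfree_image[OF m.pmod_axioms m'.pmod_axioms sfree_zcoch[OF odd]])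
      (use h_add h_pact inj in \<open>auto simp: normker_def\<close>)
  moreover have "h ` normker T p (zcoch 2) = normker t' p (lat N)"
  proof (intro equalityI subsetI)
    fix a assume "a \<in> h ` normker T p (zcoch 2)"
    then obtain c where c: "c \<in> zcoch 2" "pact T (Phi p) c = 0" "a = h c" by (auto simp: normker_def)
    have "h 0 = 0" by (auto simp: h_def fun_eq_iff)
    then have "pact t' (Phi p) a = 0" using h_pact[OF c(1), of "Phi p"] c by simp
    then show "a \<in> normker t' p (lat N)" using c(3) by (simp add: normker_def lat_def h_def)
  next
    fix a assume a: "a \<in> normker t' p (lat N)"
    then have aN: "a \<in> lat N" by (simp add: normker_def)
    have hz: "homcoch a \<in> zcoch 2" using homcoch_cocycle by (auto simp: zcoch_def fun_eq_iff)
    have "h (pact T (Phi p) (homcoch a)) = 0" using h_pact[OF hz] h_hom[OF aN] a by (simp add: normker_def)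
    then have "pact T (Phi p) (homcoch a) = 0" by (intro inj tsub_pact[OF tsub_zcoch hz])
    then have "homcoch a \<in> normker T p (zcoch 2)" using hz by (simp add: normker_def)
    then show "a \<in> h ` normker T p (zcoch 2)" using h_hom[OF aN] by (metis imageI)
  qed
  ultimately show ?thesis by simp
qed

end

subsection \<open>Elementary moves on integral bases\<close>

text \<open>Elementary operations are kept as explicit chains because they are used twice: to change
  bases of lattices and, as Nielsen moves, to construct automorphisms of free groups.\<close>

inductive zmove :: "nat set => (nat => 'v::ab_group_add) => (nat => 'v) => bool" for I where
  zmove_refl: "zmove I e e"
| zmove_add: "zmove I e e' ==> i \<in> I ==> j \<in> I ==> i \<noteq> j ==> zmove I e (e'(i := e' i + e' j))"
| zmove_sub: "zmove I e e' ==> i \<in> I ==> j \<in> I ==> i \<noteq> j ==> zmove I e (e'(i := e' i - e' j))"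

lemma zmove_trans: "zmove I e' e'' ==> zmove I e e' ==> zmove I e e''"
  by (induction rule: zmove.induct) (auto intro: zmove.intros)

lemma zmove_mono: "zmove J e e' ==> J \<subseteq> I ==> zmove I e e'"
  by (induction rule: zmove.induct) (auto intro: zmove.intros)

lemma zmove_outside: "zmove I e e' ==> k \<notin> I ==> e' k = e k"
  by (induction rule: zmove.induct) auto

lemma zmove_invariant:
  assumes "zmove I e e'" "\<And>i. i \<in> I ==> P (e i)"
    and "\<And>x y. P x ==> P y ==> P (x + y)" "\<And>x y. P x ==> P y ==> P (x - y)"
  shows "i \<in> I ==> P (e' i)"
  using assms by (induction arbitrary: i rule: zmove.induct) auto

text \<open>The Euclidean algorithm: of two nonzero values the larger in absolute value is reduced
  by the smaller, so the sum of absolute values decreases.\<close>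

lemma zmove_eliminate:
  fixes f :: "'v::ab_group_add => int"
  assumes "finite I" "I \<noteq> {}" "addmap f"
  shows "\<exists>e' i0. zmove I e e' \<and> i0 \<in> I \<and> (\<forall>i\<in>I - {i0}. f (e' i) = 0)"
proof (induction "nat (\<Sum>i\<in>I. \<bar>f (e i)\<bar>)" arbitrary: e rule: less_induct)
  case less
  show ?case
  proof (cases "\<exists>i\<in>I. \<exists>j\<in>I. i \<noteq> j \<and> f (e i) \<noteq> 0 \<and> f (e j) \<noteq> 0")
    case False
    then have "\<exists>i0\<in>I. \<forall>i\<in>I - {i0}. f (e i) = 0" using assms(2) by blast
    then show ?thesis using zmove_refl by blast
  next
    case True
    then obtain i j where ij: "i \<in> I" "j \<in> I" "i \<noteq> j" "f (e i) \<noteq> 0" "f (e j) \<noteq> 0"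
      and le: "\<bar>f (e j)\<bar> \<le> \<bar>f (e i)\<bar>" by (metis linear)
    define v where "v = (if (f (e i) > 0) = (f (e j) > 0) then e i - e j else e i + e j)"
    have mv: "zmove I e (e(i := v))" unfolding v_def using ij by (auto intro: zmove.intros)
    have "\<bar>f v\<bar> < \<bar>f (e i)\<bar>"
      using ij le unfolding v_def by (auto simp: addmapD[OF assms(3)] addmap_diff[OF assms(3)])
    moreover have "(\<Sum>k\<in>I. \<bar>f ((e(i := v)) k)\<bar>) = \<bar>f v\<bar> + (\<Sum>k\<in>I - {i}. \<bar>f (e k)\<bar>)"
      using assms(1) ij by (simp add: sum.remove)
    moreover have "(\<Sum>k\<in>I. \<bar>f (e k)\<bar>) = \<bar>f (e i)\<bar> + (\<Sum>k\<in>I - {i}. \<bar>f (e k)\<bar>)"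
      using assms(1) ij by (simp add: sum.remove)
    moreover have "(\<Sum>k\<in>I - {i}. \<bar>f (e k)\<bar>) \<ge> 0" by (simp add: sum_nonneg)
    ultimately have "nat (\<Sum>k\<in>I. \<bar>f ((e(i := v)) k)\<bar>) < nat (\<Sum>k\<in>I. \<bar>f (e k)\<bar>)" by linarith
    from less[OF this] show ?thesis using zmove_trans[OF _ mv] by blast
  qed
qed

definition zcomb :: "nat set => (nat => int) => (nat => 'a => int) => 'a => int" where
  "zcomb I z e x = (\<Sum>i\<in>I. z i * e i x)"

definition zbasis :: "nat set => (nat => 'a => int) => ('a => int) set => bool" where
  "zbasis I e L \<longleftrightarrow> (\<forall>i\<in>I. e i \<in> L) \<and> (\<forall>x\<in>L. \<exists>z. x = zcomb I z e) \<and>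
    (\<forall>z. zcomb I z e = 0 \<longrightarrow> (\<forall>i\<in>I. z i = 0))"

lemma zcomb_add: "zcomb I (\<lambda>i. z i + w i) e = zcomb I z e + zcomb I w e"
  by (auto simp: zcomb_def fun_eq_iff distrib_right sum.distrib)

lemma zcomb_diff: "zcomb I (\<lambda>i. z i - w i) e = zcomb I z e - zcomb I w e"
  by (auto simp: zcomb_def fun_eq_iff left_diff_distrib sum_subtractf)

lemma zcomb_update:
  assumes "finite I" "i \<in> I" "j \<in> I" "i \<noteq> j" "\<And>x. v x = e i x + s * e j x"
  shows "zcomb I z (e(i := v)) = zcomb I (z(j := z j + s * z i)) e"
proof
  fix x
  have "zcomb I z (e(i := v)) x = z i * v x + (z j * e j x + (\<Sum>k\<in>I - {i} - {j}. z k * e k x))"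
    unfolding zcomb_def using assms by (simp add: sum.remove[of I i] sum.remove[of "I - {i}" j])
  also have "\<dots> = z i * e i x + ((z j + s * z i) * e j x + (\<Sum>k\<in>I - {i} - {j}. z k * e k x))"
    by (simp add: assms(5) algebra_simps)
  also have "\<dots> = zcomb I (z(j := z j + s * z i)) e x"
    unfolding zcomb_def using assms by (simp add: sum.remove[of I i] sum.remove[of "I - {i}" j])
  finally show "zcomb I z (e(i := v)) x = zcomb I (z(j := z j + s * z i)) e x" .
qed

lemma zbasis_update:
  assumes I: "finite I" "i \<in> I" "j \<in> I" "i \<noteq> j" and v: "\<And>x. v x = e i x + s * e j x"
    and B: "zbasis I e L" and vL: "v \<in> L"
  shows "zbasis I (e(i := v)) L"
proof -
  have upd: "zcomb I z (e(i := v)) = zcomb I (z(j := z j + s * z i)) e" for z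
    by (rule zcomb_update[OF I]) (rule v)
  show ?thesis unfolding zbasis_def
proof (intro conjI ballI allI impI)
  show "(e(i := v)) k \<in> L" if "k \<in> I" for k using that B vL by (auto simp: zbasis_def)
  fix x assume "x \<in> L"
  then obtain z where "x = zcomb I z e" using B by (auto simp: zbasis_def)
  moreover have "z = (z(j := z j - s * z i))(j := (z(j := z j - s * z i)) j + s * (z(j := z j - s * z i)) i)"
    using I by auto
  ultimately show "\<exists>z. x = zcomb I z (e(i := v))" using upd[where z = "z(j := z j - s * z i)"] by metis
next
  fix z k assume "zcomb I z (e(i := v)) = 0" and k: "k \<in> I"
  then have z: "(z(j := z j + s * z i)) k = 0" if "k \<in> I" for k
    using B that upd by (metis zbasis_def)
  from z[OF I(2)] z[OF I(3)] z[OF k] show "z k = 0" using I by (auto split: if_splits)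
qed
qed

lemma zbasis_zmove:
  assumes "zmove I e e'" "finite I" "zbasis I e L"
    and "\<And>x y. x \<in> L ==> y \<in> L ==> x + y \<in> L" "\<And>x y. x \<in> L ==> y \<in> L ==> x - y \<in> L"
  shows "zbasis I e' L"
  using assms
proof (induction rule: zmove.induct)
  case (zmove_add e e' i j)
  then have "zbasis I e' L" by simp
  moreover from this have "e' i \<in> L" "e' j \<in> L" using zmove_add.hyps by (auto simp: zbasis_def)
  then have "e' i + e' j \<in> L" by (rule zmove_add.prems(3))
  ultimately show ?case using zmove_add by (intro zbasis_update[where s = 1]) auto
next
  case (zmove_sub e e' i j)
  then have "zbasis I e' L" by simp
  moreover from this have "e' i \<in> L" "e' j \<in> L" using zmove_sub.hyps by (auto simp: zbasis_def)
  then have "e' i - e' j \<in> L" by (rule zmove_sub.prems(4))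
  ultimately show ?case using zmove_sub by (intro zbasis_update[where s = "-1"]) auto
qed simp

text \<open>Integral echelon form, one coordinate at a time. \<open>J\<close> indexes the vectors
  annihilated so far and the others have independent images; a new coordinate removes at most one
  index from \<open>J\<close>.\<close>

lemma zmove_kernel:
  fixes F :: "'v::ab_group_add => nat => int"
  assumes "finite I" "addmap F"
  shows "\<exists>e' J. zmove I e e' \<and> J \<subseteq> I \<and> (\<forall>j\<in>J. \<forall>k<m. F (e' j) k = 0) \<and>
    (\<forall>z. (\<forall>k<m. (\<Sum>i\<in>I - J. z i * F (e' i) k) = 0) \<longrightarrow> (\<forall>i\<in>I - J. z i = 0))"
proof (induction m)
  case 0
  show ?case by (intro exI[of _ e] exI[of _ I]) (auto intro: zmove_refl)
next
  case (Suc m)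
  then obtain e1 J where e1: "zmove I e e1" and J: "J \<subseteq> I" and ker: "\<And>j k. j \<in> J ==> k < m ==> F (e1 j) k = 0"
    and ind: "\<And>z. (\<And>k. k < m ==> (\<Sum>i\<in>I - J. z i * F (e1 i) k) = 0) ==> (\<forall>i\<in>I - J. z i = 0)" by metis
  have finJ: "finite J" using J assms(1) finite_subset by blast
  show ?case
  proof (cases "J = {}")
    case True
    then show ?thesis using e1 ind by (intro exI[of _ e1] exI[of _ "{}"]) auto
  next
    case False
    have add: "addmap (\<lambda>x. F x m)" unfolding addmap_def addmapD[OF assms(2)] by simp
    obtain e2 j0 where e2: "zmove J e1 e2" and j0: "j0 \<in> J" and e20: "\<forall>i\<in>J - {j0}. F (e2 i) m = 0"
      using zmove_eliminate[OF finJ False add, of e1] by blast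
    have ker2: "F (e2 j) k = 0" if "j \<in> J" "k < m" for j k
      using zmove_invariant[OF e2, of "\<lambda>x. F x k = 0" j] ker that
      by (simp add: addmapD[OF assms(2)] addmap_diff[OF assms(2)])
    have out: "e2 i = e1 i" if "i \<in> I - J" for i using zmove_outside[OF e2] that by blast
    have mv: "zmove I e e2" using zmove_trans[OF zmove_mono[OF e2 J] e1] .
    show ?thesis
    proof (cases "F (e2 j0) m = 0")
      case True
      have "\<forall>i\<in>I - J. z i = 0" if z: "\<forall>k<Suc m. (\<Sum>i\<in>I - J. z i * F (e2 i) k) = 0" for z
        using z out by (intro ind) simp
      moreover have "\<forall>j\<in>J. \<forall>k<Suc m. F (e2 j) k = 0" using ker2 e20 True by (auto simp: less_Suc_eq)
      ultimately show ?thesis using mv J by blast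
    next
      case False
      define J' where "J' = J - {j0}"
      have IJ': "I - J' = insert j0 (I - J)" "j0 \<notin> I - J" "finite (I - J)" using j0 J assms(1) by (auto simp: J'_def)
      have "\<forall>i\<in>I - J'. z i = 0" if z: "\<forall>k<Suc m. (\<Sum>i\<in>I - J'. z i * F (e2 i) k) = 0" for z
      proof -
        have split: "(\<Sum>i\<in>I - J'. z i * F (e2 i) k) = z j0 * F (e2 j0) k + (\<Sum>i\<in>I - J. z i * F (e1 i) k)" for k
          using IJ' out by simp
        have "\<forall>i\<in>I - J. z i = 0"
        proof (rule ind)
          fix k assume k: "k < m"
          then have "(\<Sum>i\<in>I - J'. z i * F (e2 i) k) = 0" using z by simp
          then show "(\<Sum>i\<in>I - J. z i * F (e1 i) k) = 0" using split[of k] ker2[OF j0 k] by simp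
        qed
        moreover from this have "z j0 = 0" using z split[of m] False by auto
        ultimately show ?thesis using IJ' by simp
      qed
      moreover have "\<forall>j\<in>J'. \<forall>k<Suc m. F (e2 j) k = 0" using ker2 e20 by (auto simp: J'_def less_Suc_eq)
      moreover have "J' \<subseteq> I" using J by (auto simp: J'_def)
      ultimately show ?thesis using mv by blast
    qed
  qed
qed

definition unitv :: "nat => nat => int" where
  "unitv i = (\<lambda>k. if k = i then 1 else 0)"

lemma zcomb_unitv: "zcomb {..<n} a unitv = (\<lambda>i. if i < n then a i else 0)"
proof
  fix k
  have "zcomb {..<n} a unitv k = (\<Sum>i<n. if i = k then a i else 0)"
    unfolding zcomb_def unitv_def by (intro sum.cong) auto
  then show "zcomb {..<n} a unitv k = (if k < n then a k else 0)" by simp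
qed

lemma lat_eq_zcomb: "a \<in> lat n ==> a = zcomb {..<n} a unitv"
  unfolding zcomb_unitv by (auto simp: lat_def fun_eq_iff)

lemma zbasis_unitv: "zbasis {..<n} unitv (lat n)"
  unfolding zbasis_def
proof (intro conjI ballI allI impI)
  show "unitv i \<in> lat n" if "i \<in> {..<n}" for i using that by (auto simp: lat_def unitv_def)
  show "\<exists>z. x = zcomb {..<n} z unitv" if "x \<in> lat n" for x using lat_eq_zcomb[OF that] by blast
  fix z i assume "zcomb {..<n} z unitv = 0" and i: "i \<in> {..<n}"
  then have "zcomb {..<n} z unitv i = 0" by simp
  then show "z i = 0" using i unfolding zcomb_unitv by simp
qed

lemma lat_closed: "x \<in> lat n ==> y \<in> lat n ==> x + y \<in> lat n" "x \<in> lat n ==> y \<in> lat n ==> x - y \<in> lat n"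
  by (auto simp: lat_def)

lemma zcomb_insert: "finite I ==> i \<notin> I ==> zcomb (insert i I) z f = zmul (z i) (f i) + zcomb I z f"
  by (auto simp: zcomb_def zmul_def fun_eq_iff)

lemma addmap_zcomb:
  fixes F :: "('a => int) => ('b => int)"
  assumes "addmap F" "finite I"
  shows "F (zcomb I z e) = zcomb I z (\<lambda>i. F (e i))"
  using assms(2)
proof (induction rule: finite_induct)
  case empty
  have "zcomb {} z e = 0" "zcomb {} z (\<lambda>i. F (e i)) = 0" by (auto simp: zcomb_def fun_eq_iff)
  then show ?case using addmap_zero[OF assms(1)] by (simp only:)
next
  case (insert i I)
  then show ?case
    by (simp only: zcomb_insert[OF insert(1,2)] addmapD[OF assms(1)] addmap_zmul[OF assms(1)])
qed

lemma lat_kernel_basis: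
  fixes F :: "(nat => int) => nat => int"
  assumes F: "addmap F" and Fn: "\<And>x. x \<in> lat n ==> F x \<in> lat m"
  shows "\<exists>e J. J \<subseteq> {..<n} \<and> zbasis {..<n} e (lat n) \<and>
    (\<forall>z. F (zcomb {..<n} z e) = 0 \<longleftrightarrow> (\<forall>i\<in>{..<n} - J. z i = 0))"
proof -
  obtain e J where e: "zmove {..<n} unitv e" and J: "J \<subseteq> {..<n}" and ker: "\<And>j k. j \<in> J ==> k < m ==> F (e j) k = 0"
    and ind: "\<And>z. (\<And>k. k < m ==> (\<Sum>i\<in>{..<n} - J. z i * F (e i) k) = 0) ==> (\<forall>i\<in>{..<n} - J. z i = 0)"
    using zmove_kernel[OF _ F, of "{..<n}" unitv m] by (metis finite_lessThan)
  have B: "zbasis {..<n} e (lat n)" using zbasis_zmove[OF e _ zbasis_unitv] lat_closed by blast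
  have Fz: "F (zcomb {..<n} z e) k = (\<Sum>i\<in>{..<n} - J. z i * F (e i) k)" if "k < m" for z k
  proof -
    have "F (zcomb {..<n} z e) k = (\<Sum>i<n. z i * F (e i) k)"
      unfolding addmap_zcomb[OF F finite_lessThan] by (simp add: zcomb_def)
    also have "\<dots> = (\<Sum>i\<in>{..<n} - J. z i * F (e i) k)"
      using J ker[OF _ that] by (intro sum.mono_neutral_right) auto
    finally show ?thesis .
  qed
  have "F (zcomb {..<n} z e) = 0 \<longleftrightarrow> (\<forall>i\<in>{..<n} - J. z i = 0)" for z
  proof
    assume "F (zcomb {..<n} z e) = 0"
    then show "\<forall>i\<in>{..<n} - J. z i = 0" using Fz by (intro ind) (metis zero_fun_apply)
  next
    assume z: "\<forall>i\<in>{..<n} - J. z i = 0"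
    have "zcomb {..<n} z e \<in> lat n" using B by (auto simp: zbasis_def zcomb_def lat_def)
    then have "F (zcomb {..<n} z e) \<in> lat m" by (rule Fn)
    then have "F (zcomb {..<n} z e) k = 0" for k using Fz[of k z] z by (cases "k < m") (auto simp: lat_def)
    then show "F (zcomb {..<n} z e) = 0" by (simp add: fun_eq_iff)
  qed
  then show ?thesis using J B by blast
qed

lemma zbasis_coord:
  assumes "zbasis I e L"
  obtains z where "\<And>x. x \<in> L ==> x = zcomb I (z x) e"
    "\<And>x y i. x \<in> L ==> y \<in> L ==> x + y \<in> L ==> i \<in> I ==> z (x + y) i = z x i + z y i"
    "\<And>x w i. x \<in> L ==> x = zcomb I w e ==> i \<in> I ==> z x i = w i"
proof -
  have "\<exists>z. x = zcomb I z e" if "x \<in> L" for x using assms that by (auto simp: zbasis_def)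
  then obtain z where z: "\<And>x. x \<in> L ==> x = zcomb I (z x) e" by metis
  have uniq: "z x i = w i" if "x \<in> L" "x = zcomb I w e" "i \<in> I" for x w i
  proof -
    have "zcomb I (\<lambda>i. z x i - w i) e = 0" unfolding zcomb_diff using z[OF that(1)] that(2) by simp
    then have "z x i - w i = 0" using assms that(3) unfolding zbasis_def by blast
    then show ?thesis by simp
  qed
  have "z (x + y) i = z x i + z y i" if "x \<in> L" "y \<in> L" "x + y \<in> L" "i \<in> I" for x y i
    using that z[OF that(1)] z[OF that(2)] by (intro uniq[of "x + y" "\<lambda>i. z x i + z y i" i]) (simp_all only: zcomb_add)
  then show ?thesis using that z uniq by blast
qed

subsection \<open>Duality\<close>

definition pair :: "nat => (nat => int) => (nat => int) => int" where
  "pair n a v = (\<Sum>i<n. a i * v i)"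

lemma pair_simps: "pair n (a + b) v = pair n a v + pair n b v" "pair n a (v + w) = pair n a v + pair n a w"
  "pair n (a - b) v = pair n a v - pair n b v" "pair n a (v - w) = pair n a v - pair n a w"
  "pair n a 0 = 0" "pair n 0 v = 0"
  by (simp_all add: pair_def algebra_simps sum.distrib sum_subtractf)

lemma pair_tact: "pair n (tact n (\<lambda>i j. M j i) a) v = pair n a (tact n M v)"
proof -
  have "pair n (tact n (\<lambda>i j. M j i) a) v = (\<Sum>i<n. \<Sum>j<n. M j i * a j * v i)"
    by (simp add: pair_def tact_def sum_distrib_right)
  also have "\<dots> = (\<Sum>j<n. \<Sum>i<n. M j i * a j * v i)" by (rule sum.swap)
  also have "\<dots> = pair n a (tact n M v)" by (simp add: pair_def tact_def sum_distrib_left ac_simps)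
  finally show ?thesis .
qed

lemma pair_tact_pow: "pair n ((tact n (\<lambda>i j. M j i) ^^ k) a) v = pair n a ((tact n M ^^ k) v)"
proof (induction k arbitrary: v)
  case (Suc k)
  have "pair n ((tact n (\<lambda>i j. M j i) ^^ Suc k) a) v = pair n ((tact n (\<lambda>i j. M j i) ^^ k) a) (tact n M v)"
    by (simp add: pair_tact)
  then show ?case using Suc by (simp add: funpow_swap1)
qed simp

lemma pair_pact: "pair n (pact (tact n (\<lambda>i j. M j i)) q a) v = pair n a (pact (tact n M) q v)"
proof -
  have "pair n (pact (tact n (\<lambda>i j. M j i)) q a) v =
      (\<Sum>k\<le>degree q. coeff q k * pair n ((tact n (\<lambda>i j. M j i) ^^ k) a) v)"
    unfolding pair_def pact_def sum_distrib_right sum_distrib_left by (subst sum.swap) (simp add: ac_simps)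
  also have "\<dots> = pair n a (pact (tact n M) q v)"
    unfolding pair_tact_pow unfolding pair_def pact_def sum_distrib_left by (subst sum.swap) (simp add: ac_simps)
  finally show ?thesis .
qed

lemma pair_unitv: "i < n ==> pair n (unitv i) v = v i"
proof -
  assume "i < n"
  have "pair n (unitv i) v = (\<Sum>k<n. if k = i then v k else 0)" unfolding pair_def unitv_def by (intro sum.cong) auto
  then show ?thesis using \<open>i < n\<close> by simp
qed

text \<open>The kernel of \<open>F\<close> is a direct summand of the lattice, so the functional
  extends to all of \<open>lat n\<close>, where it is given by a vector.\<close>

lemma ex_pairing:
  fixes F :: "(nat => int) => nat => int" and g :: "(nat => int) => int"
  assumes F: "addmap F" and Fn: "\<And>x. x \<in> lat n ==> F x \<in> lat m"
    and g: "\<And>x y. x \<in> lat n ==> F x = 0 ==> y \<in> lat n ==> F y = 0 ==> g (x + y) = g x + g y"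
  shows "\<exists>v\<in>lat n. \<forall>a\<in>lat n. F a = 0 \<longrightarrow> pair n a v = g a"
proof -
  obtain e J where J: "J \<subseteq> {..<n}" and B: "zbasis {..<n} e (lat n)"
    and ker: "\<And>z. F (zcomb {..<n} z e) = 0 \<longleftrightarrow> (\<forall>i\<in>{..<n} - J. z i = 0)"
    using lat_kernel_basis[OF F Fn] by metis
  obtain z where z: "\<And>x. x \<in> lat n ==> x = zcomb {..<n} (z x) e"
    "\<And>x y i. x \<in> lat n ==> y \<in> lat n ==> x + y \<in> lat n ==> i \<in> {..<n} ==> z (x + y) i = z x i + z y i"
    "\<And>x w i. x \<in> lat n ==> x = zcomb {..<n} w e ==> i \<in> {..<n} ==> z x i = w i"
    using zbasis_coord[OF B] by blast
  \<comment> \<open>The projection onto the kernel of \<open>F\<close> along the basis vectors with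
    index outside \<open>J\<close>.\<close>
  define pr where "pr x = zcomb {..<n} (\<lambda>i. if i \<in> J then z x i else 0) e" for x
  have comb_lat: "zcomb {..<n} w e \<in> lat n" for w using B by (auto simp: zbasis_def zcomb_def lat_def)
  have pr_lat: "pr x \<in> lat n" for x unfolding pr_def by (rule comb_lat)
  have pr_ker: "F (pr x) = 0" for x unfolding pr_def ker by auto
  have pr_add: "pr (x + y) = pr x + pr y" if "x \<in> lat n" "y \<in> lat n" for x y
    unfolding pr_def zcomb_add[symmetric] unfolding zcomb_def using z(2)[OF that lat_closed(1)[OF that]]
    by (intro ext sum.cong) auto
  have pr_id: "pr x = x" if x: "x \<in> lat n" "F x = 0" for x
  proof -
    have "\<forall>i\<in>{..<n} - J. z x i = 0" using ker[of "z x"] z(1)[OF x(1)] x(2) by simp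
    then have "zcomb {..<n} (\<lambda>i. if i \<in> J then z x i else 0) e = zcomb {..<n} (z x) e"
      unfolding zcomb_def by (intro ext sum.cong) auto
    then show ?thesis using z(1)[OF x(1)] by (simp add: pr_def)
  qed
  define G where "G x = g (pr x)" for x
  have G_add: "G (x + y) = G x + G y" if "x \<in> lat n" "y \<in> lat n" for x y
    unfolding G_def pr_add[OF that] by (intro g pr_lat pr_ker)
  have zero_lat: "0 \<in> lat n" by (simp add: lat_def)
  have G0: "G 0 = 0" using G_add[OF zero_lat zero_lat] by simp
  have G_zmul: "G (zmul k x) = k * G x" if "x \<in> lat n" for k x
  proof -
    have kl: "zmul k x \<in> lat n" for k using that by (auto simp: lat_def zmul_def)
    show ?thesis
    proof (induction k rule: int_induct[where k = 0])
      case base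
      then show ?case unfolding zmul_simps using G0 by (simp only: mult_zero_left)
    next
      case (step1 i)
      then show ?case unfolding zmul_simps G_add[OF kl that] by (simp add: algebra_simps)
    next
      case (step2 i)
      have "zmul (i - 1) x + x = zmul i x" by (simp add: zmul_def fun_eq_iff algebra_simps)
      then have "G (zmul i x) = G (zmul (i - 1) x) + G x" using G_add[OF kl that] by metis
      then show ?case using step2 by (simp add: algebra_simps)
    qed
  qed
  have G_comb: "G (zcomb I w unitv) = (\<Sum>i\<in>I. w i * G (unitv i))" if "finite I" "I \<subseteq> {..<n}" for I w
    using that
  proof (induction rule: finite_induct)
    case empty
    have "zcomb {} w unitv = 0" by (simp add: zcomb_def fun_eq_iff)
    then show ?case using G0 by (simp only: sum.empty)
  next
    case (insert i I)
    note eq = zcomb_insert[OF insert(1,2), of w unitv]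
    have u: "unitv i \<in> lat n" using insert by (auto simp: unitv_def lat_def)
    have "zmul (w i) (unitv i) \<in> lat n" using insert by (auto simp: unitv_def lat_def zmul_def)
    moreover have "zcomb I w unitv \<in> lat n"
    proof -
      have "zcomb I w unitv k = 0" if "k \<ge> n" for k
        unfolding zcomb_def using insert that by (intro sum.neutral) (auto simp: unitv_def)
      then show ?thesis by (simp add: lat_def)
    qed
    ultimately have "G (zcomb (insert i I) w unitv) = w i * G (unitv i) + G (zcomb I w unitv)"
      unfolding eq by (simp only: G_add G_zmul[OF u])
    then show ?case using insert by simp
  qed
  define v where "v i = (if i < n then G (unitv i) else 0)" for i
  have "pair n a v = g a" if a: "a \<in> lat n" "F a = 0" for a
  proof -
    have "G a = (\<Sum>i<n. a i * G (unitv i))" using G_comb[of "{..<n}" a] lat_eq_zcomb[OF a(1)] by simp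
    then have "pair n a v = G a" by (simp add: pair_def v_def)
    then show ?thesis using pr_id[OF a] by (simp add: G_def)
  qed
  moreover have "v \<in> lat n" by (simp add: v_def lat_def)
  ultimately show ?thesis by blast
qed

text \<open>The trace form on \<open>\<int>[\<zeta>]\<close>, up to normalization: it vanishes on multiples of the cyclotomic
  polynomial and pairs \<open>1\<close> with \<open>1 - x\<close>.\<close>

definition trf :: "nat => int poly => int" where
  "trf p q = (\<Sum>k\<le>degree q. coeff q k * ((if p dvd k then 1 else 0) - (if p dvd Suc k then 1 else 0)))"

lemma trf_bound: "degree q \<le> n ==>
  trf p q = (\<Sum>k\<le>n. coeff q k * ((if p dvd k then 1 else 0) - (if p dvd Suc k then 1 else 0)))"
  unfolding trf_def by (intro sum.mono_neutral_left) (auto simp: coeff_eq_0)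

lemma trf_add: "trf p (q + r) = trf p q + trf p r"
proof -
  let ?n = "max (degree q) (degree r)"
  show ?thesis
    using trf_bound[of "q + r" ?n p] trf_bound[of q ?n p] trf_bound[of r ?n p] degree_add_le_max[of q r]
    by (simp add: distrib_right sum.distrib)
qed

lemma trf_smult: "trf p (smult a q) = a * trf p q"
  using trf_bound[of "smult a q" "degree q" p] by (simp add: trf_def sum_distrib_left ac_simps)

lemma trf_sum: "trf p (sum f A) = (\<Sum>i\<in>A. trf p (f i))"
  by (induction A rule: infinite_finite_induct) (simp_all add: trf_add, simp_all add: trf_def)

lemma trf_X1_pow: "trf p (X1 ^ k) = (if p dvd k then 1 else 0) - (if p dvd Suc k then 1 else 0)"
proof -
  have "trf p (monom 1 k) = (\<Sum>i\<le>k. coeff (monom 1 k) i * ((if p dvd i then 1 else 0) - (if p dvd Suc i then 1 else 0)))"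
    by (rule trf_bound) (rule degree_monom_le)
  also have "\<dots> = (\<Sum>i\<le>k. if i = k then (if p dvd i then 1 else 0) - (if p dvd Suc i then 1 else 0) else 0)"
    by (intro sum.cong) auto
  finally show ?thesis by (simp add: X1_pow_eq_monom)
qed

lemma trf_X1_pow_Phi: "p > 0 ==> trf p (X1 ^ k * Phi p) = 0"
proof -
  assume p: "p > 0"
  have "trf p (X1 ^ k * Phi p) = (\<Sum>i<p. (if p dvd k + i then 1 else 0) - (if p dvd Suc (k + i) then 1 else 0))"
    unfolding Phi_def sum_distrib_left trf_sum by (simp add: trf_X1_pow flip: power_add)
  also have "\<dots> = (if p dvd k then 1 else 0) - (if p dvd k + p then 1 else 0)"
    using sum_lessThan_telescope'[of "\<lambda>i. (if p dvd k + i then 1 else (0 :: int))" p] by simp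
  also have "\<dots> = 0" by simp
  finally show ?thesis .
qed

lemma trf_cg:
  assumes p: "p > 0" and "cg p q r"
  shows "trf p q = trf p r"
proof -
  obtain c where c: "q = r + c * Phi p" using assms(2) unfolding cg_def
    by (metis add.commute diff_add_cancel dvd_def mult.commute)
  have "c = (\<Sum>i\<le>degree c. smult (coeff c i) (X1 ^ i))"
    using poly_as_sum_of_monoms[of c] by (simp add: X1_pow_eq_monom smult_monom)
  then have "c * Phi p = (\<Sum>i\<le>degree c. smult (coeff c i) (X1 ^ i * Phi p))"
    by (metis (no_types, lifting) mult_smult_left sum.cong sum_distrib_right)
  then have "trf p (c * Phi p) = 0" by (simp add: trf_sum trf_smult trf_X1_pow_Phi[OF p])
  then show ?thesis by (simp add: c trf_add)
qed

text \<open>A basis \<open>f\<close> of the dual norm kernel yields functionals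
  \<open>\<Psi>\<close> on the lattice with values in Z[lambda], to which
  \<open>sfree_by_functionals\<close> is applied. They are jointly injective on the norm kernel, and
  the trace form provides vectors on which they take the values of a dual basis; multiplying these
  by \<open>pi1\<close> moves them into the norm kernel.\<close>

theorem sfree_of_dual:
  fixes M :: "nat => nat => int" and n :: nat
  defines "t \<equiv> tact n M" and "t' \<equiv> tact n (\<lambda>i j. M j i)"
  assumes p: "prime p" and per: "\<And>v. v \<in> lat n ==> (t ^^ p) v = v"
    and dual: "pmod.sfree (pact t') p (normker t' p (lat n))"
  shows "pmod.sfree (pact t) p (normker t p (lat n))"
proof -
  have p0: "p > 0" using p prime_gt_0_nat by blast
  have at: "addmap t" "addmap t'" unfolding t_def t'_def by (rule addmap_tact)+
  have sub: "tsub t (lat n)" "tsub t' (lat n)" unfolding t_def t'_def by (rule tsub_lat)+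
  interpret m: pmod "pact t" p by (rule pmod_pact[OF at(1) p])
  interpret m': pmod "pact t'" p by (rule pmod_pact[OF at(2) p])
  obtain C f where W: "m'.slat (normker t' p (lat n))" and B: "m'.sbasis C f (normker t' p (lat n))"
    using dual by (auto simp: m'.sfree_def)
  note finC = m'.sbasisD(1)[OF B]
  have pp: "pair n ((t' ^^ k) a) v = pair n a ((t ^^ k) v)" for k a v unfolding t_def t'_def by (rule pair_tact_pow)
  have pq: "pair n (pact t' q a) v = pair n a (pact t q v)" for q a v unfolding t_def t'_def by (rule pair_pact)
  have fW: "f c \<in> lat n" "pact t' (Phi p) (f c) = 0" if "c \<in> C" for c
    using m'.sbasisD(2)[OF B that] by (auto simp: normker_def)
  \<comment> \<open>The exponent \<open>p - j\<close> stands for \<open>- j\<close>, so that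
    applying \<open>t\<close> to \<open>v\<close> multiplies the polynomial by \<open>X1\<close>
    modulo \<open>Phi p\<close>. The coefficients sum to zero because \<open>f c\<close> has norm
    zero, and division by \<open>pi1\<close> gives \<open>\<Psi>\<close>.\<close>
  define \<Theta> where "\<Theta> c v = (\<Sum>j<p. smult (pair n (f c) ((t ^^ (p - j)) v)) (X1 ^ j))" for c v
  have coeff_\<Theta>: "coeff (\<Theta> c v) j = (if j < p then pair n (f c) ((t ^^ (p - j)) v) else 0)" for c v j
    by (simp add: \<Theta>_def coeff_sum X1_pow_eq_monom smult_monom)
  have \<Theta>_add: "\<Theta> c (v + w) = \<Theta> c v + \<Theta> c w" for c v w
    by (simp only: \<Theta>_def addmapD[OF addmap_funpow[OF at(1)]] pair_simps smult_add_left sum.distrib)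
  have \<Theta>_t: "cg p (\<Theta> c (t v)) (X1 * \<Theta> c v)" if v: "v \<in> lat n" for c v
  proof -
    define a where "a j = pair n (f c) ((t ^^ (p - j)) v)" for j
    have shift: "pair n (f c) ((t ^^ (p - Suc j)) (t v)) = a j" if "j < p" for j
      unfolding a_def using that by (simp add: Suc_diff_Suc flip: funpow_Suc_right comp_apply[of "t ^^ (p - Suc j)" t]) 
    obtain r where r: "p = Suc r" using p0 by (cases p) auto
    have per1: "(t ^^ p) (t v) = t v" by (rule per) (rule tsubD(4)[OF sub(1) v])
    have "\<Theta> c (t v) = smult (pair n (f c) ((t ^^ p) (t v))) 1 + (\<Sum>j<r. smult (pair n (f c) ((t ^^ (p - Suc j)) (t v))) (X1 ^ Suc j))"
      unfolding \<Theta>_def r by (subst sum.lessThan_Suc_shift) simp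
    also have "pair n (f c) ((t ^^ p) (t v)) = a r"
    proof -
      have "p - r = 1" using r by simp
      then show ?thesis unfolding per1 a_def by simp
    qed
    also have "(\<Sum>j<r. smult (pair n (f c) ((t ^^ (p - Suc j)) (t v))) (X1 ^ Suc j)) = (\<Sum>j<r. smult (a j) (X1 ^ Suc j))"
      using shift by (intro sum.cong) (auto simp: r)
    finally have 1: "\<Theta> c (t v) = smult (a r) 1 + (\<Sum>j<r. smult (a j) (X1 ^ Suc j))" .
    have "X1 * \<Theta> c v = (\<Sum>j<Suc r. smult (a j) (X1 ^ Suc j))"
      unfolding \<Theta>_def r[symmetric] sum_distrib_left a_def by (simp add: mult_smult_right)
    also have "\<dots> = smult (a r) (X1 ^ p) + (\<Sum>j<r. smult (a j) (X1 ^ Suc j))" by (simp add: r)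
    finally have "X1 * \<Theta> c v - \<Theta> c (t v) = [:a r:] * (X1 ^ p - 1)" using 1 by (simp add: smult_diff_right)
    moreover have "Phi p dvd [:a r:] * (X1 ^ p - 1)" using cg_X1_pow[of p] unfolding cg_def by (rule dvd_mult)
    ultimately have "cg p (X1 * \<Theta> c v) (\<Theta> c (t v))" by (simp add: cg_def)
    then show ?thesis by (rule cg_sym)
  qed
  have \<Theta>_1: "poly (\<Theta> c v) 1 = 0" if c: "c \<in> C" and v: "v \<in> lat n" for c v
  proof -
    have "poly (\<Theta> c v) 1 = (\<Sum>j<p. pair n (f c) ((t ^^ (p - j)) v))" by (simp add: \<Theta>_def poly_sum)
    also have "\<dots> = (\<Sum>j<p. pair n (f c) ((t ^^ (Suc j)) v))"
      by (subst sum.nat_diff_reindex[symmetric]) (auto intro!: sum.cong)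
    also have "\<dots> = (\<Sum>j<p. pair n (f c) ((t ^^ j) (t v)))" by (simp add: funpow_swap1)
    also have "\<dots> = pair n (f c) (pact t (Phi p) (t v))"
    proof -
      have "pact t (Phi p) (t v) = (\<lambda>x. \<Sum>j<p. (t ^^ j) (t v) x)" by (intro ext) (rule pact_Phi[OF p0])
      then show ?thesis unfolding pair_def sum_distrib_left by (simp add: sum.swap[of _ "{..<p}"] sum_distrib_left)
    qed
    also have "\<dots> = pair n (pact t' (Phi p) (f c)) (t v)" by (simp add: pq)
    also have "\<dots> = 0" unfolding fW(2)[OF c] by (simp add: pair_simps)
    finally show ?thesis .
  qed
  have "\<exists>g. \<Theta> c v = pi1 * g" if "c \<in> C" "v \<in> lat n" for c v
    using poly_eq_const_plus_pi1[of "\<Theta> c v"] \<Theta>_1[OF that] by auto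
  then obtain \<Psi> where \<Psi>: "\<And>c v. c \<in> C ==> v \<in> lat n ==> \<Theta> c v = pi1 * \<Psi> c v" by metis
  have lin: "m.slin (\<Psi> c) (lat n)" if c: "c \<in> C" for c
  proof (rule slin_pactI[OF at(1) p sub(1)])
    fix v w assume vw: "v \<in> lat n" "w \<in> lat n"
    have "pi1 * \<Psi> c (v + w) = pi1 * (\<Psi> c v + \<Psi> c w)"
      using \<Theta>_add[of c v w] vw lat_closed(1)[OF vw] by (simp only: \<Psi>[OF c] distrib_left)
    then show "cg p (\<Psi> c (v + w)) (\<Psi> c v + \<Psi> c w)" using cg_pi1_cancel[OF p] by (metis cg_refl)
  next
    fix v assume v: "v \<in> lat n"
    have "cg p (pi1 * \<Psi> c (t v)) (X1 * (pi1 * \<Psi> c v))"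
      using \<Theta>_t[OF v, of c] v tsubD(4)[OF sub(1) v] by (simp only: \<Psi>[OF c])
    then show "cg p (\<Psi> c (t v)) (X1 * \<Psi> c v)" using cg_pi1_cancel[OF p] by (metis mult.left_commute)
  qed
  have diff_ker: "v - t v \<in> normker t p (lat n)" if v: "v \<in> lat n" for v
  proof -
    have "pact t (Phi p) (pact t pi1 v) = pact t (pi1 * Phi p) v" by (simp only: m.s_mult[symmetric] mult.commute)
    also have "\<dots> = v - (t ^^ p) v" unfolding pi1_mult_Phi by (simp only: m.s_diff_left m.s_one pact_X1_pow[OF at(1)])
    also have "\<dots> = 0" using per[OF v] by simp
    finally show ?thesis using tsub_pact[OF sub(1) v, of pi1] unfolding normker_def pact_pi1 by blast
  qed
  have diff_ker': "a - t' a \<in> normker t' p (lat n)" if a: "a \<in> lat n" for a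
  proof -
    have ta: "a - t' a \<in> lat n" using tsub_pact[OF sub(2) a, of pi1] unfolding pact_pi1 .
    have P: "pact t' (Phi p) (a - t' a) \<in> lat n" by (rule tsub_pact[OF sub(2) ta])
    have "pact t' (Phi p) (a - t' a) i = 0" for i
    proof (cases "i < n")
      case True
      let ?u = "unitv i"
      have u: "?u \<in> lat n" using True by (auto simp: unitv_def lat_def)
      have "pact t' (Phi p) (a - t' a) i = pair n (pact t' (Phi p) (a - t' a)) ?u"
        using pair_unitv[OF True, of "pact t' (Phi p) (a - t' a)"] by (simp add: pair_def mult.commute)
      also have "\<dots> = pair n a (pact t (Phi p) ?u) - pair n a (t (pact t (Phi p) ?u))"
        using pp[of 1 a "pact t (Phi p) ?u"] by (simp add: pq pair_simps)
      also have "\<dots> = pair n a (pact t (Phi p) (?u - t ?u))"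
        by (simp add: m.s_diff_right pact_commute[OF at(1)] pair_simps)
      also have "\<dots> = 0" using diff_ker[OF u] by (simp add: normker_def pair_simps)
      finally show ?thesis .
    next
      case False
      then show ?thesis using P by (simp add: lat_def)
    qed
    then show ?thesis using ta by (simp add: normker_def fun_eq_iff)
  qed
  show ?thesis
  proof (rule m.sfree_by_functionals[OF finC slat_normker[OF at(1) p sub(1)], where F = \<Psi>])
    show "m.slin (\<Psi> c) (normker t p (lat n))" if "c \<in> C" for c
      by (rule m.slin_subset[OF lin[OF that]]) (auto simp: normker_def)
    fix v assume v: "v \<in> normker t p (lat n)" and z: "\<And>c. c \<in> C ==> cg p (\<Psi> c v) 0"
    have vl: "v \<in> lat n" using v by (simp add: normker_def)
    \<comment> \<open>A multiple of \<open>Phi p\<close> of degree below \<open>p\<close> is an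
      integer multiple of it, and vanishing at 1 excludes a nonzero multiple.\<close>
    have \<Theta>0: "\<Theta> c v = 0" if c: "c \<in> C" for c
    proof -
      have "Phi p dvd \<Theta> c v" using z[OF c] unfolding \<Psi>[OF c vl] cg_0_iff by simp
      then obtain k where k: "\<Theta> c v = Phi p * k" by auto
      have "k = 0"
      proof (rule ccontr)
        assume "k \<noteq> 0"
        have Phi0: "Phi p \<noteq> 0" using prime_elem_Phi[OF p] by auto
        have "degree (\<Theta> c v) < p" using p0 coeff_\<Theta> by (intro degree_lessI) auto
        then have "degree k = 0" using k degree_mult_eq[OF Phi0 \<open>k \<noteq> 0\<close>] degree_Phi[OF p0] by simp
        then obtain k0 where "k = [:k0:]" by (auto elim: degree_eq_zeroE)
        then show False using \<Theta>_1[OF c vl] k \<open>k \<noteq> 0\<close> p0 by (simp add: poly_Phi_1)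
      qed
      then show ?thesis using k by simp
    qed
    have f0: "pair n (f c) ((t ^^ k) v) = 0" if c: "c \<in> C" for c k
    proof -
      have base: "pair n (f c) ((t ^^ (p - j)) v) = 0" if "j < p" for j
        using coeff_\<Theta>[of c v j] \<Theta>0[OF c] that by simp
      have "(t ^^ (p * m)) v = v" for m
        using per[OF vl] by (induction m) (simp_all add: funpow_add)
      then have "(t ^^ (k mod p + p * (k div p))) v = (t ^^ (k mod p)) v" unfolding funpow_add by simp
      then have k: "(t ^^ k) v = (t ^^ (k mod p)) v" by simp
      show ?thesis
      proof (cases "k mod p = 0")
        case True
        then show ?thesis using base[of 0] p0 per[OF vl] k by simp
      next
        case False
        then have "p - (p - k mod p) = k mod p" "p - k mod p < p" using p0 by (auto simp: less_imp_le)
        then show ?thesis using base[of "p - k mod p"] k by simp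
      qed
    qed
    have W0: "pair n w v = 0" if w: "w \<in> normker t' p (lat n)" for w
    proof -
      obtain q where q: "w = (\<Sum>c\<in>C. pact t' (q c) (f c))" using m'.sbasisD(3)[OF B w] by blast
      have "pair n (pact t' r (f c)) v = 0" if c: "c \<in> C" for r c
      proof -
        have "pair n (pact t' r (f c)) v = (\<Sum>k\<le>degree r. coeff r k * pair n (f c) ((t ^^ k) v))"
          unfolding pq unfolding pair_def pact_def sum_distrib_left by (subst sum.swap) (simp add: ac_simps)
        then show ?thesis using f0[OF c] by simp
      qed
      moreover have "pair n (sum g A) v = (\<Sum>c\<in>A. pair n (g c) v)" for g and A :: "nat set"
        by (induction A rule: infinite_finite_induct) (simp_all add: pair_def distrib_right sum.distrib)
      ultimately show ?thesis by (simp add: q)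
    qed
    \<comment> \<open>All vectors \<open>a - t' a\<close> lie in the dual norm kernel, so
      \<open>v\<close> is orthogonal to them and hence fixed by \<open>t\<close>. On fixed vectors
      the norm is multiplication by \<open>p\<close>, while \<open>v\<close> has norm zero.\<close>
    have fix_v: "t v = v"
    proof
      fix i
      show "t v i = v i"
      proof (cases "i < n")
        case True
        let ?u = "unitv i"
        have u: "?u \<in> lat n" using True by (auto simp: unitv_def lat_def)
        have "pair n ?u v - pair n ?u (t v) = 0"
          using W0[OF diff_ker'[OF u]] pp[of 1 ?u v] by (simp add: pair_simps)
        then show ?thesis using pair_unitv[OF True] by simp
      next
        case False
        then show ?thesis using vl tsubD(4)[OF sub(1) vl] by (simp add: lat_def)
      qed
    qed
    have "(t ^^ k) v = v" for k by (induction k) (simp_all add: fix_v)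
    then have "pact t (Phi p) v i = int p * v i" for i using pact_Phi[OF p0, of t v i] by simp
    moreover have "pact t (Phi p) v = 0" using v by (simp add: normker_def)
    ultimately show "v = 0" using p0 by (auto simp: fun_eq_iff)
  next
    fix c0 assume c0: "c0 \<in> C"
    have "\<exists>q. w = (\<Sum>c\<in>C. pact t' (q c) (f c))" if "w \<in> normker t' p (lat n)" for w
      using m'.sbasisD(3)[OF B that] .
    then obtain Q where Q: "\<And>w. w \<in> normker t' p (lat n) ==> w = (\<Sum>c\<in>C. pact t' (Q w c) (f c))" by metis
    have uniq: "cg p (Q w c) (r c)" if "w \<in> normker t' p (lat n)" "w = (\<Sum>c\<in>C. pact t' (r c) (f c))" "c \<in> C" for w r c
    proof -
      have "(\<Sum>c\<in>C. pact t' (Q w c - r c) (f c)) = 0"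
        using Q[OF that(1)] that(2) by (simp only: m'.s_diff_left sum_subtractf diff_self)
      from m'.sbasisD(4)[OF B this that(3)] show ?thesis by (simp add: cg_def)
    qed
    \<comment> \<open>The trace of one coordinate is an additive functional on the dual norm kernel;
      \<open>ex_pairing\<close> represents it by a vector \<open>v\<close> of the original
      lattice.\<close>
    define g where "g w = trf p (Q w c0)" for w
    have "\<exists>v\<in>lat n. \<forall>a\<in>lat n. pact t' (Phi p) a = 0 \<longrightarrow> pair n a v = g a"
    proof (rule ex_pairing[OF addmap_pact[OF at(2)], where m = n])
      show "pact t' (Phi p) x \<in> lat n" if "x \<in> lat n" for x by (rule tsub_pact[OF sub(2) that])
      fix x y assume xy: "x \<in> lat n" "pact t' (Phi p) x = 0" "y \<in> lat n" "pact t' (Phi p) y = 0"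
      then have x: "x \<in> normker t' p (lat n)" and y: "y \<in> normker t' p (lat n)" by (simp_all add: normker_def)
      have "cg p (Q (x + y) c0) (Q x c0 + Q y c0)"
      proof (rule uniq[of "x + y" "\<lambda>c. Q x c + Q y c" c0, OF m'.slatD(2)[OF W x y] _ c0])
        show "x + y = (\<Sum>c\<in>C. pact t' (Q x c + Q y c) (f c))"
          unfolding m'.s_add_left sum.distrib using Q[OF x] Q[OF y] by simp
      qed
      then show "g (x + y) = g x + g y" unfolding g_def using trf_cg[OF p0] trf_add by metis
    qed
    then obtain v where v: "v \<in> lat n" and gv: "\<And>a. a \<in> lat n ==> pact t' (Phi p) a = 0 ==> pair n a v = g a" by blast
    have val: "pair n (f c) ((t ^^ k) v) = (if c = c0 then trf p (X1 ^ k) else 0)" if c: "c \<in> C" for c k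
    proof -
      let ?w = "pact t' (X1 ^ k) (f c)"
      have w: "?w \<in> normker t' p (lat n)" using m'.slatD(3)[OF W m'.sbasisD(2)[OF B c]] .
      have "?w = (\<Sum>d\<in>C. pact t' (if d = c then X1 ^ k else 0) (f d))"
      proof -
        have "(\<Sum>d\<in>C. pact t' (if d = c then X1 ^ k else 0) (f d)) = (\<Sum>d\<in>C. if d = c then pact t' (X1 ^ k) (f d) else 0)"
          by (intro sum.cong) auto
        then show ?thesis using finC c by simp
      qed
      from uniq[OF w this c0] have "cg p (Q ?w c0) (if c0 = c then X1 ^ k else 0)" .
      then have "g ?w = trf p (if c0 = c then X1 ^ k else 0)" unfolding g_def by (rule trf_cg[OF p0])
      moreover have "pair n ?w v = g ?w" using w by (intro gv) (auto simp: normker_def)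
      moreover have "pair n ?w v = pair n (f c) ((t ^^ k) v)" unfolding pq pact_X1_pow[OF at(1)] ..
      moreover have "trf p 0 = 0" by (simp add: trf_def)
      ultimately show ?thesis by auto
    qed
    have \<Psi>v: "cg p (\<Psi> c v) (if c = c0 then 1 else 0)" if c: "c \<in> C" for c
    proof -
      \<comment> \<open>The normalisation of \<open>trf\<close> is made for this: its values at
        \<open>X1 ^ (p - j)\<close> are the coefficients of \<open>pi1\<close>, so dividing by
        \<open>pi1\<close> leaves the value 1.\<close>
      have "\<Theta> c v = (if c = c0 then pi1 else 0)"
      proof (cases "c = c0")
        case True
        have "coeff (\<Theta> c v) j = coeff pi1 j" for j
        proof -
          have p2: "p \<ge> 2" by (rule prime_ge_2_nat[OF p])
          have "coeff pi1 j = (if j = 0 then 1 else if j = 1 then -1 else 0)"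
            by (simp add: pi1_eq coeff_pCons split: nat.splits)
          moreover have "trf p (X1 ^ (p - j)) = (if j = 0 then 1 else if j = 1 then -1 else 0)" if "j < p"
          proof -
            have d1: "p dvd p - j \<longleftrightarrow> j = 0"
              using that by (metis diff_diff_cancel diff_zero dvd_diff_nat dvd_refl less_imp_le_nat nat_dvd_not_less neq0_conv)
            have d2: "p dvd Suc (p - j) \<longleftrightarrow> j = 1"
            proof
              assume dv: "p dvd Suc (p - j)"
              have "j \<noteq> 0"
              proof
                assume "j = 0"
                then have "p dvd Suc p - p" using dv by (intro dvd_diff_nat) auto
                then show False using p2 by simp
              qed
              moreover have "p \<le> Suc (p - j)" by (rule dvd_imp_le[OF dv]) simp
              ultimately show "j = 1" using that by linarith
            qed (use p0 in simp)
            show ?thesis unfolding trf_X1_pow d1 d2 by auto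
          qed
          ultimately show ?thesis using True val[OF c] p2 by (auto simp: coeff_\<Theta>)
        qed
        then have "\<Theta> c v = pi1" by (intro poly_eqI)
        then show ?thesis using True by simp
      next
        case False
        then have "\<Theta> c v = 0" using val[OF c] by (intro poly_eqI) (simp add: coeff_\<Theta>)
        then show ?thesis using False by simp
      qed
      then have "pi1 * \<Psi> c v = pi1 * (if c = c0 then 1 else 0)" using \<Psi>[OF c v] by simp
      then show ?thesis using cg_pi1_cancel[OF p] by (metis cg_refl)
    qed
    have \<Psi>x: "cg p (\<Psi> c (v - t v)) (pi1 * (if c = c0 then 1 else 0))" if c: "c \<in> C" for c
      using cg_trans[OF m.slinD(2)[OF lin[OF c] v, of pi1] cg_mult_left[OF \<Psi>v[OF c]]] unfolding pact_pi1 .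
    show "\<exists>x\<in>normker t p (lat n). cg p (\<Psi> c0 x) pi1 \<and> (\<forall>d\<in>C - {c0}. cg p (\<Psi> d x) 0)"
    proof (intro bexI conjI ballI)
      show "cg p (\<Psi> c0 (v - t v)) pi1" using \<Psi>x[OF c0] by simp
      show "cg p (\<Psi> d (v - t v)) 0" if "d \<in> C - {c0}" for d using \<Psi>x[of d] that by auto
    qed (rule diff_ker[OF v])
  qed
qed

section \<open>The prime 2, and descent along an extension by the cyclotomic module\<close>

lemma zcomb_eq_sum: "finite I ==> zcomb I z e = (\<Sum>i\<in>I. zmul (z i) (e i))"
proof (induction rule: finite_induct)
  case empty
  show ?case by (auto simp: zcomb_def fun_eq_iff)
next
  case (insert i I)
  then show ?case unfolding zcomb_insert[OF insert(1,2)] sum.insert[OF insert(1,2)] by (simp only:)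
qed

text \<open>On the norm kernel \<open>t\<close> acts as -1, so a polynomial acts through its value
  at -1 and an integral basis of the kernel is already a basis over the cyclotomic ring.\<close>

lemma sfree_two:
  fixes M :: "nat => nat => int" and n :: nat
  defines "t \<equiv> tact n M"
  shows "pmod.sfree (pact t) 2 (normker t 2 (lat n))"
proof -
  have at: "addmap t" unfolding t_def by (rule addmap_tact)
  have sub: "tsub t (lat n)" unfolding t_def by (rule tsub_lat)
  have p2: "prime (2 :: nat)" by (rule two_is_prime_nat)
  interpret m: pmod "pact t" 2 by (rule pmod_pact[OF at p2])
  obtain e J where J: "J \<subseteq> {..<n}" and B: "zbasis {..<n} e (lat n)"
    and ker: "\<And>z. pact t (Phi 2) (zcomb {..<n} z e) = 0 \<longleftrightarrow> (\<forall>i\<in>{..<n} - J. z i = 0)"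
    using lat_kernel_basis[OF addmap_pact[OF at, of "Phi 2"] tsub_pact[OF sub]] by metis
  have finJ: "finite J" using J finite_subset by blast
  have Phi2: "Phi 2 = [:1, 1:]" by (simp add: Phi_def X1_def numeral_2_eq_2 one_pCons)
  have restrict: "zcomb {..<n} (\<lambda>i. if i \<in> J then z i else 0) e = (\<Sum>j\<in>J. zmul (z j) (e j))" for z
  proof -
    have "zcomb {..<n} (\<lambda>i. if i \<in> J then z i else 0) e = zcomb J z e"
      unfolding zcomb_def using J by (intro ext) (simp add: if_distrib[of "\<lambda>x. x * _"] sum.If_cases Int_absorb1)
    then show ?thesis by (simp only: zcomb_eq_sum[OF finJ])
  qed
  have eJ: "e j \<in> normker t 2 (lat n)" if j: "j \<in> J" for j
  proof -
    have "zcomb {..<n} (\<lambda>i. if i = j then 1 else 0) e = e j"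
    proof
      fix x
      have "zcomb {..<n} (\<lambda>i. if i = j then 1 else 0) e x = (\<Sum>i<n. if i = j then e i x else 0)"
        unfolding zcomb_def by (intro sum.cong) auto
      then show "zcomb {..<n} (\<lambda>i. if i = j then 1 else 0) e x = e j x" using j J by auto
    qed
    then have "pact t (Phi 2) (e j) = 0" using ker[of "\<lambda>i. if i = j then 1 else 0"] j by auto
    then show ?thesis using B j J by (auto simp: normker_def zbasis_def)
  qed
  note W = slat_normker[OF at p2 sub]
  have "m.sbasis J e (normker t 2 (lat n))" unfolding m.sbasis_def
  proof (intro conjI ballI allI impI finJ eJ)
    fix x assume x: "x \<in> normker t 2 (lat n)"
    then obtain z where z: "x = zcomb {..<n} z e" using B by (auto simp: normker_def zbasis_def)
    then have "\<forall>i\<in>{..<n} - J. z i = 0" using ker[of z] x by (simp add: normker_def)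
    then have "x = zcomb {..<n} (\<lambda>i. if i \<in> J then z i else 0) e"
      unfolding z zcomb_def by (intro ext sum.cong) auto
    also have "\<dots> = (\<Sum>j\<in>J. pact t [:z j:] (e j))" unfolding restrict pact_const ..
    finally show "\<exists>q. x = (\<Sum>j\<in>J. pact t (q j) (e j))" by (rule exI[of _ "\<lambda>j. [:z j:]"])
  next
    fix q j assume 0: "(\<Sum>j\<in>J. pact t (q j) (e j)) = 0" and j: "j \<in> J"
    have val: "pact t (q j) (e j) = zmul (poly (q j) (-1)) (e j)" if "j \<in> J" for j
    proof -
      have "[:1, 1:] dvd q j - [:poly (q j) (-1):]" using poly_eq_0_iff_dvd[of "q j - [:poly (q j) (-1):]" "-1"] by simp
      then have "cg 2 (q j) [:poly (q j) (-1):]" by (simp add: cg_def Phi2)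
      from m.slat_cg[OF W eJ[OF that] this] show ?thesis by (simp only: pact_const)
    qed
    have "(\<Sum>j\<in>J. zmul (poly (q j) (-1)) (e j)) = (\<Sum>j\<in>J. pact t (q j) (e j))"
      by (intro sum.cong refl) (rule val[symmetric])
    then have "zcomb {..<n} (\<lambda>i. if i \<in> J then poly (q i) (-1) else 0) e = 0"
      unfolding restrict using 0 by (simp only:)
    then have "(if j \<in> J then poly (q j) (-1) else 0) = 0" using B j J unfolding zbasis_def by blast
    then have "poly (q j) (-1) = 0" using j by simp
    then show "cg 2 (q j) 0" using poly_eq_0_iff_dvd[of "q j" "-1"] by (simp add: cg_0_iff Phi2)
  qed
  then show ?thesis using W unfolding m.sfree_def by blast
qed

lemma sum_lessThan_split: "(\<Sum>j<n + k. f j) = (\<Sum>j<n. f j) + (\<Sum>j<k. f (n + j))"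
  for f :: "nat => 'a::comm_monoid_add"
  by (induction k) (simp_all add: add.assoc)

text \<open>The \<open>k\<close>-th new coordinate vector is sent to \<open>S k\<close>, the sum 1 +
  ... + lambda^k, and the old ones to 0. The relation \<open>S (Suc k) = 1 + X1 * S k\<close>, with
  \<open>S (p - 1) = Phi p\<close> at the end, matches the given matrix block, so \<open>h\<close>
  is linear with kernel \<open>lat n\<close>. It has value 1 on the first new vector, which makes
  \<open>sfree_kernel\<close> applicable.\<close>

lemma sfree_descend:
  fixes A B :: "nat => nat => int" and n p N :: nat
  defines "N \<equiv> n + (p - 1)" and "t \<equiv> tact N B" and "t0 \<equiv> tact n A"
  assumes p: "prime p" and per: "\<And>v. v \<in> lat N ==> (t ^^ p) v = v"
    and BA: "\<And>i j. i < n ==> j < n ==> B i j = A i j"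
    and B0: "\<And>i j. i < p - 1 ==> j < n ==> B (n + i) j = 0"
    and B1: "\<And>i j. i < p - 1 ==> j < p - 1 ==> B (n + i) (n + j) = (if i = Suc j then 1 else 0) - (if i = 0 then 1 else 0)"
    and free: "pmod.sfree (pact t) p (normker t p (lat N))"
  shows "pmod.sfree (pact t0) p (normker t0 p (lat n))"
proof -
  have p2: "p \<ge> 2" by (rule prime_ge_2_nat[OF p])
  then have p0: "p > 0" by simp
  have at: "addmap t" "addmap t0" unfolding t_def t0_def by (rule addmap_tact)+
  have sub: "tsub t (lat N)" "tsub t0 (lat n)" unfolding t_def t0_def by (rule tsub_lat)+
  interpret m: pmod "pact t" p by (rule pmod_pact[OF at(1) p])
  interpret m0: pmod "pact t0" p by (rule pmod_pact[OF at(2) p])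
  define S where "S k = (\<Sum>l\<le>k. X1 ^ l)" for k
  define h where "h v = (\<Sum>k<p - 1. smult (v (n + k)) (S k))" for v :: "nat => int"
  have S0: "S 0 = 1" by (simp add: S_def)
  have S_Suc: "S (Suc k) = 1 + X1 * S k" for k
    unfolding S_def by (subst sum.atMost_Suc_shift) (simp add: sum_distrib_left)
  have S_last: "cg p (X1 * S (p - 2)) (- 1)"
  proof -
    have "S (p - 1) = Phi p" unfolding S_def Phi_def using p0 by (metis Suc_pred' lessThan_Suc_atMost)
    moreover have "p - 1 = Suc (p - 2)" using p2 by simp
    ultimately have "X1 * S (p - 2) - (- 1) = Phi p" using S_Suc[of "p - 2"] by simp
    then show ?thesis by (simp add: cg_def)
  qed
  have h_add: "h (v + w) = h v + h w" for v w
    by (simp add: h_def smult_add_left sum.distrib)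
  have h_t: "cg p (h (t v)) (X1 * h v)" for v
  proof -
    have tv: "t v (n + i) = (\<Sum>j<p - 1. ((if i = Suc j then 1 else 0) - (if i = 0 then 1 else 0)) * v (n + j))" if i: "i < p - 1" for i
    proof -
      have "t v (n + i) = (\<Sum>j<n + (p - 1). B (n + i) j * v j)" using i by (simp add: t_def tact_def N_def)
      also have "\<dots> = (\<Sum>j<n. B (n + i) j * v j) + (\<Sum>j<p - 1. B (n + i) (n + j) * v (n + j))"
        by (rule sum_lessThan_split)
      finally show ?thesis using i B0[OF i] B1[OF i] by simp
    qed
    define \<delta> :: "nat => nat => int" where "\<delta> i j = (if i = Suc j then 1 else 0) - (if i = 0 then 1 else 0)" for i j
    have "h (t v) = (\<Sum>i<p - 1. \<Sum>j<p - 1. [:v (n + j):] * smult (\<delta> i j) (S i))"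
    proof (unfold h_def, rule sum.cong[OF refl])
      fix i assume "i \<in> {..<p - 1}"
      then have eq: "[:t v (n + i):] = (\<Sum>j<p - 1. [:\<delta> i j * v (n + j):])" by (simp add: tv \<delta>_def sum_to_poly)
      have "smult (t v (n + i)) (S i) = [:t v (n + i):] * S i" by simp
      then have "smult (t v (n + i)) (S i) = (\<Sum>j<p - 1. [:\<delta> i j * v (n + j):]) * S i"
        unfolding eq .
      then show "smult (t v (n + i)) (S i) = (\<Sum>j<p - 1. [:v (n + j):] * smult (\<delta> i j) (S i))"
        unfolding sum_distrib_right by (simp add: mult.commute)
    qed
    also have "\<dots> = (\<Sum>j<p - 1. smult (v (n + j)) (\<Sum>i<p - 1. smult (\<delta> i j) (S i)))"
    proof (subst sum.swap, rule sum.cong[OF refl])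
      fix j
      have "smult (v (n + j)) (\<Sum>i<p - 1. smult (\<delta> i j) (S i)) = [:v (n + j):] * (\<Sum>i<p - 1. smult (\<delta> i j) (S i))" by simp
      then show "(\<Sum>i<p - 1. [:v (n + j):] * smult (\<delta> i j) (S i)) = smult (v (n + j)) (\<Sum>i<p - 1. smult (\<delta> i j) (S i))"
        by (simp only: sum_distrib_left)
    qed
    finally have 1: "h (t v) = (\<Sum>j<p - 1. smult (v (n + j)) (\<Sum>i<p - 1. smult ((if i = Suc j then 1 else 0) - (if i = 0 then 1 else 0)) (S i)))"
      unfolding \<delta>_def .
    have 2: "cg p (\<Sum>i<p - 1. smult ((if i = Suc j then 1 else 0) - (if i = 0 then 1 else 0)) (S i)) (X1 * S j)" if j: "j < p - 1" for j
    proof -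
      have "(\<Sum>i<p - 1. smult ((if i = Suc j then 1 else 0) - (if i = 0 then 1 else 0)) (S i)) =
          (\<Sum>i<p - 1. (if i = Suc j then S i else 0)) - (\<Sum>i<p - 1. (if i = 0 then S i else 0))"
        unfolding sum_subtractf[symmetric] by (intro sum.cong) auto
      also have "\<dots> = (if Suc j < p - 1 then S (Suc j) else 0) - 1" using p2 S0 by simp
      finally have eq: "(\<Sum>i<p - 1. smult ((if i = Suc j then 1 else 0) - (if i = 0 then 1 else 0)) (S i)) =
          (if Suc j < p - 1 then S (Suc j) else 0) - 1" .
      show ?thesis
      proof (cases "Suc j < p - 1")
        case True
        then show ?thesis unfolding eq using S_Suc[of j] by simp
      next
        case False
        then have "j = p - 2" using j by simp
        then show ?thesis unfolding eq using False cg_sym[OF S_last] by simp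
      qed
    qed
    have "cg p (h (t v)) (\<Sum>j<p - 1. [:v (n + j):] * (X1 * S j))"
    proof -
      have "cg p (\<Sum>j<p - 1. [:v (n + j):] * (\<Sum>i<p - 1. smult ((if i = Suc j then 1 else 0) - (if i = 0 then 1 else 0)) (S i)))
        (\<Sum>j<p - 1. [:v (n + j):] * (X1 * S j))" by (intro cg_sum cg_mult_left 2) simp
      then show ?thesis unfolding 1 by simp
    qed
    also have "(\<Sum>j<p - 1. [:v (n + j):] * (X1 * S j)) = X1 * h v"
      by (simp add: h_def sum_distrib_left)
    finally show ?thesis .
  qed
  have lin: "m.slin h (lat N)"
    by (rule slin_pactI[OF at(1) p sub(1)]) (simp_all only: h_add cg_refl h_t)
  have coeff_S: "coeff (S k) l = (if l \<le> k then 1 else 0)" for k l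
    unfolding S_def X1_pow_eq_monom by (simp add: coeff_sum)
  have coeff_h: "coeff (h v) l = (\<Sum>k<p - 1. if l \<le> k then v (n + k) else 0)" for v l
    unfolding h_def by (auto simp: coeff_sum coeff_S intro!: sum.cong)
  have h_ker: "cg p (h v) 0 \<longleftrightarrow> v \<in> lat n" if v: "v \<in> lat N" for v
  proof
    assume "v \<in> lat n"
    then have "h v = 0" by (simp add: h_def lat_def)
    then show "cg p (h v) 0" by simp
  next
    assume cg0: "cg p (h v) 0"
    have deg: "coeff (h v) l = 0" if "l \<ge> p - 1" for l unfolding coeff_h using that by (intro sum.neutral) auto
    have h0: "h v = 0"
    proof (rule ccontr)
      assume nz: "h v \<noteq> 0"
      have "degree (h v) \<ge> degree (Phi p)" using cg0 nz unfolding cg_0_iff by (rule dvd_imp_degree_le)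
      then have "coeff (h v) (degree (h v)) = 0" using deg degree_Phi[OF p0] by simp
      then show False using nz by simp
    qed
    have vl: "v (n + l) = 0" if l: "l < p - 1" for l
    proof -
      have "coeff (h v) l - coeff (h v) (Suc l) = (\<Sum>k<p - 1. if k = l then v (n + k) else 0)"
        unfolding coeff_h sum_subtractf[symmetric] by (intro sum.cong) auto
      then show ?thesis using l h0 by simp
    qed
    have "v i = 0" if "i \<ge> n" for i
    proof (cases "i < n + (p - 1)")
      case True
      then show ?thesis using vl[of "i - n"] that by simp
    qed (use v in \<open>simp add: lat_def N_def\<close>)
    then show "v \<in> lat n" by (simp add: lat_def)
  qed
  have sfreeK: "m.sfree {v \<in> normker t p (lat N). cg p (h v) 0}"
  proof (rule m.sfree_kernel[OF free])
    show "m.slin h (normker t p (lat N))" by (rule m.slin_subset[OF lin]) (auto simp: normker_def)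
    let ?u = "unitv n"
    have u: "?u \<in> lat N" using p2 by (auto simp: lat_def unitv_def N_def)
    have "pact t (Phi p) (pact t pi1 ?u) = pact t (pi1 * Phi p) ?u" by (simp only: m.s_mult[symmetric] mult.commute)
    also have "\<dots> = ?u - (t ^^ p) ?u" unfolding pi1_mult_Phi by (simp only: m.s_diff_left m.s_one pact_X1_pow[OF at(1)])
    also have "\<dots> = 0" using per[OF u] by simp
    finally show "pact t pi1 ?u \<in> normker t p (lat N)" using tsub_pact[OF sub(1) u] by (simp add: normker_def)
    have "h ?u = (\<Sum>k<p - 1. if k = 0 then S k else 0)" unfolding h_def unitv_def by (intro sum.cong) auto
    then have "h ?u = 1" using p2 S0 by simp
    then show "cg p (h (pact t pi1 ?u)) pi1" using m.slinD(2)[OF lin u, of pi1] by simp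
  qed
  have sub_lat: "lat n \<subseteq> lat N" by (auto simp: lat_def N_def)
  have tt0: "t v = t0 v" if v: "v \<in> lat n" for v
  proof
    fix i
    have restr: "(\<Sum>j<n + (p - 1). B i j * v j) = (\<Sum>j<n. B i j * v j)"
      using v by (intro sum.mono_neutral_right) (auto simp: lat_def)
    consider "i < n" | k where "i = n + k" "k < p - 1" | "i \<ge> N" by (metis N_def add_less_cancel_left le_add_diff_inverse not_le)
    then show "t v i = t0 v i"
    proof cases
      case 1
      then show ?thesis using restr BA by (simp add: t_def t0_def tact_def N_def)
    next
      case 2
      then show ?thesis using restr B0 by (simp add: t_def t0_def tact_def N_def)
    next
      case 3
      then show ?thesis by (simp add: t_def t0_def tact_def N_def)
    qed
  qed
  have id_pact: "pact t q v = pact t0 q v" if "v \<in> lat n" for q v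
  proof -
    have "tsub t (lat n)" using sub(2) tt0 unfolding tsub_def by metis
    from hom_pact[OF this, of "\<lambda>v. v" t0 v q] tt0 that show ?thesis by simp
  qed
  have eq: "{v \<in> normker t p (lat N). cg p (h v) 0} = normker t0 p (lat n)"
    using h_ker id_pact sub_lat unfolding normker_def by auto
  have "m0.sfree ((\<lambda>v. v) ` {v \<in> normker t p (lat N). cg p (h v) 0})"
    by (rule sfree_image[OF m.pmod_axioms m0.pmod_axioms sfreeK])
      (use eq id_pact in \<open>auto simp: normker_def\<close>)
  then show ?thesis unfolding eq by simp
qed

subsection \<open>Splitting off regular summands\<close>

fun psum :: "(('a => int) => ('a => int)) => int poly list => ('a => int) list => 'a => int" where
  "psum t (q # qs) (v # vs) = pact t q v + psum t qs vs"
| "psum t _ _ = 0"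

text \<open>A decomposition of \<open>M\<close> into cyclic modules with annihilators generated by
  \<open>pi1\<close>, \<open>1 - X1 ^ p\<close> and \<open>Phi p\<close>: trivial summands on
  \<open>Ts\<close>, regular ones on \<open>Rs\<close> and cyclotomic ones on
  \<open>Cs\<close>.\<close>

definition gbasis :: "(('a => int) => ('a => int)) => nat => ('a => int) set =>
    ('a => int) list => ('a => int) list => ('a => int) list => bool" where
  "gbasis t p M Ts Rs Cs \<longleftrightarrow>
    (\<forall>x\<in>M. \<exists>a b c. length a = length Ts \<and> length b = length Rs \<and> length c = length Cs \<and>
        x = psum t a Ts + psum t b Rs + psum t c Cs) \<and>
    (\<forall>a b c. length a = length Ts \<longrightarrow> length b = length Rs \<longrightarrow> length c = length Cs \<longrightarrow>
        psum t a Ts + psum t b Rs + psum t c Cs = 0 \<longrightarrow>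
        (\<forall>q\<in>set a. pi1 dvd q) \<and> (\<forall>q\<in>set b. 1 - X1 ^ p dvd q) \<and> (\<forall>q\<in>set c. Phi p dvd q)) \<and>
    (\<forall>v\<in>set Ts. pact t pi1 v = 0) \<and> (\<forall>v\<in>set Rs. pact t (1 - X1 ^ p) v = 0) \<and>
    (\<forall>v\<in>set Cs. pact t (Phi p) v = 0) \<and> set Ts \<union> set Rs \<union> set Cs \<subseteq> M"

lemma psum_map: "distinct is ==> psum t (map q is) (map e is) = (\<Sum>i\<in>set is. pact t (q i) (e i))"
  by (induction "is") simp_all

lemma list_as_map: "distinct is ==> length qs = length is ==> \<exists>q. qs = map q is"
proof (induction "is" arbitrary: qs)
  case (Cons i "is")
  then obtain x xs where qs: "qs = x # xs" by (cases qs) auto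
  obtain q where "xs = map q is" using Cons qs by auto
  then have "qs = map (q(i := x)) (i # is)" using Cons.prems qs by auto
  then show ?case by blast
qed simp

context pmod
begin

text \<open>The group generated by \<open>K\<close> and the \<open>m j\<close> over the integers. In
  the applications \<open>pi1\<close> maps every \<open>m j\<close> into \<open>K\<close>, so this
  is an extension of a trivial lattice by \<open>K\<close>.\<close>

definition zspan :: "('b::ab_group_add) set => nat set => (nat => 'b) => 'b set" where
  "zspan K J m = {x. \<exists>z :: nat => int. x - (\<Sum>j\<in>J. s [:z j:] (m j)) \<in> K}"

definition zindep :: "'b set => nat set => (nat => 'b) => bool" where
  "zindep K J m \<longleftrightarrow> (\<forall>z :: nat => int. (\<Sum>j\<in>J. s [:z j:] (m j)) \<in> K \<longrightarrow> (\<forall>j\<in>J. z j = 0))"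

lemma const_add: "[:a + b:] = [:a:] + [:b :: int:]"
  by simp

lemma zspan_shift:
  assumes K: "slat K" and \<kappa>: "\<And>j. j \<in> J ==> m' j - m j \<in> K"
  shows "zspan K J m' = zspan K J m" "zindep K J m' = zindep K J m"
proof -
  have d: "(\<Sum>j\<in>J. s [:z j:] (m' j)) - (\<Sum>j\<in>J. s [:z j:] (m j)) \<in> K" for z :: "nat => int"
    unfolding sum_subtractf[symmetric] s_diff_right[symmetric] by (intro slat_sum[OF K] slatD(3)[OF K] \<kappa>)
  have "x - (\<Sum>j\<in>J. s [:z j:] (m' j)) \<in> K \<longleftrightarrow> x - (\<Sum>j\<in>J. s [:z j:] (m j)) \<in> K" for x z
  proof
    assume "x - (\<Sum>j\<in>J. s [:z j:] (m' j)) \<in> K"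
    from slatD(2)[OF K this d[of z]] show "x - (\<Sum>j\<in>J. s [:z j:] (m j)) \<in> K" by simp
  next
    assume "x - (\<Sum>j\<in>J. s [:z j:] (m j)) \<in> K"
    from slat_diff[OF K this d[of z]] show "x - (\<Sum>j\<in>J. s [:z j:] (m' j)) \<in> K" by simp
  qed
  then show "zspan K J m' = zspan K J m" unfolding zspan_def by simp
  have "(\<Sum>j\<in>J. s [:z j:] (m' j)) \<in> K \<longleftrightarrow> (\<Sum>j\<in>J. s [:z j:] (m j)) \<in> K" for z :: "nat => int"
  proof
    assume "(\<Sum>j\<in>J. s [:z j:] (m' j)) \<in> K"
    from slat_diff[OF K this d[of z]] show "(\<Sum>j\<in>J. s [:z j:] (m j)) \<in> K" by simp
  next
    assume "(\<Sum>j\<in>J. s [:z j:] (m j)) \<in> K"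
    from slatD(2)[OF K this d[of z]] show "(\<Sum>j\<in>J. s [:z j:] (m' j)) \<in> K" by (simp add: algebra_simps)
  qed
  then show "zindep K J m' = zindep K J m" unfolding zindep_def by simp
qed

lemma zspan_shear:
  assumes fin: "finite J" and j0: "j0 \<in> J" and m'0: "m' j0 = m j0"
    and m': "\<And>j. j \<in> J - {j0} ==> m' j = m j - s [:c j:] (m j0)"
  shows "zspan K J m' = zspan K J m" "zindep K J m' = zindep K J m"
proof -
  have comb: "(\<Sum>j\<in>J. s [:z j:] (m' j)) = (\<Sum>j\<in>J. s [:(z(j0 := z j0 - (\<Sum>j\<in>J - {j0}. z j * c j))) j:] (m j))" for z
  proof -
    have "(\<Sum>j\<in>J. s [:z j:] (m' j)) = s [:z j0:] (m j0) + (\<Sum>j\<in>J - {j0}. s [:z j:] (m j) - s [:z j * c j:] (m j0))"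
      using fin j0 m'0 m' by (simp add: sum.remove s_diff_right mult.commute flip: s_mult)
    also have "\<dots> = s [:z j0:] (m j0) - s (\<Sum>j\<in>J - {j0}. [:z j * c j:]) (m j0) + (\<Sum>j\<in>J - {j0}. s [:z j:] (m j))"
      by (simp add: sum_subtractf s_sum_left)
    also have "(\<Sum>j\<in>J - {j0}. [:z j * c j:]) = [:\<Sum>j\<in>J - {j0}. z j * c j:]"
      by (induction "J - {j0}" rule: infinite_finite_induct) (simp_all add: const_add sum_to_poly)
    also have "s [:z j0:] (m j0) - s [:\<Sum>j\<in>J - {j0}. z j * c j:] (m j0) = s [:z j0 - (\<Sum>j\<in>J - {j0}. z j * c j):] (m j0)"
      by (simp flip: s_diff_left)
    finally show ?thesis using fin j0 by (simp add: sum.remove)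
  qed
  have bij: "\<exists>w. z = w(j0 := w j0 - (\<Sum>j\<in>J - {j0}. w j * c j))" for z :: "nat => int"
  proof (intro exI[of _ "z(j0 := z j0 + (\<Sum>j\<in>J - {j0}. z j * c j))"] ext)
    fix k
    have "(\<Sum>j\<in>J - {j0}. (z(j0 := z j0 + (\<Sum>j\<in>J - {j0}. z j * c j))) j * c j) = (\<Sum>j\<in>J - {j0}. z j * c j)"
      by (intro sum.cong) auto
    then show "z k = ((z(j0 := z j0 + (\<Sum>j\<in>J - {j0}. z j * c j)))(j0 := (z(j0 := z j0 + (\<Sum>j\<in>J - {j0}. z j * c j))) j0 -
      (\<Sum>j\<in>J - {j0}. (z(j0 := z j0 + (\<Sum>j\<in>J - {j0}. z j * c j))) j * c j))) k" by simp
  qed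
  show "zspan K J m' = zspan K J m"
  proof (intro equalityI subsetI)
    fix x assume "x \<in> zspan K J m'"
    then obtain z where "x - (\<Sum>j\<in>J. s [:z j:] (m' j)) \<in> K" unfolding zspan_def by blast
    then show "x \<in> zspan K J m" unfolding zspan_def comb mem_Collect_eq
      by (rule exI[of _ "z(j0 := z j0 - (\<Sum>j\<in>J - {j0}. z j * c j))"])
  next
    fix x assume "x \<in> zspan K J m"
    then obtain z :: "nat => int" where z: "x - (\<Sum>j\<in>J. s [:z j:] (m j)) \<in> K" unfolding zspan_def by blast
    obtain w where "z = w(j0 := w j0 - (\<Sum>j\<in>J - {j0}. w j * c j))" using bij by blast
    then have "x - (\<Sum>j\<in>J. s [:w j:] (m' j)) \<in> K" using z comb[of w] by simp
    then show "x \<in> zspan K J m'" unfolding zspan_def by blast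
  qed
  show "zindep K J m' = zindep K J m"
  proof
    assume ind: "zindep K J m'"
    show "zindep K J m" unfolding zindep_def
    proof (intro allI impI)
      fix z :: "nat => int" assume z: "(\<Sum>j\<in>J. s [:z j:] (m j)) \<in> K"
      obtain w where w: "z = w(j0 := w j0 - (\<Sum>j\<in>J - {j0}. w j * c j))" using bij by blast
      then have "(\<Sum>j\<in>J. s [:w j:] (m' j)) \<in> K" using z comb[of w] by simp
      then have "\<forall>j\<in>J. w j = 0" using ind unfolding zindep_def by blast
      then show "\<forall>j\<in>J. z j = 0" unfolding w using j0 by simp
    qed
  next
    assume ind: "zindep K J m"
    show "zindep K J m'" unfolding zindep_def
    proof (intro allI impI)
      fix z :: "nat => int" assume "(\<Sum>j\<in>J. s [:z j:] (m' j)) \<in> K"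
      then have z: "\<forall>j\<in>J. (z(j0 := z j0 - (\<Sum>j\<in>J - {j0}. z j * c j))) j = 0"
        using ind unfolding comb zindep_def by blast
      have "z j = 0" if "j \<in> J - {j0}" for j using bspec[OF z, of j] that by auto
      then have other: "\<forall>j\<in>J - {j0}. z j = 0" by blast
      then have "(\<Sum>j\<in>J - {j0}. z j * c j) = 0" by (intro sum.neutral) auto
      then have "z j0 = 0" using z j0 by auto
      then show "\<forall>j\<in>J. z j = 0" using other by blast
    qed
  qed
qed

lemma zspan_closed:
  assumes K: "slat K" and fin: "finite J" and rel: "\<And>j. j \<in> J ==> s pi1 (m j) \<in> K"
  shows "x \<in> zspan K J m ==> y \<in> zspan K J m ==> x + y \<in> zspan K J m"
    "x \<in> zspan K J m ==> s q x \<in> zspan K J m" "K \<subseteq> zspan K J m" "j \<in> J ==> m j \<in> zspan K J m"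
proof -
  show add: "x + y \<in> zspan K J m" if xy: "x \<in> zspan K J m" "y \<in> zspan K J m" for x y
  proof -
    obtain z w :: "nat => int" where zw: "x - (\<Sum>j\<in>J. s [:z j:] (m j)) \<in> K" "y - (\<Sum>j\<in>J. s [:w j:] (m j)) \<in> K"
      using xy unfolding zspan_def by blast
    have "x + y - (\<Sum>j\<in>J. s [:z j + w j:] (m j)) = (x - (\<Sum>j\<in>J. s [:z j:] (m j))) + (y - (\<Sum>j\<in>J. s [:w j:] (m j)))"
      by (simp only: const_add s_add_left sum.distrib) (simp add: algebra_simps)
    then have "x + y - (\<Sum>j\<in>J. s [:z j + w j:] (m j)) \<in> K" using slatD(2)[OF K zw] by (simp only:)
    then show ?thesis unfolding zspan_def mem_Collect_eq by (rule exI[of _ "\<lambda>j. z j + w j"])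
  qed
  show "s q x \<in> zspan K J m" if x: "x \<in> zspan K J m"
  proof -
    obtain z :: "nat => int" where z: "x - (\<Sum>j\<in>J. s [:z j:] (m j)) \<in> K" using x unfolding zspan_def by blast
    obtain g where g: "q = [:poly q 1:] + pi1 * g" using poly_eq_const_plus_pi1 by blast
    have qm: "s q (m j) - s [:poly q 1:] (m j) \<in> K" if "j \<in> J" for j
    proof -
      have "s q (m j) - s [:poly q 1:] (m j) = s (q - [:poly q 1:]) (m j)" by (simp only: s_diff_left)
      also have "q - [:poly q 1:] = g * pi1" using g by (metis add_diff_cancel_left' mult.commute)
      finally show ?thesis using slatD(3)[OF K rel[OF that]] by (simp add: s_mult)
    qed
    have "s q x - (\<Sum>j\<in>J. s [:poly q 1 * z j:] (m j)) =
      s q (x - (\<Sum>j\<in>J. s [:z j:] (m j))) + (\<Sum>j\<in>J. s [:z j:] (s q (m j) - s [:poly q 1:] (m j)))"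
    proof -
      have "s [:poly q 1 * z j:] (m j) = s [:z j:] (s [:poly q 1:] (m j))" for j
        unfolding s_mult[symmetric] by (simp add: mult.commute)
      moreover have "s q (s [:z j:] (m j)) = s [:z j:] (s q (m j))" for j unfolding s_mult[symmetric] by (simp only: mult.commute)
      ultimately show ?thesis by (simp add: s_diff_right s_sum_right sum_subtractf)
    qed
    also have "\<dots> \<in> K" using qm by (intro slatD(2)[OF K] slatD(3)[OF K] z slat_sum[OF K])
    finally show ?thesis unfolding zspan_def mem_Collect_eq by (rule exI[of _ "\<lambda>j. poly q 1 * z j"])
  qed
  show "K \<subseteq> zspan K J m"
  proof
    fix x assume "x \<in> K"
    then have "x - (\<Sum>j\<in>J. s [:0:] (m j)) \<in> K" by simp
    then show "x \<in> zspan K J m" unfolding zspan_def mem_Collect_eq by (rule exI[of _ "\<lambda>_. 0"])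
  qed
  show "m j \<in> zspan K J m" if j: "j \<in> J"
  proof -
    have "(\<Sum>k\<in>J. s [:if k = j then 1 else 0:] (m k)) = (\<Sum>k\<in>J. if k = j then m k else 0)"
      by (intro sum.cong) (auto simp: one_pCons[symmetric])
    also have "\<dots> = m j" using fin j by simp
    finally have "m j - (\<Sum>k\<in>J. s [:if k = j then 1 else 0:] (m k)) \<in> K" using slatD(1)[OF K] by simp
    then show ?thesis unfolding zspan_def mem_Collect_eq by (rule exI[of _ "\<lambda>k. if k = j then 1 else 0"])
  qed
qed

end

lemma cg_pi1_of_dvd:
  assumes "int p dvd poly a 1"
  shows "\<exists>h. cg p a (pi1 * h)"
proof -
  obtain g where g: "a = [:poly a 1:] + pi1 * g" using poly_eq_const_plus_pi1 by blast
  obtain k where "poly a 1 = int p * k" using assms by auto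
  then have "a = [:int p:] * [:k:] + pi1 * g" using g by simp
  moreover obtain h where "cg p [:int p:] (pi1 * h)" using cg_p_pi1 by blast
  then have "cg p ([:int p:] * [:k:] + pi1 * g) (pi1 * h * [:k:] + pi1 * g)" by (intro cg_add cg_mult cg_refl)
  ultimately have "cg p a (pi1 * (h * [:k:] + g))" by (simp only: distrib_left mult.assoc)
  then show ?thesis by blast
qed

lemma diff_self_left: "a - b - a = - (b :: 'b::ab_group_add)"
  by simp

lemma diff_eq_imp_eq_add: "a - b = c ==> a = b + (c :: 'b::ab_group_add)" "a - b = c ==> b = a - c"
  by (auto simp: algebra_simps)

lemma add_diff_swap: "a + (y - c) = y + (a + b) - (b + (c :: 'b::ab_group_add))"
  by (simp add: algebra_simps)

lemma (in pmod) zindepD: "zindep K J m ==> (\<Sum>j\<in>J. s [:z j:] (m j)) \<in> K ==> \<forall>j\<in>J. z j = 0"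
  unfolding zindep_def by blast

text \<open>The extension is governed by the elements \<open>pact t pi1 (m j)\<close> of
  \<open>K\<close> modulo \<open>pi1\<close>, vectors over the field with \<open>p\<close> elements.
  If all are zero, the extension splits. Otherwise a nonzero coordinate is normalised to a unit, so
  that some \<open>v = pact t pi1 \<mu>\<close> belongs to a basis of \<open>K\<close>; then
  \<open>\<mu>\<close> generates a regular summand, and induction treats the rest.\<close>

lemma ex_gbasis:
  fixes t :: "('a => int) => ('a => int)" and K :: "('a => int) set"
  assumes t: "addmap t" and p: "prime p"
    and "pmod.slat (pact t) p K" "pmod.sbasis (pact t) p I e K" "finite J"
    and "pmod.zindep (pact t) K J m" "\<And>j. j \<in> J ==> pact t pi1 (m j) \<in> K"
  shows "\<exists>Ts Rs Cs. gbasis t p (pmod.zspan (pact t) K J m) Ts Rs Cs"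
proof -
  interpret pmod "pact t" p by (rule pmod_pact[OF t p])
  let ?P = "pact t"
  show ?thesis using assms(3-7)
  proof (induction "card J" arbitrary: J K I e m rule: less_induct)
    case less
    note K = less.prems(1) and B = less.prems(2) and fin = less.prems(3) and ind = less.prems(4) and rel = less.prems(5)
    note finI = sbasisD(1)[OF B]
    have "\<exists>q. ?P pi1 (m j) = (\<Sum>i\<in>I. ?P (q i) (e i))" if "j \<in> J" for j using sbasisD(3)[OF B rel[OF that]] .
    then obtain G where G: "\<And>j. j \<in> J ==> ?P pi1 (m j) = (\<Sum>i\<in>I. ?P (G j i) (e i))" by metis
    show ?case
    proof (cases "\<forall>j\<in>J. \<forall>i\<in>I. int p dvd poly (G j i) 1")
      case True
      then have "\<exists>h. cg p (G j i) (pi1 * h)" if "j \<in> J" "i \<in> I" for j i using cg_pi1_of_dvd that by blast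
      then obtain H where H: "\<And>j i. j \<in> J ==> i \<in> I ==> cg p (G j i) (pi1 * H j i)" by metis
      \<comment> \<open>Every class is zero: subtracting the quotient of
        \<open>pact t pi1 (m j)\<close> by \<open>pi1\<close> turns \<open>m j\<close> into a vector
        fixed by \<open>t\<close>.\<close>
      define m' where "m' j = m j - (\<Sum>i\<in>I. ?P (H j i) (e i))" for j
      have HK: "(\<Sum>i\<in>I. ?P (H j i) (e i)) \<in> K" for j by (intro slat_sum[OF K] slatD(3)[OF K] sbasisD(2)[OF B])
      have fixed: "?P pi1 (m' j) = 0" if j: "j \<in> J" for j
      proof -
        have "?P pi1 (m' j) = (\<Sum>i\<in>I. ?P (G j i) (e i)) - (\<Sum>i\<in>I. ?P (pi1 * H j i) (e i))"
          unfolding m'_def by (simp only: s_diff_right G[OF j] s_sum_right s_mult)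
        also have "(\<Sum>i\<in>I. ?P (pi1 * H j i) (e i)) = (\<Sum>i\<in>I. ?P (G j i) (e i))"
          using slat_cg[OF K sbasisD(2)[OF B] H[OF j]] by (intro sum.cong) auto
        finally show ?thesis by (simp only: diff_self)
      qed
      have shift: "m' j - m j \<in> K" for j
      proof -
        have "m' j - m j = - (\<Sum>i\<in>I. ?P (H j i) (e i))" unfolding m'_def by (rule diff_self_left)
        then show ?thesis using slat_uminus[OF K HK[of j]] by (simp only:)
      qed
      have span: "zspan K J m' = zspan K J m" and indep: "zindep K J m'"
        using zspan_shift[OF K, of J m' m] shift ind by auto
      have rel': "?P pi1 (m' j) \<in> K" if "j \<in> J" for j using fixed[OF that] slatD(1)[OF K] by (simp only:)
      obtain js where js: "set js = J" "distinct js" using finite_distinct_list[OF fin] by blast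
      obtain ks where ks: "set ks = I" "distinct ks" using finite_distinct_list[OF finI] by blast
      have "gbasis t p (zspan K J m') (map m' js) [] (map e ks)" unfolding gbasis_def
      proof (intro conjI ballI allI impI)
        fix x assume "x \<in> zspan K J m'"
        then obtain z :: "nat => int" where "x - (\<Sum>j\<in>J. ?P [:z j:] (m' j)) \<in> K" unfolding zspan_def by blast
        then obtain q where "x - (\<Sum>j\<in>J. ?P [:z j:] (m' j)) = (\<Sum>i\<in>I. ?P (q i) (e i))" using sbasisD(3)[OF B] by blast
        from diff_eq_imp_eq_add(1)[OF this]
        have "x = (\<Sum>j\<in>J. ?P [:z j:] (m' j)) + 0 + (\<Sum>i\<in>I. ?P (q i) (e i))" by (simp only: add_0_right)
        then have "x = psum t (map (\<lambda>j. [:z j:]) js) (map m' js) + psum t [] [] + psum t (map q ks) (map e ks)"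
          unfolding psum_map[OF js(2)] psum_map[OF ks(2)] js(1) ks(1) by (simp only: psum.simps)
        then show "\<exists>a b c. length a = length (map m' js) \<and> length b = length [] \<and> length c = length (map e ks) \<and>
            x = psum t a (map m' js) + psum t b [] + psum t c (map e ks)"
          by (intro exI[of _ "map (\<lambda>j. [:z j:]) js"] exI[of _ "[]"] exI[of _ "map q ks"]) simp
      next
        fix a b c assume len: "length a = length (map m' js)" "length b = length []" "length c = length (map e ks)"
          and 0: "psum t a (map m' js) + psum t b [] + psum t c (map e ks) = 0"
        obtain qa where qa: "a = map qa js" using list_as_map[OF js(2), of a] len by auto
        obtain qc where qc: "c = map qc ks" using list_as_map[OF ks(2), of c] len by auto
        have b: "b = []" using len by simp
        have s0: "(\<Sum>j\<in>J. ?P (qa j) (m' j)) + (\<Sum>i\<in>I. ?P (qc i) (e i)) = 0"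
          using 0 unfolding qa qc b psum_map[OF js(2)] psum_map[OF ks(2)] js(1) ks(1) by (simp only: psum.simps add_0_right)
        have const: "?P (qa j) (m' j) = ?P [:poly (qa j) 1:] (m' j)" if j: "j \<in> J" for j
        proof -
          obtain g where "qa j = [:poly (qa j) 1:] + pi1 * g" using poly_eq_const_plus_pi1 by blast
          then have "qa j = [:poly (qa j) 1:] + g * pi1" by (simp only: mult.commute)
          from arg_cong[OF this, of "\<lambda>q. ?P q (m' j)"]
          have "?P (qa j) (m' j) = ?P [:poly (qa j) 1:] (m' j) + ?P g (?P pi1 (m' j))" by (simp only: s_add_left s_mult)
          then show ?thesis unfolding fixed[OF j] by (simp only: s_zero_right add_0_right)
        qed
        have "(\<Sum>j\<in>J. ?P [:poly (qa j) 1:] (m' j)) = (\<Sum>j\<in>J. ?P (qa j) (m' j))"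
          by (intro sum.cong refl) (rule const[symmetric])
        also have "\<dots> = - (\<Sum>i\<in>I. ?P (qc i) (e i))" using s0 by (simp only: eq_neg_iff_add_eq_0)
        also have "\<dots> \<in> K" by (intro slat_uminus[OF K] slat_sum[OF K] slatD(3)[OF K] sbasisD(2)[OF B])
        finally have z0: "\<forall>j\<in>J. poly (qa j) 1 = 0" by (rule zindepD[OF indep])
        show "pi1 dvd q" if "q \<in> set a" for q
        proof -
          from that obtain j where "j \<in> J" "q = qa j" using qa js by auto
          then have "q = [:0:] + pi1 * g ==> pi1 dvd q" "poly q 1 = 0" for g using z0 by auto
          then show ?thesis using poly_eq_const_plus_pi1[of q] by auto
        qed
        show "1 - X1 ^ p dvd q" if "q \<in> set b" for q using that b by simp
        have "?P (qa j) (m' j) = 0" if "j \<in> J" for j using const[OF that] z0 that by (simp only: pCons_0_0 s_zero_left)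
        then have "(\<Sum>j\<in>J. ?P (qa j) (m' j)) = 0" by (rule sum.neutral[OF ballI])
        then have "(\<Sum>i\<in>I. ?P (qc i) (e i)) = 0" using s0 by (simp only: add_0)
        then show "Phi p dvd q" if "q \<in> set c" for q using sbasisD(4)[OF B] that qc ks by (auto simp: cg_0_iff)
      next
        show "pact t pi1 v = 0" if "v \<in> set (map m' js)" for v using that fixed js by auto
        show "pact t (Phi p) v = 0" if "v \<in> set (map e ks)" for v
        proof -
          from that obtain i where "i \<in> I" "v = e i" using ks by auto
          then show ?thesis using slatD(4)[OF K sbasisD(2)[OF B]] by blast
        qed
        show "set (map m' js) \<union> set [] \<union> set (map e ks) \<subseteq> zspan K J m'"
        proof -
          have "m' j \<in> zspan K J m'" if "j \<in> J" for j by (rule zspan_closed(4)[where m = m' and J = J, OF K fin rel' that])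
          moreover have "e i \<in> zspan K J m'" if "i \<in> I" for i
            using zspan_closed(3)[where m = m' and J = J, OF K fin rel'] sbasisD(2)[OF B that] by blast
          ultimately show ?thesis using js ks by auto
        qed
      qed simp
      then show ?thesis unfolding span by blast
    next
      case False
      then obtain j0 i0 where j0: "j0 \<in> J" and i0: "i0 \<in> I" and nd: "\<not> int p dvd poly (G j0 i0) 1" by blast
      define c where "c = poly (G j0 i0) 1"
      obtain u w g1 where uw: "cg p (u * w) 1" and u: "cg p u ([:c:] + pi1 * g1)"
        using Phi_unit_residue[OF p nd] unfolding c_def by blast
      obtain g2 where g2: "G j0 i0 = [:c:] + pi1 * g2" using poly_eq_const_plus_pi1[of "G j0 i0"] unfolding c_def by blast
      \<comment> \<open>The coordinate and the unit \<open>u\<close> have the same residue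
        \<open>c\<close>. Shifting \<open>m j0\<close> by \<open>h\<close> times \<open>e i0\<close>
        changes the coordinate by \<open>pi1 * h\<close>, which makes it congruent to
        \<open>u\<close>.\<close>
      define h where "h = g2 - g1"
      have Gu: "cg p (G j0 i0 - pi1 * h) u"
      proof -
        have "G j0 i0 - pi1 * h = [:c:] + pi1 * g1" unfolding g2 h_def by (simp add: algebra_simps)
        then show ?thesis using cg_sym[OF u] by simp
      qed
      \<comment> \<open>Its coefficient at \<open>e i0\<close> is a unit, so \<open>v\<close> can
        replace \<open>e i0\<close> in the basis of \<open>K\<close>.\<close>
      define v where "v = ?P u (e i0) + (\<Sum>i\<in>I - {i0}. ?P (G j0 i) (e i))"
      define e' where "e' = e(i0 := v)"
      have B': "sbasis I e' K" unfolding e'_def v_def by (rule sbasis_replace[OF K B i0 uw])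
      have vK: "v \<in> K" using sbasisD(2)[OF B' i0] by (simp add: e'_def)
      define \<mu> where "\<mu> = m j0 - ?P h (e i0)"
      have \<mu>: "?P pi1 \<mu> = v"
      proof -
        have "?P pi1 \<mu> = (\<Sum>i\<in>I. ?P (G j0 i) (e i)) - ?P (pi1 * h) (e i0)"
          unfolding \<mu>_def by (simp only: s_diff_right G[OF j0] s_mult)
        also have "\<dots> = ?P (G j0 i0 - pi1 * h) (e i0) + (\<Sum>i\<in>I - {i0}. ?P (G j0 i) (e i))"
          unfolding sum.remove[OF finI i0] s_diff_left by (simp only: add_diff_eq diff_add_eq)
        also have "?P (G j0 i0 - pi1 * h) (e i0) = ?P u (e i0)" by (rule slat_cg[OF K sbasisD(2)[OF B i0] Gu])
        finally show ?thesis by (simp only: v_def)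
      qed
      define m1 where "m1 = m(j0 := \<mu>)"
      have "m1 j - m j \<in> K" for j
      proof (cases "j = j0")
        case True
        have "m1 j - m j = - ?P h (e i0)" unfolding m1_def \<mu>_def True fun_upd_same by (rule diff_self_left)
        then show ?thesis using slat_uminus[OF K slatD(3)[OF K sbasisD(2)[OF B i0], of h]] by (simp only:)
      next
        case False
        then have "m1 j - m j = 0" by (simp only: m1_def fun_upd_other not_False_eq_True diff_self)
        then show ?thesis using slatD(1)[OF K] by (simp only:)
      qed
      then have s1: "zspan K J m1 = zspan K J m" "zindep K J m1 = zindep K J m" using zspan_shift[OF K, of J m1 m] by blast+
      have "\<exists>q. ?P pi1 (m j) = (\<Sum>i\<in>I. ?P (q i) (e' i))" if "j \<in> J" for j using sbasisD(3)[OF B' rel[OF that]] .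
      then obtain G' where G': "\<And>j. j \<in> J ==> ?P pi1 (m j) = (\<Sum>i\<in>I. ?P (G' j i) (e' i))" by metis
      define d where "d j = poly (G' j i0) 1" for j
      have "\<exists>g. G' j i0 = [:d j:] + pi1 * g" for j unfolding d_def by (rule poly_eq_const_plus_pi1)
      then obtain hh where hh: "\<And>j. G' j i0 = [:d j:] + pi1 * hh j" by metis
      \<comment> \<open>The \<open>v\<close>-coordinate of \<open>pact t pi1 (m j)\<close> is
        \<open>d j + pi1 * hh j\<close>. The integer part is removed by subtracting a multiple of
        \<open>\<mu>\<close>, the rest by subtracting a multiple of \<open>v\<close>.\<close>
      define m2 where "m2 = (\<lambda>j. m1 j - ?P [:d j:] (m1 j0))(j0 := m1 j0)"
      have s2: "zspan K J m2 = zspan K J m1" "zindep K J m2 = zindep K J m1"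
        by (rule zspan_shear[OF fin j0, of m2 m1 d]; simp add: m2_def)+
      define m3 where "m3 = (\<lambda>j. m2 j - ?P (hh j) v)(j0 := \<mu>)"
      have m3j0: "m3 j0 = \<mu>" by (simp only: m3_def fun_upd_same)
      have "m3 j - m2 j \<in> K" for j
      proof (cases "j = j0")
        case True
        then have "m3 j - m2 j = 0" by (simp only: m3_def m2_def m1_def fun_upd_same diff_self)
        then show ?thesis using slatD(1)[OF K] by (simp only:)
      next
        case False
        then have "m3 j - m2 j = - ?P (hh j) v" unfolding m3_def by (simp only: fun_upd_other not_False_eq_True diff_self_left )
        then show ?thesis using slat_uminus[OF K slatD(3)[OF K vK, of "hh j"]] by (simp only:)
      qed
      then have s3: "zspan K J m3 = zspan K J m2" "zindep K J m3 = zindep K J m2" using zspan_shift[OF K, of J m3 m2] by blast+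
      have span3: "zspan K J m3 = zspan K J m" and ind3: "zindep K J m3" using s1 s2 s3 ind by (simp_all only:)
      define K' where "K' = {x. \<exists>q. x = (\<Sum>i\<in>I - {i0}. ?P (q i) (e' i))}"
      have K': "slat K'" "sbasis (I - {i0}) e' K'" "K' \<subseteq> K"
        unfolding K'_def by (rule sbasis_subset[OF K B' Diff_subset])+
      define J' where "J' = J - {j0}"
      have finJ': "finite J'" using fin by (simp add: J'_def)
      have rel3: "?P pi1 (m3 j) \<in> K'" if j: "j \<in> J'" for j
      proof -
        have jj: "j \<noteq> j0" "j \<in> J" using j by (auto simp: J'_def)
        have m3j: "m3 j = m j - ?P [:d j:] \<mu> - ?P (hh j) v" using jj by (simp only: m3_def m2_def m1_def fun_upd_other not_False_eq_True fun_upd_same )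
        have "?P pi1 (m3 j) = ?P pi1 (m j) - ?P [:d j:] (?P pi1 \<mu>) - ?P (pi1 * hh j) v"
          unfolding m3j s_diff_right s_mult[symmetric] by (simp only: mult.commute)
        also have "\<dots> = (\<Sum>i\<in>I. ?P (G' j i) (e' i)) - ?P ([:d j:] + pi1 * hh j) v"
          unfolding G'[OF jj(2)] \<mu> s_add_left by (simp only: diff_diff_eq)
        also have "\<dots> = (\<Sum>i\<in>I - {i0}. ?P (G' j i) (e' i))"
          unfolding sum.remove[OF finI i0] hh[symmetric] by (simp only: e'_def fun_upd_same add_diff_cancel_left')
        finally show ?thesis unfolding K'_def by blast
      qed
      have ind3': "zindep K' J' m3" unfolding zindep_def
      proof (intro allI impI)
        fix z :: "nat => int" assume z: "(\<Sum>j\<in>J'. ?P [:z j:] (m3 j)) \<in> K'"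
        have "(\<Sum>j\<in>J. ?P [:(z(j0 := 0)) j:] (m3 j)) = ?P 0 (m3 j0) + (\<Sum>j\<in>J'. ?P [:(z(j0 := 0)) j:] (m3 j))"
          unfolding J'_def sum.remove[OF fin j0] by (simp only: fun_upd_same pCons_0_0)
        also have "(\<Sum>j\<in>J'. ?P [:(z(j0 := 0)) j:] (m3 j)) = (\<Sum>j\<in>J'. ?P [:z j:] (m3 j))"
          by (intro sum.cong) (auto simp: J'_def)
        finally have "(\<Sum>j\<in>J. ?P [:(z(j0 := 0)) j:] (m3 j)) \<in> K" using z K'(3) by (simp only: s_zero_left add_0 subsetD)
        note z0 = zindepD[OF ind3 this]
        show "\<forall>j\<in>J'. z j = 0"
        proof
          fix j assume "j \<in> J'"
          then show "z j = 0" using bspec[OF z0, of j] by (auto simp: J'_def)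
        qed
      qed
      have "card J' < card J" unfolding J'_def using fin j0 by (meson card_Diff1_less)
      then obtain Ts Rs Cs where gb: "gbasis t p (zspan K' J' m3) Ts Rs Cs"
        using less.hyps[OF _ K'(1,2) finJ' ind3' rel3] by blast
      have relK3: "?P pi1 (m3 j) \<in> K" if "j \<in> J" for j
      proof (cases "j = j0")
        case True
        then show ?thesis using vK \<mu> m3j0 by (simp only:)
      next
        case False
        then show ?thesis using rel3[of j] that K'(3) by (auto simp: J'_def)
      qed
      have sub: "zspan K' J' m3 \<subseteq> zspan K J m3"
      proof
        fix x assume "x \<in> zspan K' J' m3"
        then obtain z :: "nat => int" where z: "x - (\<Sum>j\<in>J'. ?P [:z j:] (m3 j)) \<in> K'" unfolding zspan_def by blast
        have "(\<Sum>j\<in>J. ?P [:(z(j0 := 0)) j:] (m3 j)) = ?P 0 (m3 j0) + (\<Sum>j\<in>J'. ?P [:(z(j0 := 0)) j:] (m3 j))"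
          unfolding J'_def sum.remove[OF fin j0] by (simp only: fun_upd_same pCons_0_0)
        also have "(\<Sum>j\<in>J'. ?P [:(z(j0 := 0)) j:] (m3 j)) = (\<Sum>j\<in>J'. ?P [:z j:] (m3 j))"
          by (intro sum.cong) (auto simp: J'_def)
        finally have "x - (\<Sum>j\<in>J. ?P [:(z(j0 := 0)) j:] (m3 j)) \<in> K" using z K'(3) by (simp only: s_zero_left add_0 subsetD)
        then show "x \<in> zspan K J m3" unfolding zspan_def mem_Collect_eq by (rule exI[of _ "z(j0 := 0)"])
      qed
      have "gbasis t p (zspan K J m3) Ts (\<mu> # Rs) Cs" unfolding gbasis_def
      proof (intro conjI ballI allI impI)
        fix x assume "x \<in> zspan K J m3"
        then obtain z :: "nat => int" where z: "x - (\<Sum>j\<in>J. ?P [:z j:] (m3 j)) \<in> K" unfolding zspan_def by blast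
        then obtain q where q: "x - (\<Sum>j\<in>J. ?P [:z j:] (m3 j)) = (\<Sum>i\<in>I. ?P (q i) (e' i))" using sbasisD(3)[OF B'] by blast
        define y where "y = (\<Sum>j\<in>J'. ?P [:z j:] (m3 j)) + (\<Sum>i\<in>I - {i0}. ?P (q i) (e' i))"
        define r where "r = [:z j0:] + q i0 * pi1"
        have "x = (\<Sum>j\<in>J. ?P [:z j:] (m3 j)) + (\<Sum>i\<in>I. ?P (q i) (e' i))" by (rule diff_eq_imp_eq_add(1)[OF q])
        also have "\<dots> = y + ?P r \<mu>"
          unfolding sum.remove[OF fin j0] sum.remove[OF finI i0] y_def J'_def r_def s_add_left s_mult \<mu> m3j0 e'_def fun_upd_same
          by (simp only: add.assoc add.commute add.left_commute)
        finally have x: "x = y + ?P r \<mu>" .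
        have "y - (\<Sum>j\<in>J'. ?P [:z j:] (m3 j)) \<in> K'" unfolding y_def K'_def add_diff_cancel_left' by blast
        then have "y \<in> zspan K' J' m3" unfolding zspan_def by blast
        then obtain a b c where abc: "length a = length Ts" "length b = length Rs" "length c = length Cs"
          "y = psum t a Ts + psum t b Rs + psum t c Cs" using gb unfolding gbasis_def by blast
        have "x = psum t a Ts + psum t (r # b) (\<mu> # Rs) + psum t c Cs"
          unfolding x abc(4) psum.simps by (simp only: add.assoc add.commute add.left_commute)
        then show "\<exists>a b c. length a = length Ts \<and> length b = length (\<mu> # Rs) \<and> length c = length Cs \<and>
            x = psum t a Ts + psum t b (\<mu> # Rs) + psum t c Cs"
          using abc by (intro exI[of _ a] exI[of _ "r # b"] exI[of _ c]) simp
      next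
        fix a b c assume len: "length a = length Ts" "length b = length (\<mu> # Rs)" "length c = length Cs"
          and 0: "psum t a Ts + psum t b (\<mu> # Rs) + psum t c Cs = 0"
        obtain q b' where b: "b = q # b'" using len by (cases b) auto
        have len': "length b' = length Rs" using len b by simp
        define y where "y = psum t a Ts + psum t b' Rs + psum t c Cs"
        have y0: "y + ?P q \<mu> = 0" using 0 unfolding b psum.simps y_def by (simp only: add.assoc add.commute add.left_commute)
        let ?Z = "zspan K' J' m3"
        have cl: "x \<in> ?Z ==> y \<in> ?Z ==> x + y \<in> ?Z" "x \<in> ?Z ==> ?P q x \<in> ?Z" "K' \<subseteq> ?Z" for x y q
          using zspan_closed(1-3)[where m = m3 and J = J', OF K'(1) finJ' rel3] by blast+
        have psum_in: "psum t qs vs \<in> zspan K' J' m3" if "set vs \<subseteq> zspan K' J' m3" for qs vs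
          using that
        proof (induction vs arbitrary: qs)
          case Nil
          show ?case unfolding psum.simps using cl(3) slatD(1)[OF K'(1)] by blast
        next
          case (Cons v vs)
          note IHvs = Cons.IH and Cons_prems = Cons.prems
          show ?case
          proof (cases qs)
            case Nil
            then show ?thesis unfolding Nil psum.simps using cl(3) slatD(1)[OF K'(1)] by blast
          next
            case (Cons q qs')
            show ?thesis unfolding Cons psum.simps using IHvs[of qs'] Cons_prems by (intro cl(1) cl(2)) auto
          qed
        qed
        have "set Ts \<union> set Rs \<union> set Cs \<subseteq> zspan K' J' m3" using gb unfolding gbasis_def by blast
        then have "y \<in> zspan K' J' m3" unfolding y_def by (intro cl(1) psum_in) auto
        then obtain z :: "nat => int" where z: "y - (\<Sum>j\<in>J'. ?P [:z j:] (m3 j)) \<in> K'" unfolding zspan_def by blast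
        then obtain r where r: "y - (\<Sum>j\<in>J'. ?P [:z j:] (m3 j)) = (\<Sum>i\<in>I - {i0}. ?P (r i) (e' i))" unfolding K'_def by blast
        obtain q' where "q = [:poly q 1:] + pi1 * q'" using poly_eq_const_plus_pi1 by blast
        then have q': "q = [:poly q 1:] + q' * pi1" by (simp only: mult.commute)
        have Pq: "?P q \<mu> = ?P [:poly q 1:] \<mu> + ?P q' v"
          using arg_cong[OF q', of "\<lambda>q. ?P q \<mu>"] by (simp only: s_add_left s_mult \<mu>)
        have "(\<Sum>j\<in>J. ?P [:(z(j0 := poly q 1)) j:] (m3 j)) = ?P [:poly q 1:] \<mu> + (\<Sum>j\<in>J'. ?P [:(z(j0 := poly q 1)) j:] (m3 j))"
          unfolding J'_def sum.remove[OF fin j0] by (simp only: fun_upd_same m3j0)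
        also have "(\<Sum>j\<in>J'. ?P [:(z(j0 := poly q 1)) j:] (m3 j)) = (\<Sum>j\<in>J'. ?P [:z j:] (m3 j))"
          by (intro sum.cong) (auto simp: J'_def)
        also have "(\<Sum>j\<in>J'. ?P [:z j:] (m3 j)) = y - (\<Sum>i\<in>I - {i0}. ?P (r i) (e' i))" by (rule diff_eq_imp_eq_add(2)[OF r])
        finally have S: "(\<Sum>j\<in>J. ?P [:(z(j0 := poly q 1)) j:] (m3 j)) = ?P [:poly q 1:] \<mu> + (y - (\<Sum>i\<in>I - {i0}. ?P (r i) (e' i)))" .
        also have "\<dots> = (y + ?P q \<mu>) - (?P q' v + (\<Sum>i\<in>I - {i0}. ?P (r i) (e' i)))"
          unfolding Pq by (rule add_diff_swap)
        also have "\<dots> = - (?P q' v + (\<Sum>i\<in>I - {i0}. ?P (r i) (e' i)))" unfolding y0 by (simp only: diff_0)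
        finally have S': "(\<Sum>j\<in>J. ?P [:(z(j0 := poly q 1)) j:] (m3 j)) = - (?P q' v + (\<Sum>i\<in>I - {i0}. ?P (r i) (e' i)))" .
        also have "\<dots> \<in> K" using sbasisD(2)[OF B']
          by (intro slat_uminus[OF K] slatD(2)[OF K] slatD(3)[OF K] vK slat_sum[OF K]) auto
        finally have zz: "\<forall>j\<in>J. (z(j0 := poly q 1)) j = 0" by (rule zindepD[OF ind3])
        have q1: "poly q 1 = 0" using bspec[OF zz j0] by simp
        have "(\<Sum>j\<in>J. ?P [:(z(j0 := poly q 1)) j:] (m3 j)) = 0"
          using zz by (intro sum.neutral ballI) (simp only: pCons_0_0 s_zero_left)
        then have "?P q' v + (\<Sum>i\<in>I - {i0}. ?P (r i) (e' i)) = 0" using S' by (simp only: neg_equal_0_iff_equal)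
        moreover have "(\<Sum>i\<in>I. ?P ((r(i0 := q')) i) (e' i)) = ?P q' v + (\<Sum>i\<in>I - {i0}. ?P ((r(i0 := q')) i) (e' i))"
          unfolding sum.remove[OF finI i0] by (simp only: fun_upd_same e'_def)
        moreover have "(\<Sum>i\<in>I - {i0}. ?P ((r(i0 := q')) i) (e' i)) = (\<Sum>i\<in>I - {i0}. ?P (r i) (e' i))"
          by (intro sum.cong) auto
        ultimately have "(\<Sum>i\<in>I. ?P ((r(i0 := q')) i) (e' i)) = 0" by (simp only:)
        from sbasisD(4)[OF B' this i0] have cq': "cg p q' 0" by simp
        then obtain k where "q' = Phi p * k" unfolding cg_0_iff by auto
        \<comment> \<open>Divisibility by \<open>1 - X1 ^ p\<close> is obtained in two parts:
          \<open>pi1\<close> from independence modulo \<open>K\<close>, and \<open>Phi p\<close>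
          from independence inside \<open>K\<close>.\<close>
        then have "q = (1 - X1 ^ p) * k" using q' q1 pi1_mult_Phi[of p] by (metis add_0 mult.assoc mult.commute pCons_0_0)
        then have dq: "1 - X1 ^ p dvd q" by simp
        have "?P q' v = 0" using slat_cg[OF K vK cq'] by (simp only: s_zero_left)
        then have "?P q \<mu> = 0" using Pq q1 by (simp only: pCons_0_0 s_zero_left add_0)
        then have "y = 0" using y0 by (simp only: add_0_right)
        then have rest: "(\<forall>q\<in>set a. pi1 dvd q) \<and> (\<forall>q\<in>set b'. 1 - X1 ^ p dvd q) \<and> (\<forall>q\<in>set c. Phi p dvd q)"
          using gb len len' unfolding gbasis_def y_def by blast
        show "pi1 dvd q" if "q \<in> set a" for q using that rest by blast
        show "1 - X1 ^ p dvd q" if "q \<in> set b" for q using that rest dq b by auto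
        show "Phi p dvd q" if "q \<in> set c" for q using that rest by blast
      next
        show "pact t pi1 w = 0" if "w \<in> set Ts" for w using that gb unfolding gbasis_def by blast
        show "pact t (Phi p) w = 0" if "w \<in> set Cs" for w using that gb unfolding gbasis_def by blast
        have "?P (1 - X1 ^ p) \<mu> = ?P (Phi p) v"
          unfolding pi1_mult_Phi[symmetric] mult.commute[of pi1] s_mult \<mu> ..
        then have "?P (1 - X1 ^ p) \<mu> = 0" using slatD(4)[OF K vK] by (simp only:)
        then show "pact t (1 - X1 ^ p) w = 0" if "w \<in> set (\<mu> # Rs)" for w
          using that gb unfolding gbasis_def by auto
        have "\<mu> \<in> zspan K J m3" using zspan_closed(4)[where m = m3 and J = J, OF K fin relK3 j0] m3j0 by (simp only:)
        then show "set Ts \<union> set (\<mu> # Rs) \<union> set Cs \<subseteq> zspan K J m3" using gb sub unfolding gbasis_def by auto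
      qed
      then show ?thesis unfolding span3 by blast
    qed
  qed
qed

lemma ex_gbasis_lat:
  fixes M :: "nat => nat => int" and n :: nat
  defines "t \<equiv> tact n M"
  assumes p: "prime p" and per: "\<And>v. v \<in> lat n ==> (t ^^ p) v = v"
    and free: "pmod.sfree (pact t) p (normker t p (lat n))"
  shows "\<exists>Ts Rs Cs. gbasis t p (lat n) Ts Rs Cs"
proof -
  have at: "addmap t" unfolding t_def by (rule addmap_tact)
  have sub: "tsub t (lat n)" unfolding t_def by (rule tsub_lat)
  interpret pmod "pact t" p by (rule pmod_pact[OF at p])
  let ?K = "normker t p (lat n)"
  have K: "slat ?K" by (rule slat_normker[OF at p sub])
  obtain I b where b: "sbasis I b ?K" using free unfolding sfree_def by blast
  obtain e J where J: "J \<subseteq> {..<n}" and e: "zbasis {..<n} e (lat n)"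
    and ker: "\<And>z. pact t (Phi p) (zcomb {..<n} z e) = 0 \<longleftrightarrow> (\<forall>i\<in>{..<n} - J. z i = 0)"
    using lat_kernel_basis[OF addmap_pact[OF at, of "Phi p"], of n n] tsub_pact[OF sub] by metis
  let ?J = "{..<n} - J"
  have el: "e i \<in> lat n" if "i < n" for i using e that by (auto simp: zbasis_def)
  have comb: "(\<Sum>j\<in>?J. pact t [:z j:] (e j)) = zcomb {..<n} (\<lambda>i. if i \<in> ?J then z i else 0) e" for z
  proof -
    have "(\<Sum>j\<in>?J. pact t [:z j:] (e j)) = zcomb ?J z e" unfolding pact_const by (rule zcomb_eq_sum[symmetric]) simp
    also have "\<dots> = zcomb {..<n} (\<lambda>i. if i \<in> ?J then z i else 0) e"
    proof
      show "zcomb ?J z e k = zcomb {..<n} (\<lambda>i. if i \<in> ?J then z i else 0) e k" for k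
        unfolding zcomb_def by (intro sum.mono_neutral_cong_left) auto
    qed
    finally show ?thesis .
  qed
  have inlat: "zcomb {..<n} z e \<in> lat n" for z
    using el by (auto simp: lat_def zcomb_def intro!: sum.neutral)
  have span: "zspan ?K ?J e = lat n"
  proof (intro equalityI subsetI)
    fix x assume "x \<in> zspan ?K ?J e"
    then obtain z where "x - (\<Sum>j\<in>?J. pact t [:z j:] (e j)) \<in> ?K" unfolding zspan_def by blast
    then have "x - zcomb {..<n} (\<lambda>i. if i \<in> ?J then z i else 0) e \<in> lat n" unfolding comb by (simp only: normker_def mem_Collect_eq)
    from lat_closed(1)[OF this inlat[of "\<lambda>i. if i \<in> ?J then z i else 0"]] show "x \<in> lat n" by (simp only: diff_add_cancel)
  next
    fix x assume x: "x \<in> lat n"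
    then obtain z where z: "x = zcomb {..<n} z e" using e by (auto simp: zbasis_def)
    have d: "x - (\<Sum>j\<in>?J. pact t [:z j:] (e j)) = zcomb {..<n} (\<lambda>i. if i \<in> ?J then 0 else z i) e"
      unfolding comb z by (auto simp: zcomb_def fun_eq_iff sum_subtractf[symmetric] intro!: sum.cong)
    have "pact t (Phi p) (zcomb {..<n} (\<lambda>i. if i \<in> ?J then 0 else z i) e) = 0" unfolding ker by auto
    then have "x - (\<Sum>j\<in>?J. pact t [:z j:] (e j)) \<in> ?K" unfolding d normker_def using inlat by blast
    then show "x \<in> zspan ?K ?J e" unfolding zspan_def by blast
  qed
  have indep: "zindep ?K ?J e" unfolding zindep_def
  proof (intro allI impI)
    fix z :: "nat => int" assume "(\<Sum>j\<in>?J. pact t [:z j:] (e j)) \<in> ?K"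
    then have "pact t (Phi p) (zcomb {..<n} (\<lambda>i. if i \<in> ?J then z i else 0) e) = 0"
      unfolding comb normker_def by blast
    then show "\<forall>j\<in>?J. z j = 0" unfolding ker by auto
  qed
  have rel: "pact t pi1 (e j) \<in> ?K" if "j \<in> ?J" for j
  proof -
    have ej: "e j \<in> lat n" using el that by simp
    have "pact t (Phi p) (pact t pi1 (e j)) = pact t (pi1 * Phi p) (e j)" by (simp only: s_mult[symmetric] mult.commute)
    also have "\<dots> = e j - (t ^^ p) (e j)" unfolding pi1_mult_Phi by (simp only: s_diff_left s_one pact_X1_pow[OF at])
    also have "\<dots> = 0" using per[OF ej] by (simp only: diff_self)
    finally show ?thesis using tsub_pact[OF sub ej] by (simp add: normker_def)
  qed
  have fJ: "finite ?J" by simp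
  show ?thesis using ex_gbasis[OF at p K b fJ indep rel] unfolding span .
qed

section \<open>Integral bases and block matrices of cyclic summands\<close>

fun lc :: "int list => ('a => int) list => 'a => int" where
  "lc (z # zs) (w # ws) = zmul z w + lc zs ws"
| "lc _ _ = 0"

lemma lc_append: "length zs = length ws ==> lc (zs @ zs') (ws @ ws') = lc zs ws + lc zs' ws'"
proof (induction zs ws rule: list_induct2)
  case (Cons z zs w ws)
  then show ?case unfolding append_Cons lc.simps by (simp only: add.assoc)
qed (simp only: append_Nil lc.simps add_0)

lemma lc_nth: "length zs = length ws ==> lc zs ws k = (\<Sum>i<length ws. zs ! i * (ws ! i) k)"
proof (induction zs ws rule: list_induct2)
  case (Cons z zs w ws)
  then show ?case by (simp add: sum.lessThan_Suc_shift zmul_def del: sum.lessThan_Suc)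
qed simp

fun chain :: "('b => 'b) => nat => 'b => 'b list" where
  "chain t 0 v = []"
| "chain t (Suc d) v = v # chain t d (t v)"

lemma length_chain [simp]: "length (chain t d v) = d"
  by (induction d arbitrary: v) auto

lemma chain_nth: "j < d ==> chain t d v ! j = (t ^^ j) v"
proof (induction d arbitrary: v j)
  case (Suc d)
  then show ?case by (cases j) (simp_all add: funpow_swap1)
qed simp

lemma lc_chain: "length zs = d ==> lc zs (chain t d v) = pact t (Poly zs) v"
proof (induction zs arbitrary: d v)
  case (Cons z zs)
  then show ?case by (cases d) (simp_all add: pact_pCons)
qed simp

lemma monic_division:
  fixes m q :: "int poly"
  assumes "lead_coeff m = 1"
  shows "\<exists>r. m dvd q - r \<and> (r = 0 \<or> degree r < degree m)"
proof -
  obtain f r where fr: "pseudo_divmod q m = (f, r)" by fastforce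
  have "m \<noteq> 0" using assms by auto
  from pseudo_divmod[OF this fr] have "q = m * f + r" "r = 0 \<or> degree r < degree m" using assms by auto
  then show ?thesis by (intro exI[of _ r]) auto
qed

text \<open>Division by the monic \<open>m\<close> turns a polynomial coefficient into
  \<open>d\<close> integer coefficients on the chain of \<open>v\<close>. Conversely,
  \<open>d\<close> integers form a polynomial of degree below \<open>d\<close>, which
  \<open>m\<close> divides only if it is zero.\<close>

lemma lc_concat_chain:
  fixes t :: "('a => int) => ('a => int)"
  assumes at: "addmap t" and m: "lead_coeff m = 1" "degree m = d" "d > 0"
    and kill: "\<forall>v\<in>set vs. pact t m v = 0"
  shows "length qs = length vs ==> \<exists>zs. length zs = length (concat (map (chain t d) vs)) \<and> psum t qs vs = lc zs (concat (map (chain t d) vs))"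
    and "length zs = length (concat (map (chain t d) vs)) ==>
      \<exists>qs. length qs = length vs \<and> psum t qs vs = lc zs (concat (map (chain t d) vs)) \<and>
        ((\<forall>q\<in>set qs. m dvd q) \<longrightarrow> (\<forall>z\<in>set zs. z = 0))"
proof -
  show "\<exists>zs. length zs = length (concat (map (chain t d) vs)) \<and> psum t qs vs = lc zs (concat (map (chain t d) vs))"
    if "length qs = length vs"
    using that kill
  proof (induction qs vs rule: list_induct2)
    case Nil
    show ?case by simp
  next
    case (Cons q qs v vs)
    then obtain zs where zs: "length zs = length (concat (map (chain t d) vs))" "psum t qs vs = lc zs (concat (map (chain t d) vs))"
      by auto
    obtain r k where k: "q = r + k * m" and r: "r = 0 \<or> degree r < d"
      using monic_division[OF m(1), of q] unfolding m(2) dvd_def by (metis diff_add_cancel add.commute mult.commute)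
    define ys where "ys = map (coeff r) [0..<d]"
    have "Poly ys = r"
    proof (rule poly_eqI)
      fix i
      show "coeff (Poly ys) i = coeff r i"
        using r by (auto simp: ys_def coeff_Poly_eq nth_default_def coeff_eq_0)
    qed
    then have "lc ys (chain t d v) = pact t r v" using lc_chain[of ys d t v] by (simp add: ys_def)
    also have "\<dots> = pact t q v"
    proof -
      have "pact t q v = pact t r v + pact t k (pact t m v)" unfolding k by (simp only: pact_add_left pact_mult[OF at])
      also have "pact t m v = 0" by (rule bspec[OF Cons.prems]) simp
      finally show ?thesis by (simp only: addmap_zero[OF addmap_pact[OF at]] add_0_right)
    qed
    finally have y: "lc ys (chain t d v) = pact t q v" .
    have ly: "length ys = length (chain t d v)" by (simp add: ys_def)
    have "psum t (q # qs) (v # vs) = lc (ys @ zs) (concat (map (chain t d) (v # vs)))"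
      unfolding list.map concat.simps lc_append[OF ly] psum.simps y zs(2) ..
    moreover have "length (ys @ zs) = length (concat (map (chain t d) (v # vs)))" using zs ly by simp
    ultimately show ?case by blast
  qed
  show "\<exists>qs. length qs = length vs \<and> psum t qs vs = lc zs (concat (map (chain t d) vs)) \<and>
        ((\<forall>q\<in>set qs. m dvd q) \<longrightarrow> (\<forall>z\<in>set zs. z = 0))"
    if "length zs = length (concat (map (chain t d) vs))"
    using that
  proof (induction vs arbitrary: zs)
    case Nil
    then show ?case by simp
  next
    case (Cons v vs)
    define ys zs' where "ys = take d zs" and "zs' = drop d zs"
    have zs: "zs = ys @ zs'" by (simp add: ys_def zs'_def)
    have ly: "length ys = length (chain t d v)" and lz: "length zs' = length (concat (map (chain t d) vs))"
      using Cons.prems by (auto simp: ys_def zs'_def)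
    obtain qs where qs: "length qs = length vs" "psum t qs vs = lc zs' (concat (map (chain t d) vs))"
      "(\<forall>q\<in>set qs. m dvd q) \<longrightarrow> (\<forall>z\<in>set zs'. z = 0)" using Cons.IH[OF lz] by blast
    have dy: "length ys = d" using ly by simp
    have "psum t (Poly ys # qs) (v # vs) = lc zs (concat (map (chain t d) (v # vs)))"
      unfolding list.map concat.simps zs lc_append[OF ly] psum.simps lc_chain[OF dy] qs(2) ..
    moreover have "\<forall>z\<in>set ys. z = 0" if dv: "m dvd Poly ys"
    proof -
      have "degree (Poly ys) < d" if "Poly ys \<noteq> 0"
      proof -
        have "coeff (Poly ys) (degree (Poly ys)) = nth_default 0 ys (degree (Poly ys))" by (simp add: coeff_Poly_eq)
        moreover have "coeff (Poly ys) (degree (Poly ys)) \<noteq> 0" using that by (rule leading_coeff_neq_0)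
        ultimately show ?thesis using nth_default_beyond[of ys "degree (Poly ys)" "0::int"] dy by (metis not_le)
      qed
      then have "Poly ys = 0" using dvd_imp_degree_le[OF dv] m(2) by (metis not_le)
      then have "coeff (Poly ys) i = 0" for i by simp
      then have "nth_default 0 ys i = 0" for i by (simp add: coeff_Poly_eq)
      then show ?thesis by (metis in_set_conv_nth nth_default_nth)
    qed
    ultimately show ?case using qs by (intro exI[of _ "Poly ys # qs"]) (auto simp: zs)
  qed
qed

definition intertw :: "((nat => int) => (nat => int)) => int mat => (nat => int) list => bool" where
  "intertw t D ws \<longleftrightarrow> D \<in> carrier_mat (length ws) (length ws) \<and>
    (\<forall>j<length ws. \<forall>k. t (ws ! j) k = (\<Sum>i<length ws. D $$ (i, j) * (ws ! i) k))"

lemma intertw_concat: "list_all2 (intertw t) Ds Ws ==> intertw t (diag_block_mat Ds) (concat Ws)"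
proof (induction rule: list_all2_induct)
  case Nil
  show ?case by (simp add: intertw_def)
next
  case (Cons D Ds ws Ws)
  let ?E = "diag_block_mat Ds" and ?vs = "concat Ws"
  let ?a = "length ws" and ?b = "length (concat Ws)"
  have D: "D \<in> carrier_mat ?a ?a" and tD: "\<And>j k. j < ?a ==> t (ws ! j) k = (\<Sum>i<?a. D $$ (i, j) * (ws ! i) k)"
    and E: "?E \<in> carrier_mat ?b ?b" and tE: "\<And>j k. j < ?b ==> t (?vs ! j) k = (\<Sum>i<?b. ?E $$ (i, j) * (?vs ! i) k)"
    using Cons by (auto simp: intertw_def)
  define F where "F = four_block_mat D (0\<^sub>m ?a ?b) (0\<^sub>m ?b ?a) ?E"
  have F: "diag_block_mat (D # Ds) = F" using D E by (simp add: F_def Let_def)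
  have Fc: "F \<in> carrier_mat (?a + ?b) (?a + ?b)" unfolding F_def using D E by auto
  have Fi: "F $$ (i, j) = (if i < ?a then if j < ?a then D $$ (i, j) else 0 else if j < ?a then 0 else ?E $$ (i - ?a, j - ?a))"
    if "i < ?a + ?b" "j < ?a + ?b" for i j
    unfolding F_def using D E that by (subst index_mat_four_block) auto
  have "t ((ws @ ?vs) ! j) k = (\<Sum>i<?a + ?b. F $$ (i, j) * ((ws @ ?vs) ! i) k)" if j: "j < ?a + ?b" for j k
  proof -
    have "(\<Sum>i<?a + ?b. F $$ (i, j) * ((ws @ ?vs) ! i) k) = (\<Sum>i<?a. F $$ (i, j) * ((ws @ ?vs) ! i) k) + (\<Sum>i<?b. F $$ (?a + i, j) * ((ws @ ?vs) ! (?a + i)) k)"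
      by (rule sum_lessThan_split)
    also have "\<dots> = (\<Sum>i<?a. (if j < ?a then D $$ (i, j) else 0) * (ws ! i) k) + (\<Sum>i<?b. (if j < ?a then 0 else ?E $$ (i, j - ?a)) * (?vs ! i) k)"
      using j by (intro arg_cong2[of _ _ _ _ "(+)"] sum.cong) (auto simp: Fi nth_append)
    also have "\<dots> = t ((ws @ ?vs) ! j) k"
      using j tD[of j k] tE[of "j - ?a" k] by (auto simp: nth_append)
    finally show ?thesis by simp
  qed
  then show ?case unfolding F intertw_def using Fc by simp
qed

lemma intertw_blocks:
  fixes t :: "(nat => int) => nat => int"
  assumes at: "addmap t"
  shows "pact t pi1 v = 0 ==> intertw t triv_block (chain t 1 v)"
    and "p > 1 ==> pact t (1 - X1 ^ p) v = 0 ==> intertw t (reg_block p) (chain t p v)"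
    and "p > 1 ==> pact t (Phi p) v = 0 ==> intertw t (cyc_block p) (chain t (p - 1) v)"
proof -
  assume "pact t pi1 v = 0"
  then have "v - t v = 0" by (simp only: pact_pi1)
  then have "t v = v" by (simp only: right_minus_eq)
  then show "intertw t triv_block (chain t 1 v)" by (simp add: intertw_def triv_block_def)
next
  assume p: "p > 1" and v: "pact t (1 - X1 ^ p) v = 0"
  have "pact t 1 v = v" by (simp add: one_pCons pact_const zmul_simps)
  then have "v - (t ^^ p) v = 0" using v by (simp only: pact_minus_left pact_X1_pow[OF at])
  then have tp: "(t ^^ p) v = v" by (simp only: right_minus_eq)
  have "t (chain t p v ! j) k = (\<Sum>i<p. reg_block p $$ (i, j) * (chain t p v ! i) k)" if j: "j < p" for j k
  proof -
    have "(\<Sum>i<p. reg_block p $$ (i, j) * (chain t p v ! i) k) = (\<Sum>i<p. if i = (j + 1) mod p then (t ^^ i) v k else 0)"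
      using j by (intro sum.cong) (auto simp: reg_block_def chain_nth)
    also have "\<dots> = (t ^^ ((j + 1) mod p)) v k" using p by simp
    also have "\<dots> = (t ^^ (j + 1)) v k" using j tp by (cases "j + 1 = p") auto
    finally show ?thesis using j by (simp add: chain_nth)
  qed
  then show "intertw t (reg_block p) (chain t p v)" by (simp add: intertw_def reg_block_def)
next
  assume p: "p > 1" and v: "pact t (Phi p) v = 0"
  have sum0: "(\<Sum>i<p - 1. (t ^^ i) v k) + (t ^^ (p - 1)) v k = 0" for k
  proof -
    have "(\<Sum>i<Suc (p - 1). (t ^^ i) v k) = 0" using pact_Phi[of p t v k] v p by simp
    then show ?thesis by simp
  qed
  have "t (chain t (p - 1) v ! j) k = (\<Sum>i<p - 1. cyc_block p $$ (i, j) * (chain t (p - 1) v ! i) k)" if j: "j < p - 1" for j k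
  proof (cases "j + 2 < p")
    case True
    have "(\<Sum>i<p - 1. cyc_block p $$ (i, j) * (chain t (p - 1) v ! i) k) = (\<Sum>i<p - 1. if i = j + 1 then (t ^^ i) v k else 0)"
      using j True by (intro sum.cong) (auto simp: cyc_block_def chain_nth)
    also have "\<dots> = (t ^^ (j + 1)) v k" using True by simp
    finally show ?thesis using j by (simp add: chain_nth)
  next
    case False
    then have jp: "Suc j = p - 1" using j by simp
    have "(\<Sum>i<p - 1. cyc_block p $$ (i, j) * (chain t (p - 1) v ! i) k) = - (\<Sum>i<p - 1. (t ^^ i) v k)"
      unfolding sum_negf[symmetric] using j False by (intro sum.cong) (auto simp: cyc_block_def chain_nth)
    also have "\<dots> = (t ^^ Suc j) v k" using sum0[of k] unfolding jp by simp
    finally show ?thesis using j by (simp add: chain_nth)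
  qed
  then show "intertw t (cyc_block p) (chain t (p - 1) v)" by (simp add: intertw_def cyc_block_def)
qed

text \<open>Comparison of the traces of \<open>Q * R\<close> and \<open>R * Q\<close>.\<close>

lemma double_sum_swap:
  fixes Q R :: "int mat"
  assumes "Q \<in> carrier_mat n m" "R \<in> carrier_mat m n" "Q * R = 1\<^sub>m n" "R * Q = 1\<^sub>m m"
  shows "m = n"
proof -
  have QR: "(Q * R) $$ (k, k) = (\<Sum>i<m. Q $$ (k, i) * R $$ (i, k))" if "k < n" for k
    using assms(1,2) that by (auto simp: scalar_prod_def lessThan_atLeast0 intro!: sum.cong)
  have RQ: "(R * Q) $$ (i, i) = (\<Sum>k<n. R $$ (i, k) * Q $$ (k, i))" if "i < m" for i
    using assms(1,2) that by (auto simp: scalar_prod_def lessThan_atLeast0 intro!: sum.cong)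
  have "int n = (\<Sum>k<n. (Q * R) $$ (k, k))" unfolding assms(3) by simp
  also have "\<dots> = (\<Sum>k<n. \<Sum>i<m. Q $$ (k, i) * R $$ (i, k))" using QR by simp
  also have "\<dots> = (\<Sum>i<m. \<Sum>k<n. R $$ (i, k) * Q $$ (k, i))" by (subst sum.swap) (simp add: mult.commute)
  also have "\<dots> = (\<Sum>i<m. (R * Q) $$ (i, i))" using RQ by simp
  also have "\<dots> = int m" unfolding assms(4) by simp
  finally show ?thesis by simp
qed

lemma conjugate_of_intertw:
  fixes A D :: "int mat" and n :: nat
  defines "t \<equiv> tact n (\<lambda>i j. A $$ (i, j))"
  assumes A: "A \<in> carrier_mat n n" and W: "set W \<subseteq> lat n" and inter: "intertw t D W"
    and span: "\<And>x. x \<in> lat n ==> \<exists>zs. length zs = length W \<and> x = lc zs W"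
    and indep: "\<And>zs. length zs = length W ==> lc zs W = 0 ==> \<forall>z\<in>set zs. z = 0"
  shows "length W = n \<and> (\<exists>P\<in>carrier (GL_Z n). P * A = D * P)"
proof -
  define m where "m = length W"
  define Q where "Q = mat n m (\<lambda>(k, j). (W ! j) k)"
  have Q: "Q \<in> carrier_mat n m" by (simp add: Q_def)
  have D: "D \<in> carrier_mat m m" using inter by (simp add: intertw_def m_def)
  have "\<exists>zs. length zs = m \<and> unitv k = lc zs W" if "k < n" for k
    using span[of "unitv k"] that by (simp add: m_def lat_def unitv_def)
  then obtain Z where Z: "\<And>k. k < n ==> length (Z k) = m \<and> unitv k = lc (Z k) W" by metis
  define R where "R = mat m n (\<lambda>(i, k). Z k ! i)"
  have R: "R \<in> carrier_mat m n" by (simp add: R_def)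
  have QR: "Q * R = 1\<^sub>m n"
  proof (rule eq_matI)
    fix i j assume ij: "i < dim_row (1\<^sub>m n :: int mat)" "j < dim_col (1\<^sub>m n :: int mat)"
    have "(Q * R) $$ (i, j) = (\<Sum>l<m. (W ! l) i * (Z j ! l))"
      using ij by (auto simp: Q_def R_def scalar_prod_def lessThan_atLeast0 intro!: sum.cong)
    also have "\<dots> = lc (Z j) W i" using Z[of j] ij lc_nth[of "Z j" W i] by (simp add: m_def mult.commute)
    also have "\<dots> = unitv j i" using Z[of j] ij by simp
    finally show "(Q * R) $$ (i, j) = 1\<^sub>m n $$ (i, j)" using ij by (auto simp: unitv_def)
  qed (simp_all add: Q_def R_def)
  have RQ: "R * Q = 1\<^sub>m m"
  proof (rule eq_matI)
    fix i j assume ij: "i < dim_row (1\<^sub>m m :: int mat)" "j < dim_col (1\<^sub>m m :: int mat)"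
    \<comment> \<open>\<open>Q * E\<close> is zero, so each column of \<open>E\<close> is an integer
      relation between the vectors of \<open>W\<close> and vanishes by independence.\<close>
    define E where "E = R * Q - 1\<^sub>m m"
    have E: "E \<in> carrier_mat m m" unfolding E_def by (rule minus_carrier_mat) simp
    have "Q * E = Q * (R * Q) - Q * 1\<^sub>m m" unfolding E_def using R Q by (intro mult_minus_distrib_mat) auto
    also have "Q * (R * Q) = Q * R * Q" using Q R by (intro assoc_mult_mat[symmetric]) auto
    finally have QE: "Q * E = 0\<^sub>m n m" using Q by (simp add: QR)
    define zs where "zs = map (\<lambda>l. E $$ (l, j)) [0..<m]"
    have len: "length zs = length W" by (simp add: zs_def m_def)
    have "lc zs W k = 0" for k
    proof (cases "k < n")
      case True
      have "lc zs W k = (\<Sum>l<m. Q $$ (k, l) * E $$ (l, j))"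
        unfolding lc_nth[OF len] using True by (intro sum.cong) (auto simp: m_def[symmetric] zs_def Q_def)
      also have "\<dots> = (Q * E) $$ (k, j)"
        using True ij Q E by (auto simp: scalar_prod_def lessThan_atLeast0 intro!: sum.cong)
      finally show ?thesis unfolding QE using True ij by simp
    next
      case False
      have "(W ! l) k = 0" if "l < m" for l using subsetD[OF W nth_mem[of l W]] False that by (simp add: lat_def m_def)
      then show ?thesis unfolding lc_nth[OF len] by (auto simp: m_def intro!: sum.neutral)
    qed
    then have "lc zs W = 0" by (simp add: fun_eq_iff)
    from indep[OF len this] have "E $$ (i, j) = 0" using ij by (auto simp: zs_def)
    then show "(R * Q) $$ (i, j) = 1\<^sub>m m $$ (i, j)" using ij R Q by (simp add: E_def)
  qed (use R Q in simp_all)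
  have mn: "m = n" by (rule double_sum_swap[OF Q R QR RQ])
  have AQ: "A * Q = Q * D"
  proof (rule eq_matI)
    fix k j assume kj: "k < dim_row (Q * D)" "j < dim_col (Q * D)"
    then have k: "k < n" and j: "j < m" using Q D by auto
    have "(A * Q) $$ (k, j) = t (W ! j) k"
      using k j A Q by (auto simp: t_def tact_def Q_def scalar_prod_def lessThan_atLeast0 intro!: sum.cong)
    also have "\<dots> = (\<Sum>i<m. D $$ (i, j) * (W ! i) k)" using inter j by (simp add: intertw_def m_def)
    also have "\<dots> = (Q * D) $$ (k, j)"
      using k j D by (auto simp: Q_def scalar_prod_def lessThan_atLeast0 mult.commute intro!: sum.cong)
    finally show "(A * Q) $$ (k, j) = (Q * D) $$ (k, j)" .
  qed (use A Q D in auto)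
  have "R * A = R * A * (Q * R)" unfolding QR using R A by simp
  also have "\<dots> = R * A * Q * R"
    by (rule assoc_mult_mat[symmetric, OF mult_carrier_mat[OF R A] Q R])
  also have "R * A * Q = R * Q * D"
    unfolding assoc_mult_mat[OF R A Q] AQ by (rule assoc_mult_mat[symmetric, OF R Q D])
  also have "R * Q * D = D" unfolding RQ using D by simp
  finally have RA: "R * A = D * R" .
  have "det R * det Q = 1" using det_mult[of R n Q] R Q RQ unfolding mn by simp
  then have "det R = 1 \<or> det R = -1" using zmult_eq_1_iff by blast
  then have "R \<in> carrier (GL_Z n)" using R mn by (simp add: GL_Z_def)
  then show ?thesis using RA mn by (auto simp: m_def)
qed

lemma lc_three:
  "length zs = length (U @ V @ W) ==> \<exists>a b c. zs = a @ b @ c \<and> length a = length U \<and> length b = length V \<and> length c = length W"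
  by (intro exI[of _ "take (length U) zs"] exI[of _ "take (length V) (drop (length U) zs)"]
      exI[of _ "drop (length V) (drop (length U) zs)"]) (auto simp del: drop_drop)

theorem standard_of_sfree:
  fixes A :: "int mat" and n :: nat
  defines "t \<equiv> tact n (\<lambda>i j. A $$ (i, j))"
  assumes p: "prime p" and A: "A \<in> carrier_mat n n" and per: "\<And>v. v \<in> lat n ==> (t ^^ p) v = v"
    and free: "pmod.sfree (pact t) p (normker t p (lat n))"
  shows "standard_rep n p A"
proof -
  have at: "addmap t" unfolding t_def by (rule addmap_tact)
  have sub: "tsub t (lat n)" unfolding t_def by (rule tsub_lat)
  have p1: "p > 1" using p prime_gt_1_nat by blast
  obtain Ts Rs Cs where gb: "gbasis t p (lat n) Ts Rs Cs"
    using ex_gbasis_lat[OF p, of n "\<lambda>i j. A $$ (i, j)"] per free unfolding t_def by blast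
  note g = gb[unfolded gbasis_def]
  let ?T = "concat (map (chain t 1) Ts)" and ?R = "concat (map (chain t p) Rs)" and ?C = "concat (map (chain t (p - 1)) Cs)"
  define W where "W = ?T @ ?R @ ?C"
  \<comment> \<open>\<open>lc_concat_chain\<close> asks for monic annihilators; \<open>pi1\<close>
    and \<open>1 - X1 ^ p\<close> have leading coefficient -1 and are therefore negated.\<close>
  have mT: "lead_coeff (- pi1) = 1" "degree (- pi1) = 1" by (auto simp: pi1_def X1_def one_pCons)
  have dX: "- (1 - X1 ^ p) = monom 1 p - 1" by (simp add: X1_def monom_altdef)
  have degR: "degree (- (1 - X1 ^ p)) = p"
    unfolding dX using p1 by (intro antisym degree_le le_degree) (auto simp: one_pCons coeff_pCons split: nat.splits)
  have mR: "lead_coeff (- (1 - X1 ^ p)) = 1" unfolding degR unfolding dX using p1 by (auto simp: one_pCons coeff_pCons split: nat.splits)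
  have mC: "lead_coeff (Phi p) = 1" "degree (Phi p) = p - 1" using p1 lead_coeff_Phi[of p] degree_Phi[of p] by linarith+
  have neg: "pact t (- q) v = 0" if "pact t q v = 0" for q v
    using pact_minus_left[of t 0 q v] that by (simp only: diff_0 pact_0 diff_self)
  have kT: "\<forall>v\<in>set Ts. pact t (- pi1) v = 0" using g neg by blast
  have kR: "\<forall>v\<in>set Rs. pact t (- (1 - X1 ^ p)) v = 0" using g neg by blast
  have kC: "\<forall>v\<in>set Cs. pact t (Phi p) v = 0" using g by blast
  have d1: "(0::nat) < 1" by simp
  note cT = lc_concat_chain[OF at mT d1 kT]
  note cR = lc_concat_chain[OF at mR degR _ kR]
  note cC = lc_concat_chain[OF at mC _ kC]
  have pp: "p > 0" "p - 1 > 0" using p1 by auto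
  have Wn: "set W \<subseteq> lat n"
  proof -
    have "set (chain t d v) \<subseteq> lat n" if "v \<in> lat n" for d v
      using that by (induction d arbitrary: v) (auto simp: tsubD(4)[OF sub])
    then show ?thesis using g unfolding W_def by (auto simp del: One_nat_def) blast+
  qed
  have span: "\<exists>zs. length zs = length W \<and> x = lc zs W" if x: "x \<in> lat n" for x
  proof -
    from g x obtain a b c where abc: "length a = length Ts" "length b = length Rs" "length c = length Cs"
      "x = psum t a Ts + psum t b Rs + psum t c Cs" by blast
    obtain za where za: "length za = length ?T" "psum t a Ts = lc za ?T" using cT(1) abc by blast
    obtain zb where zb: "length zb = length ?R" "psum t b Rs = lc zb ?R" using cR(1)[OF pp(1)] abc by blast
    obtain zc where zc: "length zc = length ?C" "psum t c Cs = lc zc ?C" using cC(1)[OF pp(2)] abc by blast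
    have "x = lc (za @ zb @ zc) W"
      unfolding W_def lc_append[OF za(1)] lc_append[OF zb(1)] abc(4) za(2) zb(2) zc(2) by (simp only: add.assoc)
    moreover have "length (za @ zb @ zc) = length W" unfolding W_def using za zb zc by simp
    ultimately show ?thesis by blast
  qed
  have indep: "\<forall>z\<in>set zs. z = 0" if len: "length zs = length W" and 0: "lc zs W = 0" for zs
  proof -
    obtain za zb zc where zs: "zs = za @ zb @ zc" and l: "length za = length ?T" "length zb = length ?R" "length zc = length ?C"
      using lc_three[OF len[unfolded W_def]] by blast
    obtain a where a: "length a = length Ts" "psum t a Ts = lc za ?T" "(\<forall>q\<in>set a. - pi1 dvd q) \<longrightarrow> (\<forall>z\<in>set za. z = 0)"
      using cT(2)[OF l(1)] by blast
    obtain b where b: "length b = length Rs" "psum t b Rs = lc zb ?R" "(\<forall>q\<in>set b. - (1 - X1 ^ p) dvd q) \<longrightarrow> (\<forall>z\<in>set zb. z = 0)"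
      using cR(2)[OF pp(1) l(2)] by blast
    obtain c where c: "length c = length Cs" "psum t c Cs = lc zc ?C" "(\<forall>q\<in>set c. Phi p dvd q) \<longrightarrow> (\<forall>z\<in>set zc. z = 0)"
      using cC(2)[OF pp(2) l(3)] by blast
    have "psum t a Ts + psum t b Rs + psum t c Cs = 0"
      using 0 unfolding W_def zs lc_append[OF l(1)] lc_append[OF l(2)] a(2) b(2) c(2) by (simp only: add.assoc)
    then have "(\<forall>q\<in>set a. pi1 dvd q) \<and> (\<forall>q\<in>set b. 1 - X1 ^ p dvd q) \<and> (\<forall>q\<in>set c. Phi p dvd q)"
      using g a(1) b(1) c(1) by blast
    then show ?thesis using a(3) b(3) c(3) unfolding zs minus_dvd_iff by auto
  qed
  let ?Ds = "replicate (length Ts) triv_block @ replicate (length Rs) (reg_block p) @ replicate (length Cs) (cyc_block p)"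
  have all2: "list_all2 (intertw t) (replicate (length vs) D) (map f vs)" if "\<And>v. v \<in> set vs ==> intertw t D (f v)" for vs D f
    using that by (auto simp: list_all2_conv_all_nth)
  have "list_all2 (intertw t) ?Ds (map (chain t 1) Ts @ map (chain t p) Rs @ map (chain t (p - 1)) Cs)"
    by (intro list_all2_appendI all2 intertw_blocks[OF at] p1) (use g in blast)+
  from intertw_concat[OF this] have inter: "intertw t (diag_block_mat ?Ds) W" by (simp only: W_def concat_append)
  have "length W = n" and "\<exists>P\<in>carrier (GL_Z n). P * A = diag_block_mat ?Ds * P"
    using conjugate_of_intertw[OF A Wn, folded t_def, OF inter span indep] by blast+
  moreover have "length W = length Ts + length Rs * p + length Cs * (p - 1)"
    by (simp add: W_def length_concat o_def sum_list_triv)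
  ultimately show ?thesis unfolding standard_rep_def by metis
qed

subsection \<open>Automorphisms realizing a given matrix\<close>

lemma es_outside: "x \<in> FN n ==> n \<le> i ==> es i x = 0"
  by (rule addmap_eqI[of "es i" "\<lambda>_. 0"]) (auto simp: addmap_es es_gen addmap_def[of "\<lambda>_. 0"])

lemma es_comp:
  fixes f :: "fw => fw"
  assumes f: "addmap f" and x: "x \<in> FN n"
  shows "es i (f x) = (\<Sum>j<n. es i (f (gen j)) * es j x)"
  using _ _ x
proof (rule addmap_eqI[of "\<lambda>x. es i (f x)" "\<lambda>x. \<Sum>j<n. es i (f (gen j)) * es j x"])
  show "addmap (\<lambda>x. es i (f x))" by (rule addmap_comp[OF addmap_es f])
  show "addmap (\<lambda>x. \<Sum>j<n. es i (f (gen j)) * es j x)"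
    by (simp add: addmap_def addmapD[OF addmap_es] algebra_simps sum.distrib)
  show "es i (f (gen k)) = (\<Sum>j<n. es i (f (gen j)) * es j (gen k))" if "k < n" for k
    using that by (simp add: es_gen if_distrib[where f = "\<lambda>u. _ * u"] cong: if_cong)
qed

definition emat :: "nat => (fw => fw) => int mat" where
  "emat n f = mat n n (\<lambda>(i, j). es i (f (gen j)))"

lemma emat_carrier [simp]: "emat n f \<in> carrier_mat n n" "dim_row (emat n f) = n" "dim_col (emat n f) = n"
  by (auto simp: emat_def)

lemma emat_comp:
  assumes "addmap f" "\<And>j. j < n ==> g (gen j) \<in> FN n"
  shows "emat n (\<lambda>x. f (g x)) = emat n f * emat n g"
  by (rule eq_matI)
    (auto simp: emat_def scalar_prod_def lessThan_atLeast0 es_comp[OF assms(1) assms(2)] intro!: sum.cong)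

lemma emat_cong: "(\<And>x. x \<in> FN n ==> f x = g x) ==> emat n f = emat n g"
  by (rule eq_matI) (auto simp: emat_def)

lemma emat_id: "emat n (\<lambda>x. x) = 1\<^sub>m n"
  by (rule eq_matI) (auto simp: emat_def es_gen)

text \<open>The inverse is required only on \<open>FN n\<close>: on the remaining generators of the
  type the map is arbitrary.\<close>

definition faut :: "nat => (fw => fw) => bool" where
  "faut n f \<longleftrightarrow> addmap f \<and> (\<exists>g. addmap g \<and> (\<forall>x\<in>FN n. f x \<in> FN n \<and> g x \<in> FN n \<and> f (g x) = x \<and> g (f x) = x))"

lemma fautI:
  assumes "addmap f" "addmap g" "\<And>j. j < n ==> f (gen j) \<in> FN n" "\<And>j. j < n ==> g (gen j) \<in> FN n"
    "\<And>j. j < n ==> f (g (gen j)) = gen j" "\<And>j. j < n ==> g (f (gen j)) = gen j"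
  shows "faut n f"
proof -
  have "f x \<in> FN n \<and> g x \<in> FN n \<and> f (g x) = x \<and> g (f x) = x" if x: "x \<in> FN n" for x
    using addmap_FN[OF assms(1) x assms(3)] addmap_FN[OF assms(2) x assms(4)]
      addmap_eqI[OF addmap_comp[OF assms(1,2)] _ x, of "\<lambda>x. x"] addmap_eqI[OF addmap_comp[OF assms(2,1)] _ x, of "\<lambda>x. x"]
      assms(5,6) by (auto simp: addmap_def[of "\<lambda>x. x"])
  then show ?thesis unfolding faut_def using assms(1,2) by blast
qed

lemma faut_comp:
  assumes "faut n f" "faut n g"
  shows "faut n (\<lambda>x. f (g x))"
proof -
  obtain f' g' where f: "addmap f" "addmap f'" "\<forall>x\<in>FN n. f x \<in> FN n \<and> f' x \<in> FN n \<and> f (f' x) = x \<and> f' (f x) = x"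
    and g: "addmap g" "addmap g'" "\<forall>x\<in>FN n. g x \<in> FN n \<and> g' x \<in> FN n \<and> g (g' x) = x \<and> g' (g x) = x"
    using assms unfolding faut_def by blast
  show ?thesis unfolding faut_def
    using addmap_comp[OF f(1) g(1)] addmap_comp[OF g(2) f(2)] f(3) g(3)
    by (intro conjI exI[of _ "\<lambda>x. g' (f' x)"]) auto
qed

definition zm :: "int => fw => fw" where
  "zm m x = (if m \<ge> 0 then sum_list (replicate (nat m) x) else - sum_list (replicate (nat (- m)) x))"

lemma addmap_sum_list: "addmap f ==> f (sum_list xs) = sum_list (map f xs)"
  for f :: "'a::group_add => 'b::group_add"
  by (induction xs) (auto simp: addmap_zero addmapD)

lemma FN_sum_list: "set xs \<subseteq> FN n ==> sum_list xs \<in> FN n"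
  by (induction xs) auto

lemma zm_uminus: "zm (- m) x = - zm m x"
  by (cases "m = 0") (auto simp: zm_def)

lemma addmap_zm: "addmap f ==> f (zm m x) = zm m (f x)" for f :: "fw => fw"
  by (auto simp: zm_def addmap_sum_list addmap_uminus)

lemma FN_zm: "x \<in> FN n ==> zm m x \<in> FN n"
  by (auto simp: zm_def intro!: FN_sum_list)

lemma es_zm: "es i (zm m x) = m * es i x"
  by (auto simp: zm_def addmap_sum_list[OF addmap_es] addmap_uminus[OF addmap_es] sum_list_replicate)

text \<open>Row \<open>j\<close> is the class of the image of \<open>gen j\<close> in the
  abelianization, so row operations amount to changing the generators before the automorphism is
  applied.\<close>

definition realz :: "nat => (nat => nat => int) => bool" where
  "realz n e \<longleftrightarrow> (\<exists>h. faut n h \<and> (\<forall>j<n. \<forall>i<n. es i (h (gen j)) = e j i))"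

definition zspanning :: "nat => (nat => nat => int) => bool" where
  "zspanning n e \<longleftrightarrow> (\<forall>k<n. \<exists>z. \<forall>i<n. (\<Sum>j<n. z j * e j i) = (if i = k then 1 else 0))"

definition shear :: "nat => (nat => int) => (nat => nat => int) => nat => nat => int" where
  "shear k c e = (\<lambda>j i. e j i + c j * e k i)"

text \<open>Precompose with the Nielsen map sending \<open>gen j\<close> to
  \<open>gen j - c j * gen k\<close>, in abelianized notation. It fixes \<open>gen k\<close>, so the
  map with opposite coefficients is its inverse.\<close>

lemma realz_shear:
  assumes k: "k < n" and c: "c k = 0" and "realz n (shear k c e)"
  shows "realz n e"
proof -
  obtain h where h: "faut n h" "\<And>i j. i < n ==> j < n ==> es i (h (gen j)) = shear k c e j i"
    using assms(3) unfolding realz_def by blast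
  define \<tau> where "\<tau> c = fext (\<lambda>j. gen j + zm (c j) (gen k))" for c
  have add: "addmap (\<tau> c)" for c unfolding \<tau>_def by (rule addmap_fext)
  have gen: "\<tau> c (gen j) = gen j + zm (c j) (gen k)" for c j by (simp add: \<tau>_def)
  have zm0: "zm 0 x = 0" for x by (simp add: zm_def)
  have inv: "\<tau> c (\<tau> d (gen j)) = gen j" if "c k = 0" "\<And>j. d j = - c j" for c d j
    unfolding gen addmapD[OF add] addmap_zm[OF add] using that by (simp add: zm0 zm_uminus add.assoc)
  have FNt: "\<tau> c (gen j) \<in> FN n" if "j < n" for c j using that k unfolding gen by (intro FN_plus FN_zm) auto
  have "faut n (\<tau> (\<lambda>j. - c j))"
    by (rule fautI[OF add add[of c] FNt FNt inv inv]) (simp_all add: c)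
  then have "faut n (\<lambda>x. h (\<tau> (\<lambda>j. - c j) x))" by (rule faut_comp[OF h(1)])
  moreover have "es i (h (\<tau> (\<lambda>j. - c j) (gen j))) = e j i" if "i < n" "j < n" for i j
  proof -
    have "addmap h" using h(1) by (simp add: faut_def)
    then show ?thesis using h(2)[OF that] h(2)[OF that(1) k] c
      by (simp add: gen addmapD addmap_zm addmapD[OF addmap_es] es_zm shear_def)
  qed
  ultimately show ?thesis unfolding realz_def by blast
qed

lemma zspanning_shear:
  assumes k: "k < n" and c: "c k = 0" and sp: "zspanning n e"
  shows "zspanning n (shear k c e)"
  unfolding zspanning_def
proof (intro allI impI)
  fix l assume "l < n"
  then obtain z where z: "\<And>i. i < n ==> (\<Sum>j<n. z j * e j i) = (if i = l then 1 else 0)" using sp unfolding zspanning_def by blast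
  define S where "S = (\<Sum>j<n. z j * c j)"
  define w where "w j = z j - (if j = k then S else 0)" for j
  have "(\<Sum>j<n. w j * shear k c e j i) = (if i = l then 1 else 0)" if "i < n" for i
  proof -
    have wc: "w j * c j = z j * c j" for j using c by (simp add: w_def)
    have "(\<Sum>j<n. w j * shear k c e j i) = (\<Sum>j<n. w j * e j i) + (\<Sum>j<n. w j * c j) * e k i"
      unfolding shear_def by (simp add: algebra_simps sum.distrib sum_distrib_left)
    also have "(\<Sum>j<n. w j * c j) = S" unfolding wc S_def ..
    also have "(\<Sum>j<n. w j * e j i) = (\<Sum>j<n. z j * e j i) - (\<Sum>j<n. if j = k then S * e j i else 0)"
      unfolding sum_subtractf[symmetric] by (intro sum.cong) (auto simp: w_def algebra_simps)
    also have "(\<Sum>j<n. if j = k then S * e j i else 0) = S * e k i" using k by simp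
    finally show ?thesis using z[OF that] by simp
  qed
  then show "\<exists>z. \<forall>i<n. (\<Sum>j<n. z j * shear k c e j i) = (if i = l then 1 else 0)" by blast
qed

lemma realz_sign:
  assumes k: "k < n" and u: "u * u = 1" and "realz n (e(k := (\<lambda>i. u * e k i)))"
  shows "realz n e"
proof -
  obtain h where h: "faut n h" "\<And>i j. i < n ==> j < n ==> es i (h (gen j)) = (e(k := (\<lambda>i. u * e k i))) j i"
    using assms(3) unfolding realz_def by blast
  define s where "s = fext (\<lambda>j. if j = k then zm u (gen j) else gen j)"
  have add: "addmap s" unfolding s_def by (rule addmap_fext)
  have gen: "s (gen j) = (if j = k then zm u (gen j) else gen j)" for j by (simp add: s_def)
  have u1: "u = 1 \<or> u = -1" using u zmult_eq_1_iff by blast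
  have ss: "s (s (gen j)) = gen j" for j
    using u1 by (auto simp: gen addmap_zm[OF add] addmap_uminus[OF add] zm_def)
  have FNs: "s (gen j) \<in> FN n" if "j < n" for j using that by (auto simp: gen intro!: FN_zm)
  have "faut n s" by (rule fautI[OF add add]) (blast intro: FNs ss)+
  then have "faut n (\<lambda>x. h (s x))" by (rule faut_comp[OF h(1)])
  moreover have "es i (h (s (gen j))) = e j i" if "i < n" "j < n" for i j
  proof -
    have "addmap h" using h(1) by (simp add: faut_def)
    then show ?thesis using h(2)[OF that] u by (auto simp: gen addmap_zm es_zm simp flip: mult.assoc)
  qed
  ultimately show ?thesis unfolding realz_def by blast
qed

lemma zspanning_sign:
  assumes u: "u * u = 1" and sp: "zspanning n e"
  shows "zspanning n (e(k := (\<lambda>i. u * e k i)))"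
  unfolding zspanning_def
proof (intro allI impI)
  fix l assume "l < n"
  then obtain z where z: "\<And>i. i < n ==> (\<Sum>j<n. z j * e j i) = (if i = l then 1 else 0)" using sp unfolding zspanning_def by blast
  have "(z(k := u * z k)) j * (e(k := (\<lambda>i. u * e k i))) j i = z j * e j i" for j i
    using u by (simp add: algebra_simps)
  then show "\<exists>z. \<forall>i<n. (\<Sum>j<n. z j * (e(k := (\<lambda>i. u * e k i))) j i) = (if i = l then 1 else 0)"
    using z by (intro exI[of _ "z(k := u * z k)"] allI impI) (simp only:)
qed

lemma zmove_shear:
  assumes "zmove {..<n} e e'"
  shows "zspanning n e ==> zspanning n e'" "realz n e' ==> realz n e"
proof -
  have "(zspanning n e \<longrightarrow> zspanning n e') \<and> (realz n e' \<longrightarrow> realz n e)" using assms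
  proof (induction rule: zmove.induct)
    case (zmove_add e e' i j)
    have "e'(i := e' i + e' j) = shear j ((\<lambda>_. 0)(i := 1)) e'" by (auto simp: shear_def fun_eq_iff)
    then show ?case using zmove_add realz_shear[of j n "(\<lambda>_. 0)(i := 1)" e'] zspanning_shear[of j n "(\<lambda>_. 0)(i := 1)" e'] by auto
  next
    case (zmove_sub e e' i j)
    have "e'(i := e' i - e' j) = shear j ((\<lambda>_. 0)(i := - 1)) e'" by (auto simp: shear_def fun_eq_iff)
    then show ?case using zmove_sub realz_shear[of j n "(\<lambda>_. 0)(i := - 1)" e'] zspanning_shear[of j n "(\<lambda>_. 0)(i := - 1)" e'] by auto
  qed auto
  then show "zspanning n e ==> zspanning n e'" "realz n e' ==> realz n e" by auto
qed

text \<open>Surjectivity of Aut F_n onto GL(n, Z) by elimination. The invariant is that the first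
  \<open>k\<close> columns agree with the identity, and the induction starts from
  \<open>k = n\<close>.\<close>

lemma realz_if_zspanning:
  assumes "k \<le> n" "zspanning n e" "\<And>r j. r < k ==> j < n ==> e j r = (if j = r then 1 else 0)"
  shows "realz n e"
  using assms
proof (induction k arbitrary: e rule: inc_induct)
  case base
  have "faut n (\<lambda>x. x)" by (rule fautI[of _ "\<lambda>x. x"]) (auto simp: addmap_def)
  then show ?case unfolding realz_def using base by (intro exI[of _ "\<lambda>x. x"]) (auto simp: es_gen)
next
  case (step k e)
  let ?I = "{k..<n}"
  have kn: "k < n" using step by simp
  have row: "addmap (\<lambda>v :: nat => int. v k)" by (simp add: addmap_def)
  have "finite ?I" "?I \<noteq> {}" using kn by auto
  from zmove_eliminate[OF this row, of e]
  obtain e1 i0 where mv: "zmove ?I e e1" and i0: "i0 \<in> ?I" and el: "\<And>i. i \<in> ?I - {i0} ==> e1 i k = 0" by blast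
  have mv': "zmove {..<n} e e1" by (rule zmove_mono[OF mv]) auto
  have sp1: "zspanning n e1" by (rule zmove_shear(1)[OF mv' step.prems(1)])
  have rows1: "e1 j r = (if j = r then 1 else 0)" if "r < k" "j < n" for r j
  proof (cases "j \<in> ?I")
    case True
    have "\<forall>r<k. e1 j r = 0"
      by (rule zmove_invariant[OF mv, of "\<lambda>x. \<forall>r<k. x r = 0"]) (use step.prems True in auto)
    then show ?thesis using that True by auto
  next
    case False
    then show ?thesis using zmove_outside[OF mv False] step.prems(2) that by simp
  qed
  define u where "u = e1 i0 k"
  \<comment> \<open>In a combination of rows giving the \<open>k\<close>-th unit vector the rows
    before \<open>k\<close> have coefficient 0, and those after them other than \<open>i0\<close>
    vanish in column \<open>k\<close>. Hence the pivot is invertible.\<close>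
  have u: "u * u = 1"
  proof -
    obtain z where z: "\<And>i. i < n ==> (\<Sum>j<n. z j * e1 j i) = (if i = k then 1 else 0)" using sp1 kn unfolding zspanning_def by blast
    have z0: "z r = 0" if r: "r < k" for r
    proof -
      have "(\<Sum>j<n. z j * e1 j r) = (\<Sum>j<n. if j = r then z j else 0)" using rows1 r by (intro sum.cong) auto
      also have "\<dots> = z r" using r kn by simp
      finally show ?thesis using z[of r] r kn by simp
    qed
    have "(\<Sum>j<n. z j * e1 j k) = (\<Sum>j<n. if j = i0 then z j * u else 0)"
    proof (rule sum.cong)
      fix j assume "j \<in> {..<n}"
      then show "z j * e1 j k = (if j = i0 then z j * u else 0)"
        using z0[of j] el[of j] by (cases "j < k") (auto simp: u_def)
    qed simp
    also have "\<dots> = z i0 * u" using i0 by simp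
    finally have "z i0 * u = 1" using z[OF kn] by simp
    then show ?thesis using zmult_eq_1_iff by auto
  qed
  obtain e2 where e2: "zspanning n e2" "realz n e2 \<longrightarrow> realz n e1" "e2 k k = 1"
    "\<And>r j. r < k ==> j < n ==> e2 j r = (if j = r then 1 else 0)"
  proof (cases "i0 = k")
    case True
    show ?thesis
      by (rule that[OF zspanning_sign[OF u sp1, of k]])
        (use realz_sign[OF kn u] u rows1 kn True in \<open>auto simp: u_def\<close>)
  next
    case False
    \<comment> \<open>Row \<open>k\<close> has entry 0 in its own column; adding \<open>u\<close>
      times the pivot row puts \<open>u * u = 1\<close> there.\<close>
    define c where "c = (\<lambda>j. if j = k then u else 0)"
    have c: "c i0 = 0" and i0n: "i0 < n" using False i0 by (auto simp: c_def)
    show ?thesis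
      by (rule that[OF zspanning_shear[where c = c and k = i0, OF i0n c sp1]])
        (use realz_shear[where c = c and k = i0 and e = e1, OF i0n c] el[of k] u rows1 kn False i0 in \<open>auto simp: shear_def c_def u_def\<close>)
  qed
  define c where "c j = (if j = k then 0 else - e2 j k)" for j
  have c: "c k = 0" by (simp add: c_def)
  have "realz n (shear k c e2)"
  proof (rule step.IH)
    show "zspanning n (shear k c e2)" by (rule zspanning_shear[where c = c and k = k, OF kn c e2(1)])
    show "shear k c e2 j r = (if j = r then 1 else 0)" if "r < Suc k" "j < n" for r j
      using that e2(3,4) kn by (cases "r = k") (auto simp: shear_def c_def)
  qed
  then show ?case using zmove_shear(2)[OF mv'] e2(2) realz_shear[where c = c and k = k, OF kn c] by blast
qed

text \<open>The adjugate gives the integral inverse, whose entries express the unit vectors by the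
  columns of \<open>P\<close>.\<close>

lemma ex_faut_emat:
  assumes P: "P \<in> carrier (GL_Z n)"
  shows "\<exists>h. faut n h \<and> emat n h = P"
proof -
  have Pc: "P \<in> carrier_mat n n" and d: "det P * det P = 1" using P by (auto simp: GL_Z_def)
  have "zspanning n (\<lambda>j i. P $$ (i, j))" unfolding zspanning_def
  proof (intro allI impI)
    fix k assume k: "k < n"
    have "(\<Sum>j<n. det P * adj_mat P $$ (j, k) * P $$ (i, j)) = (if i = k then 1 else 0)" if i: "i < n" for i
    proof -
      have "(P * adj_mat P) $$ (i, k) = (\<Sum>j<n. P $$ (i, j) * adj_mat P $$ (j, k))"
        using i k Pc adj_mat(1)[OF Pc] by (auto simp: scalar_prod_def lessThan_atLeast0 intro!: sum.cong)
      moreover have "(P * adj_mat P) $$ (i, k) = det P * (if i = k then 1 else 0)" using adj_mat(2)[OF Pc] i k by simp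
      ultimately have "det P * (\<Sum>j<n. P $$ (i, j) * adj_mat P $$ (j, k)) = (if i = k then 1 else 0)" using d by auto
      then show ?thesis by (simp add: sum_distrib_left mult_ac)
    qed
    then show "\<exists>z. \<forall>i<n. (\<Sum>j<n. z j * P $$ (i, j)) = (if i = k then 1 else 0)"
      by (intro exI[of _ "\<lambda>j. det P * adj_mat P $$ (j, k)"] allI impI)
  qed
  from realz_if_zspanning[OF _ this, of 0] obtain h where h: "faut n h" "\<And>i j. i < n ==> j < n ==> es i (h (gen j)) = P $$ (i, j)"
    unfolding realz_def by auto
  have "emat n h = P" by (rule eq_matI) (use h Pc in \<open>auto simp: emat_def\<close>)
  then show ?thesis using h by blast
qed

section \<open>Periodic automorphisms inducing the standard blocks\<close>

definition preal :: "nat => int mat => bool" where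
  "preal p D \<longleftrightarrow> dim_col D = dim_row D \<and>
    (\<exists>f. addmap f \<and> (\<forall>x\<in>FN (dim_row D). f x \<in> FN (dim_row D) \<and> (f ^^ p) x = x) \<and> emat (dim_row D) f = D)"

lemma prealI:
  assumes f: "addmap f" and D: "D \<in> carrier_mat n n" and gen: "\<And>j. j < n ==> f (gen j) \<in> FN n \<and> (f ^^ p) (gen j) = gen j"
    and es: "\<And>i j. i < n ==> j < n ==> es i (f (gen j)) = D $$ (i, j)"
  shows "preal p D"
proof -
  have "f x \<in> FN n" if "x \<in> FN n" for x by (rule addmap_FN[OF f that]) (use gen in auto)
  moreover have "(f ^^ p) x = x" if x: "x \<in> FN n" for x
    by (rule addmap_eqI[OF addmap_funpow[OF f] _ x]) (use gen in \<open>auto simp: addmap_def\<close>)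
  moreover have "emat n f = D" by (rule eq_matI) (use D es in \<open>auto simp: emat_def\<close>)
  ultimately show ?thesis unfolding preal_def using D f by auto
qed

text \<open>The free product of the two endomorphisms, with the generators of the second factor
  shifted by \<open>a\<close>.\<close>

lemma preal_four_block:
  assumes "preal p D" "preal p E"
  shows "preal p (four_block_mat D (0\<^sub>m (dim_row D) (dim_col E)) (0\<^sub>m (dim_row E) (dim_col D)) E)"
proof -
  define a b where "a = dim_row D" and "b = dim_row E"
  have D: "D \<in> carrier_mat a a" and E: "E \<in> carrier_mat b b" using assms by (auto simp: preal_def a_def b_def)
  obtain f where f: "addmap f" "\<And>x. x \<in> FN a ==> f x \<in> FN a" "\<And>x. x \<in> FN a ==> (f ^^ p) x = x" "emat a f = D"
    using assms(1) unfolding preal_def a_def by blast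
  obtain g where g: "addmap g" "\<And>x. x \<in> FN b ==> g x \<in> FN b" "\<And>x. x \<in> FN b ==> (g ^^ p) x = x" "emat b g = E"
    using assms(2) unfolding preal_def b_def by blast
  define sh where "sh = fext (\<lambda>j. gen (a + j))"
  have sh: "addmap sh" "sh (gen j) = gen (a + j)" for j unfolding sh_def by (rule addmap_fext) simp
  have shFN: "sh x \<in> FN (a + b)" if "x \<in> FN b" for x by (rule addmap_FN[OF sh(1) that]) (simp add: sh)
  have essh: "es i (sh x) = (if i < a then 0 else es (i - a) x)" for i x
  proof -
    have "(\<lambda>x. es i (sh x)) = (\<lambda>x. if i < a then 0 else es (i - a) x)"
      by (rule addmap_eqI_all[OF addmap_comp[OF addmap_es sh(1)]])
        (auto simp: addmap_def addmapD[OF addmap_es] es_gen sh)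
    then show ?thesis by (rule fun_cong)
  qed
  define h where "h = fext (\<lambda>j. if j < a then f (gen j) else sh (g (gen (j - a))))"
  have h: "addmap h" unfolding h_def by (rule addmap_fext)
  have hf: "h x = f x" if "x \<in> FN a" for x
    by (rule addmap_eqI[OF h f(1) that]) (simp add: h_def)
  have hg: "h (sh x) = sh (g x)" if "x \<in> FN b" for x
    by (rule addmap_eqI[OF addmap_comp[OF h sh(1)] addmap_comp[OF sh(1) g(1)] that]) (simp add: h_def sh)
  have hfk: "(h ^^ k) x = (f ^^ k) x \<and> (f ^^ k) x \<in> FN a" if "x \<in> FN a" for k x
    by (induction k) (use that hf f(2) in auto)
  have hgk: "(h ^^ k) (sh x) = sh ((g ^^ k) x) \<and> (g ^^ k) x \<in> FN b" if "x \<in> FN b" for k x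
    by (induction k) (use that hg g(2) in auto)
  let ?F = "four_block_mat D (0\<^sub>m a b) (0\<^sub>m b a) E"
  have esf: "es i (f (gen j)) = D $$ (i, j)" if "i < a" "j < a" for i j unfolding f(4)[symmetric] using that by (simp add: emat_def)
  have esg: "es i (g (gen j)) = E $$ (i, j)" if "i < b" "j < b" for i j unfolding g(4)[symmetric] using that by (simp add: emat_def)
  have "preal p ?F"
  proof (rule prealI[OF h])
    show "?F \<in> carrier_mat (a + b) (a + b)" using D E by auto
    show "h (gen j) \<in> FN (a + b) \<and> (h ^^ p) (gen j) = gen j" if j: "j < a + b" for j
    proof (cases "j < a")
      case True
      then have "gen j \<in> FN a" by simp
      then show ?thesis using hf hfk[of "gen j" p] f(2,3) FN_mono[of a "a + b"] by auto
    next
      case False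
      then have "gen (j - a) \<in> FN b" "gen j = sh (gen (j - a))" using j by (auto simp: sh)
      then show ?thesis using hg hgk[of "gen (j - a)" p] g(2,3) shFN by auto
    qed
    show "es i (h (gen j)) = ?F $$ (i, j)" if ij: "i < a + b" "j < a + b" for i j
    proof (cases "j < a")
      case True
      then have jF: "gen j \<in> FN a" by simp
      have "es i (h (gen j)) = (if i < a then D $$ (i, j) else 0)"
        using es_outside[OF f(2)[OF jF], of i] esf[of i j] True by (auto simp: hf[OF jF])
      then show ?thesis using ij D E True by auto
    next
      case False
      then have jF: "gen (j - a) \<in> FN b" and jj: "gen j = sh (gen (j - a))" using ij by (auto simp: sh)
      have "es i (h (gen j)) = (if i < a then 0 else E $$ (i - a, j - a))"
        unfolding jj hg[OF jF] essh using esg[of "i - a" "j - a"] ij False by auto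
      then show ?thesis using ij D E False by auto
    qed
  qed
  moreover have "dim_row D = a" "dim_col E = b" "dim_row E = b" "dim_col D = a" using D E by auto
  ultimately show ?thesis by (simp only:)
qed

lemma preal_diag_block: "(\<And>D. D \<in> set Ds ==> preal p D) ==> preal p (diag_block_mat Ds)"
proof (induction Ds)
  case Nil
  have "preal p (0\<^sub>m 0 0)" by (rule prealI[of "\<lambda>x. x" _ 0]) (auto simp: addmap_def)
  then show ?case by simp
next
  case (Cons D Ds)
  then have "preal p D" "preal p (diag_block_mat Ds)" by auto
  from preal_four_block[OF this] show ?case by (simp add: Let_def)
qed

lemma funpow_cyclic:
  assumes "\<And>j. j < p ==> f (y j) = y (Suc j mod p)" "j < p"
  shows "(f ^^ p) (y j) = y j"
proof -
  have "(f ^^ k) (y j) = y ((j + k) mod p)" for k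
  proof (induction k)
    case (Suc k)
    have "(j + k) mod p < p" using assms(2) by simp
    then show ?case using Suc assms(1)[of "(j + k) mod p"] by (simp add: mod_Suc_eq)
  qed (use assms in simp)
  then show ?thesis using assms(2) by simp
qed

lemma preal_triv: "preal p triv_block"
proof (rule prealI[of "\<lambda>x. x" _ 1])
  have "((\<lambda>x. x) ^^ p) = (\<lambda>x :: fw. x)" by (induction p) auto
  then show "gen j \<in> FN 1 \<and> ((\<lambda>x. x) ^^ p) (gen j) = gen j" if "j < 1" for j using that by simp
qed (auto simp: addmap_def triv_block_def es_gen)

lemma preal_reg:
  assumes p: "p > 0"
  shows "preal p (reg_block p)"
proof (rule prealI[OF addmap_fext, of _ p "\<lambda>j. gen (Suc j mod p)"])
  show "fext (\<lambda>j. gen (Suc j mod p)) (gen j) \<in> FN p \<and> (fext (\<lambda>j. gen (Suc j mod p)) ^^ p) (gen j) = gen j" if "j < p" for j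
    using funpow_cyclic[of p "fext (\<lambda>j. gen (Suc j mod p))" gen j] that p by simp
qed (auto simp: reg_block_def es_gen)

text \<open>The generators together with \<open>y m\<close>, the inverse of their ordered sum, are
  permuted cyclically. This is consistent since the ordered sum of all \<open>y j\<close> is 0, and
  a cyclic rotation of a trivial product is trivial.\<close>

lemma preal_cyc:
  assumes p: "p > 1"
  shows "preal p (cyc_block p)"
proof -
  define m where "m = p - 1"
  have pm: "p = Suc m" "m > 0" using p by (auto simp: m_def)
  define s where "s = sum_list (map gen [0..<m])"
  define y where "y j = (if j < m then gen j else - s)" for j
  define f where "f = fext (\<lambda>j. y (Suc j))"
  have f: "addmap f" unfolding f_def by (rule addmap_fext)
  have fgen: "f (gen j) = y (Suc j)" for j by (simp add: f_def)
  have "map y [0..<m] = map gen [0..<m]" by (simp add: y_def)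
  then have "sum_list (map y [0..<m]) = s" unfolding s_def by (simp only:)
  then have "sum_list (map y [0..<Suc m]) = 0" by (simp add: y_def[of m])
  moreover have "[0..<Suc m] = 0 # map Suc [0..<m]" by (simp add: map_Suc_upt upt_conv_Cons del: upt_Suc)
  ultimately have "gen 0 + sum_list (map (\<lambda>j. y (Suc j)) [0..<m]) = 0"
    using pm(2) by (simp add: y_def o_def del: upt_Suc)
  then have sum: "- sum_list (map (\<lambda>j. y (Suc j)) [0..<m]) = gen 0" by (simp add: eq_neg_iff_add_eq_0[symmetric])
  have fs: "f (- s) = gen 0"
    unfolding s_def addmap_uminus[OF f] addmap_sum_list[OF f] map_map o_def fgen by (rule sum)
  have fy: "f (y j) = y (Suc j mod p)" if "j < p" for j
  proof (cases "j < m")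
    case True
    then show ?thesis using pm by (simp add: y_def fgen)
  next
    case False
    then have "j = m" using that pm by simp
    then show ?thesis using pm fs by (simp add: y_def)
  qed
  have sFN: "s \<in> FN m" unfolding s_def by (rule FN_sum_list) auto
  have yFN: "y j \<in> FN m" for j using sFN by (auto simp: y_def)
  have ess: "es i s = 1" if "i < m" for i
  proof -
    have "sum_list (map (\<lambda>j. es i (gen j)) [0..<k]) = (if i < k then 1 else 0)" for k
      by (induction k) (auto simp: es_gen)
    then show ?thesis using that by (simp add: s_def addmap_sum_list[OF addmap_es] o_def)
  qed
  show ?thesis
  proof (rule prealI[OF f, of _ m])
    show "cyc_block p \<in> carrier_mat m m" by (simp add: cyc_block_def m_def)
    show "f (gen j) \<in> FN m \<and> (f ^^ p) (gen j) = gen j" if "j < m" for j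
      using funpow_cyclic[of p f y j, OF fy] that pm yFN by (simp add: fgen y_def[of j])
    show "es i (f (gen j)) = cyc_block p $$ (i, j)" if "i < m" "j < m" for i j
      using that pm ess[of i] by (auto simp: fgen y_def cyc_block_def es_gen addmap_uminus[OF addmap_es])
  qed
qed

text \<open>The conjugating matrix \<open>P\<close> lifts to an automorphism, which conjugates the
  block automorphism; conjugation preserves periodicity.\<close>

theorem ex_periodic_aut:
  assumes p: "prime p" and A: "A \<in> carrier_mat n n" and st: "standard_rep n p A"
  shows "\<exists>f. addmap f \<and> (\<forall>x\<in>FN n. f x \<in> FN n \<and> (f ^^ p) x = x) \<and> emat n f = A"
proof -
  have p1: "p > 1" using p prime_gt_1_nat by blast
  obtain a b c P where P: "P \<in> carrier (GL_Z n)"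
    and PA: "P * A = diag_block_mat (replicate a triv_block @ replicate b (reg_block p) @ replicate c (cyc_block p)) * P"
    using st unfolding standard_rep_def by blast
  define D where "D = diag_block_mat (replicate a triv_block @ replicate b (reg_block p) @ replicate c (cyc_block p))"
  have Pc: "P \<in> carrier_mat n n" using P by (simp add: GL_Z_def)
  have "preal p D" unfolding D_def using preal_triv preal_reg preal_cyc p1 by (intro preal_diag_block) auto
  moreover have Dn: "dim_row D = n" using arg_cong[OF PA, of dim_row] Pc by (simp add: D_def)
  ultimately obtain f where f: "addmap f" "\<And>x. x \<in> FN n ==> f x \<in> FN n" "\<And>x. x \<in> FN n ==> (f ^^ p) x = x" "emat n f = D"
    unfolding preal_def by blast
  obtain h where h: "faut n h" "emat n h = P" using ex_faut_emat[OF P] by blast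
  obtain k where ah: "addmap h" and ak: "addmap k"
    and hk: "\<And>x. x \<in> FN n ==> h x \<in> FN n \<and> k x \<in> FN n \<and> h (k x) = x \<and> k (h x) = x" using h(1) unfolding faut_def by blast
  define f' where "f' = (\<lambda>x. k (f (h x)))"
  have f': "addmap f'" unfolding f'_def by (rule addmap_comp[OF ak addmap_comp[OF f(1) ah]])
  have pow: "(f' ^^ i) x = k ((f ^^ i) (h x)) \<and> (f ^^ i) (h x) \<in> FN n" if "x \<in> FN n" for i x
    by (induction i) (use that hk f(2) in \<open>auto simp: f'_def\<close>)
  have "f' x \<in> FN n \<and> (f' ^^ p) x = x" if x: "x \<in> FN n" for x
    using pow[OF x, of p] hk f(2) f(3)[of "h x"] x by (auto simp: f'_def)
  moreover have "emat n f' = A"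
  proof -
    have kP: "emat n k * P = 1\<^sub>m n"
      unfolding h(2)[symmetric] using hk by (subst emat_comp[OF ak, symmetric]) (auto simp: emat_id[symmetric] intro: emat_cong)
    have "emat n f' = emat n k * emat n (\<lambda>x. f (h x))"
      unfolding f'_def by (rule emat_comp[OF ak, of n "\<lambda>x. f (h x)"]) (use hk f(2) in simp)
    also have "emat n (\<lambda>x. f (h x)) = D * P"
      unfolding f(4)[symmetric] h(2)[symmetric] by (rule emat_comp[OF f(1), of n h]) (use hk in simp)
    also have "D * P = P * A" unfolding PA D_def ..
    also have "emat n k * (P * A) = emat n k * P * A" by (rule assoc_mult_mat[symmetric, OF emat_carrier(1) Pc A])
    finally show ?thesis unfolding kP using A by simp
  qed
  ultimately show ?thesis using f' by blast
qed

subsection \<open>Outer automorphisms as self-maps of the free group type\<close>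

lemma carrier_free_group: "carrier (free_group n) = word_of ` FN n"
proof (intro equalityI subsetI)
  fix w assume "w \<in> carrier (free_group n)"
  then have "\<forall>l\<in>set w. fst l < n" "nocanc w" by (auto simp: free_group_def fg_red_fixed_iff)
  then show "w \<in> word_of ` FN n" by (intro image_eqI[of _ _ "Fw w"]) (auto simp: word_of_Fw FN_def)
next
  fix w assume "w \<in> word_of ` FN n"
  then show "w \<in> carrier (free_group n)"
    using word_of by (auto simp: free_group_def FN_def fg_red_fixed_iff)
qed

lemma mult_free_group: "word_of x \<otimes>\<^bsub>free_group n\<^esub> word_of y = word_of (x + y)"
  by (simp add: free_group_def word_of_plus)

lemma one_free_group: "\<one>\<^bsub>free_group n\<^esub> = word_of 0"
  by (simp add: free_group_def word_of_zero)

lemma group_free_group: "group (free_group n)"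
proof (rule groupI)
  fix u assume "u \<in> carrier (free_group n)"
  then obtain x where "u = word_of x" "x \<in> FN n" unfolding carrier_free_group by blast
  then show "\<exists>v\<in>carrier (free_group n). v \<otimes>\<^bsub>free_group n\<^esub> u = \<one>\<^bsub>free_group n\<^esub>"
    unfolding carrier_free_group by (intro bexI[of _ "word_of (- x)"]) (auto simp: mult_free_group one_free_group)
qed (auto simp: carrier_free_group mult_free_group one_free_group add.assoc)

lemma inv_free_group: "x \<in> FN n ==> inv\<^bsub>free_group n\<^esub> (word_of x) = word_of (- x)"
  by (rule group.inv_equality[OF group_free_group]) (auto simp: carrier_free_group mult_free_group one_free_group)

text \<open>Elements of \<open>AutoGroup\<close> are extensional functions on words, so the map is
  undefined outside the carrier and only its values on \<open>FN n\<close> matter.\<close>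

definition au :: "nat => (fw => fw) => fg_word => fg_word" where
  "au n f = (\<lambda>w\<in>carrier (free_group n). word_of (f (Fw w)))"

lemma au_apply: "x \<in> FN n ==> au n f (word_of x) = word_of (f x)"
  by (simp add: au_def carrier_free_group word_of_inverse)

lemma au_eq_iff: "au n f = au n g \<longleftrightarrow> (\<forall>x\<in>FN n. f x = g x)"
proof
  assume "au n f = au n g"
  then have "word_of (f x) = word_of (g x)" if "x \<in> FN n" for x using au_apply[OF that] by metis
  then show "\<forall>x\<in>FN n. f x = g x" by (simp add: word_of_inject)
next
  assume "\<forall>x\<in>FN n. f x = g x"
  then show "au n f = au n g" by (auto simp: au_def carrier_free_group word_of_inverse intro!: restrict_ext)
qed

lemma inn_eq: "inn n = (\<lambda>g. au n (\<lambda>x. g + x - g)) ` FN n"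
proof -
  have "(\<lambda>x\<in>carrier (free_group n). word_of g \<otimes>\<^bsub>free_group n\<^esub> x \<otimes>\<^bsub>free_group n\<^esub> inv\<^bsub>free_group n\<^esub> word_of g) = au n (\<lambda>x. g + x - g)"
    if "g \<in> FN n" for g
    unfolding au_def
    by (rule restrict_ext) (auto simp: carrier_free_group mult_free_group inv_free_group[OF that] word_of_inverse)
  then show ?thesis unfolding inn_def carrier_free_group[of n] Setcompr_eq_image by (auto simp: image_image)
qed

lemma fautD: "faut n f ==> addmap f" "faut n f ==> x \<in> FN n ==> f x \<in> FN n"
  by (auto simp: faut_def)

lemma au_in_auto:
  assumes "faut n f"
  shows "au n f \<in> auto (free_group n)"
proof -
  obtain g where f: "addmap f" and fg: "\<And>x. x \<in> FN n ==> f x \<in> FN n \<and> g x \<in> FN n \<and> f (g x) = x \<and> g (f x) = x"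
    using assms unfolding faut_def by blast
  have "au n f \<in> hom (free_group n) (free_group n)"
    using fg by (auto simp: hom_def carrier_free_group au_apply mult_free_group FN_plus addmapD[OF f])
  moreover have "bij_betw (au n f) (carrier (free_group n)) (carrier (free_group n))"
    by (rule bij_betw_byWitness[where f' = "au n g"]) (use fg in \<open>auto simp: carrier_free_group au_apply\<close>)
  ultimately show ?thesis by (simp add: auto_def Bij_def au_def)
qed

lemma mult_AutoGroup:
  assumes "faut n f" "faut n g"
  shows "au n f \<otimes>\<^bsub>AutoGroup (free_group n)\<^esub> au n g = au n (\<lambda>x. f (g x))"
proof -
  have "au n f \<in> Bij (carrier (free_group n))" "au n g \<in> Bij (carrier (free_group n))"
    using au_in_auto assms by (auto simp: auto_def)
  then have "au n f \<otimes>\<^bsub>AutoGroup (free_group n)\<^esub> au n g = compose (carrier (free_group n)) (au n f) (au n g)"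
    by (simp add: AutoGroup_def BijGroup_def)
  also have "\<dots> = au n (\<lambda>x. f (g x))"
    unfolding compose_def unfolding au_def[of n "\<lambda>x. f (g x)"]
    by (rule restrict_ext) (auto simp: carrier_free_group au_apply word_of_inverse fautD[OF assms(2)])
  finally show ?thesis .
qed

lemma one_AutoGroup: "\<one>\<^bsub>AutoGroup (free_group n)\<^esub> = au n (\<lambda>x. x)"
  unfolding au_def by (simp add: AutoGroup_def BijGroup_def) (rule restrict_ext, auto simp: carrier_free_group word_of_inverse)

lemma auto_as_map:
  assumes "\<phi> \<in> auto (free_group n)"
  shows "\<exists>f. addmap f \<and> (\<forall>x\<in>FN n. f x \<in> FN n) \<and> \<phi> = au n f"
proof -
  let ?G = "free_group n"
  have hom: "\<phi> \<in> hom ?G ?G" and ext: "\<phi> \<in> extensional (carrier ?G)" using assms by (auto simp: auto_def Bij_def)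
  define F where "F x = Fw (\<phi> (word_of x))" for x
  have F: "word_of (F x) = \<phi> (word_of x) \<and> F x \<in> FN n" if x: "x \<in> FN n" for x
  proof -
    have "\<phi> (word_of x) \<in> carrier ?G" using hom_in_carrier[OF hom] x by (simp add: carrier_free_group)
    then obtain y where "\<phi> (word_of x) = word_of y" "y \<in> FN n" unfolding carrier_free_group by blast
    then show ?thesis by (simp add: F_def word_of_inverse)
  qed
  have Fadd: "F (x + y) = F x + F y" if "x \<in> FN n" "y \<in> FN n" for x y
  proof -
    have "word_of (F (x + y)) = \<phi> (word_of x \<otimes>\<^bsub>?G\<^esub> word_of y)" using F that by (simp add: FN_plus mult_free_group)
    also have "\<dots> = word_of (F x) \<otimes>\<^bsub>?G\<^esub> word_of (F y)" using hom_mult[OF hom] F that by (simp add: carrier_free_group)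
    finally show ?thesis by (simp add: mult_free_group word_of_inject)
  qed
  have F0: "F 0 = 0" using Fadd[of 0 0] by (metis FN_zero add_0 add_right_cancel)
  define f where "f = fext (\<lambda>i. F (gen i))"
  have f: "addmap f" "\<And>i. f (gen i) = F (gen i)" unfolding f_def by (rule addmap_fext) simp
  have fg: "f (fgen l) = F (fgen l)" if "fst l < n" for l
  proof (cases "snd l")
    case True
    then show ?thesis using f(2)[of "fst l"] by (cases l) simp
  next
    case False
    then have l: "fgen l = - gen (fst l)" by (cases l) (simp add: fgen_False)
    have "F (gen (fst l)) + F (- gen (fst l)) = 0" using Fadd[of "gen (fst l)" "- gen (fst l)"] that F0 by simp
    then show ?thesis unfolding l addmap_uminus[OF f(1)] f(2) by (rule minus_unique)
  qed
  have fF: "f x = F x" if "x \<in> FN n" for x using that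
  proof (induction rule: FN_induct)
    case zero
    then show ?case by (simp add: F0 addmap_zero[OF f(1)])
  next
    case (Cons l x)
    then show ?case using Fadd[of "fgen l" x] fg[of l] by (simp add: addmapD[OF f(1)])
  qed
  have "\<phi> w = au n f w" for w
  proof (cases "w \<in> carrier ?G")
    case True
    then obtain x where "w = word_of x" "x \<in> FN n" unfolding carrier_free_group by blast
    then show ?thesis using F fF by (simp add: au_apply)
  next
    case False
    then show ?thesis using ext by (auto simp: au_def extensional_def)
  qed
  then show ?thesis using f(1) fF F by (intro exI[of _ f]) auto
qed

lemma auto_eq_au:
  assumes "\<phi> \<in> carrier (AutoGroup (free_group n))"
  shows "\<exists>f. faut n f \<and> \<phi> = au n f"
proof -
  let ?A = "AutoGroup (free_group n)" and ?C = "carrier (free_group n)"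
  interpret A: group ?A by (rule group.AutoGroup[OF group_free_group])
  have car: "carrier ?A = auto (free_group n)" by (simp add: AutoGroup_def)
  obtain f where f: "addmap f" "\<And>x. x \<in> FN n ==> f x \<in> FN n" "\<phi> = au n f" using auto_as_map assms car by blast
  obtain g where g: "addmap g" "\<And>x. x \<in> FN n ==> g x \<in> FN n" "inv\<^bsub>?A\<^esub> \<phi> = au n g"
    using auto_as_map[of "inv\<^bsub>?A\<^esub> \<phi>"] A.inv_closed[OF assms] car by blast
  have mult: "(\<alpha> \<otimes>\<^bsub>?A\<^esub> \<beta>) w = \<alpha> (\<beta> w)" if "\<alpha> \<in> carrier ?A" "\<beta> \<in> carrier ?A" "w \<in> ?C" for \<alpha> \<beta> w
    using that by (simp add: AutoGroup_def BijGroup_def auto_def compose_def)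
  have "f (g x) = x \<and> g (f x) = x" if x: "x \<in> FN n" for x
  proof -
    have w: "word_of x \<in> ?C" using x by (simp add: carrier_free_group)
    have "word_of (f (g x)) = word_of x"
      using mult[OF assms A.inv_closed[OF assms] w] A.r_inv[OF assms] x f g by (simp add: one_AutoGroup au_apply)
    moreover have "word_of (g (f x)) = word_of x"
      using mult[OF A.inv_closed[OF assms] assms w] A.l_inv[OF assms] x f g by (simp add: one_AutoGroup au_apply)
    ultimately show ?thesis by (simp add: word_of_inject)
  qed
  then have "faut n f" unfolding faut_def using f g by blast
  then show ?thesis using f(3) by blast
qed

lemma addmap_conj: "addmap (\<lambda>x :: fw. g + x - g)"
  by (simp add: addmap_def diff_conv_add_uminus add.assoc del: add_uminus_conv_diff)

lemma faut_conj:
  assumes g: "g \<in> FN n"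
  shows "faut n (\<lambda>x. g + x - g)"
proof (rule fautI[OF addmap_conj addmap_conj[of "- g"]])
  show "g + gen j - g \<in> FN n" "- g + gen j - - g \<in> FN n" if "j < n" for j
    using that g by (simp_all only: diff_conv_add_uminus FN_plus FN_uminus FN_fgen fst_conv)
qed (simp_all add: diff_conv_add_uminus add.assoc del: add_uminus_conv_diff)

lemma normal_inn: "inn n \<lhd> AutoGroup (free_group n)"
proof -
  let ?A = "AutoGroup (free_group n)"
  interpret A: group ?A by (rule group.AutoGroup[OF group_free_group])
  have car: "carrier ?A = auto (free_group n)" by (simp add: AutoGroup_def)
  have sub: "inn n \<subseteq> carrier ?A" unfolding inn_eq car using au_in_auto[OF faut_conj] by blast
  have mult: "au n (\<lambda>x. g + x - g) \<otimes>\<^bsub>?A\<^esub> au n (\<lambda>x. h + x - h) = au n (\<lambda>x. (g + h) + x - (g + h))" if "g \<in> FN n" "h \<in> FN n" for g h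
    unfolding mult_AutoGroup[OF faut_conj[OF that(1)] faut_conj[OF that(2)]]
    by (simp add: au_eq_iff diff_conv_add_uminus minus_add add.assoc del: add_uminus_conv_diff)
  have "subgroup (inn n) ?A"
  proof (rule A.subgroupI[OF sub])
    show "inn n \<noteq> {}" unfolding inn_eq using FN_zero by blast
    fix a assume "a \<in> inn n"
    then obtain g where g: "g \<in> FN n" "a = au n (\<lambda>x. g + x - g)" unfolding inn_eq by blast
    define b where "b = au n (\<lambda>x. - g + x - - g)"
    have ba: "b \<otimes>\<^bsub>?A\<^esub> a = \<one>\<^bsub>?A\<^esub>"
      using mult[of "- g" g] g unfolding b_def by (simp add: one_AutoGroup)
    have b: "b \<in> inn n" unfolding inn_eq b_def by (rule image_eqI[of _ _ "- g"]) (use g in simp_all)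
    have "inv\<^bsub>?A\<^esub> a = b" by (rule A.inv_equality[OF ba]) (use b sub \<open>a \<in> inn n\<close> in auto)
    then show "inv\<^bsub>?A\<^esub> a \<in> inn n" using b by simp
  next
    fix a b assume "a \<in> inn n" "b \<in> inn n"
    then obtain g h where "g \<in> FN n" "h \<in> FN n" "a = au n (\<lambda>x. g + x - g)" "b = au n (\<lambda>x. h + x - h)" unfolding inn_eq by blast
    then show "a \<otimes>\<^bsub>?A\<^esub> b \<in> inn n" unfolding inn_eq by (intro image_eqI[of _ _ "g + h"]) (auto simp only: mult FN_plus)
  qed
  then show ?thesis
  proof (rule A.normal_invI)
    fix \<phi> h assume \<phi>: "\<phi> \<in> carrier ?A" and "h \<in> inn n"
    then obtain g where g: "g \<in> FN n" "h = au n (\<lambda>x. g + x - g)" unfolding inn_eq by blast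
    obtain f where f: "faut n f" "\<phi> = au n f" using auto_eq_au[OF \<phi>] by blast
    obtain k where k: "faut n k" "inv\<^bsub>?A\<^esub> \<phi> = au n k" using auto_eq_au[OF A.inv_closed[OF \<phi>]] by blast
    have "au n (\<lambda>x. f (k x)) = au n (\<lambda>x. x)"
      using A.r_inv[OF \<phi>] unfolding k(2) unfolding f(2) mult_AutoGroup[OF f(1) k(1)] one_AutoGroup .
    then have fk: "f (k x) = x" if "x \<in> FN n" for x using that by (simp add: au_eq_iff)
    have "\<phi> \<otimes>\<^bsub>?A\<^esub> h \<otimes>\<^bsub>?A\<^esub> inv\<^bsub>?A\<^esub> \<phi> = au n (\<lambda>x. f (g + k x - g))"
      unfolding k(2) unfolding f(2) g(2)
      by (simp only: mult_AutoGroup[OF f(1) faut_conj[OF g(1)]] mult_AutoGroup[OF faut_comp[OF f(1) faut_conj[OF g(1)]] k(1)])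
    also have "\<dots> = au n (\<lambda>x. f g + x - f g)"
      using fautD(1)[OF f(1)] fk by (simp add: au_eq_iff addmapD addmap_diff)
    finally show "\<phi> \<otimes>\<^bsub>?A\<^esub> h \<otimes>\<^bsub>?A\<^esub> inv\<^bsub>?A\<^esub> \<phi> \<in> inn n"
      unfolding inn_eq using fautD(2)[OF f(1) g(1)] by blast
  qed
qed

definition out :: "nat => (fw => fw) => (fg_word => fg_word) set" where
  "out n f = inn n #>\<^bsub>AutoGroup (free_group n)\<^esub> au n f"

lemma group_Out: "group (Out n)"
  unfolding Out_def by (rule normal.factorgroup_is_group[OF normal_inn])

lemma au_carrier: "faut n f ==> au n f \<in> carrier (AutoGroup (free_group n))"
  using au_in_auto by (simp add: AutoGroup_def)

lemma out_carrier: "faut n f ==> out n f \<in> carrier (Out n)"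
  using au_carrier[of n f] by (auto simp: Out_def FactGroup_def RCOSETS_def out_def)

lemma Out_eq_out: "X \<in> carrier (Out n) ==> \<exists>f. faut n f \<and> X = out n f"
  using auto_eq_au by (auto simp: Out_def FactGroup_def RCOSETS_def out_def)

lemma mult_out: "faut n f ==> faut n g ==> out n f \<otimes>\<^bsub>Out n\<^esub> out n g = out n (\<lambda>x. f (g x))"
  using normal.rcos_sum[OF normal_inn[of n], of "au n f" "au n g"] au_carrier[of n f] au_carrier[of n g]
  by (simp add: Out_def FactGroup_def out_def mult_AutoGroup)

lemma out_cong: "(\<And>x. x \<in> FN n ==> f x = g x) ==> out n f = out n g"
  unfolding out_def using au_eq_iff[of n f g] by simp

text \<open>The representative chosen inside \<open>beta\<close> differs from \<open>f\<close> by a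
  conjugation, which cancels in exponent sums.\<close>

lemma beta_out:
  assumes "faut n f"
  shows "beta n (out n f) = emat n f"
proof -
  have "au n f \<in> out n f" unfolding out_def
    by (rule group.rcos_self[OF group.AutoGroup[OF group_free_group] au_carrier[OF assms] normal_imp_subgroup[OF normal_inn]])
  define \<phi> where "\<phi> = (SOME \<phi>. \<phi> \<in> out n f)"
  have "\<phi> \<in> out n f" unfolding \<phi>_def using \<open>au n f \<in> out n f\<close> by (rule someI[of "\<lambda>\<phi>. \<phi> \<in> out n f"])
  then obtain g where g: "g \<in> FN n" "\<phi> = au n (\<lambda>x. g + f x - g)"
    unfolding out_def r_coset_def inn_eq using mult_AutoGroup[OF faut_conj assms] by auto
  have "beta_aut n (au n (\<lambda>x. g + f x - g)) = emat n f"
  proof (rule eq_matI)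
    fix i j assume "i < dim_row (emat n f)" "j < dim_col (emat n f)"
    then have ij: "i < n" "j < n" by auto
    then have "au n (\<lambda>x. g + f x - g) [(j, True)] = word_of (g + f (gen j) - g)" using au_apply[of "gen j"] by simp
    then show "beta_aut n (au n (\<lambda>x. g + f x - g)) $$ (i, j) = emat n f $$ (i, j)"
      using ij by (simp add: beta_aut_def emat_def es_def[symmetric] addmapD[OF addmap_es] addmap_diff[OF addmap_es])
  qed (simp_all add: beta_aut_def)
  then show ?thesis unfolding beta_def \<phi>_def[symmetric] g(2) .
qed

lemma out_eq_one:
  assumes "faut n f" "out n f = \<one>\<^bsub>Out n\<^esub>"
  shows "\<exists>g\<in>FN n. \<forall>x\<in>FN n. f x = g + x - g"
proof -
  have "inn n #>\<^bsub>AutoGroup (free_group n)\<^esub> au n f = inn n" using assms(2) by (simp add: Out_def FactGroup_def out_def)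
  then have "au n f \<in> inn n"
    using group.coset_join1[OF group.AutoGroup[OF group_free_group] _ au_carrier[OF assms(1)] normal_imp_subgroup[OF normal_inn]] by blast
  then show ?thesis unfolding inn_eq by (auto simp: au_eq_iff)
qed

section \<open>Powers of a matrix of prime order and lifts of cyclic groups\<close>

lemma pow_mat_add: "A \<in> carrier_mat n n ==> A ^\<^sub>m (k + l) = A ^\<^sub>m k * (A ^\<^sub>m l :: int mat)"
proof (induction l)
  case (Suc l)
  have "A ^\<^sub>m (k + Suc l) = A ^\<^sub>m k * A ^\<^sub>m l * A" using Suc by simp
  also have "\<dots> = A ^\<^sub>m k * (A ^\<^sub>m l * A)"
    by (rule assoc_mult_mat[OF pow_carrier_mat[OF Suc.prems] pow_carrier_mat[OF Suc.prems] Suc.prems])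
  finally show ?case by simp
next
  case 0
  then show ?case using right_mult_one_mat[OF pow_carrier_mat[OF 0, of k]] by simp
qed

lemma pow_mat_multiple:
  fixes A :: "int mat"
  assumes A: "A \<in> carrier_mat n n" and p: "A ^\<^sub>m p = 1\<^sub>m n"
  shows "A ^\<^sub>m (p * k) = 1\<^sub>m n"
proof (induction k)
  case (Suc k)
  then show ?case using pow_mat_add[OF A, of p "p * k"] p by simp
qed (use A in simp)

lemma pow_mat_eq_imp_mod_eq:
  fixes A :: "int mat"
  assumes A: "A \<in> carrier_mat n n" and p: "prime p" "A ^\<^sub>m p = 1\<^sub>m n" "A \<noteq> 1\<^sub>m n" and eq: "A ^\<^sub>m k = A ^\<^sub>m l"
  shows "k mod p = l mod p"
  using eq
proof (induction k l rule: linorder_wlog)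
  case (le k l)
  have p0: "p > 0" using p prime_gt_0_nat by blast
  define d where "d = l - k"
  \<comment> \<open>Multiplication by the power with exponent \<open>(p - 1) * k\<close> stands in
    for division by the \<open>k\<close>-th power.\<close>
  have pk: "(p - 1) * k + k = p * k" using p0 by (simp add: algebra_simps)
  have "d + p * k = l + (p - 1) * k" using le(1) pk unfolding d_def by linarith
  then have "A ^\<^sub>m (d + p * k) = A ^\<^sub>m (l + (p - 1) * k)" by (simp only:)
  also have "\<dots> = A ^\<^sub>m (k + (p - 1) * k)" unfolding pow_mat_add[OF A] le(2) ..
  also have "\<dots> = 1\<^sub>m n" using pow_mat_multiple[OF A p(2), of k] pk by (simp add: add.commute)
  finally have d: "A ^\<^sub>m d = 1\<^sub>m n"
    unfolding pow_mat_add[OF A] pow_mat_multiple[OF A p(2)] using right_mult_one_mat[OF pow_carrier_mat[OF A, of d]] by (simp only:)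
  have "p dvd d"
  proof (rule ccontr)
    assume nd: "\<not> p dvd d"
    then have "d \<noteq> 0" by (metis dvd_0_right)
    then obtain c x y where c: "c dvd d" "c dvd p" "d * x = p * y + c" using bezout_add_strong_nat by blast
    have "c = 1" using c p nd by (metis prime_nat_iff)
    then have "A ^\<^sub>m (d * x) = A ^\<^sub>m (p * y) * A" using c A by simp
    then have "A = 1\<^sub>m n" using pow_mat_multiple[OF A d, of x] pow_mat_multiple[OF A p(2), of y] A by simp
    then show False using p(3) by simp
  qed
  then show ?case using le(1) unfolding d_def by (metis mod_eq_dvd_iff_nat)
next
  case (sym k l)
  then show ?case by metis
qed

lemma faut_funpow: "faut n f ==> faut n (f ^^ k)"
proof (induction k)
  case 0
  have "faut n (\<lambda>x. x)" by (rule fautI[of _ "\<lambda>x. x"]) (auto simp: addmap_def)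
  then show ?case by (simp add: id_def)
next
  case (Suc k)
  then show ?case using faut_comp[OF Suc.prems Suc.IH[OF Suc.prems]] by (simp add: comp_def)
qed

lemma emat_funpow:
  assumes "addmap f" "\<And>x. x \<in> FN n ==> f x \<in> FN n"
  shows "emat n (f ^^ k) = emat n f ^\<^sub>m k"
proof (induction k)
  case 0
  show ?case using emat_id[of n] by (simp add: id_def)
next
  case (Suc k)
  have "emat n (\<lambda>x. (f ^^ k) (f x)) = emat n (f ^^ k) * emat n f"
    by (rule emat_comp[OF addmap_funpow[OF assms(1)]]) (use assms(2) in simp)
  moreover have "(f ^^ Suc k) = (\<lambda>x. (f ^^ k) (f x))" by (simp add: funpow_Suc_right comp_def del: funpow.simps)
  ultimately show ?case using Suc by (simp del: funpow.simps)
qed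

theorem lifts_of_standard:
  assumes p: "prime p" and A: "A \<in> carrier (GL_Z n)" "A ^\<^sub>m p = 1\<^sub>m n" "A \<noteq> 1\<^sub>m n"
    and st: "standard_rep n p A"
  shows "lifts_to_Out n (cyclic_subgroup A)"
proof -
  have Ac: "A \<in> carrier_mat n n" using A(1) by (simp add: GL_Z_def)
  obtain f where f: "addmap f" "\<And>x. x \<in> FN n ==> f x \<in> FN n" "\<And>x. x \<in> FN n ==> (f ^^ p) x = x" "emat n f = A"
    using ex_periodic_aut[OF p Ac st] by blast
  have p0: "p > 0" using p prime_gt_0_nat by blast
  have fk: "(f ^^ k) x \<in> FN n" if "x \<in> FN n" for k x using that f(2) by (induction k) auto
  have "faut n f" unfolding faut_def
  proof (intro conjI exI[of _ "f ^^ (p - 1)"] ballI)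
    fix x assume x: "x \<in> FN n"
    have "(f ^^ Suc (p - 1)) x = x" using f(3)[OF x] p0 by simp
    then show "f ((f ^^ (p - 1)) x) = x" "(f ^^ (p - 1)) (f x) = x" by (simp_all add: funpow_swap1)
  qed (use f fk addmap_funpow in auto)
  then have faut: "faut n (f ^^ k)" for k by (rule faut_funpow)
  have emat: "emat n (f ^^ k) = A ^\<^sub>m k" for k using emat_funpow[OF f(1,2)] f(4) by simp
  have out: "out n (f ^^ k) = out n (f ^^ l)" if "A ^\<^sub>m k = A ^\<^sub>m l" for k l
  proof (rule out_cong)
    fix x assume x: "x \<in> FN n"
    from pow_mat_eq_imp_mod_eq[OF Ac p A(2,3) that] show "(f ^^ k) x = (f ^^ l) x"
      using funpow_mod_eq[OF f(3)[OF x]] by metis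
  qed
  \<comment> \<open>The exponent of \<open>u\<close> is determined only modulo \<open>p\<close>, and
    \<open>f ^^ p\<close> is the identity on \<open>FN n\<close>, so the choice does not affect the
    class.\<close>
  define \<iota> where "\<iota> u = out n (f ^^ (SOME k. A ^\<^sub>m k = u))" for u
  have \<iota>: "\<iota> (A ^\<^sub>m k) = out n (f ^^ k)" for k
    unfolding \<iota>_def by (rule out) (rule someI[of "\<lambda>l. A ^\<^sub>m l = A ^\<^sub>m k" k], rule refl)
  have beta: "beta n (\<iota> u) = u" if "u \<in> cyclic_subgroup A" for u
    using that \<iota> beta_out[OF faut] emat by (auto simp: cyclic_subgroup_def)
  have "\<iota> \<in> hom ((GL_Z n)\<lparr>carrier := cyclic_subgroup A\<rparr>) (Out n)"
  proof (rule homI)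
    fix u assume "u \<in> carrier ((GL_Z n)\<lparr>carrier := cyclic_subgroup A\<rparr>)"
    then show "\<iota> u \<in> carrier (Out n)" using \<iota> out_carrier[OF faut] by (auto simp: cyclic_subgroup_def)
  next
    fix u v assume "u \<in> carrier ((GL_Z n)\<lparr>carrier := cyclic_subgroup A\<rparr>)" "v \<in> carrier ((GL_Z n)\<lparr>carrier := cyclic_subgroup A\<rparr>)"
    then obtain k l where u: "u = A ^\<^sub>m k" and v: "v = A ^\<^sub>m l" by (auto simp: cyclic_subgroup_def)
    have "\<iota> (u * v) = out n (f ^^ (k + l))" unfolding u v pow_mat_add[OF Ac, symmetric] by (rule \<iota>)
    also have "\<dots> = \<iota> u \<otimes>\<^bsub>Out n\<^esub> \<iota> v" unfolding u v \<iota> mult_out[OF faut faut] by (simp add: funpow_add comp_def)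
    finally show "\<iota> (u \<otimes>\<^bsub>(GL_Z n)\<lparr>carrier := cyclic_subgroup A\<rparr>\<^esub> v) = \<iota> u \<otimes>\<^bsub>Out n\<^esub> \<iota> v" by (simp add: GL_Z_def)
  qed
  moreover have "inj_on \<iota> (cyclic_subgroup A)" by (rule inj_onI) (metis beta)
  ultimately show ?thesis unfolding lifts_to_Out_def using beta by blast
qed

text \<open>An automorphism \<open>f\<close> representing the image of \<open>A\<close> has a
  \<open>p\<close>-th power that represents the image of the identity matrix. That image is
  idempotent in a group, hence trivial, so the power is inner.\<close>

lemma outer_lift:
  assumes A: "A \<in> carrier (GL_Z n)" "A ^\<^sub>m p = 1\<^sub>m n" and p: "p > 0" and "lifts_to_Out n (cyclic_subgroup A)"
  shows "\<exists>f g. faut n f \<and> emat n f = A \<and> g \<in> FN n \<and> (\<forall>x\<in>FN n. (f ^^ p) x = g + x - g)"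
proof -
  let ?G = "(GL_Z n)\<lparr>carrier := cyclic_subgroup A\<rparr>"
  have Ac: "A \<in> carrier_mat n n" using A(1) by (simp add: GL_Z_def)
  obtain \<iota> where hom: "\<iota> \<in> hom ?G (Out n)" and beta: "\<And>u. u \<in> cyclic_subgroup A ==> beta n (\<iota> u) = u"
    using assms(4) unfolding lifts_to_Out_def by blast
  have pow: "A ^\<^sub>m k \<in> cyclic_subgroup A" for k by (auto simp: cyclic_subgroup_def)
  have A1: "A ^\<^sub>m 1 = A" using Ac by simp
  have mult: "\<iota> (A ^\<^sub>m k * A ^\<^sub>m l) = \<iota> (A ^\<^sub>m k) \<otimes>\<^bsub>Out n\<^esub> \<iota> (A ^\<^sub>m l)" for k l
    using hom_mult[OF hom, of "A ^\<^sub>m k" "A ^\<^sub>m l"] pow by (simp add: GL_Z_def)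
  have car: "\<iota> (A ^\<^sub>m k) \<in> carrier (Out n)" for k using hom_in_carrier[OF hom, of "A ^\<^sub>m k"] pow by simp
  obtain f where f: "faut n f" "\<iota> A = out n f" using Out_eq_out[OF car[of 1]] unfolding A1 by blast
  have emat: "emat n f = A" using beta[OF pow[of 1]] beta_out[OF f(1)] f(2) unfolding A1 by simp
  have \<iota>: "\<iota> (A ^\<^sub>m Suc k) = out n (f ^^ Suc k)" for k
  proof (induction k)
    case 0
    show ?case using f(2) Ac by simp
  next
    case (Suc k)
    have "\<iota> (A ^\<^sub>m Suc (Suc k)) = \<iota> (A ^\<^sub>m Suc k) \<otimes>\<^bsub>Out n\<^esub> \<iota> A" using mult[of "Suc k" 1] unfolding A1 by simp
    also have "\<dots> = out n (\<lambda>x. (f ^^ Suc k) (f x))" unfolding Suc f(2) by (rule mult_out[OF faut_funpow[OF f(1)] f(1)])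
    also have "(\<lambda>x. (f ^^ Suc k) (f x)) = f ^^ Suc (Suc k)" by (simp add: fun_eq_iff funpow_swap1)
    finally show ?case .
  qed
  interpret Out: group "Out n" by (rule group_Out)
  have "\<iota> (1\<^sub>m n) \<otimes>\<^bsub>Out n\<^esub> \<iota> (1\<^sub>m n) = \<iota> (1\<^sub>m n)" using mult[of 0 0] Ac by simp
  moreover have "\<iota> (1\<^sub>m n) \<in> carrier (Out n)" using car[of 0] Ac by simp
  ultimately have "\<iota> (1\<^sub>m n) = \<one>\<^bsub>Out n\<^esub>" using Out.l_cancel_one' by metis
  then have "out n (f ^^ p) = \<one>\<^bsub>Out n\<^esub>" using \<iota>[of "p - 1"] p A(2) by simp
  from out_eq_one[OF faut_funpow[OF f(1)] this] show ?thesis using f emat by blast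
qed

section \<open>From an outer lift to a periodic automorphism of a larger free group\<close>

lemma flen_addmap_le:
  fixes h :: "fw => fw"
  assumes h: "addmap h" and L: "\<And>j. flen (h (gen j)) \<le> L"
  shows "flen (h x) \<le> L * flen x"
proof (induction x rule: fw_induct)
  case zero
  then show ?case by (simp add: addmap_zero[OF h])
next
  case (Cons l x)
  have "flen (h (fgen l)) \<le> L"
  proof (cases "snd l")
    case True
    then show ?thesis using L[of "fst l"] by (cases l) simp
  next
    case False
    then have "fgen l = - gen (fst l)" by (cases l) (simp add: fgen_False)
    then show ?thesis using L[of "fst l"] by (simp add: addmap_uminus[OF h])
  qed
  then have "flen (h (fgen l + x)) \<le> L + L * flen x"
    using flen_add_le[of "h (fgen l)" "h x"] Cons.IH by (simp add: addmapD[OF h])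
  moreover have "flen (fgen l + x) = Suc (flen x)" using word_of_fgen_plus[OF Cons.hyps] by (simp add: flen_def)
  ultimately show ?case by simp
qed

lemma free_autI:
  assumes p: "prime p" and \<psi>: "addmap \<psi>" and per: "\<And>x. (\<psi> ^^ p) x = x"
    and FN: "\<And>j. j < N ==> \<psi> (gen j) \<in> FN N" and fixed: "\<And>j. j \<ge> N ==> \<psi> (gen j) = gen j"
  shows "\<exists>L. free_aut N p \<psi> L"
proof -
  have p0: "p > 0" using p prime_gt_0_nat by blast
  \<comment> \<open>The double sum dominates each single length, and the successor covers the
    generators beyond \<open>N\<close>, which are fixed and have length 1.\<close>
  define L where "L = Suc (\<Sum>i<p. \<Sum>j<N. flen ((\<psi> ^^ i) (gen j)))"
  have fixk: "(\<psi> ^^ i) (gen j) = gen j" if "j \<ge> N" for i j using fixed[OF that] by (induction i) auto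
  have Lgen: "flen ((\<psi> ^^ i) (gen j)) \<le> L" if i: "i < p" for i j
  proof (cases "j < N")
    case True
    have "flen ((\<psi> ^^ i) (gen j)) \<le> (\<Sum>j<N. flen ((\<psi> ^^ i) (gen j)))" using True by (intro member_le_sum) auto
    also have "\<dots> \<le> (\<Sum>i<p. \<Sum>j<N. flen ((\<psi> ^^ i) (gen j)))"
      using i member_le_sum[of i "{..<p}" "\<lambda>i. \<Sum>j<N. flen ((\<psi> ^^ i) (gen j))"] by simp
    finally show ?thesis by (simp add: L_def)
  next
    case False
    then show ?thesis by (simp add: fixk L_def)
  qed
  have "flen ((\<psi> ^^ i) x) \<le> L * flen x" for i x
  proof -
    have "(\<psi> ^^ i) x = (\<psi> ^^ (i mod p)) x" using funpow_mod_eq[OF per[of x]] by simp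
    moreover have "flen ((\<psi> ^^ (i mod p)) x) \<le> L * flen x"
      by (rule flen_addmap_le[OF addmap_funpow[OF \<psi>] Lgen]) (simp add: p0)
    ultimately show ?thesis by simp
  qed
  moreover have "\<psi> x \<in> FN N" if "x \<in> FN N" for x by (rule addmap_FN[OF \<psi> that FN])
  ultimately have "free_aut N p \<psi> L" using p \<psi> per by unfold_locales auto
  then show ?thesis by blast
qed

lemma tact_cong: "(\<And>i j. i < n ==> j < n ==> M i j = M' i j) ==> tact n M = tact n M'"
  by (auto simp: tact_def fun_eq_iff intro!: sum.cong)

lemma tact_periodic:
  fixes A :: "int mat"
  assumes A: "A \<in> carrier_mat n n" and p: "A ^\<^sub>m p = 1\<^sub>m n" and v: "v \<in> lat n"
  shows "((tact n (\<lambda>i j. A $$ (i, j))) ^^ p) v = v"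
proof -
  have id: "tact n (\<lambda>i j. 1\<^sub>m n $$ (i, j)) v = v"
  proof
    fix i
    show "tact n (\<lambda>i j. 1\<^sub>m n $$ (i, j)) v i = v i"
    proof (cases "i < n")
      case True
      then have "tact n (\<lambda>i j. 1\<^sub>m n $$ (i, j)) v i = (\<Sum>j<n. 1\<^sub>m n $$ (i, j) * v j)"
        unfolding tact_def by (simp only: if_True)
      also have "\<dots> = (\<Sum>j<n. if j = i then v j else 0)" using True by (intro sum.cong) auto
      finally show ?thesis using True by simp
    qed (use v in \<open>simp add: tact_def lat_def\<close>)
  qed
  have "((tact n (\<lambda>i j. A $$ (i, j))) ^^ k) v = tact n (\<lambda>i j. (A ^\<^sub>m k) $$ (i, j)) v" for k
  proof (induction k)
    case 0
    show ?case using id A by simp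
  next
    case (Suc k)
    have AS: "A ^\<^sub>m Suc k = A * A ^\<^sub>m k" using pow_mat_add[OF A, of 1 k] A by simp
    show ?case
    proof
      fix i
      have "tact n (\<lambda>i j. A $$ (i, j)) (tact n (\<lambda>i j. (A ^\<^sub>m k) $$ (i, j)) v) i = tact n (\<lambda>i j. (A ^\<^sub>m Suc k) $$ (i, j)) v i"
      proof (cases "i < n")
        case True
        have "tact n (\<lambda>i j. A $$ (i, j)) (tact n (\<lambda>i j. (A ^\<^sub>m k) $$ (i, j)) v) i
            = (\<Sum>l<n. \<Sum>j<n. A $$ (i, l) * (A ^\<^sub>m k) $$ (l, j) * v j)"
          using True by (simp add: tact_def sum_distrib_left mult.assoc)
        also have "\<dots> = (\<Sum>j<n. (\<Sum>l<n. A $$ (i, l) * (A ^\<^sub>m k) $$ (l, j)) * v j)"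
          by (subst sum.swap) (simp add: sum_distrib_right)
        also have "\<dots> = (\<Sum>j<n. (A ^\<^sub>m Suc k) $$ (i, j) * v j)"
          unfolding AS using True A pow_carrier_mat[OF A, of k]
          by (intro sum.cong) (auto simp: scalar_prod_def lessThan_atLeast0)
        finally show ?thesis using True by (simp add: tact_def)
      qed (simp add: tact_def)
      then show "((tact n (\<lambda>i j. A $$ (i, j))) ^^ Suc k) v i = tact n (\<lambda>i j. (A ^\<^sub>m Suc k) $$ (i, j)) v i"
        using Suc by simp
    qed
  qed
  then show ?thesis using id p by simp
qed

text \<open>The complex yields freeness for the transposed matrix (\<open>sfree_dual\<close>), and
  \<open>sfree_of_dual\<close> transposes back.\<close>

lemma sfree_of_periodic:
  assumes p: "prime p" "odd p" and \<psi>: "addmap \<psi>" and per: "\<And>x. (\<psi> ^^ p) x = x"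
    and FN: "\<And>j. j < N ==> \<psi> (gen j) \<in> FN N" and fixed: "\<And>j. j \<ge> N ==> \<psi> (gen j) = gen j"
  defines "t \<equiv> tact N (\<lambda>i j. es i (\<psi> (gen j)))"
  shows "pmod.sfree (pact t) p (normker t p (lat N))" "v \<in> lat N ==> (t ^^ p) v = v"
proof -
  obtain L where "free_aut N p \<psi> L" using free_autI[OF p(1) \<psi> per FN fixed] by blast
  then interpret free_aut N p \<psi> L .
  have t: "t = tact N (\<lambda>i j. emat N \<psi> $$ (i, j))" unfolding t_def by (rule tact_cong) (simp add: emat_def)
  have "emat N (\<psi> ^^ p) = 1\<^sub>m N" unfolding emat_id[symmetric] by (rule emat_cong) (rule per)
  moreover have "\<psi> x \<in> FN N" if "x \<in> FN N" for x by (rule addmap_FN[OF \<psi> that FN])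
  ultimately have "emat N \<psi> ^\<^sub>m p = 1\<^sub>m N" using emat_funpow[OF \<psi>, of N p] by simp
  then have tp: "(t ^^ p) v = v" if "v \<in> lat N" for v unfolding t by (rule tact_periodic[OF emat_carrier(1) _ that])
  show "v \<in> lat N ==> (t ^^ p) v = v" by (rule tp)
  show "pmod.sfree (pact t) p (normker t p (lat N))"
    using sfree_of_dual[OF assms(1), of N "\<lambda>i j. es i (\<psi> (gen j))"] tp sfree_dual[OF assms(2)] unfolding t_def by blast
qed

text \<open>The free product with \<open>p - 1\<close> further generators trivialises the inner automorphism
  by which \<open>f ^^ p\<close> acts: with \<open>Y 0 = 0\<close>, \<open>Y p = g\<close> and \<open>Y i\<close> (\<open>0 < i < p\<close>) the new generators,
  the \<open>k\<close>-th power of the extension acts as \<open>f ^^ k\<close> followed by conjugation with \<open>Y k\<close>.\<close>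

lemma sfree_of_outer_periodic:
  assumes p: "prime p" "odd p" and f: "faut n f" and g: "g \<in> FN n" and fp: "\<And>x. x \<in> FN n ==> (f ^^ p) x = g + x - g"
    and fg: "f g = g"
  defines "t \<equiv> tact n (\<lambda>i j. es i (f (gen j)))"
  shows "pmod.sfree (pact t) p (normker t p (lat n))"
proof -
  have p2: "p > 2" using p by (metis even_numeral order_le_less prime_ge_2_nat)
  define N where "N = n + (p - 1)"
  define Y where "Y i = (if i = 0 then 0 else if i < p then gen (n + i - 1) else g)" for i
  \<comment> \<open>The new generator \<open>gen j\<close> is \<open>Y (j - n + 1)\<close>, so the
    offset 2 means that \<open>\<psi>\<close> sends \<open>Y i\<close> to
    \<open>- Y 1 + Y (Suc i)\<close>. The terms \<open>Y 1\<close> telescope under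
    iteration.\<close>
  define \<psi> where "\<psi> = fext (\<lambda>j. if j < n then - Y 1 + f (gen j) + Y 1 else if j < N then - Y 1 + Y (j - n + 2) else gen j)"
  have Y0: "Y 0 = 0" and Y1: "Y 1 = gen n" and Yp: "Y p = g" using p2 by (auto simp: Y_def)
  have \<psi>: "addmap \<psi>" unfolding \<psi>_def by (rule addmap_fext)
  note \<psi>_simps = addmapD[OF \<psi>] addmap_uminus[OF \<psi>]
  have fadd: "addmap f" and fFN: "\<And>x. x \<in> FN n ==> f x \<in> FN n" using fautD[OF f] by auto
  have fFNk: "(f ^^ k) x \<in> FN n" if "x \<in> FN n" for k x using that fFN by (induction k) auto
  have addc: "addmap (\<lambda>x. - Y 1 + f x + Y 1)"
    using addmap_comp[OF addmap_conj[of "- Y 1"] fadd] by simp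
  have \<psi>f: "\<psi> x = - Y 1 + f x + Y 1" if "x \<in> FN n" for x
    by (rule addmap_eqI[OF \<psi> addc that]) (simp add: \<psi>_def)
  have \<psi>Y: "\<psi> (Y i) = - Y 1 + Y (Suc i)" if "i < p" for i
  proof (cases "i = 0")
    case True
    then show ?thesis by (simp add: Y0 addmap_zero[OF \<psi>])
  next
    case False
    have "Y i = gen (n + i - 1)" using False that by (simp add: Y_def)
    moreover have "\<psi> (gen (n + i - 1)) = - Y 1 + Y (n + i - 1 - n + 2)"
      unfolding \<psi>_def fext_gen using False that by (auto simp: N_def)
    moreover have "n + i - 1 - n + 2 = Suc i" using False by simp
    ultimately show ?thesis by simp
  qed
  have powf: "(\<psi> ^^ k) x = - Y k + (f ^^ k) x + Y k" if "x \<in> FN n" "k \<le> p" for k x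
    using that(2)
  proof (induction k)
    case 0
    show ?case by (simp add: Y0)
  next
    case (Suc k)
    have "(\<psi> ^^ Suc k) x = \<psi> (- Y k + (f ^^ k) x + Y k)" using Suc by simp
    also have "\<dots> = - (- Y 1 + Y (Suc k)) + (- Y 1 + f ((f ^^ k) x) + Y 1) + (- Y 1 + Y (Suc k))"
      using Suc.prems by (simp only: \<psi>_simps \<psi>Y \<psi>f[OF fFNk[OF that(1)]] Suc_le_lessD)
    also have "\<dots> = - Y (Suc k) + (f ^^ Suc k) x + Y (Suc k)" by (simp add: minus_add add.assoc)
    finally show ?case .
  qed
  have powY: "(\<psi> ^^ k) (Y i) = - Y k + Y (i + k)" if "i + k \<le> p" for k i
    using that
  proof (induction k)
    case 0
    show ?case by (simp add: Y0)
  next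
    case (Suc k)
    have "(\<psi> ^^ Suc k) (Y i) = \<psi> (- Y k + Y (i + k))" using Suc by simp
    also have "\<dots> = - (- Y 1 + Y (Suc k)) + (- Y 1 + Y (Suc (i + k)))"
      using Suc.prems \<psi>Y[of k] \<psi>Y[of "i + k"] by (simp only: \<psi>_simps)
    also have "\<dots> = - Y (Suc k) + Y (i + Suc k)" by (simp add: minus_add add.assoc)
    finally show ?case .
  qed
  have fgk: "(f ^^ k) g = g" for k using fg by (induction k) auto
  have perY: "(\<psi> ^^ p) (Y i) = Y i" if "i < p" for i
  proof -
    \<comment> \<open>\<open>powY\<close> reaches only to the index \<open>p\<close>, so the period
      is cut there: \<open>p - i\<close> steps lead to \<open>- Y (p - i) + g\<close>, and the
      remaining \<open>i\<close> steps return to \<open>Y i\<close> because all powers of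
      \<open>f\<close> fix \<open>g\<close>.\<close>
    have "(\<psi> ^^ (i + (p - i))) (Y i) = (\<psi> ^^ i) ((\<psi> ^^ (p - i)) (Y i))" by (simp only: funpow_add comp_apply)
    also have "(\<psi> ^^ (p - i)) (Y i) = - Y (p - i) + g" using powY[of i "p - i"] that Yp by simp
    also have "(\<psi> ^^ i) (- Y (p - i) + g) = - (\<psi> ^^ i) (Y (p - i)) + (\<psi> ^^ i) g"
      by (simp only: addmapD[OF addmap_funpow[OF \<psi>]] addmap_uminus[OF addmap_funpow[OF \<psi>]])
    also have "\<dots> = - (- Y i + g) + (- Y i + g + Y i)"
      using powY[of "p - i" i] powf[OF g, of i] that Yp fgk by simp
    also have "\<dots> = Y i" by (simp add: minus_add add.assoc)
    finally show ?thesis using that by simp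
  qed
  have fixed: "\<psi> (gen j) = gen j" if "j \<ge> N" for j using that by (simp add: \<psi>_def N_def)
  have gen: "(\<psi> ^^ p) (gen j) = gen j" for j
  proof -
    consider "j < n" | "n \<le> j" "j < N" | "j \<ge> N" by linarith
    then show ?thesis
    proof cases
      case 1
      then show ?thesis using powf[of "gen j" p] fp[of "gen j"] by (simp add: Yp diff_conv_add_uminus add.assoc del: add_uminus_conv_diff)
    next
      case 2
      then have "gen j = Y (j - n + 1)" "j - n + 1 < p" by (auto simp: Y_def N_def)
      then show ?thesis using perY by metis
    next
      case 3
      have "(\<psi> ^^ k) (gen j) = gen j" for k using fixed[OF 3] by (induction k) auto
      then show ?thesis .
    qed
  qed
  have per: "(\<psi> ^^ p) x = x" for x
  proof -
    have "(\<psi> ^^ p) = (\<lambda>x. x)"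
      by (rule addmap_eqI_all[OF addmap_funpow[OF \<psi>]]) (use gen in \<open>auto simp: addmap_def\<close>)
    then show ?thesis by simp
  qed
  have YFN: "Y i \<in> FN N" if "i \<le> p" for i
    using that p2 FN_mono[of n N g] g by (auto simp: Y_def N_def)
  have FN: "\<psi> (gen j) \<in> FN N" if "j < N" for j
  proof (cases "j < n")
    case True
    then have "f (gen j) \<in> FN N" using FN_mono[of n N] fFN[of "gen j"] by (auto simp: N_def)
    then show ?thesis using True YFN[of 1] p2 by (simp add: \<psi>_def FN_plus)
  next
    case False
    then have "- Y 1 + Y (j - n + 2) \<in> FN N" using that YFN[of 1] YFN[of "j - n + 2"] p2 by (intro FN_plus) (auto simp: N_def)
    then show ?thesis using False that by (simp add: \<psi>_def)
  qed
  let ?B = "\<lambda>i j. es i (\<psi> (gen j))" and ?A = "\<lambda>i j. es i (f (gen j))"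
  note free = sfree_of_periodic[OF p \<psi> per FN fixed]
  have esx: "es i (\<psi> (gen j)) = es i (f (gen j))" if "j < n" for i j
    using that by (simp add: \<psi>f addmapD[OF addmap_es] addmap_uminus[OF addmap_es])
  show ?thesis unfolding t_def
  proof (rule sfree_descend[of p n ?B ?A])
    show "prime p" by (rule p(1))
    show "(tact (n + (p - 1)) ?B ^^ p) v = v" if "v \<in> lat (n + (p - 1))" for v
      using free(2) that unfolding N_def by blast
    show "?B i j = ?A i j" if "i < n" "j < n" for i j using esx that by simp
    show "?B (n + i) j = 0" if "i < p - 1" "j < n" for i j
      using esx[OF that(2)] es_outside[OF fFN[of "gen j"], of "n + i"] that by simp
    show "?B (n + i) (n + j) = (if i = Suc j then 1 else 0) - (if i = 0 then 1 else 0)" if ij: "i < p - 1" "j < p - 1" for i j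
    proof -
      have "n + j < N" "n + j - n = j" using ij by (auto simp: N_def)
      then have "\<psi> (gen (n + j)) = - gen n + Y (j + 2)" unfolding \<psi>_def fext_gen Y1 by simp
      then have "?B (n + i) (n + j) = es (n + i) (Y (j + 2)) - (if i = 0 then 1 else 0)"
        by (simp add: addmapD[OF addmap_es] addmap_uminus[OF addmap_es] es_gen)
      moreover have "es (n + i) (Y (j + 2)) = (if i = Suc j then 1 else 0)"
        using ij es_outside[OF g, of "n + i"] by (auto simp: Y_def es_gen)
      ultimately show ?thesis by simp
    qed
    show "pmod.sfree (pact (tact (n + (p - 1)) ?B)) p (normker (tact (n + (p - 1)) ?B) p (lat (n + (p - 1))))"
      using free(1) unfolding N_def .
  qed
qed

theorem standard_of_lifts:
  assumes p: "prime p" and A: "A \<in> carrier (GL_Z n)" "A ^\<^sub>m p = 1\<^sub>m n" "A \<noteq> 1\<^sub>m n" and n: "n \<ge> 1"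
    and lifts: "lifts_to_Out n (cyclic_subgroup A)"
  shows "standard_rep n p A"
proof -
  have Ac: "A \<in> carrier_mat n n" using A(1) by (simp add: GL_Z_def)
  show ?thesis
  proof (rule standard_of_sfree[OF p Ac tact_periodic[OF Ac A(2)]])
    show "pmod.sfree (pact (tact n (\<lambda>i j. A $$ (i, j)))) p (normker (tact n (\<lambda>i j. A $$ (i, j))) p (lat n))"
    proof (cases "p = 2")
      case True
      then show ?thesis using sfree_two by simp
    next
      case False
      then have odd: "odd p" using p primes_dvd_imp_eq two_is_prime_nat by blast
      \<comment> \<open>In rank 1 the matrix is 1 or -1, and odd order leaves only the identity.
        Rank at least 2 makes the centre of the free group trivial.\<close>
      have n2: "n \<ge> 2"
      proof (rule ccontr)
        assume "\<not> n \<ge> 2"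
        then have n1: "n = 1" using n by simp
        define a where "a = A $$ (0, 0)"
        have pow: "(A ^\<^sub>m k) $$ (0, 0) = a ^ k" for k
        proof (induction k)
          case 0
          show ?case using Ac n1 by simp
        next
          case (Suc k)
          have "(A ^\<^sub>m Suc k) $$ (0, 0) = (A ^\<^sub>m k) $$ (0, 0) * a"
            using Ac pow_carrier_mat[OF Ac, of k] n1 by (simp add: scalar_prod_def a_def)
          then show ?case using Suc by simp
        qed
        have ap: "a ^ p = 1" using pow[of p] A(2) n1 by simp
        have "p \<noteq> 0" using p by auto
        then have "a dvd a ^ p" by (simp add: dvd_power)
        then have "a = 1 \<or> a = - 1" unfolding ap by auto
        then have "a = 1" using ap odd by (auto simp: power_minus_odd)
        then have "A = 1\<^sub>m n" using Ac n1 by (intro eq_matI) (auto simp: a_def)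
        then show False using A(3) by simp
      qed
      have p0: "p > 0" using p prime_gt_0_nat by blast
      obtain f g where f: "faut n f" "emat n f = A" and g: "g \<in> FN n" and fp: "\<And>x. x \<in> FN n ==> (f ^^ p) x = g + x - g"
        using outer_lift[OF A(1,2) p0 lifts] by blast
      obtain f' where f': "\<And>x. x \<in> FN n ==> f' x \<in> FN n \<and> f (f' x) = x" using f(1) unfolding faut_def by blast
      have fadd: "addmap f" by (rule fautD(1)[OF f(1)])
      \<comment> \<open>\<open>f\<close> commutes with its \<open>p\<close>-th power, so conjugation
        by \<open>g\<close> and by \<open>f g\<close> agree on the generators and
        \<open>- g + f g\<close> is central.\<close>
      have "- g + f g = 0"
      proof (rule center_trivial[OF n2])
        fix i assume "i < n"
        then have "gen i \<in> FN n" by simp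
        then obtain x where x: "x \<in> FN n" "f x = gen i" using f' by blast
        have "(f ^^ p) (f x) = f ((f ^^ p) x)" by (simp add: funpow_swap1)
        then have "g + gen i - g = f g + gen i - f g"
          using fp[OF x(1)] fp[OF fautD(2)[OF f(1) x(1)]] x(2) by (simp add: addmapD[OF fadd] addmap_diff[OF fadd])
        then have "- g + (g + gen i - g) + f g = - g + (f g + gen i - f g) + f g" by simp
        then show "- g + f g + gen i = gen i + (- g + f g)"
          by (simp add: diff_conv_add_uminus add.assoc del: add_uminus_conv_diff)
      qed
      then have "f g = g" by (metis add_0_right add_minus_cancel)
      from sfree_of_outer_periodic[OF p odd f(1) g fp this]
      have "pmod.sfree (pact (tact n (\<lambda>i j. es i (f (gen j))))) p (normker (tact n (\<lambda>i j. es i (f (gen j)))) p (lat n))" .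
      moreover have "tact n (\<lambda>i j. es i (f (gen j))) = tact n (\<lambda>i j. A $$ (i, j))"
        unfolding f(2)[symmetric] by (rule tact_cong) (simp add: emat_def)
      ultimately show ?thesis by simp
    qed
  qed
qed

theorem theorem4:
  fixes p n :: nat and A :: "int mat"
  assumes "prime p" and "n \<ge> 1"
    and "A \<in> carrier (GL_Z n)" and "A ^\<^sub>m p = 1\<^sub>m n" and "A \<noteq> 1\<^sub>m n"
  shows "lifts_to_Out n (cyclic_subgroup A) \<longleftrightarrow> standard_rep n p A"
  using lifts_of_standard[OF assms(1,3,4,5)] standard_of_lifts[OF assms(1,3,4,5,2)] by blast

end
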